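(* Let $A$ be a finitely-generated $k$-algebra that is module-finite over its center, and let $(\tau,B)$ be an impression of $A$, with $\tau: A\to \operatorname{End}_B(B^d)$, such that $B$ is a prime ring. If $V$ is a large $A$-module, then there is some $\mathfrak{q}\in\operatorname{Max}B$ such that $V\cong (B/\mathfrak{q})^d$ as $A$-modules, where the $A$-module structure on $(B/\mathfrak{q})^d$ is given by $av:=\tau_{\mathfrak{q}}(a)v$.
   Context: $k$ is an algebraically closed field of characteristic zero; all algebras are unital and finitely generated over $k$; modules are left modules. $\operatorname{Max}$ denotes the set of maximal ideals with the Zariski topology. Let $A$ be an algebra with center $Z$. A pre-impression of $A$ is a pair $(\tau,B)$ where $B$ is a commutative finitely-generated $k$-algebra and $\tau: A\to\operatorname{End}_B(B^d)\cong M_d(B)$, $d<\infty$, is an algebra monomorphism for which there is an open dense subset $U\subseteq\operatorname{Max}B$ such that, for each $\mathfrak{q}\in U$, the composition with evaluation $\tau_{\mathfrak{q}}: A\xrightarrow{\tau}\operatorname{End}_B(B^d)\to\operatorname{End}_B((B/\mathfrak{q})^d)\cong\operatorname{End}_k(k^d)$ is a simple representation of $A$. The map $\tau_{\mathfrak{q}}$ is defined in the same way for every $\mathfrak{q}\in\operatorname{Max}B$. Put $R:=\{f\in B \mid f1_d\in\operatorname{im}\tau\}\subset B$ (which is isomorphic to $Z$). The pair $(\tau,B)$ is an impression of $A$ if in addition the map $\operatorname{Max}B\to\operatorname{Max}R$, $\mathfrak{q}\mapsto\mathfrak{q}\cap R$, is surjective. A large $A$-module is a simple $A$-module of maximal $k$-dimension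 among all simple $A$-modules. A ring is prime if its zero ideal is prime. *)

theory Defs
  imports
    "HOL-Algebra.Algebraic_Closure"
    "HOL-Algebra.Generated_Rings"
    "HOL-Analysis.Abstract_Topology"
    "HOL-Library.Extended_Nat"
    "Jordan_Normal_Form.Missing_VectorSpace"
begin

section \<open>Algebras over a field\<close>

text \<open>
  The locale \<^locale>\<open>algebra\<close> of HOL-Algebra is restricted to commutative algebras; the following is
  its noncommutative analogue.
\<close>

locale assoc_algebra = module + ring M +
  assumes smult_mult_left:
      "\<lbrakk> c \<in> carrier R; x \<in> carrier M; y \<in> carrier M \<rbrakk> \<Longrightarrow>
        (c \<odot>\<^bsub>M\<^esub> x) \<otimes>\<^bsub>M\<^esub> y = c \<odot>\<^bsub>M\<^esub> (x \<otimes>\<^bsub>M\<^esub> y)"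
    and smult_mult_right:
      "\<lbrakk> c \<in> carrier R; x \<in> carrier M; y \<in> carrier M \<rbrakk> \<Longrightarrow>
        x \<otimes>\<^bsub>M\<^esub> (c \<odot>\<^bsub>M\<^esub> y) = c \<odot>\<^bsub>M\<^esub> (x \<otimes>\<^bsub>M\<^esub> y)"

definition char_zero :: "('k, 'm) ring_scheme \<Rightarrow> bool" where
  "char_zero K \<longleftrightarrow> (\<forall>n::nat. n > 0 \<longrightarrow> [n] \<cdot>\<^bsub>K\<^esub> \<one>\<^bsub>K\<^esub> \<noteq> \<zero>\<^bsub>K\<^esub>)"

text \<open>
  The subalgebra generated by \<open>S\<close> is the subring generated by \<open>S\<close> and the scalars.
\<close>

definition fin_gen_over :: "'k ring \<Rightarrow> ('k, 'a) module \<Rightarrow> bool" where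
  "fin_gen_over K A \<longleftrightarrow>
    (\<exists>S. finite S \<and> S \<subseteq> carrier A \<and>
         generate_ring A ((\<lambda>c. c \<odot>\<^bsub>A\<^esub> \<one>\<^bsub>A\<^esub>) ` carrier K \<union> S) = carrier A)"

definition alg_hom :: "'k ring \<Rightarrow> ('k, 'a) module \<Rightarrow> ('k, 'c) module \<Rightarrow> ('a \<Rightarrow> 'c) set" where
  "alg_hom K A C =
    {h \<in> ring_hom A C. \<forall>c \<in> carrier K. \<forall>a \<in> carrier A. h (c \<odot>\<^bsub>A\<^esub> a) = c \<odot>\<^bsub>C\<^esub> h a}"

definition center :: "('a, 'm) ring_scheme \<Rightarrow> 'a set" where
  "center A = {z \<in> carrier A. \<forall>a \<in> carrier A. z \<otimes>\<^bsub>A\<^esub> a = a \<otimes>\<^bsub>A\<^esub> z}"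

definition module_finite_over_center :: "('a, 'm) ring_scheme \<Rightarrow> bool" where
  "module_finite_over_center A \<longleftrightarrow>
    (\<exists>S. finite S \<and> S \<subseteq> carrier A \<and>
         (\<forall>a \<in> carrier A. \<exists>z \<in> S \<rightarrow> center A. a = (\<Oplus>\<^bsub>A\<^esub>s \<in> S. z s \<otimes>\<^bsub>A\<^esub> s)))"


section \<open>The maximal spectrum\<close>

definition Max_spec :: "('b, 'm) ring_scheme \<Rightarrow> 'b set set" where
  "Max_spec B = {q. maximalideal q B}"

text \<open>
  The closed sets are the sets \<open>{q. S \<subseteq> q}\<close> for arbitrary subsets \<open>S\<close> of the ring.
\<close>

definition zariski_open :: "('b, 'm) ring_scheme \<Rightarrow> 'b set set \<Rightarrow> bool" where
  "zariski_open B U \<longleftrightarrow> (\<exists>S \<subseteq> carrier B. U = {q \<in> Max_spec B. \<not> S \<subseteq> q})"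

definition zariski :: "('b, 'm) ring_scheme \<Rightarrow> 'b set topology" where
  "zariski B = topology (zariski_open B)"

lemma istopology_zariski_open:
  assumes "cring B"
  shows "istopology (zariski_open B)"
  unfolding istopology_def
proof (intro conjI allI impI)
  fix U V assume "zariski_open B U" "zariski_open B V"
  then obtain S T where S: "S \<subseteq> carrier B" "U = {q \<in> Max_spec B. \<not> S \<subseteq> q}"
    and T: "T \<subseteq> carrier B" "V = {q \<in> Max_spec B. \<not> T \<subseteq> q}"
    unfolding zariski_open_def by auto
  define P where "P = {s \<otimes>\<^bsub>B\<^esub> t | s t. s \<in> S \<and> t \<in> T}"
  have "P \<subseteq> carrier B"
    using S(1) T(1) cring.cring_simprules(5)[OF assms] unfolding P_def by blast
  moreover have "\<not> P \<subseteq> q \<longleftrightarrow> \<not> S \<subseteq> q \<and> \<not> T \<subseteq> q" if "q \<in> Max_spec B" for q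
  proof -
    have q: "maximalideal q B" using that by (simp add: Max_spec_def)
    interpret primeideal q B
      using cring.maximalideal_prime[OF assms q] .
    show ?thesis
    proof
      assume "\<not> P \<subseteq> q"
      then obtain s t where st: "s \<in> S" "t \<in> T" "s \<otimes>\<^bsub>B\<^esub> t \<notin> q"
        unfolding P_def by blast
      with S(1) T(1) show "\<not> S \<subseteq> q \<and> \<not> T \<subseteq> q"
        using I_l_closed I_r_closed by blast
    next
      assume "\<not> S \<subseteq> q \<and> \<not> T \<subseteq> q"
      then obtain s t where "s \<in> S" "s \<notin> q" "t \<in> T" "t \<notin> q" by blast
      then have "s \<otimes>\<^bsub>B\<^esub> t \<in> P" "s \<otimes>\<^bsub>B\<^esub> t \<notin> q"
        using S(1) T(1) I_prime unfolding P_def by blast+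
      then show "\<not> P \<subseteq> q" by blast
    qed
  qed
  ultimately have "P \<subseteq> carrier B" "U \<inter> V = {q \<in> Max_spec B. \<not> P \<subseteq> q}"
    unfolding S(2) T(2) by auto
  then show "zariski_open B (U \<inter> V)" unfolding zariski_open_def by blast
next
  fix \<K> assume "\<forall>K \<in> \<K>. zariski_open B K"
  then obtain S where S: "\<And>K. K \<in> \<K> \<Longrightarrow> S K \<subseteq> carrier B \<and> K = {q \<in> Max_spec B. \<not> S K \<subseteq> q}"
    unfolding zariski_open_def by metis
  then have "\<Union>\<K> = {q \<in> Max_spec B. \<not> (\<Union>K \<in> \<K>. S K) \<subseteq> q}" by blast
  moreover have "(\<Union>K \<in> \<K>. S K) \<subseteq> carrier B" using S by blast
  ultimately show "zariski_open B (\<Union>\<K>)" unfolding zariski_open_def by blast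
qed

lemma openin_zariski:
  assumes "cring B"
  shows "openin (zariski B) U \<longleftrightarrow> zariski_open B U"
  unfolding zariski_def using topology_inverse'[OF istopology_zariski_open[OF assms]] by simp

lemma topspace_zariski:
  assumes "cring B"
  shows "topspace (zariski B) = Max_spec B"
proof
  show "topspace (zariski B) \<subseteq> Max_spec B"
    unfolding topspace_def openin_zariski[OF assms] zariski_open_def by blast
  interpret cring B by fact
  have "zariski_open B (Max_spec B)"
    unfolding zariski_open_def
    by (intro exI[of _ "carrier B"])
      (auto simp: Max_spec_def dest: maximalideal.I_notcarr maximalideal.axioms(1) ideal.Icarr)
  then show "Max_spec B \<subseteq> topspace (zariski B)"
    unfolding topspace_def openin_zariski[OF assms] by blast
qed


section \<open>Left modules over noncommutative rings\<close>

text \<open>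
  The locale \<^locale>\<open>module\<close> requires commutative scalars. As there, the multiplicative fields of the
  record of a module are irrelevant.
\<close>

locale left_module = R?: ring R + M?: abelian_group M
  for R :: "('a, 'r) ring_scheme" (structure) and M :: "('a, 'b, 'm) module_scheme" (structure) +
  assumes smult_closed:
      "\<lbrakk> a \<in> carrier R; x \<in> carrier M \<rbrakk> \<Longrightarrow> a \<odot>\<^bsub>M\<^esub> x \<in> carrier M"
    and smult_l_distr:
      "\<lbrakk> a \<in> carrier R; b \<in> carrier R; x \<in> carrier M \<rbrakk> \<Longrightarrow>
        (a \<oplus> b) \<odot>\<^bsub>M\<^esub> x = a \<odot>\<^bsub>M\<^esub> x \<oplus>\<^bsub>M\<^esub> b \<odot>\<^bsub>M\<^esub> x"
    and smult_r_distr: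
      "\<lbrakk> a \<in> carrier R; x \<in> carrier M; y \<in> carrier M \<rbrakk> \<Longrightarrow>
        a \<odot>\<^bsub>M\<^esub> (x \<oplus>\<^bsub>M\<^esub> y) = a \<odot>\<^bsub>M\<^esub> x \<oplus>\<^bsub>M\<^esub> a \<odot>\<^bsub>M\<^esub> y"
    and smult_assoc:
      "\<lbrakk> a \<in> carrier R; b \<in> carrier R; x \<in> carrier M \<rbrakk> \<Longrightarrow>
        (a \<otimes> b) \<odot>\<^bsub>M\<^esub> x = a \<odot>\<^bsub>M\<^esub> (b \<odot>\<^bsub>M\<^esub> x)"
    and smult_one:
      "x \<in> carrier M \<Longrightarrow> \<one> \<odot>\<^bsub>M\<^esub> x = x"

definition simple_module :: "('a, 'm) ring_scheme \<Rightarrow> ('a, 'v) module \<Rightarrow> bool" where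
  "simple_module A V \<longleftrightarrow>
    left_module A V \<and> carrier V \<noteq> {\<zero>\<^bsub>V\<^esub>} \<and>
    (\<forall>N. Module.submodule N A V \<longrightarrow> N = {\<zero>\<^bsub>V\<^esub>} \<or> N = carrier V)"

definition module_isomorphic ::
  "('a, 'm) ring_scheme \<Rightarrow> ('a, 'v) module \<Rightarrow> ('a, 'w) module \<Rightarrow> bool" where
  "module_isomorphic A V W \<longleftrightarrow> (\<exists>h \<in> module_hom A V W. bij_betw h (carrier V) (carrier W))"

definition restrict_scalars :: "('k, 'a) module \<Rightarrow> ('a, 'v) module \<Rightarrow> ('k, 'v) module" where
  "restrict_scalars A V =
    \<lparr>carrier = carrier V, monoid.mult = monoid.mult V, one = one V, zero = zero V, add = add V,
     smult = (\<lambda>c v. (c \<odot>\<^bsub>A\<^esub> \<one>\<^bsub>A\<^esub>) \<odot>\<^bsub>V\<^esub> v)\<rparr>"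

definition kdim :: "'k ring \<Rightarrow> ('k, 'a) module \<Rightarrow> ('a, 'v) module \<Rightarrow> enat" where
  "kdim K A V =
    (if vectorspace.fin_dim K (restrict_scalars A V)
     then enat (vectorspace.dim K (restrict_scalars A V)) else \<infinity>)"

definition transport_module :: "('v \<Rightarrow> 'w) \<Rightarrow> ('a, 'v) module \<Rightarrow> ('a, 'w) module" where
  "transport_module h V =
    (let g = the_inv_into (carrier V) h in
     \<lparr>carrier = h ` carrier V,
      monoid.mult = (\<lambda>x y. h (g x \<otimes>\<^bsub>V\<^esub> g y)), one = h \<one>\<^bsub>V\<^esub>,
      zero = h \<zero>\<^bsub>V\<^esub>, add = (\<lambda>x y. h (g x \<oplus>\<^bsub>V\<^esub> g y)),
      smult = (\<lambda>a x. h (a \<odot>\<^bsub>V\<^esub> g x))\<rparr>)"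

lemma transport_module_simps:
  assumes "inj_on h (carrier V)"
  shows "carrier (transport_module h V) = h ` carrier V"
    and "\<zero>\<^bsub>transport_module h V\<^esub> = h \<zero>\<^bsub>V\<^esub>"
    and "\<lbrakk>x \<in> carrier V; y \<in> carrier V\<rbrakk> \<Longrightarrow> h x \<oplus>\<^bsub>transport_module h V\<^esub> h y = h (x \<oplus>\<^bsub>V\<^esub> y)"
    and "x \<in> carrier V \<Longrightarrow> a \<odot>\<^bsub>transport_module h V\<^esub> h x = h (a \<odot>\<^bsub>V\<^esub> x)"
  using assms by (simp_all add: transport_module_def Let_def the_inv_into_f_f)

lemma left_module_transport:
  assumes V: "left_module A V" and h: "inj_on h (carrier V)"
  shows "left_module A (transport_module h V)"
proof -
  interpret left_module A V by fact
  note simps = transport_module_simps[OF h]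
  show ?thesis
  proof (intro left_module.intro left_module_axioms.intro abelian_groupI)
    show "ring A" by (rule R.ring_axioms)
    fix x assume "x \<in> carrier (transport_module h V)"
    then obtain v where v: "v \<in> carrier V" "x = h v" by (auto simp: simps)
    then show "\<exists>y\<in>carrier (transport_module h V).
        y \<oplus>\<^bsub>transport_module h V\<^esub> x = \<zero>\<^bsub>transport_module h V\<^esub>"
      by (intro bexI[of _ "h (\<ominus>\<^bsub>V\<^esub> v)"]) (auto simp: simps M.l_neg)
    fix x y assume "x \<in> carrier (transport_module h V)" "y \<in> carrier (transport_module h V)"
    then show "x \<oplus>\<^bsub>transport_module h V\<^esub> y = y \<oplus>\<^bsub>transport_module h V\<^esub> x"
      by (auto simp: simps M.a_comm)
  qed (auto simp: simps smult_closed smult_l_distr smult_r_distr smult_assoc smult_one M.a_assoc)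
qed

lemma module_hom_transport:
  assumes V: "left_module A V" and h: "inj_on h (carrier V)"
  shows "h \<in> module_hom A V (transport_module h V)"
proof -
  interpret left_module A V by fact
  show ?thesis
    by (auto simp: module_hom_def transport_module_simps[OF h])
qed

lemma simple_module_transport:
  assumes V: "simple_module A V" and h: "inj_on h (carrier V)"
  shows "simple_module A (transport_module h V)"
proof -
  interpret left_module A V using V by (simp add: simple_module_def)
  note simps = transport_module_simps[OF h]
  let ?W = "transport_module h V"
  interpret W: left_module A ?W by (rule left_module_transport[OF left_module_axioms h])
  have "carrier ?W \<noteq> {\<zero>\<^bsub>?W\<^esub>}"
  proof
    assume "carrier ?W = {\<zero>\<^bsub>?W\<^esub>}"
    then have "h ` carrier V = h ` {\<zero>\<^bsub>V\<^esub>}" by (simp add: simps)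
    then have "carrier V = {\<zero>\<^bsub>V\<^esub>}" using inj_on_image_eq_iff[OF h, of "carrier V" "{\<zero>\<^bsub>V\<^esub>}"] by simp
    then show False using V by (simp add: simple_module_def)
  qed
  moreover have "N = {\<zero>\<^bsub>?W\<^esub>} \<or> N = carrier ?W" if "Module.submodule N A ?W" for N
  proof -
    interpret N: Module.submodule N A ?W by fact
    define L where "L = {v \<in> carrier V. h v \<in> N}"
    have N_sub: "N \<subseteq> h ` carrier V" using N.subset by (simp add: simps)
    then have NL: "N = h ` L" unfolding L_def by auto
    have "Module.submodule L A V"
    proof (intro Module.submodule.intro subgroup.intro Module.submodule_axioms.intro)
      show "L \<subseteq> carrier (add_monoid V)" by (auto simp: L_def)
      show "x \<otimes>\<^bsub>add_monoid V\<^esub> y \<in> L" if "x \<in> L" "y \<in> L" for x y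
        using that N.m_closed[of "h x" "h y"] by (auto simp: L_def simps)
      show "\<one>\<^bsub>add_monoid V\<^esub> \<in> L"
        using N.one_closed by (auto simp: L_def simps)
      show "a \<odot>\<^bsub>V\<^esub> x \<in> L" if "a \<in> carrier A" "x \<in> L" for a x
        using that N.smult_closed[of a "h x"] by (auto simp: L_def simps smult_closed)
      show "inv\<^bsub>add_monoid V\<^esub> x \<in> L" if "x \<in> L" for x
      proof -
        have x: "x \<in> carrier V" "h x \<in> N" using that by (auto simp: L_def)
        have "h (\<ominus>\<^bsub>V\<^esub> x) \<oplus>\<^bsub>?W\<^esub> h x = \<zero>\<^bsub>?W\<^esub>" using x by (simp add: simps M.l_neg)
        then have "h (\<ominus>\<^bsub>V\<^esub> x) = \<ominus>\<^bsub>?W\<^esub> h x"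
          using x W.M.minus_equality[of "h (\<ominus>\<^bsub>V\<^esub> x)" "h x"] by (simp add: simps)
        moreover have "\<ominus>\<^bsub>?W\<^esub> h x \<in> N"
          using N.m_inv_closed[OF x(2)] by (simp add: a_inv_def)
        ultimately show ?thesis using x by (simp add: L_def a_inv_def[symmetric])
      qed
    qed
    then have "L = {\<zero>\<^bsub>V\<^esub>} \<or> L = carrier V" using V by (simp add: simple_module_def)
    then show ?thesis using NL by (auto simp: simps)
  qed
  ultimately show ?thesis using W.left_module_axioms by (simp add: simple_module_def)
qed

lemma simple_module_representative:
  fixes A :: "('a, 'm) ring_scheme" and V :: "('a, 'v) module"
  assumes V: "simple_module A V"
  shows "\<exists>W :: ('a, 'a set) module. simple_module A W \<and> module_isomorphic A V W"
proof -
  interpret left_module A V using V by (simp add: simple_module_def)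
  obtain v where v: "v \<in> carrier V" "v \<noteq> \<zero>\<^bsub>V\<^esub>"
    using V M.zero_closed unfolding simple_module_def by blast
  define L where "L = (\<lambda>a. a \<odot>\<^bsub>V\<^esub> v) ` carrier A"
  have zero: "\<zero>\<^bsub>A\<^esub> \<odot>\<^bsub>V\<^esub> v = \<zero>\<^bsub>V\<^esub>"
  proof -
    have "\<zero>\<^bsub>A\<^esub> \<odot>\<^bsub>V\<^esub> v \<oplus>\<^bsub>V\<^esub> \<zero>\<^bsub>A\<^esub> \<odot>\<^bsub>V\<^esub> v = \<zero>\<^bsub>A\<^esub> \<odot>\<^bsub>V\<^esub> v"
      using v smult_l_distr[of "\<zero>\<^bsub>A\<^esub>" "\<zero>\<^bsub>A\<^esub>" v] by simp
    then show ?thesis using v smult_closed[of "\<zero>\<^bsub>A\<^esub>" v] M.add.r_cancel_one by auto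
  qed
  have "Module.submodule L A V"
  proof (intro Module.submodule.intro subgroup.intro Module.submodule_axioms.intro)
    show "L \<subseteq> carrier (add_monoid V)" using v by (auto simp: L_def smult_closed)
    show "x \<otimes>\<^bsub>add_monoid V\<^esub> y \<in> L" if "x \<in> L" "y \<in> L" for x y
      using that v by (auto simp: L_def smult_l_distr[symmetric])
    show "\<one>\<^bsub>add_monoid V\<^esub> \<in> L" using zero by (auto simp: L_def image_iff intro!: bexI[of _ "\<zero>\<^bsub>A\<^esub>"])
    show "a \<odot>\<^bsub>V\<^esub> x \<in> L" if a: "a \<in> carrier A" and x: "x \<in> L" for a x
    proof -
      obtain b where b: "b \<in> carrier A" "x = b \<odot>\<^bsub>V\<^esub> v" using x unfolding L_def by blast
      then have "a \<odot>\<^bsub>V\<^esub> x = (a \<otimes>\<^bsub>A\<^esub> b) \<odot>\<^bsub>V\<^esub> v" using smult_assoc[OF a b(1) v(1)] by simp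
      then show ?thesis using a b(1) unfolding L_def by blast
    qed
    show "inv\<^bsub>add_monoid V\<^esub> x \<in> L" if x: "x \<in> L" for x
    proof -
      obtain a where a: "a \<in> carrier A" "x = a \<odot>\<^bsub>V\<^esub> v" using x unfolding L_def by blast
      have "(\<ominus>\<^bsub>A\<^esub> a) \<odot>\<^bsub>V\<^esub> v \<oplus>\<^bsub>V\<^esub> x = \<zero>\<^bsub>V\<^esub>"
        using a v zero smult_l_distr[of "\<ominus>\<^bsub>A\<^esub> a" a v] by (simp add: R.l_neg)
      then have "(\<ominus>\<^bsub>A\<^esub> a) \<odot>\<^bsub>V\<^esub> v = \<ominus>\<^bsub>V\<^esub> x"
        using a v M.minus_equality by (simp add: smult_closed)
      then have "\<ominus>\<^bsub>V\<^esub> x \<in> L" using a unfolding L_def by (metis R.a_inv_closed imageI)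
      then show ?thesis by (simp add: a_inv_def)
    qed
  qed
  then have "L = {\<zero>\<^bsub>V\<^esub>} \<or> L = carrier V" using V unfolding simple_module_def by simp
  moreover have "v \<in> L" using v smult_one[of v] unfolding L_def by (metis R.one_closed imageI)
  ultimately have L: "L = carrier V" using v(2) by auto
  define h where "h w = {a \<in> carrier A. a \<odot>\<^bsub>V\<^esub> v = w}" for w
  have h: "inj_on h (carrier V)"
  proof (rule inj_onI)
    fix x y assume xy: "x \<in> carrier V" "y \<in> carrier V" "h x = h y"
    then have "x \<in> L" by (simp add: L)
    then obtain a where "a \<in> carrier A" "x = a \<odot>\<^bsub>V\<^esub> v" unfolding L_def by blast
    then have "a \<in> h x" by (simp add: h_def)
    then have "a \<in> h y" using xy(3) by simp
    then show "x = y" using \<open>x = a \<odot>\<^bsub>V\<^esub> v\<close> by (simp add: h_def)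
  qed
  have "bij_betw h (carrier V) (carrier (transport_module h V))"
    using h by (simp add: bij_betw_def transport_module_simps[OF h])
  then have "module_isomorphic A V (transport_module h V)"
    using module_hom_transport[OF left_module_axioms h] unfolding module_isomorphic_def by blast
  then show ?thesis using simple_module_transport[OF V h] by blast
qed

text \<open>
  The competing modules \<open>W\<close> range over all simple modules whose carrier consists of subsets of \<open>A\<close>.
  By \<open>simple_module_representative\<close>, these are all simple modules up to isomorphism.
\<close>

definition large_module :: "'k ring \<Rightarrow> ('k, 'a) module \<Rightarrow> ('a, 'v) module \<Rightarrow> bool" where
  "large_module K A V \<longleftrightarrow>
    simple_module A V \<and>
    (\<forall>W :: ('a, 'a set) module. simple_module A W \<longrightarrow> kdim K A W \<le> kdim K A V)"


section \<open>Impressions\<close>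

text \<open>
  \<open>mat_algebra B d\<close> is the algebra of \<open>d \<times> d\<close> matrices over \<open>B\<close>, and \<open>scalar_mat B d f\<close> is \<open>f\<close> times the
  identity matrix.
\<close>

definition scalar_mat :: "('b, 'm) ring_scheme \<Rightarrow> nat \<Rightarrow> 'b \<Rightarrow> (nat \<times> nat \<Rightarrow> 'b)" where
  "scalar_mat B d f = (\<lambda>(i, j) \<in> {..<d} \<times> {..<d}. if i = j then f else \<zero>\<^bsub>B\<^esub>)"

definition mat_algebra :: "('k, 'b) module \<Rightarrow> nat \<Rightarrow> ('k, nat \<times> nat \<Rightarrow> 'b) module" where
  "mat_algebra B d =
    \<lparr>carrier = {..<d} \<times> {..<d} \<rightarrow>\<^sub>E carrier B,
     monoid.mult = (\<lambda>M N. \<lambda>(i, j) \<in> {..<d} \<times> {..<d}. \<Oplus>\<^bsub>B\<^esub>l \<in> {..<d}. M (i, l) \<otimes>\<^bsub>B\<^esub> N (l, j)),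
     one = scalar_mat B d \<one>\<^bsub>B\<^esub>,
     zero = scalar_mat B d \<zero>\<^bsub>B\<^esub>,
     add = (\<lambda>M N. \<lambda>(i, j) \<in> {..<d} \<times> {..<d}. M (i, j) \<oplus>\<^bsub>B\<^esub> N (i, j)),
     smult = (\<lambda>c M. \<lambda>(i, j) \<in> {..<d} \<times> {..<d}. c \<odot>\<^bsub>B\<^esub> M (i, j))\<rparr>"

definition eval_mat ::
  "('b, 'm) ring_scheme \<Rightarrow> nat \<Rightarrow> 'b set \<Rightarrow> (nat \<times> nat \<Rightarrow> 'b) \<Rightarrow> (nat \<times> nat \<Rightarrow> 'b set)" where
  "eval_mat B d q M = (\<lambda>(i, j) \<in> {..<d} \<times> {..<d}. q +>\<^bsub>B\<^esub> M (i, j))"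

text \<open>
  \<open>eval_module B d \<tau> q\<close> is the module of column vectors \<open>(B/q)\<^sup>d\<close> on which \<open>a\<close> acts through the
  matrix \<open>\<tau>\<^sub>q(a)\<close>.
\<close>

definition eval_module ::
  "('b, 'm) ring_scheme \<Rightarrow> nat \<Rightarrow> ('a \<Rightarrow> nat \<times> nat \<Rightarrow> 'b) \<Rightarrow> 'b set \<Rightarrow> ('a, nat \<Rightarrow> 'b set) module" where
  "eval_module B d \<tau> q =
    \<lparr>carrier = {..<d} \<rightarrow>\<^sub>E carrier (B Quot q),
     monoid.mult = undefined, one = undefined,
     zero = (\<lambda>i \<in> {..<d}. \<zero>\<^bsub>B Quot q\<^esub>),
     add = (\<lambda>v w. \<lambda>i \<in> {..<d}. v i \<oplus>\<^bsub>B Quot q\<^esub> w i),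
     smult = (\<lambda>a v. \<lambda>i \<in> {..<d}.
       \<Oplus>\<^bsub>B Quot q\<^esub>j \<in> {..<d}. eval_mat B d q (\<tau> a) (i, j) \<otimes>\<^bsub>B Quot q\<^esub> v j)\<rparr>"

definition pre_impression ::
  "'k ring \<Rightarrow> ('k, 'a) module \<Rightarrow> ('k, 'b) module \<Rightarrow> nat \<Rightarrow> ('a \<Rightarrow> nat \<times> nat \<Rightarrow> 'b) \<Rightarrow> bool" where
  "pre_impression K A B d \<tau> \<longleftrightarrow>
    algebra K B \<and> fin_gen_over K B \<and>
    \<tau> \<in> alg_hom K A (mat_algebra B d) \<and> inj_on \<tau> (carrier A) \<and>
    (\<exists>U. openin (zariski B) U \<and> (zariski B) closure_of U = Max_spec B \<and>
         (\<forall>q \<in> U. simple_module A (eval_module B d \<tau> q)))"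

definition impression_scalars ::
  "('k, 'a) module \<Rightarrow> ('k, 'b) module \<Rightarrow> nat \<Rightarrow> ('a \<Rightarrow> nat \<times> nat \<Rightarrow> 'b) \<Rightarrow> 'b set" where
  "impression_scalars A B d \<tau> = {f \<in> carrier B. scalar_mat B d f \<in> \<tau> ` carrier A}"

definition impression ::
  "'k ring \<Rightarrow> ('k, 'a) module \<Rightarrow> ('k, 'b) module \<Rightarrow> nat \<Rightarrow> ('a \<Rightarrow> nat \<times> nat \<Rightarrow> 'b) \<Rightarrow> bool" where
  "impression K A B d \<tau> \<longleftrightarrow>
    pre_impression K A B d \<tau> \<and>
    (let R = impression_scalars A B d \<tau> in
     (\<lambda>q. q \<inter> R) ` Max_spec B = Max_spec (B\<lparr>carrier := R\<rparr>))"

end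

theory Submission
  imports Defs
begin

text \<open>
  Let \<open>J\<close> be the annihilator of the large module \<open>V\<close>, and \<open>Z\<close> the center of \<open>A\<close>. The point \<open>q\<close> is found by
  lifting the central character of \<open>V\<close>, and \<open>V\<close> is compared with the evaluation at \<open>q\<close> by means of a trace.
  
  Fix a point \<open>q0\<close> at which the evaluation is simple. By density, \<open>A\<close> contains lifts of the matrix units of
  this evaluation, and the lifts of the first unit have nonzero trace in \<open>B\<close>. From such units a trace-dual
  family is built inside \<open>A\<close> (\<open>dual_basis\<close>). Since \<open>B\<close> is a domain, duality of \<open>d\<^sup>2\<close> matrices becomes a
  completeness relation (\<open>biorthogonal_flip\<close>), with two consequences: every element of \<open>Z\<close> is mapped by \<open>\<tau>\<close> to a
  scalar matrix (\<open>center_scalar\<close>), and the Casimir elements \<open>\<Sum>\<^sub>p e\<^sub>p a c\<^sub>p\<close> are scalars as well (\<open>\<tau>_casimir\<close>).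
  
  So \<open>R\<close> is a copy of \<open>Z\<close>. Since \<open>A\<close> is finite over \<open>Z\<close>, the ideal of \<open>R\<close> that corresponds to \<open>Z \<inter> J\<close> is
  maximal (\<open>maximalideal_annihilating_scalars\<close>), and the impression provides a point \<open>q\<close> above it. By the Nullstellensatz
  (\<open>maximalideal_residue\<close>) \<open>Z\<close> acts on \<open>V\<close> through \<open>K\<close>. Hence \<open>V\<close> has finite dimension, and this dimension is at
  least \<open>d\<close> because \<open>V\<close> is large. Density then gives \<open>d \<times> d\<close> matrix units modulo \<open>J\<close>.
  
  With such units, it suffices to find a point \<open>p\<close> for which the annihilator of the evaluation at \<open>p\<close> is
  contained in \<open>J\<close> (\<open>isomorphic_of_annihilator_subset\<close>). Suppose that \<open>q0\<close> is not such a point. Then the annihilator of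
  its evaluation and \<open>J\<close> are comaximal, and there are common matrix units for both ideals. If \<open>q\<close> failed too,
  then some \<open>a\<close> would annihilate the evaluation at \<open>q\<close> and act on \<open>V\<close> as the identity. The Casimir element of
  \<open>a\<close> is then a scalar in \<open>q\<close>, so it annihilates \<open>V\<close>; but its action on \<open>V\<close> is that of the sum of the diagonal
  matrix units (\<open>exists_separating_scalar\<close>).
\<close>

section \<open>Linear relations over a domain\<close>

lemma (in ring) subring_finsum_closed:
  assumes T: "subring T R" and "finite I" "\<And>i. i \<in> I \<Longrightarrow> f i \<in> T"
  shows "(\<Oplus>i\<in>I. f i) \<in> T"
  using assms(2,3)
proof (induction I rule: finite_induct)
  case (insert i I)
  then have "f \<in> I \<rightarrow> carrier R" "f i \<in> carrier R" using subringE(1)[OF T] by auto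
  then show ?case using insert subringE(7)[OF T] by simp
qed (use subringE(2)[OF T] in simp)

text \<open>
  Gaussian elimination without division: the column of a nonzero entry \<open>M p0 k\<close> is cleared by
  multiplying the other rows by that entry. The coefficients therefore stay in the subring \<open>T\<close>, which is
  what the descent of the G-domain property needs.
\<close>

lemma (in domain) exists_linear_relation:
  assumes T: "subring T R"
    and "finite Q" "finite P" "card Q < card P"
    and "\<And>p k. p \<in> P \<Longrightarrow> k \<in> Q \<Longrightarrow> M p k \<in> T"
  shows "\<exists>\<beta>. (\<forall>p\<in>P. \<beta> p \<in> T) \<and> (\<exists>p\<in>P. \<beta> p \<noteq> \<zero>) \<and>
             (\<forall>k\<in>Q. (\<Oplus>p\<in>P. \<beta> p \<otimes> M p k) = \<zero>)"
  using assms(2-)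
proof (induction Q arbitrary: P M rule: finite_induct)
  case empty
  then obtain p where "p \<in> P" by fastforce
  then show ?case by (intro exI[of _ "\<lambda>_. \<one>"]) (use subringE(3)[OF T] in auto)
next
  case (insert k Q)
  note M = insert.prems(3)
  have TR: "t \<in> T \<Longrightarrow> t \<in> carrier R" for t using subringE(1)[OF T] by blast
  have Tmin: "a \<ominus> b \<in> T" if "a \<in> T" "b \<in> T" for a b
    using that subringE(5,7)[OF T] unfolding a_minus_def by blast
  show ?case
  proof (cases "\<forall>p\<in>P. M p k = \<zero>")
    case True
    obtain \<beta> where \<beta>: "\<forall>p\<in>P. \<beta> p \<in> T" "\<exists>p\<in>P. \<beta> p \<noteq> \<zero>"
      "\<forall>l\<in>Q. (\<Oplus>p\<in>P. \<beta> p \<otimes> M p l) = \<zero>"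
      using insert.IH[of P M] insert.prems insert.hyps by auto
    have "(\<Oplus>p\<in>P. \<beta> p \<otimes> M p k) = (\<Oplus>p\<in>P. \<zero>)"
      by (rule finsum_cong') (use True \<beta>(1) TR in auto)
    then show ?thesis using \<beta> by (intro exI[of _ \<beta>]) auto
  next
    case False
    then obtain p0 where p0: "p0 \<in> P" "M p0 k \<noteq> \<zero>" by blast
    define P' where "P' = P - {p0}"
    have P: "P = insert p0 P'" "p0 \<notin> P'" "finite P'"
      using p0 insert.prems by (auto simp: P'_def)
    have MT: "M p l \<in> T" if "p \<in> insert p0 P'" "l \<in> insert k Q" for p l
      using M that P by auto
    note Mc = TR[OF MT]
    \<comment> \<open>the other rows, cleared in column \<open>k\<close>\<close>
    define M' where "M' p l = M p0 k \<otimes> M p l \<ominus> M p k \<otimes> M p0 l" for p l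
    have "card Q < card P'"
      using insert.prems insert.hyps P by auto
    then obtain \<beta>' where \<beta>'T: "\<forall>p\<in>P'. \<beta>' p \<in> T" and \<beta>'2: "\<exists>p\<in>P'. \<beta>' p \<noteq> \<zero>"
      and \<beta>'3: "\<forall>l\<in>Q. (\<Oplus>p\<in>P'. \<beta>' p \<otimes> M' p l) = \<zero>"
      using insert.IH[of P' M'] P(3) MT Tmin subringE(6)[OF T] unfolding M'_def by auto
    have \<beta>'c: "\<And>p. p \<in> P' \<Longrightarrow> \<beta>' p \<in> carrier R" using \<beta>'T TR by blast
    define \<beta> where "\<beta> p = (if p = p0 then (\<Oplus>p\<in>P'. \<beta>' p \<otimes> (\<ominus> M p k)) else \<beta>' p \<otimes> M p0 k)" for p
    have sum0: "(\<Oplus>p\<in>P'. \<beta>' p \<otimes> (\<ominus> M p k)) \<in> T"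
      by (rule subring_finsum_closed[OF T P(3)]) (use \<beta>'T MT subringE(5,6)[OF T] in auto)
    have \<beta>T: "\<beta> p \<in> T" if "p \<in> P" for p
      using that \<beta>'T MT P sum0 subringE(6)[OF T] unfolding \<beta>_def by auto
    note \<beta>c = TR[OF \<beta>T]
    have eq: "(\<Oplus>p\<in>P. \<beta> p \<otimes> M p l) = (\<Oplus>p\<in>P'. \<beta>' p \<otimes> M' p l)" if l: "l \<in> insert k Q" for l
    proof -
      have "(\<Oplus>p\<in>P. \<beta> p \<otimes> M p l) = \<beta> p0 \<otimes> M p0 l \<oplus> (\<Oplus>p\<in>P'. \<beta> p \<otimes> M p l)"
        unfolding P(1) by (rule finsum_insert) (use P \<beta>c Mc l in auto)
      also have "\<beta> p0 \<otimes> M p0 l = (\<Oplus>p\<in>P'. \<beta>' p \<otimes> (\<ominus> M p k) \<otimes> M p0 l)"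
        unfolding \<beta>_def by (simp, rule finsum_ldistr) (use P \<beta>'c Mc l in auto)
      also have "(\<Oplus>p\<in>P'. \<beta> p \<otimes> M p l) = (\<Oplus>p\<in>P'. \<beta>' p \<otimes> M p0 k \<otimes> M p l)"
        by (rule finsum_cong') (use P \<beta>'c Mc l in \<open>auto simp: \<beta>_def\<close>)
      also have "(\<Oplus>p\<in>P'. \<beta>' p \<otimes> (\<ominus> M p k) \<otimes> M p0 l) \<oplus> (\<Oplus>p\<in>P'. \<beta>' p \<otimes> M p0 k \<otimes> M p l)
          = (\<Oplus>p\<in>P'. \<beta>' p \<otimes> (\<ominus> M p k) \<otimes> M p0 l \<oplus> \<beta>' p \<otimes> M p0 k \<otimes> M p l)"
        by (rule finsum_addf[symmetric]) (use P \<beta>'c Mc l in auto)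
      also have "\<dots> = (\<Oplus>p\<in>P'. \<beta>' p \<otimes> M' p l)"
      proof (rule finsum_cong')
        fix p assume p: "p \<in> P'"
        have c: "\<beta>' p \<in> carrier R" "M p k \<in> carrier R" "M p0 k \<in> carrier R" "M p l \<in> carrier R"
          "M p0 l \<in> carrier R"
          using p \<beta>'c Mc l by auto
        then show "\<beta>' p \<otimes> (\<ominus> M p k) \<otimes> M p0 l \<oplus> \<beta>' p \<otimes> M p0 k \<otimes> M p l = \<beta>' p \<otimes> M' p l"
          unfolding M'_def by algebra
      qed (use P \<beta>'c Mc l in \<open>auto simp: M'_def\<close>)
      finally show ?thesis .
    qed
    have "(\<Oplus>p\<in>P'. \<beta>' p \<otimes> M' p k) = (\<Oplus>p\<in>P'. \<zero>)"
    proof (rule finsum_cong')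
      fix p assume p: "p \<in> P'"
      have "\<beta>' p \<in> carrier R" "M p k \<in> carrier R" "M p0 k \<in> carrier R"
        using p \<beta>'c Mc by auto
      then show "\<beta>' p \<otimes> M' p k = \<zero>" unfolding M'_def by algebra
    qed auto
    then have "\<forall>l\<in>insert k Q. (\<Oplus>p\<in>P. \<beta> p \<otimes> M p l) = \<zero>"
      using eq \<beta>'3 by auto
    moreover obtain p where "p \<in> P'" "\<beta>' p \<noteq> \<zero>" using \<beta>'2 by blast
    then have "p \<in> P" "\<beta> p \<noteq> \<zero>"
      using P p0 \<beta>'c Mc[of p0 k] integral[of "\<beta>' p" "M p0 k"] by (auto simp: \<beta>_def)
    ultimately show ?thesis using \<beta>T by blast
  qed
qed

lemma (in abelian_monoid) finsum_delta:
  assumes "finite I" "i \<in> I" "f i \<in> carrier G"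
  shows "(\<Oplus>j\<in>I. if j = i then f j else \<zero>) = f i"
    and "(\<Oplus>j\<in>I. if i = j then f j else \<zero>) = f i"
proof -
  have "(\<Oplus>j\<in>I. if i = j then f j else \<zero>) = (\<Oplus>j\<in>I. if i = j then f i else \<zero>)"
    by (rule finsum_cong') (use assms in auto)
  also have "\<dots> = f i"
    by (rule finsum_singleton) (use assms in auto)
  finally show "(\<Oplus>j\<in>I. if i = j then f j else \<zero>) = f i" .
  then show "(\<Oplus>j\<in>I. if j = i then f j else \<zero>) = f i" by (simp add: eq_commute)
qed

lemma (in abelian_monoid) finsum_swap:
  assumes "finite I" "finite J" "\<And>i j. i \<in> I \<Longrightarrow> j \<in> J \<Longrightarrow> f i j \<in> carrier G"
  shows "(\<Oplus>i\<in>I. \<Oplus>j\<in>J. f i j) = (\<Oplus>j\<in>J. \<Oplus>i\<in>I. f i j)"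
  using assms(1) assms(3)
proof (induction I rule: finite_induct)
  case empty
  then show ?case by simp
next
  case (insert i I)
  have "(\<Oplus>i\<in>insert i I. \<Oplus>j\<in>J. f i j) = (\<Oplus>j\<in>J. f i j) \<oplus> (\<Oplus>j\<in>J. \<Oplus>i\<in>I. f i j)"
    using insert by (subst finsum_insert) (auto intro!: finsum_closed)
  also have "\<dots> = (\<Oplus>j\<in>J. f i j \<oplus> (\<Oplus>i\<in>I. f i j))"
    by (rule finsum_addf[symmetric]) (use insert in \<open>auto intro!: finsum_closed\<close>)
  also have "\<dots> = (\<Oplus>j\<in>J. \<Oplus>i\<in>insert i I. f i j)"
    by (rule finsum_cong') (use insert in \<open>auto intro!: finsum_closed\<close>)
  finally show ?case .
qed

text \<open>
  Up to the factor \<open>\<delta>\<close>, one-sided inverses of square matrices are two-sided. Determinants are avoided: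
  the rows of \<open>x\<close> and the \<open>k\<close>-th coordinate vector satisfy a linear relation, since there is one vector
  more than there are coordinates, and pairing the relation with the rows of \<open>y\<close> determines its
  coefficients.
\<close>

lemma (in domain) biorthogonal_flip:
  assumes I: "finite I" and \<delta>: "\<delta> \<in> carrier R" "\<delta> \<noteq> \<zero>"
    and x: "\<And>i k. i \<in> I \<Longrightarrow> k \<in> I \<Longrightarrow> x i k \<in> carrier R"
    and y: "\<And>i k. i \<in> I \<Longrightarrow> k \<in> I \<Longrightarrow> y i k \<in> carrier R"
    and yx: "\<And>i j. i \<in> I \<Longrightarrow> j \<in> I \<Longrightarrow> (\<Oplus>k\<in>I. y i k \<otimes> x j k) = (if i = j then \<delta> else \<zero>)"
    and kl: "k \<in> I" "l \<in> I"
  shows "(\<Oplus>i\<in>I. y i k \<otimes> x i l) = (if k = l then \<delta> else \<zero>)"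
proof -
  \<comment> \<open>\<open>None\<close> stands for the coordinate vector, \<open>Some i\<close> for a row of \<open>x\<close>\<close>
  define P where "P = insert None (Some ` I)"
  define M where "M p l = (case p of None \<Rightarrow> if l = k then \<one> else \<zero> | Some i \<Rightarrow> x i l)" for p l
  have finP: "finite P" "finite (Some ` I)" "None \<notin> Some ` I" using I by (auto simp: P_def)
  have "card I < card P" unfolding P_def using I by (simp add: card_image)
  moreover have Mc: "M p l \<in> carrier R" if "p \<in> P" "l \<in> I" for p l
    using that x by (auto simp: P_def M_def)
  ultimately obtain \<beta> where \<beta>: "\<forall>p\<in>P. \<beta> p \<in> carrier R" "\<exists>p\<in>P. \<beta> p \<noteq> \<zero>"
      "\<forall>l\<in>I. (\<Oplus>p\<in>P. \<beta> p \<otimes> M p l) = \<zero>"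
    using exists_linear_relation[OF carrier_is_subring I finP(1), of M] by blast
  define \<gamma> where "\<gamma> = \<beta> None"
  have \<gamma>: "\<gamma> \<in> carrier R" and \<beta>c: "\<And>i. i \<in> I \<Longrightarrow> \<beta> (Some i) \<in> carrier R"
    using \<beta>(1) by (auto simp: \<gamma>_def P_def)
  have rel: "\<gamma> \<otimes> (if l = k then \<one> else \<zero>) \<oplus> (\<Oplus>i\<in>I. \<beta> (Some i) \<otimes> x i l) = \<zero>" if l: "l \<in> I" for l
  proof -
    have "\<zero> = (\<Oplus>p\<in>P. \<beta> p \<otimes> M p l)" using \<beta>(3) l by simp
    also have "\<dots> = \<beta> None \<otimes> M None l \<oplus> (\<Oplus>p\<in>Some ` I. \<beta> p \<otimes> M p l)"
      unfolding P_def by (rule finsum_insert) (use finP \<beta>(1) Mc l in \<open>auto simp: P_def\<close>)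
    also have "(\<Oplus>p\<in>Some ` I. \<beta> p \<otimes> M p l) = (\<Oplus>i\<in>I. \<beta> (Some i) \<otimes> M (Some i) l)"
      by (rule finsum_reindex) (use \<beta>(1) Mc l in \<open>auto simp: P_def\<close>)
    finally show ?thesis by (simp add: M_def \<gamma>_def)
  qed
  have coeff: "\<beta> (Some j) \<otimes> \<delta> = \<ominus> (\<gamma> \<otimes> y j k)" if j: "j \<in> I" for j
  proof -
    have "(\<Oplus>l\<in>I. y j l \<otimes> (\<gamma> \<otimes> (if l = k then \<one> else \<zero>) \<oplus> (\<Oplus>i\<in>I. \<beta> (Some i) \<otimes> x i l)))
        = (\<Oplus>l\<in>I. \<zero>)"
      by (rule finsum_cong') (use rel y j in auto)
    then have "\<zero> = (\<Oplus>l\<in>I. y j l \<otimes> (\<gamma> \<otimes> (if l = k then \<one> else \<zero>) \<oplus> (\<Oplus>i\<in>I. \<beta> (Some i) \<otimes> x i l)))"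
      by simp
    also have "\<dots> = (\<Oplus>l\<in>I. (if l = k then \<gamma> \<otimes> y j l else \<zero>) \<oplus>
        (\<Oplus>i\<in>I. \<beta> (Some i) \<otimes> (y j l \<otimes> x i l)))"
    proof (rule finsum_cong')
      fix l assume l: "l \<in> I"
      have s: "(\<Oplus>i\<in>I. \<beta> (Some i) \<otimes> x i l) \<in> carrier R"
        using \<beta>c x l by (auto intro!: finsum_closed)
      have "y j l \<otimes> (\<Oplus>i\<in>I. \<beta> (Some i) \<otimes> x i l) = (\<Oplus>i\<in>I. y j l \<otimes> (\<beta> (Some i) \<otimes> x i l))"
        by (rule finsum_rdistr) (use I y j l \<beta>c x in auto)
      also have "\<dots> = (\<Oplus>i\<in>I. \<beta> (Some i) \<otimes> (y j l \<otimes> x i l))"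
        by (rule finsum_cong') (use y j l \<beta>c x in \<open>auto simp: m_lcomm\<close>)
      finally show "y j l \<otimes> (\<gamma> \<otimes> (if l = k then \<one> else \<zero>) \<oplus> (\<Oplus>i\<in>I. \<beta> (Some i) \<otimes> x i l))
          = (if l = k then \<gamma> \<otimes> y j l else \<zero>) \<oplus> (\<Oplus>i\<in>I. \<beta> (Some i) \<otimes> (y j l \<otimes> x i l))"
        using y[OF j l] \<gamma> s by (auto simp: r_distr m_comm)
    qed (use y j \<gamma> \<beta>c x in \<open>auto intro!: finsum_closed\<close>)
    also have "\<dots> = (\<Oplus>l\<in>I. if l = k then \<gamma> \<otimes> y j l else \<zero>) \<oplus>
        (\<Oplus>l\<in>I. \<Oplus>i\<in>I. \<beta> (Some i) \<otimes> (y j l \<otimes> x i l))"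
      by (rule finsum_addf) (use y j \<gamma> \<beta>c x in \<open>auto intro!: finsum_closed\<close>)
    also have "(\<Oplus>l\<in>I. if l = k then \<gamma> \<otimes> y j l else \<zero>) = \<gamma> \<otimes> y j k"
      by (rule finsum_delta) (use I kl y j \<gamma> in auto)
    also have "(\<Oplus>l\<in>I. \<Oplus>i\<in>I. \<beta> (Some i) \<otimes> (y j l \<otimes> x i l)) =
        (\<Oplus>i\<in>I. \<Oplus>l\<in>I. \<beta> (Some i) \<otimes> (y j l \<otimes> x i l))"
      by (rule finsum_swap) (use I y j \<beta>c x in auto)
    also have "\<dots> = (\<Oplus>i\<in>I. if j = i then \<beta> (Some i) \<otimes> \<delta> else \<zero>)"
    proof (rule finsum_cong')
      fix i assume i: "i \<in> I"
      have "(\<Oplus>l\<in>I. \<beta> (Some i) \<otimes> (y j l \<otimes> x i l)) = \<beta> (Some i) \<otimes> (\<Oplus>l\<in>I. y j l \<otimes> x i l)"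
        by (rule finsum_rdistr[symmetric]) (use I y j i \<beta>c x in auto)
      then show "(\<Oplus>l\<in>I. \<beta> (Some i) \<otimes> (y j l \<otimes> x i l)) = (if j = i then \<beta> (Some i) \<otimes> \<delta> else \<zero>)"
        using yx[OF j i] \<beta>c[OF i] by auto
    qed (use \<beta>c \<delta> in auto)
    also have "\<dots> = \<beta> (Some j) \<otimes> \<delta>"
      by (rule finsum_delta) (use I j \<beta>c \<delta> in auto)
    finally have "\<gamma> \<otimes> y j k \<oplus> \<beta> (Some j) \<otimes> \<delta> = \<zero>" by simp
    then have "\<beta> (Some j) \<otimes> \<delta> \<oplus> \<gamma> \<otimes> y j k = \<zero>"
      using y j kl \<beta>c \<delta> \<gamma> by (subst a_comm) auto
    then show ?thesis
      using y j kl \<beta>c \<delta> \<gamma> minus_equality[of "\<beta> (Some j) \<otimes> \<delta>" "\<gamma> \<otimes> y j k"] by simp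
  qed
  have \<gamma>0: "\<gamma> \<noteq> \<zero>"
  proof
    assume "\<gamma> = \<zero>"
    then have "\<beta> (Some j) = \<zero>" if "j \<in> I" for j
      using coeff[OF that] \<delta> \<beta>c[OF that] y[OF that kl(1)] integral[of "\<beta> (Some j)" \<delta>] by auto
    then show False using \<beta>(2) \<open>\<gamma> = \<zero>\<close> by (auto simp: P_def \<gamma>_def)
  qed
  let ?s = "\<Oplus>i\<in>I. y i k \<otimes> x i l"
  have s: "?s \<in> carrier R" using x y kl by (auto intro!: finsum_closed)
  have "\<gamma> \<otimes> ?s = (\<Oplus>i\<in>I. \<gamma> \<otimes> (y i k \<otimes> x i l))"
    by (rule finsum_rdistr) (use I x y kl \<gamma> in auto)
  also have "\<dots> = (\<Oplus>i\<in>I. (\<ominus> \<delta>) \<otimes> (\<beta> (Some i) \<otimes> x i l))"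
  proof (rule finsum_cong')
    fix i assume i: "i \<in> I"
    have c: "\<gamma> \<in> carrier R" "y i k \<in> carrier R" "x i l \<in> carrier R" "\<beta> (Some i) \<in> carrier R"
      "\<delta> \<in> carrier R" using x y kl i \<gamma> \<beta>c \<delta> by auto
    have "(\<ominus> \<delta>) \<otimes> (\<beta> (Some i) \<otimes> x i l) = \<ominus> (\<beta> (Some i) \<otimes> \<delta>) \<otimes> x i l" using c by algebra
    also have "\<dots> = \<gamma> \<otimes> (y i k \<otimes> x i l)" unfolding coeff[OF i] using c by algebra
    finally show "\<gamma> \<otimes> (y i k \<otimes> x i l) = (\<ominus> \<delta>) \<otimes> (\<beta> (Some i) \<otimes> x i l)" by simp
  qed (use x kl \<delta> \<beta>c in auto)
  also have "\<dots> = (\<ominus> \<delta>) \<otimes> (\<Oplus>i\<in>I. \<beta> (Some i) \<otimes> x i l)"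
    by (rule finsum_rdistr[symmetric]) (use I x kl \<delta> \<beta>c in auto)
  also have "(\<Oplus>i\<in>I. \<beta> (Some i) \<otimes> x i l) = \<ominus> (\<gamma> \<otimes> (if l = k then \<one> else \<zero>))"
  proof -
    have "(\<Oplus>i\<in>I. \<beta> (Some i) \<otimes> x i l) \<in> carrier R" using x kl \<beta>c by (auto intro!: finsum_closed)
    then show ?thesis using rel[OF kl(2)] \<gamma>
      by (intro minus_equality[symmetric]) (auto simp: a_comm)
  qed
  also have "(\<ominus> \<delta>) \<otimes> \<ominus> (\<gamma> \<otimes> (if l = k then \<one> else \<zero>)) = \<gamma> \<otimes> (if k = l then \<delta> else \<zero>)"
    using \<delta> \<gamma> by (auto simp: l_minus r_minus m_comm)
  finally show ?thesis using m_lcancel[OF \<gamma>0 \<gamma> s] \<delta> by auto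
qed

section \<open>Dual bases\<close>

text \<open>
  Elements of \<open>A\<close> that multiply like \<open>d \<times> d\<close> matrix units modulo \<open>I\<close>. Their diagonal sum may differ from
  the identity of \<open>A/I\<close>: such families already come from \<open>d\<close> independent vectors in a module of larger
  dimension.
\<close>

locale matrix_units =
  fixes A :: "('a, 'm) ring_scheme" (structure) and I :: "'a set" and d :: nat
    and e :: "nat \<Rightarrow> nat \<Rightarrow> 'a"
  assumes ideal_I: "ideal I A"
    and e_closed: "\<And>i j. i < d \<Longrightarrow> j < d \<Longrightarrow> e i j \<in> carrier A"
    and e_mult: "\<And>i j k l. i < d \<Longrightarrow> j < d \<Longrightarrow> k < d \<Longrightarrow> l < d \<Longrightarrow>
       (e i j \<otimes> e k l) \<ominus> (if j = k then e i l else \<zero>) \<in> I"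
    and d_pos: "0 < d"
begin

sublocale ideal I A by (rule ideal_I)

abbreviation proj where "proj \<equiv> (+>) I"

abbreviation Quo where "Quo \<equiv> A Quot I"

sublocale pr: ring_hom_ring A Quo proj by (rule rcos_ring_hom_ring)

lemma proj_eq_iff: "a \<in> carrier A \<Longrightarrow> b \<in> carrier A \<Longrightarrow> proj a = proj b \<longleftrightarrow> a \<ominus> b \<in> I"
  using quotient_eq_iff_same_a_r_cos[OF ideal_I] by blast

lemma proj_zero_iff: "a \<in> carrier A \<Longrightarrow> proj a = \<zero>\<^bsub>Quo\<^esub> \<longleftrightarrow> a \<in> I"
  using proj_eq_iff[of a "\<zero>"] by (simp add: a_minus_def)

lemma proj_mult:
  assumes "i < d" "j < d" "k < d" "l < d"
  shows "proj (e i j) \<otimes>\<^bsub>Quo\<^esub> proj (e k l) = (if j = k then proj (e i l) else \<zero>\<^bsub>Quo\<^esub>)"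
proof -
  have "proj (e i j \<otimes> e k l) = proj (if j = k then e i l else \<zero>)"
    using e_mult[OF assms] assms e_closed by (subst proj_eq_iff) auto
  then show ?thesis using e_closed assms by (auto split: if_splits)
qed

abbreviation Idx where "Idx \<equiv> {..<d} \<times> {..<d}"

abbreviation unit_at where "unit_at p \<equiv> e (fst p) (snd p)"

abbreviation unit_flip where "unit_flip p \<equiv> e (snd p) (fst p)"

text \<open>
  If \<open>T\<close> vanished on \<open>I\<close>, then the family \<open>e\<^sub>j\<^sub>i\<close> would be dual to \<open>e\<^sub>i\<^sub>j\<close>, up to the factor
  \<open>T e\<^sub>0\<^sub>0\<close>, for the form \<open>(a, b) \<mapsto> T (a b)\<close>.
  In general this is only an approximation modulo \<open>I\<close>, and it is corrected by an elimination that never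
  divides. The pairing with the unit at \<open>j = (a, b)\<close> is carried by the operator
  \<open>H j t = e\<^sub>0\<^sub>a t e\<^sub>b\<^sub>0\<close>, whose value at the unit at \<open>i\<close> is \<open>e\<^sub>0\<^sub>0\<close> or \<open>0\<close> modulo \<open>I\<close>. Elimination makes these values
  exactly \<open>u\<close> or \<open>0\<close>, one \<open>i\<close> after the other. The coefficients do not commute, so every step is
  also performed on the adjoints \<open>G j\<close>, defined by \<open>T (s (H j t)) = T ((G j s) t)\<close>, which exist because
  \<open>T\<close> is a trace. In the end \<open>G j e\<^sub>0\<^sub>0\<close> is the dual family.
\<close>

lemma dual_basis:
  fixes T :: "'a \<Rightarrow> 'b" and B :: "('b, 'n) ring_scheme"
  assumes B: "abelian_group B"
    and Tc: "\<And>a. a \<in> carrier A \<Longrightarrow> T a \<in> carrier B"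
    and Tadd: "\<And>a b. a \<in> carrier A \<Longrightarrow> b \<in> carrier A \<Longrightarrow> T (a \<oplus> b) = T a \<oplus>\<^bsub>B\<^esub> T b"
    and Tcyc: "\<And>a b. a \<in> carrier A \<Longrightarrow> b \<in> carrier A \<Longrightarrow> T (a \<otimes> b) = T (b \<otimes> a)"
  obtains u c where "u \<in> carrier A" "u \<ominus> e 0 0 \<in> I"
    "\<And>p. p \<in> Idx \<Longrightarrow> c p \<in> carrier A" "\<And>p. p \<in> Idx \<Longrightarrow> c p \<ominus> unit_flip p \<in> I"
    "\<And>p r. p \<in> Idx \<Longrightarrow> r \<in> Idx \<Longrightarrow> T (c p \<otimes> unit_at r) = (if p = r then T u else \<zero>\<^bsub>B\<^esub>)"
proof -
  interpret B: abelian_group B by fact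
  interpret Q: ring Quo by (rule quotient_is_ring)
  have T0: "T \<zero> = \<zero>\<^bsub>B\<^esub>"
    using Tadd[of \<zero> \<zero>] Tc[of \<zero>] B.add.r_cancel_one[of "T \<zero>" "T \<zero>"] by auto
  have Tminus: "T (a \<ominus> b) = T a \<ominus>\<^bsub>B\<^esub> T b" if "a \<in> carrier A" "b \<in> carrier A" for a b
  proof -
    have "T (\<ominus> b) \<oplus>\<^bsub>B\<^esub> T b = \<zero>\<^bsub>B\<^esub>" using Tadd[of "\<ominus> b" b] that T0 by (simp add: l_neg)
    then have "T (\<ominus> b) = \<ominus>\<^bsub>B\<^esub> T b" using that Tc B.minus_equality by simp
    then show ?thesis using that Tadd[of a "\<ominus> b"] by (simp add: a_minus_def B.minus_eq)
  qed
  define J where "J = Idx"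
  define E where "E = proj (e 0 0)"
  have ec: "unit_at p \<in> carrier A" "unit_flip p \<in> carrier A" if "p \<in> J" for p
    using that e_closed by (auto simp: J_def)
  have e0: "e 0 (fst p) \<in> carrier A" "e (snd p) 0 \<in> carrier A" if "p \<in> J" for p
    using that e_closed d_pos by (auto simp: J_def)
  have e00: "e 0 0 \<in> carrier A" using e_closed d_pos by auto
  have Ec: "E \<in> carrier Quo" using e00 by (simp add: E_def)
  have EE: "E \<otimes>\<^bsub>Quo\<^esub> E = E" using proj_mult[of 0 0 0 0] d_pos by (simp add: E_def)
  \<comment> \<open>the values of \<open>H j\<close> are exact at the units in \<open>S\<close>, and correct modulo \<open>I\<close> at all others\<close>
  define Inv where "Inv S u H G \<longleftrightarrow> u \<in> carrier A \<and> proj u = E \<and>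
      (\<forall>j\<in>J. \<forall>t\<in>carrier A. H j t \<in> carrier A \<and> G j t \<in> carrier A) \<and>
      (\<forall>j\<in>J. \<forall>s\<in>carrier A. \<forall>t\<in>carrier A. T (s \<otimes> H j t) = T (G j s \<otimes> t)) \<and>
      (\<forall>i\<in>J. \<forall>j\<in>J. proj (H j (unit_at i)) = (if i = j then E else \<zero>\<^bsub>Quo\<^esub>)) \<and>
      (\<forall>j\<in>J. \<forall>s\<in>carrier A. proj s = E \<longrightarrow> proj (G j s) = proj (unit_flip j)) \<and>
      (\<forall>j\<in>J. \<forall>s\<in>carrier A. proj s = \<zero>\<^bsub>Quo\<^esub> \<longrightarrow> proj (G j s) = \<zero>\<^bsub>Quo\<^esub>) \<and>
      (\<forall>i\<in>S. \<forall>j\<in>J. H j (unit_at i) = (if i = j then u else \<zero>))"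
    for S u and H G :: "nat \<times> nat \<Rightarrow> 'a \<Rightarrow> 'a"
  have "\<exists>u H G. Inv S u H G"
    if "finite S" "S \<subseteq> J" for S
    using that
  proof (induction S rule: finite_induct)
    case empty
    define H where "H j t = e 0 (fst j) \<otimes> t \<otimes> e (snd j) 0" for j :: "nat \<times> nat" and t
    define G where "G j s = e (snd j) 0 \<otimes> s \<otimes> e 0 (fst j)" for j :: "nat \<times> nat" and s
    have b1: "T (s \<otimes> H j t) = T (G j s \<otimes> t)" if "j \<in> J" "s \<in> carrier A" "t \<in> carrier A" for j s t
    proof -
      have "T (s \<otimes> H j t) = T ((s \<otimes> e 0 (fst j) \<otimes> t) \<otimes> e (snd j) 0)"
        using e0[OF that(1)] that by (simp add: H_def m_assoc)
      also have "\<dots> = T (e (snd j) 0 \<otimes> (s \<otimes> e 0 (fst j) \<otimes> t))"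
        using e0[OF that(1)] that by (intro Tcyc) auto
      finally show ?thesis using e0[OF that(1)] that by (simp add: G_def m_assoc)
    qed
    have b2: "proj (H j (unit_at i)) = (if i = j then E else \<zero>\<^bsub>Quo\<^esub>)"
      if "i \<in> J" "j \<in> J" for i j
    proof -
      obtain a b k l where "i = (k, l)" "j = (a, b)" by fastforce
      with that have ij: "i = (k, l)" "j = (a, b)" "k < d" "l < d" "a < d" "b < d"
        by (auto simp: J_def)
      have "proj (H j (unit_at i)) = proj (e 0 a) \<otimes>\<^bsub>Quo\<^esub> proj (e k l) \<otimes>\<^bsub>Quo\<^esub> proj (e b 0)"
        using ij d_pos e_closed by (simp add: H_def)
      also have "\<dots> = (if i = j then E else \<zero>\<^bsub>Quo\<^esub>)"
        using ij d_pos proj_mult[of 0 a k l] proj_mult[of 0 l b 0] proj_mult[of 0 b b 0] e_closed[of b 0]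
        by (simp add: E_def)
      finally show ?thesis .
    qed
    have b3: "proj (G j s) = proj (unit_flip j)" if "j \<in> J" "s \<in> carrier A" "proj s = E" for j s
      using that e0[OF that(1)] proj_mult d_pos e_closed by (auto simp: G_def E_def J_def)
    have b4: "proj (G j s) = \<zero>\<^bsub>Quo\<^esub>" if "j \<in> J" "s \<in> carrier A" "proj s = \<zero>\<^bsub>Quo\<^esub>" for j s
      using that e0[OF that(1)] by (auto simp: G_def)
    have b5: "H j t \<in> carrier A" "G j t \<in> carrier A" if "j \<in> J" "t \<in> carrier A" for j t
      using that e0[OF that(1)] by (auto simp: G_def H_def)
    have "Inv {} (e 0 0) H G"
      unfolding Inv_def
      by (intro conjI ballI impI e00 E_def[symmetric] b1 b2 b3 b4 b5) auto
    then show ?case by blast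
  next
    case (insert r S)
    then obtain u H G where inv: "Inv S u H G" by auto
    then have IH: "u \<in> carrier A" "proj u = E"
      "\<And>j t. j \<in> J \<Longrightarrow> t \<in> carrier A \<Longrightarrow> H j t \<in> carrier A"
      "\<And>j t. j \<in> J \<Longrightarrow> t \<in> carrier A \<Longrightarrow> G j t \<in> carrier A"
      "\<And>j s t. j \<in> J \<Longrightarrow> s \<in> carrier A \<Longrightarrow> t \<in> carrier A \<Longrightarrow> T (s \<otimes> H j t) = T (G j s \<otimes> t)"
      "\<And>i j. i \<in> J \<Longrightarrow> j \<in> J \<Longrightarrow> proj (H j (unit_at i)) = (if i = j then E else \<zero>\<^bsub>Quo\<^esub>)"
      "\<And>j s. j \<in> J \<Longrightarrow> s \<in> carrier A \<Longrightarrow> proj s = E \<Longrightarrow> proj (G j s) = proj (unit_flip j)"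
      "\<And>j s. j \<in> J \<Longrightarrow> s \<in> carrier A \<Longrightarrow> proj s = \<zero>\<^bsub>Quo\<^esub> \<Longrightarrow> proj (G j s) = \<zero>\<^bsub>Quo\<^esub>"
      "\<And>i j. i \<in> S \<Longrightarrow> j \<in> J \<Longrightarrow> H j (unit_at i) = (if i = j then u else \<zero>)"
      unfolding Inv_def by blast+
    have r: "r \<in> J" and S: "S \<subseteq> J" using insert.prems by auto
    note c = IH(1,3,4)
    \<comment> \<open>\<open>w\<close> is the pivot, and \<open>v j\<close> the entry that \<open>H' j\<close> has to clear\<close>
    define w where "w = H r (unit_at r)"
    define v where "v j = H j (unit_at r)" for j
    have w: "w \<in> carrier A" "proj w = E"
      using IH(3)[OF r ec(1)[OF r]] IH(6)[OF r r] by (auto simp: w_def)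
    have v: "v j \<in> carrier A" if "j \<in> J" for j
      using IH(3)[OF that ec(1)[OF r]] by (simp add: v_def)
    have v0: "proj (v j) = \<zero>\<^bsub>Quo\<^esub>" if "j \<in> J" "j \<noteq> r" for j
      using IH(6)[OF r that(1)] that by (auto simp: v_def)
    define H' where "H' j t = (if j = r then H r t \<otimes> u else w \<otimes> H j t \<ominus> H r t \<otimes> v j)" for j t
    define G' where "G' j s = (if j = r then G r (u \<otimes> s) else G j (s \<otimes> w) \<ominus> G r (v j \<otimes> s))" for j s
    have 1: "H' j t \<in> carrier A" "G' j t \<in> carrier A" if "j \<in> J" "t \<in> carrier A" for j t
      using that c r v w by (auto simp: H'_def G'_def )
    have 2: "T (s \<otimes> H' j t) = T (G' j s \<otimes> t)" if j: "j \<in> J" and st: "s \<in> carrier A" "t \<in> carrier A" for j s t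
    proof (cases "j = r")
      case True
      have "T (s \<otimes> H' j t) = T ((s \<otimes> H r t) \<otimes> u)"
        using st c r True by (simp add: H'_def m_assoc)
      also have "\<dots> = T ((u \<otimes> s) \<otimes> H r t)"
        using st c r Tcyc[of "s \<otimes> H r t" u] by (simp add: m_assoc)
      finally show ?thesis using st c r IH(5) True by (simp add: G'_def)
    next
      case False
      have cc: "H j t \<in> carrier A" "H r t \<in> carrier A" "v j \<in> carrier A"
        "G j (s \<otimes> w) \<in> carrier A" "G r (v j \<otimes> s) \<in> carrier A"
        using c j r st w v[OF j] by auto
      have "s \<otimes> H' j t = (s \<otimes> w) \<otimes> H j t \<ominus> (s \<otimes> H r t) \<otimes> v j"
        using False st w cc by (simp add: H'_def a_minus_def r_distr r_minus m_assoc)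
      then have "T (s \<otimes> H' j t) = T ((s \<otimes> w) \<otimes> H j t) \<ominus>\<^bsub>B\<^esub> T ((s \<otimes> H r t) \<otimes> v j)"
        using st w cc by (simp add: Tminus)
      also have "T ((s \<otimes> H r t) \<otimes> v j) = T ((v j \<otimes> s) \<otimes> H r t)"
        using Tcyc[of "s \<otimes> H r t" "v j"] st cc by (simp add: m_assoc)
      also have "\<dots> = T (G r (v j \<otimes> s) \<otimes> t)" using IH(5)[OF r, of "v j \<otimes> s" t] st cc by simp
      also have "T ((s \<otimes> w) \<otimes> H j t) = T (G j (s \<otimes> w) \<otimes> t)" using IH(5)[OF j] st w by simp
      also have "T (G j (s \<otimes> w) \<otimes> t) \<ominus>\<^bsub>B\<^esub> T (G r (v j \<otimes> s) \<otimes> t)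
          = T (G j (s \<otimes> w) \<otimes> t \<ominus> G r (v j \<otimes> s) \<otimes> t)"
        using st cc by (simp add: Tminus)
      also have "G j (s \<otimes> w) \<otimes> t \<ominus> G r (v j \<otimes> s) \<otimes> t = G' j s \<otimes> t"
        using False st cc by (simp add: G'_def a_minus_def l_distr l_minus)
      finally show ?thesis .
    qed
    have pm: "proj (a \<ominus> b) = proj a \<ominus>\<^bsub>Quo\<^esub> proj b" if "a \<in> carrier A" "b \<in> carrier A" for a b
      using that by (simp add: a_minus_def a_minus_def)
    have 3: "proj (H' j (unit_at i)) = (if i = j then E else \<zero>\<^bsub>Quo\<^esub>)" if i: "i \<in> J" and j: "j \<in> J" for i j
    proof -
      have cc: "H j (unit_at i) \<in> carrier A" "H r (unit_at i) \<in> carrier A" "v j \<in> carrier A"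
        using IH(3) ec(1)[OF i] j r v[OF j] by auto
      show ?thesis
        using cc w v0[OF j] IH(6)[OF i j] IH(6)[OF i r] IH(1,2) Ec EE
        by (auto simp: H'_def pm a_minus_def )
    qed
    have 4: "proj (G' j s) = proj (unit_flip j)" if j: "j \<in> J" and s: "s \<in> carrier A" "proj s = E" for j s
    proof (cases "j = r")
      case True
      have "proj (u \<otimes> s) = E" using IH(1,2) s EE by simp
      then show ?thesis using IH(7)[OF r, of "u \<otimes> s"] IH(1) s True by (simp add: G'_def)
    next
      case False
      have p: "proj (s \<otimes> w) = E" "proj (v j \<otimes> s) = \<zero>\<^bsub>Quo\<^esub>"
        using s w v[OF j] v0[OF j False] EE Ec by auto
      have cc: "G j (s \<otimes> w) \<in> carrier A" "G r (v j \<otimes> s) \<in> carrier A"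
        using IH(4) j r s w v[OF j] by auto
      show ?thesis
        using False p cc IH(7)[OF j, of "s \<otimes> w"] IH(8)[OF r, of "v j \<otimes> s"] s w v[OF j] ec[OF j]
        by (simp add: G'_def pm a_minus_def)
    qed
    have 5: "proj (G' j s) = \<zero>\<^bsub>Quo\<^esub>" if j: "j \<in> J" and s: "s \<in> carrier A" "proj s = \<zero>\<^bsub>Quo\<^esub>" for j s
    proof (cases "j = r")
      case True
      have "proj (u \<otimes> s) = \<zero>\<^bsub>Quo\<^esub>" using IH(1,2) s Ec by simp
      then show ?thesis using IH(8)[OF r, of "u \<otimes> s"] IH(1) s True by (simp add: G'_def)
    next
      case False
      have p: "proj (s \<otimes> w) = \<zero>\<^bsub>Quo\<^esub>" "proj (v j \<otimes> s) = \<zero>\<^bsub>Quo\<^esub>"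
        using s w v[OF j] v0[OF j False] EE Ec by auto
      have cc: "G j (s \<otimes> w) \<in> carrier A" "G r (v j \<otimes> s) \<in> carrier A"
        using IH(4) j r s w v[OF j] by auto
      show ?thesis
        using False p cc IH(8)[OF j, of "s \<otimes> w"] IH(8)[OF r, of "v j \<otimes> s"] s w v[OF j] ec[OF j]
        by (simp add: G'_def pm a_minus_def)
    qed
    have 6: "H' j (unit_at i) = (if i = j then w \<otimes> u else \<zero>)" if i: "i \<in> insert r S" and j: "j \<in> J" for i j
    proof (cases "i = r")
      case True
      show ?thesis
      proof (cases "j = r")
        case True
        then show ?thesis using \<open>i = r\<close> by (simp add: H'_def w_def)
      next
        case False
        have "w \<otimes> H j (unit_at i) \<ominus> H r (unit_at i) \<otimes> v j = \<zero>"
        proof -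
          have "H j (unit_at i) = v j" "H r (unit_at i) = w" using \<open>i = r\<close> by (simp_all add: v_def w_def)
          then show ?thesis using w v[OF j] by (simp add: a_minus_def r_neg)
        qed
        then show ?thesis using False \<open>i = r\<close> by (simp add: H'_def)
      qed
    next
      case False
      then have iS: "i \<in> S" using i by simp
      show ?thesis
        using False IH(9)[OF iS j] IH(9)[OF iS r] v[OF j] w IH(1) insert.hyps
        by (auto simp: H'_def a_minus_def)
    qed
    have "w \<otimes> u \<in> carrier A" "proj (w \<otimes> u) = E" using w IH(1,2) EE by auto
    then have "Inv (insert r S) (w \<otimes> u) H' G'"
      unfolding Inv_def
      by (intro conjI ballI impI 1 2 3 4 5 6) auto
    then show ?case by blast
  qed
  from this[of J] obtain u H G where inv: "Inv J u H G" by (auto simp: J_def)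
  then have fin: "u \<in> carrier A" "proj u = E"
      "\<And>j t. j \<in> J \<Longrightarrow> t \<in> carrier A \<Longrightarrow> G j t \<in> carrier A"
      "\<And>j s t. j \<in> J \<Longrightarrow> s \<in> carrier A \<Longrightarrow> t \<in> carrier A \<Longrightarrow> T (s \<otimes> H j t) = T (G j s \<otimes> t)"
      "\<And>j s. j \<in> J \<Longrightarrow> s \<in> carrier A \<Longrightarrow> proj s = E \<Longrightarrow> proj (G j s) = proj (unit_flip j)"
      "\<And>i j. i \<in> J \<Longrightarrow> j \<in> J \<Longrightarrow> H j (unit_at i) = (if i = j then u else \<zero>)"
    unfolding Inv_def by blast+
  show thesis
  proof (rule that[of "e 0 0 \<otimes> u" "\<lambda>j. G j (e 0 0)"])
    show "e 0 0 \<otimes> u \<in> carrier A" using e00 fin by simp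
    show "e 0 0 \<otimes> u \<ominus> e 0 0 \<in> I"
      using e00 fin EE by (subst proj_eq_iff[symmetric]) (auto simp: E_def)
    show "G p (e 0 0) \<in> carrier A" if "p \<in> Idx" for p
      using fin(3) that e00 by (simp add: J_def)
    show "G p (e 0 0) \<ominus> unit_flip p \<in> I" if "p \<in> Idx" for p
      using fin(3)[of p, OF _ e00] fin(5)[of p, OF _ e00] ec[of p] that[folded J_def]
      by (subst proj_eq_iff[symmetric]) (auto simp: E_def)
    show "T (G p (e 0 0) \<otimes> unit_at r) = (if p = r then T (e 0 0 \<otimes> u) else \<zero>\<^bsub>B\<^esub>)"
      if "p \<in> Idx" "r \<in> Idx" for p r
      using fin(4)[OF _ e00 ec(1), of p r] fin(6)[of r p] that[folded J_def] e00 T0 by auto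
  qed
qed

end

section \<open>Eigenvectors over an algebraically closed field\<close>

text \<open>
  A vector space over \<open>K\<close>, given by a bare action: the modules below become vector spaces without a change
  of the record that carries them.
\<close>

locale lin_action = K?: field K + V?: abelian_group V
  for K :: "('k, 'm) ring_scheme" and V :: "('v, 'n) ring_scheme" +
  fixes act :: "'k \<Rightarrow> 'v \<Rightarrow> 'v"
  assumes act_closed: "\<And>c v. c \<in> carrier K \<Longrightarrow> v \<in> carrier V \<Longrightarrow> act c v \<in> carrier V"
    and act_add: "\<And>c v w. c \<in> carrier K \<Longrightarrow> v \<in> carrier V \<Longrightarrow> w \<in> carrier V \<Longrightarrow>
        act c (v \<oplus>\<^bsub>V\<^esub> w) = act c v \<oplus>\<^bsub>V\<^esub> act c w"
    and act_plus: "\<And>b c v. b \<in> carrier K \<Longrightarrow> c \<in> carrier K \<Longrightarrow> v \<in> carrier V \<Longrightarrow>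
        act (b \<oplus>\<^bsub>K\<^esub> c) v = act b v \<oplus>\<^bsub>V\<^esub> act c v"
    and act_mult: "\<And>b c v. b \<in> carrier K \<Longrightarrow> c \<in> carrier K \<Longrightarrow> v \<in> carrier V \<Longrightarrow>
        act (b \<otimes>\<^bsub>K\<^esub> c) v = act b (act c v)"
    and act_one: "\<And>v. v \<in> carrier V \<Longrightarrow> act \<one>\<^bsub>K\<^esub> v = v"
begin

lemma act_zero: "v \<in> carrier V \<Longrightarrow> act \<zero>\<^bsub>K\<^esub> v = \<zero>\<^bsub>V\<^esub>"
  using act_plus[of "\<zero>\<^bsub>K\<^esub>" "\<zero>\<^bsub>K\<^esub>" v] act_closed[of "\<zero>\<^bsub>K\<^esub>" v]
    V.add.r_cancel_one[of "act \<zero>\<^bsub>K\<^esub> v" "act \<zero>\<^bsub>K\<^esub> v"] by auto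

lemma act_zero_right: "c \<in> carrier K \<Longrightarrow> act c \<zero>\<^bsub>V\<^esub> = \<zero>\<^bsub>V\<^esub>"
  using act_add[of c "\<zero>\<^bsub>V\<^esub>" "\<zero>\<^bsub>V\<^esub>"] act_closed[of c "\<zero>\<^bsub>V\<^esub>"]
    V.add.r_cancel_one[of "act c \<zero>\<^bsub>V\<^esub>" "act c \<zero>\<^bsub>V\<^esub>"] by auto

lemma act_minus: "c \<in> carrier K \<Longrightarrow> v \<in> carrier V \<Longrightarrow> act (\<ominus>\<^bsub>K\<^esub> c) v = \<ominus>\<^bsub>V\<^esub> act c v"
  using act_plus[of "\<ominus>\<^bsub>K\<^esub> c" c v] act_closed act_zero[of v]
  by (simp add: K.l_neg V.minus_equality)

lemma act_eq_zero:
  assumes "c \<in> carrier K" "v \<in> carrier V" "act c v = \<zero>\<^bsub>V\<^esub>" "v \<noteq> \<zero>\<^bsub>V\<^esub>"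
  shows "c = \<zero>\<^bsub>K\<^esub>"
proof (rule ccontr)
  assume "c \<noteq> \<zero>\<^bsub>K\<^esub>"
  then have u: "c \<in> Units K" using assms K.field_Units by simp
  then have "v = act (inv\<^bsub>K\<^esub> c \<otimes>\<^bsub>K\<^esub> c) v" using assms act_one by simp
  also have "\<dots> = \<zero>\<^bsub>V\<^esub>" using assms u act_mult[of "inv\<^bsub>K\<^esub> c" c v] act_zero_right by simp
  finally show False using assms by simp
qed

lemma act_finsum:
  assumes "c \<in> carrier K" "finite I" "\<And>i. i \<in> I \<Longrightarrow> f i \<in> carrier V"
  shows "act c (\<Oplus>\<^bsub>V\<^esub>i\<in>I. f i) = (\<Oplus>\<^bsub>V\<^esub>i\<in>I. act c (f i))"
  using assms(2,3)
proof (induction I rule: finite_induct)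
  case empty
  then show ?case using assms(1) act_zero_right by simp
next
  case (insert i I)
  then have "f \<in> I \<rightarrow> carrier V" "(\<lambda>i. act c (f i)) \<in> I \<rightarrow> carrier V" "f i \<in> carrier V"
    "act c (f i) \<in> carrier V"
    using act_closed assms(1) by auto
  then show ?case using insert assms(1) by (simp add: act_add)
qed

end

text \<open>
  \<open>poly_at \<phi> v cs\<close> is \<open>p(\<phi>) v\<close> for the polynomial \<open>p\<close> with coefficient list \<open>cs\<close>, constant term first, and
  \<open>synth_div \<lambda> cs\<close> is the quotient of \<open>p\<close> by \<open>X - \<lambda>\<close>.
\<close>

context lin_action
begin

fun poly_at :: "('v \<Rightarrow> 'v) \<Rightarrow> 'v \<Rightarrow> 'k list \<Rightarrow> 'v" where
  "poly_at \<phi> v [] = \<zero>\<^bsub>V\<^esub>"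
| "poly_at \<phi> v (c # cs) = act c v \<oplus>\<^bsub>V\<^esub> \<phi> (poly_at \<phi> v cs)"

fun poly_val :: "'k \<Rightarrow> 'k list \<Rightarrow> 'k" where
  "poly_val l [] = \<zero>\<^bsub>K\<^esub>"
| "poly_val l (c # cs) = c \<oplus>\<^bsub>K\<^esub> l \<otimes>\<^bsub>K\<^esub> poly_val l cs"

fun synth_div :: "'k \<Rightarrow> 'k list \<Rightarrow> 'k list" where
  "synth_div l [] = []"
| "synth_div l (c # cs) = (if cs = [] then [] else poly_val l cs # synth_div l cs)"

lemma poly_val_closed: "l \<in> carrier K \<Longrightarrow> set cs \<subseteq> carrier K \<Longrightarrow> poly_val l cs \<in> carrier K"
  by (induction cs) auto

lemma synth_div_closed: "l \<in> carrier K \<Longrightarrow> set cs \<subseteq> carrier K \<Longrightarrow> set (synth_div l cs) \<subseteq> carrier K"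
  by (induction cs) (auto simp: poly_val_closed)

lemma length_synth_div: "length (synth_div l cs) = length cs - 1"
  by (induction cs) auto

lemma synth_div_zero:
  "l \<in> carrier K \<Longrightarrow> set cs \<subseteq> carrier K \<Longrightarrow> set (synth_div l cs) \<subseteq> {\<zero>\<^bsub>K\<^esub>} \<Longrightarrow> poly_val l cs = \<zero>\<^bsub>K\<^esub> \<Longrightarrow>
    set cs \<subseteq> {\<zero>\<^bsub>K\<^esub>}"
  by (induction cs) (auto split: if_splits)

lemma poly_val_eval:
  assumes "l \<in> carrier K" "set cs \<subseteq> carrier K"
  shows "K.eval (rev cs) l = poly_val l cs"
  using assms(2)
proof (induction cs)
  case (Cons c cs)
  then show ?case
    using assms(1) K.eval_append_aux[of "rev cs" c l] poly_val_closed[of l cs]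
    by (simp add: K.a_comm K.m_comm)
qed simp

context
  fixes \<phi> :: "'v \<Rightarrow> 'v"
  assumes \<phi>_closed: "\<And>v. v \<in> carrier V \<Longrightarrow> \<phi> v \<in> carrier V"
    and \<phi>_add: "\<And>v w. v \<in> carrier V \<Longrightarrow> w \<in> carrier V \<Longrightarrow> \<phi> (v \<oplus>\<^bsub>V\<^esub> w) = \<phi> v \<oplus>\<^bsub>V\<^esub> \<phi> w"
    and \<phi>_act: "\<And>c v. c \<in> carrier K \<Longrightarrow> v \<in> carrier V \<Longrightarrow> \<phi> (act c v) = act c (\<phi> v)"
begin

lemma \<phi>_zero: "\<phi> \<zero>\<^bsub>V\<^esub> = \<zero>\<^bsub>V\<^esub>"
  using \<phi>_add[of "\<zero>\<^bsub>V\<^esub>" "\<zero>\<^bsub>V\<^esub>"] \<phi>_closed[of "\<zero>\<^bsub>V\<^esub>"]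
    V.add.r_cancel_one[of "\<phi> \<zero>\<^bsub>V\<^esub>" "\<phi> \<zero>\<^bsub>V\<^esub>"] by auto

lemma poly_at_closed:
  "v \<in> carrier V \<Longrightarrow> set cs \<subseteq> carrier K \<Longrightarrow> poly_at \<phi> v cs \<in> carrier V"
  by (induction cs) (auto simp: act_closed \<phi>_closed)

lemma poly_at_append_zero:
  "v \<in> carrier V \<Longrightarrow> set cs \<subseteq> carrier K \<Longrightarrow> poly_at \<phi> v (cs @ [\<zero>\<^bsub>K\<^esub>]) = poly_at \<phi> v cs"
  by (induction cs) (auto simp: act_zero \<phi>_zero)

lemma poly_at_synth_div:
  assumes v: "v \<in> carrier V" and l: "l \<in> carrier K" and "set cs \<subseteq> carrier K"
  shows "poly_at \<phi> v cs \<oplus>\<^bsub>V\<^esub> act l (poly_at \<phi> v (synth_div l cs)) =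
    \<phi> (poly_at \<phi> v (synth_div l cs)) \<oplus>\<^bsub>V\<^esub> act (poly_val l cs) v"
  using assms(3)
proof (induction cs)
  case Nil
  then show ?case using l v by (simp add: act_zero act_zero_right \<phi>_zero)
next
  case (Cons c cs)
  show ?case
  proof (cases "cs = []")
    case True
    then show ?thesis
      using Cons.prems l v act_closed by (simp add: act_zero_right \<phi>_zero)
  next
    case False
    define p where "p = poly_at \<phi> v cs"
    define g where "g = poly_at \<phi> v (synth_div l cs)"
    define r where "r = poly_val l cs"
    have c: "c \<in> carrier K" "r \<in> carrier K" "p \<in> carrier V" "g \<in> carrier V"
      using Cons.prems l v poly_at_closed[OF v, of cs] poly_at_closed[OF v synth_div_closed[OF l, of cs]]
      by (simp_all add: p_def g_def r_def poly_val_closed)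
    note cl = c l v act_closed \<phi>_closed
    have IH: "p \<oplus>\<^bsub>V\<^esub> act l g = \<phi> g \<oplus>\<^bsub>V\<^esub> act r v"
      using Cons by (simp add: p_def g_def r_def)
    then have "\<phi> p \<oplus>\<^bsub>V\<^esub> act l (\<phi> g) = \<phi> (\<phi> g \<oplus>\<^bsub>V\<^esub> act r v)"
      using cl by (metis \<phi>_act \<phi>_add)
    then have *: "act l (\<phi> g) \<oplus>\<^bsub>V\<^esub> \<phi> p = \<phi> (\<phi> g \<oplus>\<^bsub>V\<^esub> act r v)"
      using cl by (simp add: V.a_comm)
    have "poly_at \<phi> v (c # cs) \<oplus>\<^bsub>V\<^esub> act l (poly_at \<phi> v (synth_div l (c # cs)))
        = (act c v \<oplus>\<^bsub>V\<^esub> \<phi> p) \<oplus>\<^bsub>V\<^esub> act l (act r v \<oplus>\<^bsub>V\<^esub> \<phi> g)"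
      using False by (simp add: p_def g_def r_def)
    also have "\<dots> = act c v \<oplus>\<^bsub>V\<^esub> act l (act r v) \<oplus>\<^bsub>V\<^esub> (act l (\<phi> g) \<oplus>\<^bsub>V\<^esub> \<phi> p)"
      using cl by (simp add: act_add V.a_ac)
    also have "\<dots> = \<phi> (act r v \<oplus>\<^bsub>V\<^esub> \<phi> g) \<oplus>\<^bsub>V\<^esub> act (c \<oplus>\<^bsub>K\<^esub> l \<otimes>\<^bsub>K\<^esub> r) v"
      unfolding * using cl by (simp add: act_plus act_mult V.a_ac)
    finally show ?thesis using False by (simp add: g_def r_def)
  qed
qed

end

end

lemma (in algebraically_closed) exists_root:
  assumes "polynomial\<^bsub>L\<^esub> (carrier L) p" "length p > 1"
  obtains l where "l \<in> carrier L" "eval p l = \<zero>"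
proof -
  have p: "p \<in> carrier (poly_ring L)" using assms by (simp add: univ_poly_carrier)
  then have "size (roots p) = degree p" using roots_over_carrier splitted_def by blast
  then have "roots p \<noteq> {#}" using assms(2) by auto
  then obtain l where "l \<in># roots p" by blast
  then have "is_root p l" using roots_mem_iff_is_root[OF p] by simp
  then show thesis using that by (auto simp: is_root_def)
qed

text \<open>
  A polynomial \<open>p\<close> with \<open>p(\<phi>) v = 0\<close> is split as \<open>(X - l) g\<close>. Either \<open>g(\<phi>) v\<close> is an eigenvector with eigenvalue
  \<open>l\<close>, or \<open>g\<close> is a shorter polynomial with the same property.
\<close>

lemma exists_eigenvector:
  assumes "algebraically_closed K" and "lin_action K V act"
    and \<phi>: "\<And>v. v \<in> carrier V \<Longrightarrow> \<phi> v \<in> carrier V"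
      "\<And>v w. v \<in> carrier V \<Longrightarrow> w \<in> carrier V \<Longrightarrow> \<phi> (v \<oplus>\<^bsub>V\<^esub> w) = \<phi> v \<oplus>\<^bsub>V\<^esub> \<phi> w"
      "\<And>c v. c \<in> carrier K \<Longrightarrow> v \<in> carrier V \<Longrightarrow> \<phi> (act c v) = act c (\<phi> v)"
    and v: "v \<in> carrier V" "v \<noteq> \<zero>\<^bsub>V\<^esub>"
    and cs: "set cs \<subseteq> carrier K" "\<not> set cs \<subseteq> {\<zero>\<^bsub>K\<^esub>}" "lin_action.poly_at V act \<phi> v cs = \<zero>\<^bsub>V\<^esub>"
  shows "\<exists>l\<in>carrier K. \<exists>w\<in>carrier V. w \<noteq> \<zero>\<^bsub>V\<^esub> \<and> \<phi> w = act l w"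
proof -
  interpret algebraically_closed K by fact
  interpret lin_action K V act by fact
  show ?thesis using cs
  proof (induction "length cs" arbitrary: cs rule: less_induct)
    case less
    then obtain cs' c where cs': "cs = cs' @ [c]" by (cases cs rule: rev_cases) auto
    show ?case
    proof (cases "c = \<zero>\<^bsub>K\<^esub>")
      case True
      then show ?thesis
        using less.hyps[of cs'] less.prems poly_at_append_zero[OF \<phi>, of v cs'] v cs' by auto
    next
      case False
      show ?thesis
      proof (cases "cs' = []")
        case True
        then show ?thesis
          using less.prems cs' False v act_closed[of c v] act_eq_zero[of c v] \<phi>_zero[OF \<phi>] by auto
      next
        case nonconst: False
        have "polynomial\<^bsub>K\<^esub> (carrier K) (rev cs)" "length (rev cs) > 1"
          using less.prems(1) cs' False nonconst by (auto simp: polynomial_def Suc_lessI)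
        then obtain l where l: "l \<in> carrier K" "eval (rev cs) l = \<zero>\<^bsub>K\<^esub>" by (rule exists_root)
        then have root: "poly_val l cs = \<zero>\<^bsub>K\<^esub>" using less.prems(1) poly_val_eval by simp
        define w where "w = poly_at \<phi> v (synth_div l cs)"
        have syn: "set (synth_div l cs) \<subseteq> carrier K" "\<not> set (synth_div l cs) \<subseteq> {\<zero>\<^bsub>K\<^esub>}"
          using synth_div_closed[OF l(1) less.prems(1)] synth_div_zero[OF l(1) less.prems(1)]
            root less.prems(2) by auto
        have w: "w \<in> carrier V" using poly_at_closed[OF \<phi> v(1) syn(1)] by (simp add: w_def)
        have "\<phi> w = act l w"
          using poly_at_synth_div[OF \<phi> v(1) l(1) less.prems(1)] less.prems(3) root v w l act_closed \<phi>(1)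
          by (simp add: w_def[symmetric] act_zero)
        moreover have "length (synth_div l cs) < length cs"
          using cs' by (simp add: length_synth_div)
        ultimately show ?thesis
          using less.hyps[of "synth_div l cs"] syn w l unfolding w_def by blast
      qed
    qed
  qed
qed

section \<open>Zariski's lemma\<close>

text \<open>
  Kaplansky's G-domains: the fraction field of \<open>T\<close> is obtained by inverting a single element.
\<close>

definition (in ring) g_subring :: "'a set \<Rightarrow> bool" where
  "g_subring T \<longleftrightarrow> (\<exists>r\<in>T. r \<noteq> \<zero> \<and> (\<forall>s\<in>T. s \<noteq> \<zero> \<longrightarrow> (\<exists>t\<in>T. \<exists>n::nat. s \<otimes> t = r [^] n)))"

lemma (in ring) subring_pow_closed:
  assumes "subring T R" "t \<in> T" shows "t [^] (n::nat) \<in> T"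
  using subringE(3,6)[OF assms(1)] assms(2) by (induction n) auto

lemma (in domain) pow_nonzero: "a \<in> carrier R \<Longrightarrow> a \<noteq> \<zero> \<Longrightarrow> a [^] (n::nat) \<noteq> \<zero>"
  using integral by (induction n) auto

text \<open>
  For transcendental \<open>x\<close> the ring \<open>T[x]\<close> is a polynomial ring. Let every nonzero element divide a power of \<open>u\<close>.
  Then \<open>u x + 1\<close> divides a power of \<open>u\<close>, and \<open>u\<close> is invertible modulo \<open>u x + 1\<close> because \<open>u x\<close> is \<open>-1\<close>
  there. So \<open>u x + 1\<close> is a unit, although it has positive degree.
\<close>

lemma (in domain) g_subring_simple_extension_imp_algebraic:
  assumes T: "subring T R" and x: "x \<in> carrier R" and G: "g_subring (simple_extension T x)"
  shows "(algebraic over T) x"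
proof (rule ccontr)
  let ?S = "simple_extension T x"
  assume "\<not> (algebraic over T) x"
  then have tr: "inj_on (\<lambda>p. eval p x) (carrier (T[X]))"
    by (simp add: over_def transcendental_def)
  have S: "subring ?S R" by (rule simple_extension_is_subring[OF T x])
  have xS: "x \<in> ?S" by (rule simple_extension_mem[OF T x])
  have TR: "T \<subseteq> carrier R" by (rule subringE(1)[OF T])
  have SR: "s \<in> ?S \<Longrightarrow> s \<in> carrier R" for s using subringE(1)[OF S] by blast
  have img: "?S = (\<lambda>p. eval p x) ` carrier (T[X])" by (rule simple_extension_as_eval_img[OF TR x])
  obtain u where u: "u \<in> ?S" "u \<noteq> \<zero>"
    and u_dvd: "\<And>s. s \<in> ?S \<Longrightarrow> s \<noteq> \<zero> \<Longrightarrow> \<exists>t\<in>?S. \<exists>n::nat. s \<otimes> t = u [^] n"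
    using G unfolding g_subring_def by blast
  obtain U where U: "U \<in> carrier (T[X])" "u = eval U x" using u(1) img by auto
  have Upoly: "polynomial T U" "set U \<subseteq> carrier R" "U \<noteq> []"
    using U u(2) univ_poly_carrier[of R T U] polynomial_in_carrier[OF T, of U] by auto
  define W where "W = U @ [\<one>]"
  have Wpoly: "polynomial T W"
    using Upoly subringE(3)[OF T] by (auto simp: W_def polynomial_def)
  define w where "w = u \<otimes> x \<oplus> \<one>"
  have Wx: "eval W x = w"
    using eval_append_aux[OF Upoly(2) one_closed x] U(2) by (simp add: W_def w_def)
  have w: "w \<in> ?S" using subringE(3,6,7)[OF S] u(1) xS by (simp add: w_def)
  have "w \<noteq> \<zero>"
  proof
    assume "w = \<zero>"
    then have "eval W x = eval [] x" using Wx by simp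
    then have "W = []"
      using inj_onD[OF tr] Wpoly univ_poly_carrier univ_poly_zero_closed by blast
    then show False by (simp add: W_def)
  qed
  then obtain g n where g: "g \<in> ?S" "w \<otimes> g = u [^] (n::nat)" using u_dvd[OF w] by blast
  define y where "y = u \<otimes> x"
  have y: "y \<in> ?S" using subringE(6)[OF S] u(1) xS by (simp add: y_def)
  \<comment> \<open>powers of \<open>u x\<close> are \<open>1\<close> or \<open>-1\<close> modulo \<open>u x + 1\<close>\<close>
  have "\<exists>k\<in>?S. \<exists>e\<in>{\<one>, \<ominus> \<one>}. y [^] n = w \<otimes> k \<oplus> e" for n :: nat
  proof (induction n)
    case 0
    show ?case using subringE(2)[OF S] SR[OF w] by (intro bexI[of _ "\<zero>"] bexI[of _ "\<one>"]) auto
  next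
    case (Suc n)
    then obtain k e where k: "k \<in> ?S" "e \<in> {\<one>, \<ominus> \<one>}" "y [^] n = w \<otimes> k \<oplus> e" by blast
    have e: "e \<in> ?S" "\<ominus> e \<in> {\<one>, \<ominus> \<one>}" "\<ominus> e \<in> ?S" using k(2) subringE(3,5)[OF S] by auto
    have c: "w \<in> carrier R" "k \<in> carrier R" "e \<in> carrier R" "y \<in> carrier R"
      using SR w k(1) e y by auto
    have wy: "w = y \<oplus> \<one>" by (simp add: w_def y_def)
    have "y [^] Suc n = (w \<otimes> k \<oplus> e) \<otimes> y" using k(3) by simp
    also have "\<dots> = w \<otimes> (k \<otimes> y \<oplus> e) \<oplus> \<ominus> e" unfolding wy using c by algebra
    finally have "y [^] Suc n = w \<otimes> (k \<otimes> y \<oplus> e) \<oplus> \<ominus> e" .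
    moreover have "k \<otimes> y \<oplus> e \<in> ?S" using subringE(6,7)[OF S] k(1) y e(1) by simp
    ultimately show ?case using e(2) by blast
  qed
  then obtain k e where k: "k \<in> ?S" "e \<in> {\<one>, \<ominus> \<one>}" "y [^] n = w \<otimes> k \<oplus> e" by blast
  have e: "e \<in> ?S" "e \<otimes> e = \<one>" using k(2) subringE(3,5)[OF S] by (auto simp: l_minus r_minus)
  have c: "w \<in> carrier R" "k \<in> carrier R" "e \<in> carrier R" "g \<in> carrier R" "x [^] n \<in> carrier R"
    using SR w k(1) e(1) g(1) x by auto
  have xn: "x [^] n \<in> ?S" by (rule subring_pow_closed[OF S xS])
  define h where "h = e \<otimes> (x [^] n \<otimes> g \<oplus> \<ominus> k)"
  have h: "h \<in> ?S" using subringE(5,6,7)[OF S] k(1) g(1) e(1) xn by (simp add: h_def)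
  have "w \<otimes> k \<oplus> e = u [^] n \<otimes> x [^] n"
    using k(3) SR[OF u(1)] x by (simp add: y_def nat_pow_distrib)
  also have "\<dots> = w \<otimes> g \<otimes> x [^] n" using g(2) by simp
  finally have eq: "w \<otimes> k \<oplus> e = w \<otimes> g \<otimes> x [^] n" .
  have "e = (w \<otimes> k \<oplus> e) \<oplus> \<ominus> (w \<otimes> k)" using c by algebra
  then have "e = w \<otimes> g \<otimes> x [^] n \<oplus> \<ominus> (w \<otimes> k)" by (simp only: eq)
  moreover have "w \<otimes> h = e \<otimes> (w \<otimes> g \<otimes> x [^] n \<oplus> \<ominus> (w \<otimes> k))" unfolding h_def using c by algebra
  ultimately have "w \<otimes> h = e \<otimes> e" by simp
  then have wh: "w \<otimes> h = \<one>" using e(2) by simp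
  obtain H where H: "H \<in> carrier (T[X])" "h = eval H x" using h img by auto
  have Hpoly: "polynomial T H" "H \<noteq> []"
    using H wh c(1) univ_poly_carrier by auto
  interpret ev: ring_hom_ring "T[X]" R "\<lambda>p. eval p x" by (rule eval_ring_hom[OF T x])
  have Wc: "W \<in> carrier (T[X])" using Wpoly univ_poly_carrier by blast
  have "eval (W \<otimes>\<^bsub>T[X]\<^esub> H) x = eval \<one>\<^bsub>T[X]\<^esub> x"
    using ev.hom_mult[OF Wc H(1)] Wx H(2) wh ev.hom_one by simp
  then have "W \<otimes>\<^bsub>T[X]\<^esub> H = \<one>\<^bsub>T[X]\<^esub>"
    using inj_onD[OF tr, of "W \<otimes>\<^bsub>T[X]\<^esub> H" "\<one>\<^bsub>T[X]\<^esub>"] ev.R.m_closed[OF Wc H(1)] ev.R.one_closed by blast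
  then have "degree (poly_mult W H) = 0" by (simp add: univ_poly_mult univ_poly_one)
  moreover have "degree (poly_mult W H) = degree W + degree H"
    using poly_mult_degree_eq[OF T Wpoly Hpoly(1)] Hpoly(2) by (simp add: W_def)
  moreover have "degree W > 0" using Upoly(3) by (simp add: W_def)
  ultimately show False by simp
qed

lemma (in domain) eval_as_finsum:
  assumes "set p \<subseteq> T" "subring T R" "x \<in> carrier R"
  shows "\<exists>\<eta>\<in>{..<length p} \<rightarrow> T. eval p x = (\<Oplus>i\<in>{..<length p}. \<eta> i \<otimes> x [^] i)"
  using assms(1)
proof (induction p)
  case Nil
  then show ?case by simp
next
  case (Cons a p)
  then obtain \<eta> where \<eta>: "\<eta> \<in> {..<length p} \<rightarrow> T" "eval p x = (\<Oplus>i\<in>{..<length p}. \<eta> i \<otimes> x [^] i)"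
    by auto
  have TR: "T \<subseteq> carrier R" using subringE(1)[OF assms(2)] .
  define \<zeta> where "\<zeta> = \<eta>(length p := a)"
  have \<zeta>: "\<zeta> \<in> {..<length (a # p)} \<rightarrow> T" using \<eta>(1) Cons.prems by (auto simp: \<zeta>_def less_Suc_eq)
  have "(\<Oplus>i\<in>{..<length (a # p)}. \<zeta> i \<otimes> x [^] i)
      = \<zeta> (length p) \<otimes> x [^] length p \<oplus> (\<Oplus>i\<in>{..<length p}. \<zeta> i \<otimes> x [^] i)"
    using \<zeta> TR assms(3) by (simp add: lessThan_Suc finsum_insert Pi_iff subset_iff)
  also have "(\<Oplus>i\<in>{..<length p}. \<zeta> i \<otimes> x [^] i) = (\<Oplus>i\<in>{..<length p}. \<eta> i \<otimes> x [^] i)"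
    by (rule finsum_cong') (use \<eta>(1) TR assms(3) in \<open>auto simp: \<zeta>_def\<close>)
  finally show ?case using \<zeta> \<eta>(2) by (intro bexI[of _ \<zeta>]) (auto simp: \<zeta>_def)
qed

text \<open>
  After division of the relation by a power of \<open>u\<close> its constant term is nonzero, and this constant term is a
  multiple of \<open>u\<close>.
\<close>

lemma (in domain) relation_imp_multiple_in_subring:
  assumes T: "subring T R" and S: "subring S R" "T \<subseteq> S" and u: "u \<in> S" "u \<noteq> \<zero>"
    and "\<And>i. i < n \<Longrightarrow> \<gamma> i \<in> T" "\<exists>i<n. \<gamma> i \<noteq> \<zero>" "(\<Oplus>i\<in>{..<n::nat}. \<gamma> i \<otimes> u [^] i) = \<zero>"
  shows "\<exists>w\<in>S. u \<otimes> w \<in> T \<and> u \<otimes> w \<noteq> \<zero>"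
  using assms(6-8)
proof (induction n arbitrary: \<gamma>)
  case 0
  then show ?case by simp
next
  case (Suc n)
  have SR: "S \<subseteq> carrier R" using subringE(1)[OF S(1)] .
  have uc: "u \<in> carrier R" using u SR by blast
  have \<gamma>S: "\<gamma> i \<in> S" if "i < Suc n" for i using Suc.prems(1)[OF that] S(2) by blast
  have \<gamma>c: "\<gamma> i \<in> carrier R" if "i < Suc n" for i using \<gamma>S[OF that] SR by blast
  let ?w = "\<Oplus>i\<in>{..<n}. \<gamma> (Suc i) \<otimes> u [^] i"
  have w: "?w \<in> S"
    by (rule subring_finsum_closed[OF S(1)])
      (use \<gamma>S subring_pow_closed[OF S(1) u(1)] subringE(6)[OF S(1)] in auto)
  have wc: "?w \<in> carrier R" using w SR by blast
  have "\<zero> = (\<Oplus>i\<in>{..n}. \<gamma> i \<otimes> u [^] i)" using Suc.prems(3) by (simp add: lessThan_Suc_atMost)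
  have split: "(\<Oplus>i\<in>{..<Suc n}. \<gamma> i \<otimes> u [^] i) = \<gamma> 0 \<oplus> u \<otimes> ?w"
  proof -
    have "(\<Oplus>i\<in>{..<Suc n}. \<gamma> i \<otimes> u [^] i) = \<gamma> 0 \<otimes> u [^] (0::nat) \<oplus> (\<Oplus>i\<in>Suc ` {..<n}. \<gamma> i \<otimes> u [^] i)"
      unfolding lessThan_Suc_eq_insert_0 by (rule finsum_insert) (use \<gamma>c uc in auto)
    also have "(\<Oplus>i\<in>Suc ` {..<n}. \<gamma> i \<otimes> u [^] i) = (\<Oplus>i\<in>{..<n}. \<gamma> (Suc i) \<otimes> u [^] Suc i)"
      by (rule finsum_reindex) (use \<gamma>c uc in auto)
    also have "\<dots> = (\<Oplus>i\<in>{..<n}. u \<otimes> (\<gamma> (Suc i) \<otimes> u [^] i))"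
      by (rule finsum_cong') (use \<gamma>c uc in \<open>auto simp: m_ac\<close>)
    also have "\<dots> = u \<otimes> ?w"
      by (rule finsum_rdistr[symmetric]) (use \<gamma>c uc in auto)
    finally show ?thesis using \<gamma>c[of 0] by simp
  qed
  show ?case
  proof (cases "\<gamma> 0 = \<zero>")
    case True
    then have "u \<otimes> ?w = \<zero>" using split Suc.prems(3) uc wc by simp
    then have "?w = \<zero>" using integral[of u ?w] u(2) uc wc by blast
    moreover have "\<exists>i<n. \<gamma> (Suc i) \<noteq> \<zero>"
      using Suc.prems(2) True by (metis less_Suc_eq_0_disj)
    ultimately show ?thesis using Suc.IH[of "\<lambda>i. \<gamma> (Suc i)"] Suc.prems(1) by auto
  next
    case False
    have "u \<otimes> (\<ominus> ?w) = \<gamma> 0"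
      using split Suc.prems(3) uc wc \<gamma>c[of 0] by (simp add: r_minus minus_equality)
    then show ?thesis
      using False Suc.prems(1)[of 0] subringE(5)[OF S(1) w] by (intro bexI[of _ "\<ominus> ?w"]) auto
  qed
qed

text \<open>
  Together with the previous descent this is Kaplansky's route to Zariski's lemma. Let \<open>c x\<^sup>D\<close> be a combination of lower powers of \<open>x\<close>, with \<open>D\<close> minimal. Up to powers of \<open>c\<close>, every
  element of \<open>T[x]\<close> is then a unique combination of \<open>1, x, \<dots>, x\<^sup>D\<^sup>-\<^sup>1\<close>, and a divisibility in \<open>T[x]\<close>
  can be read off from the coefficients of \<open>1\<close>.
\<close>

lemma (in domain) g_subring_of_algebraic_extension:
  assumes T: "subring T R" and x: "x \<in> carrier R" and alg: "(algebraic over T) x"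
    and G: "g_subring (simple_extension T x)"
  shows "g_subring T"
proof -
  let ?S = "simple_extension T x"
  have S: "subring ?S R" by (rule simple_extension_is_subring[OF T x])
  have xS: "x \<in> ?S" by (rule simple_extension_mem[OF T x])
  have TR: "T \<subseteq> carrier R" by (rule subringE(1)[OF T])
  have SR: "?S \<subseteq> carrier R" by (rule subringE(1)[OF S])
  have TS: "T \<subseteq> ?S" by (rule simple_extension_incl[OF TR x])
  have Tc: "t \<in> T \<Longrightarrow> t \<in> carrier R" for t using TR by blast
  define Low where "Low n = {(\<Oplus>i\<in>{..<n}. \<eta> i \<otimes> x [^] i) | \<eta>. \<eta> \<in> {..<n::nat} \<rightarrow> T}" for n
  \<comment> \<open>elements of \<open>Low n\<close> are combinations of powers below \<open>n\<close>, so \<open>P n\<close> is an equation of degree \<open>n\<close> for \<open>x\<close>\<close>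
  define P where "P n \<longleftrightarrow> (\<exists>c\<in>T. c \<noteq> \<zero> \<and> c \<otimes> x [^] n \<in> Low n)" for n
  have "\<exists>n. P n"
  proof -
    obtain p where p: "p \<in> carrier (T[X])" "p \<noteq> []" "eval p x = \<zero>"
      using algebraicE[OF T x alg] by blast
    then obtain a q where q: "p = a # q" by (cases p) auto
    have a: "a \<in> T" "a \<noteq> \<zero>" "set q \<subseteq> T"
      using p q univ_poly_carrier[of R T p] by (auto simp: polynomial_def)
    have qc: "eval q x \<in> carrier R" using a(3) TR x by (auto intro!: eval_in_carrier)
    have neg: "set (map (\<lambda>b. \<ominus> \<one> \<otimes> b) q) \<subseteq> T" using a(3) subringE(3,5,6)[OF T] by auto
    have "eval (map (\<lambda>b. \<ominus> \<one> \<otimes> b) q) x = \<ominus> \<one> \<otimes> eval q x" using a(3)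
    proof (induction q)
      case (Cons b q)
      then have "b \<in> carrier R" "eval q x \<in> carrier R"
        using TR x by (auto intro!: eval_in_carrier)
      then show ?case using Cons x by (simp add: r_distr m_assoc)
    qed simp
    moreover have "a \<otimes> x [^] length q \<oplus> eval q x = \<zero>" using p q by simp
    then have "a \<otimes> x [^] length q = \<ominus> \<one> \<otimes> eval q x"
      using qc Tc[OF a(1)] x by (simp add: l_minus minus_equality[symmetric])
    ultimately have "a \<otimes> x [^] length q \<in> Low (length q)"
      using eval_as_finsum[OF neg T x] by (auto simp: Low_def)
    then show ?thesis using a by (auto simp: P_def)
  qed
  define D where "D = (LEAST n. P n)"
  have PD: "P D" and minD: "\<And>m. m < D \<Longrightarrow> \<not> P m"
    unfolding D_def using LeastI_ex[OF \<open>\<exists>n. P n\<close>] not_less_Least by blast+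
  obtain c where c: "c \<in> T" "c \<noteq> \<zero>" "c \<otimes> x [^] D \<in> Low D" using PD by (auto simp: P_def)
  have D0: "0 < D"
  proof (rule ccontr)
    assume "\<not> 0 < D"
    then show False using c Tc by (simp add: Low_def)
  qed
  have Low_c: "y \<in> carrier R" if "y \<in> Low n" for y n
    using that Tc x by (auto simp: Low_def Pi_iff intro!: finsum_closed)
  have Low_add: "y \<oplus> z \<in> Low n" if yz: "y \<in> Low n" "z \<in> Low n" for y z n
  proof -
    obtain \<eta> \<zeta> where e: "\<eta> \<in> {..<n} \<rightarrow> T" "y = (\<Oplus>i\<in>{..<n}. \<eta> i \<otimes> x [^] i)"
      "\<zeta> \<in> {..<n} \<rightarrow> T" "z = (\<Oplus>i\<in>{..<n}. \<zeta> i \<otimes> x [^] i)"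
      using yz by (auto simp: Low_def)
    have "y \<oplus> z = (\<Oplus>i\<in>{..<n}. \<eta> i \<otimes> x [^] i \<oplus> \<zeta> i \<otimes> x [^] i)"
      unfolding e by (rule finsum_addf[symmetric]) (use e Tc x in auto)
    also have "\<dots> = (\<Oplus>i\<in>{..<n}. (\<eta> i \<oplus> \<zeta> i) \<otimes> x [^] i)"
      by (rule finsum_cong') (use e Tc x in \<open>auto simp: l_distr Pi_iff\<close>)
    finally show ?thesis using e subringE(7)[OF T] unfolding Low_def by (auto simp: Pi_iff)
  qed
  have Low_smult: "t \<otimes> y \<in> Low n" if t: "t \<in> T" and y: "y \<in> Low n" for t y n
  proof -
    obtain \<eta> where e: "\<eta> \<in> {..<n} \<rightarrow> T" "y = (\<Oplus>i\<in>{..<n}. \<eta> i \<otimes> x [^] i)"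
      using y by (auto simp: Low_def)
    have "t \<otimes> y = (\<Oplus>i\<in>{..<n}. t \<otimes> (\<eta> i \<otimes> x [^] i))"
      unfolding e by (rule finsum_rdistr) (use e t Tc x in auto)
    also have "\<dots> = (\<Oplus>i\<in>{..<n}. (t \<otimes> \<eta> i) \<otimes> x [^] i)"
      by (rule finsum_cong') (use e t Tc x in \<open>auto simp: m_assoc Pi_iff\<close>)
    finally show ?thesis using e t subringE(6)[OF T] unfolding Low_def by (auto simp: Pi_iff)
  qed
  have Low_pow: "x [^] j \<in> Low n" if "j < n" for j n :: nat
  proof -
    have "(\<Oplus>i\<in>{..<n}. (if i = j then \<one> else \<zero>) \<otimes> x [^] i)
        = (\<Oplus>i\<in>{..<n}. if i = j then x [^] i else \<zero>)"
      by (rule finsum_cong') (use x in auto)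
    also have "\<dots> = x [^] j" by (rule finsum_delta) (use that x in auto)
    finally show ?thesis
      unfolding Low_def using subringE(2,3)[OF T]
      by (intro CollectI exI[of _ "\<lambda>i. if i = j then \<one> else \<zero>"]) auto
  qed
  have Low_sum: "(\<Oplus>i\<in>{..<m}. f i) \<in> Low D" if "\<And>i. i < m \<Longrightarrow> f i \<in> Low D" for f and m :: nat
    using that
  proof (induction m)
    case 0
    have "\<zero> \<otimes> x [^] (0::nat) \<in> Low D" by (rule Low_smult[OF subringE(2)[OF T] Low_pow[OF D0]])
    then show ?case using x by simp
  next
    case (Suc m)
    then have "(\<Oplus>i\<in>{..<Suc m}. f i) = f m \<oplus> (\<Oplus>i\<in>{..<m}. f i)"
      unfolding lessThan_Suc by (intro finsum_insert) (auto intro!: Low_c Suc.prems)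
    then show ?case using Suc Low_add by simp
  qed
  have Low_x: "c \<otimes> (y \<otimes> x) \<in> Low D" if y: "y \<in> Low D" for y
  proof -
    obtain \<eta> where e: "\<eta> \<in> {..<D} \<rightarrow> T" "y = (\<Oplus>i\<in>{..<D}. \<eta> i \<otimes> x [^] i)"
      using y by (auto simp: Low_def)
    have "y \<otimes> x = (\<Oplus>i\<in>{..<D}. \<eta> i \<otimes> x [^] i \<otimes> x)"
      unfolding e by (rule finsum_ldistr) (use e Tc x in auto)
    then have "c \<otimes> (y \<otimes> x) = (\<Oplus>i\<in>{..<D}. c \<otimes> (\<eta> i \<otimes> x [^] i \<otimes> x))"
      using finsum_rdistr[of "{..<D}" c "\<lambda>i. \<eta> i \<otimes> x [^] i \<otimes> x"] e c Tc x by auto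
    also have "\<dots> \<in> Low D"
    proof (rule Low_sum)
      fix i assume i: "i < D"
      then have \<eta>: "\<eta> i \<in> T" using e by auto
      have "c \<otimes> x [^] Suc i \<in> Low D"
        using Low_smult[OF c(1) Low_pow[of "Suc i" D]] c(3) i by (cases "Suc i = D") auto
      then have "\<eta> i \<otimes> (c \<otimes> x [^] Suc i) \<in> Low D" by (rule Low_smult[OF \<eta>])
      moreover have "c \<otimes> (\<eta> i \<otimes> x [^] i \<otimes> x) = \<eta> i \<otimes> (c \<otimes> x [^] Suc i)"
        using \<eta> c(1) Tc x by (simp add: m_ac)
      ultimately show "c \<otimes> (\<eta> i \<otimes> x [^] i \<otimes> x) \<in> Low D" by simp
    qed
    finally show ?thesis .
  qed
  have reduce: "\<exists>N::nat. c [^] N \<otimes> h \<in> Low D" if "h \<in> ?S" for h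
    using that
  proof (induction rule: simple_extension.induct)
    case zero
    show ?case using Low_sum[of 0] c Tc by simp
  next
    case (lin k1 k2)
    then obtain N :: nat where N: "c [^] N \<otimes> k1 \<in> Low D" by blast
    have cc: "c [^] N \<in> T" "c [^] Suc N \<in> T" by (rule subring_pow_closed[OF T c(1)])+
    have k: "k1 \<in> carrier R" "k2 \<in> carrier R" "c \<in> carrier R" "c [^] N \<in> carrier R"
      using lin SR Tc c cc by auto
    have "c \<otimes> ((c [^] N \<otimes> k1) \<otimes> x) \<oplus> (c [^] Suc N \<otimes> k2) \<otimes> x [^] (0::nat) \<in> Low D"
      by (rule Low_add[OF Low_x[OF N] Low_smult[OF subringE(6)[OF T cc(2) lin(2)] Low_pow[OF D0]]])
    also have "c \<otimes> ((c [^] N \<otimes> k1) \<otimes> x) \<oplus> (c [^] Suc N \<otimes> k2) \<otimes> x [^] (0::nat)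
        = c [^] Suc N \<otimes> (k1 \<otimes> x \<oplus> k2)"
      using k x by (simp add: r_distr m_ac)
    finally show ?case by blast
  qed
  have indep: "\<forall>i<D. \<eta> i = \<zero>"
    if \<eta>: "\<eta> \<in> {..<D} \<rightarrow> T" and sum0: "(\<Oplus>i\<in>{..<D}. \<eta> i \<otimes> x [^] i) = \<zero>" for \<eta>
  proof (rule ccontr)
    assume "\<not> (\<forall>i<D. \<eta> i = \<zero>)"
    then have ne: "{i. i < D \<and> \<eta> i \<noteq> \<zero>} \<noteq> {}" by auto
    define j where "j = Max {i. i < D \<and> \<eta> i \<noteq> \<zero>}"
    have fin: "finite {i. i < D \<and> \<eta> i \<noteq> \<zero>}" by simp
    have j: "j < D" "\<eta> j \<noteq> \<zero>" using Max_in[OF fin ne] by (auto simp: j_def)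
    have top: "\<eta> i = \<zero>" if "j < i" "i < D" for i
    proof (rule ccontr)
      assume "\<eta> i \<noteq> \<zero>"
      then have "i \<le> j" using Max_ge[OF fin, of i] that by (simp add: j_def)
      then show False using that by simp
    qed
    have \<eta>c: "\<eta> i \<in> carrier R" if "i < D" for i using \<eta> Tc that by auto
    have "(\<Oplus>i\<in>{..<D}. \<eta> i \<otimes> x [^] i) = (\<Oplus>i\<in>{..<Suc j}. \<eta> i \<otimes> x [^] i)"
      by (rule add.finprod_mono_neutral_cong_right) (use j top \<eta>c x in auto)
    also have "\<dots> = \<eta> j \<otimes> x [^] j \<oplus> (\<Oplus>i\<in>{..<j}. \<eta> i \<otimes> x [^] i)"
      using j \<eta>c x by (simp add: lessThan_Suc Pi_iff)
    finally have eq: "\<eta> j \<otimes> x [^] j \<oplus> (\<Oplus>i\<in>{..<j}. \<eta> i \<otimes> x [^] i) = \<zero>" using sum0 by simp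
    have "(\<Oplus>i\<in>{..<j}. \<eta> i \<otimes> x [^] i) \<in> Low j"
      unfolding Low_def by (intro CollectI exI[of _ \<eta>]) (use \<eta> j in auto)
    then have "\<ominus> \<one> \<otimes> (\<Oplus>i\<in>{..<j}. \<eta> i \<otimes> x [^] i) \<in> Low j"
      using Low_smult subringE(3,5)[OF T] by blast
    moreover have "\<ominus> \<one> \<otimes> (\<Oplus>i\<in>{..<j}. \<eta> i \<otimes> x [^] i) = \<eta> j \<otimes> x [^] j"
      using eq \<open>(\<Oplus>i\<in>{..<j}. \<eta> i \<otimes> x [^] i) \<in> Low j\<close> Low_c \<eta>c[OF j(1)] x
      by (simp add: l_minus minus_equality)
    ultimately have "P j" using j \<eta> by (auto simp: P_def)
    then show False using minD[OF j(1)] by blast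
  qed
  obtain u where u: "u \<in> ?S" "u \<noteq> \<zero>"
    and u_dvd: "\<And>s. s \<in> ?S \<Longrightarrow> s \<noteq> \<zero> \<Longrightarrow> \<exists>t\<in>?S. \<exists>n::nat. s \<otimes> t = u [^] n"
    using G unfolding g_subring_def by blast
  \<comment> \<open>the first \<open>D + 1\<close> powers of \<open>u\<close> are linearly dependent over \<open>T\<close>, hence \<open>u\<close> is algebraic over \<open>T\<close>\<close>
  have "\<exists>w\<in>?S. u \<otimes> w \<in> T \<and> u \<otimes> w \<noteq> \<zero>"
  proof -
    have "\<exists>N::nat. \<exists>\<eta>\<in>{..<D} \<rightarrow> T. c [^] N \<otimes> u [^] i = (\<Oplus>j\<in>{..<D}. \<eta> j \<otimes> x [^] j)" for i :: nat
      using reduce[OF subring_pow_closed[OF S u(1), of i]] by (auto simp: Low_def)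
    then obtain N :: "nat \<Rightarrow> nat" and \<eta> where \<eta>: "\<And>i. \<eta> i \<in> {..<D} \<rightarrow> T"
      "\<And>i::nat. c [^] N i \<otimes> u [^] i = (\<Oplus>j\<in>{..<D}. \<eta> i j \<otimes> x [^] j)"
      by metis
    have "\<exists>\<beta>. (\<forall>i\<in>{..<Suc D}. \<beta> i \<in> T) \<and> (\<exists>i\<in>{..<Suc D}. \<beta> i \<noteq> \<zero>) \<and>
        (\<forall>j\<in>{..<D}. (\<Oplus>i\<in>{..<Suc D}. \<beta> i \<otimes> \<eta> i j) = \<zero>)"
    proof (rule exists_linear_relation[OF T])
      show "\<eta> i j \<in> T" if "j \<in> {..<D}" for i j using \<eta>(1)[of i] that by auto
    qed auto
    then obtain \<beta> where \<beta>: "\<forall>i\<in>{..<Suc D}. \<beta> i \<in> T" "\<exists>i\<in>{..<Suc D}. \<beta> i \<noteq> \<zero>"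
      "\<forall>j\<in>{..<D}. (\<Oplus>i\<in>{..<Suc D}. \<beta> i \<otimes> \<eta> i j) = \<zero>"
      by blast
    define \<gamma> where "\<gamma> i = \<beta> i \<otimes> c [^] N i" for i
    have cN: "c [^] N i \<in> T" for i by (rule subring_pow_closed[OF T c(1)])
    have \<gamma>: "\<gamma> i \<in> T" if "i < Suc D" for i
      using \<beta>(1) that cN subringE(6)[OF T] by (simp add: \<gamma>_def)
    have nz: "\<exists>i<Suc D. \<gamma> i \<noteq> \<zero>"
      using \<beta>(1,2) pow_nonzero[OF Tc[OF c(1)] c(2)] integral Tc cN unfolding \<gamma>_def
      by (metis lessThan_iff)
    have \<beta>c: "\<beta> i \<in> carrier R" if "i < Suc D" for i using \<beta>(1) Tc that by auto
    have \<eta>c: "\<eta> i j \<in> carrier R" if "j < D" for i j using \<eta>(1) Tc that by auto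
    have uc: "u \<in> carrier R" using u SR by blast
    have "(\<Oplus>i\<in>{..<Suc D}. \<gamma> i \<otimes> u [^] i)
        = (\<Oplus>i\<in>{..<Suc D}. \<Oplus>j\<in>{..<D}. \<beta> i \<otimes> \<eta> i j \<otimes> x [^] j)"
    proof (rule finsum_cong')
      fix i assume i: "i \<in> {..<Suc D}"
      have "\<gamma> i \<otimes> u [^] i = \<beta> i \<otimes> (\<Oplus>j\<in>{..<D}. \<eta> i j \<otimes> x [^] j)"
        using i \<beta>c Tc[OF cN] uc by (simp add: \<gamma>_def m_assoc \<eta>(2)[symmetric])
      also have "\<dots> = (\<Oplus>j\<in>{..<D}. \<beta> i \<otimes> (\<eta> i j \<otimes> x [^] j))"
        by (rule finsum_rdistr) (use i \<beta>c \<eta>c x in auto)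
      also have "\<dots> = (\<Oplus>j\<in>{..<D}. \<beta> i \<otimes> \<eta> i j \<otimes> x [^] j)"
        by (rule finsum_cong') (use i \<beta>c \<eta>c x in \<open>auto simp: m_assoc\<close>)
      finally show "\<gamma> i \<otimes> u [^] i = (\<Oplus>j\<in>{..<D}. \<beta> i \<otimes> \<eta> i j \<otimes> x [^] j)" .
    qed (use \<beta>c \<eta>c x in \<open>auto intro!: finsum_closed\<close>)
    also have "\<dots> = (\<Oplus>j\<in>{..<D}. \<Oplus>i\<in>{..<Suc D}. \<beta> i \<otimes> \<eta> i j \<otimes> x [^] j)"
      by (rule finsum_swap) (use \<beta>c \<eta>c x in auto)
    also have "\<dots> = (\<Oplus>j\<in>{..<D}. \<zero>)"
    proof (rule finsum_cong')
      fix j assume j: "j \<in> {..<D}"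
      have "(\<Oplus>i\<in>{..<Suc D}. \<beta> i \<otimes> \<eta> i j \<otimes> x [^] j) = (\<Oplus>i\<in>{..<Suc D}. \<beta> i \<otimes> \<eta> i j) \<otimes> x [^] j"
        by (rule finsum_ldistr[symmetric]) (use j \<beta>c \<eta>c x in auto)
      then show "(\<Oplus>i\<in>{..<Suc D}. \<beta> i \<otimes> \<eta> i j \<otimes> x [^] j) = \<zero>" using \<beta>(3) j x by simp
    qed auto
    finally have "(\<Oplus>i\<in>{..<Suc D}. \<gamma> i \<otimes> u [^] i) = \<zero>" by simp
    from relation_imp_multiple_in_subring[OF T S TS u \<gamma> nz this] show ?thesis by blast
  qed
  then obtain w where w: "w \<in> ?S" "u \<otimes> w \<in> T" "u \<otimes> w \<noteq> \<zero>" by blast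
  define t where "t = u \<otimes> w"
  have t: "t \<in> T" "t \<noteq> \<zero>" using w by (auto simp: t_def)
  \<comment> \<open>\<open>c u w\<close> inverts everything in \<open>T\<close>: compare the coefficients of \<open>1\<close>, using independence\<close>
  have "\<exists>t'\<in>T. \<exists>n::nat. s \<otimes> t' = (c \<otimes> t) [^] n" if s: "s \<in> T" "s \<noteq> \<zero>" for s
  proof -
    obtain g n where g: "g \<in> ?S" "s \<otimes> g = u [^] (n::nat)" using u_dvd[of s] s TS by blast
    define h where "h = g \<otimes> w [^] n"
    have h: "h \<in> ?S" using g w subring_pow_closed[OF S] subringE(6)[OF S] by (simp add: h_def)
    have cs: "s \<in> carrier R" "g \<in> carrier R" "w \<in> carrier R" "u \<in> carrier R" "c \<in> carrier R"
      "t \<in> carrier R"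
      using s g w u c t Tc SR by auto
    have "s \<otimes> h = t [^] n"
      using cs g(2) by (simp add: h_def t_def nat_pow_distrib m_assoc[symmetric])
    obtain N where "c [^] (N::nat) \<otimes> h \<in> Low D" using reduce[OF h] by blast
    then obtain \<eta> where \<eta>: "\<eta> \<in> {..<D} \<rightarrow> T" "c [^] N \<otimes> h = (\<Oplus>i\<in>{..<D}. \<eta> i \<otimes> x [^] i)"
      by (auto simp: Low_def)
    define k where "k = c [^] N \<otimes> t [^] n"
    have k: "k \<in> T" using subring_pow_closed[OF T] subringE(6)[OF T] c t by (simp add: k_def)
    define \<zeta> where "\<zeta> i = s \<otimes> \<eta> i \<ominus> (if i = 0 then k else \<zero>)" for i
    have \<zeta>: "\<zeta> \<in> {..<D} \<rightarrow> T"
      using \<eta>(1) s k subringE(2,5,6,7)[OF T] by (auto simp: \<zeta>_def a_minus_def Pi_iff)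
    have \<eta>c: "\<eta> i \<in> carrier R" if "i < D" for i using \<eta> Tc that by auto
    have "(\<Oplus>i\<in>{..<D}. \<zeta> i \<otimes> x [^] i) =
        (\<Oplus>i\<in>{..<D}. s \<otimes> (\<eta> i \<otimes> x [^] i) \<oplus> (if i = 0 then \<ominus> k else \<zero>))"
      by (rule finsum_cong')
        (use \<eta>c cs x Tc[OF k] in \<open>auto simp: \<zeta>_def a_minus_def l_distr m_assoc\<close>)
    also have "\<dots> = (\<Oplus>i\<in>{..<D}. s \<otimes> (\<eta> i \<otimes> x [^] i)) \<oplus> (\<Oplus>i\<in>{..<D}. if i = 0 then \<ominus> k else \<zero>)"
      by (rule finsum_addf) (use \<eta>c cs x Tc[OF k] in auto)
    also have "(\<Oplus>i\<in>{..<D}. s \<otimes> (\<eta> i \<otimes> x [^] i)) = s \<otimes> (c [^] N \<otimes> h)"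
      unfolding \<eta>(2) by (rule finsum_rdistr[symmetric]) (use \<eta>c cs x in auto)
    also have "(\<Oplus>i\<in>{..<D}. if i = 0 then \<ominus> k else \<zero>) = \<ominus> k"
      by (rule finsum_delta) (use D0 Tc[OF k] in auto)
    also have "s \<otimes> (c [^] N \<otimes> h) = k"
      using cs h SR \<open>s \<otimes> h = t [^] n\<close> m_lcomm[of s "c [^] N" h] by (auto simp: k_def)
    also have "k \<oplus> \<ominus> k = \<zero>" using Tc[OF k] by (simp add: r_neg)
    finally have "\<forall>i<D. \<zeta> i = \<zero>" by (rule indep[OF \<zeta>])
    then have "s \<otimes> \<eta> 0 = k" using D0 cs \<eta>c Tc[OF k] by (simp add: \<zeta>_def)
    then have "s \<otimes> (\<eta> 0 \<otimes> (c [^] n \<otimes> t [^] N)) = k \<otimes> (c [^] n \<otimes> t [^] N)"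
      using cs \<eta>c[OF D0] Tc[OF k] by (simp add: m_assoc[symmetric])
    also have "\<dots> = (c \<otimes> t) [^] (N + n)"
      using cs by (simp add: k_def nat_pow_distrib nat_pow_mult[symmetric] m_ac)
    finally have eq: "s \<otimes> (\<eta> 0 \<otimes> (c [^] n \<otimes> t [^] N)) = (c \<otimes> t) [^] (N + n)" .
    have "\<eta> 0 \<otimes> (c [^] n \<otimes> t [^] N) \<in> T"
      using \<eta>(1) D0 subring_pow_closed[OF T c(1)] subring_pow_closed[OF T t(1)] subringE(6)[OF T]
      by (simp add: Pi_iff)
    then show ?thesis
      using eq by (intro bexI[of _ "\<eta> 0 \<otimes> (c [^] n \<otimes> t [^] N)"] exI[of _ "N + n"])
  qed
  moreover have "c \<otimes> t \<in> T" "c \<otimes> t \<noteq> \<zero>"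
    using c t subringE(6)[OF T] integral[of c t] Tc by auto
  ultimately show ?thesis unfolding g_subring_def by blast
qed

lemma (in domain) g_subring_of_finite_extension:
  assumes "subring T R" "set xs \<subseteq> carrier R" "g_subring (finite_extension T xs)"
  shows "g_subring T"
  using assms(2,3)
proof (induction xs)
  case (Cons x xs)
  then have sub: "subring (finite_extension T xs) R"
    using finite_extension_is_subring[OF assms(1)] by simp
  then have "g_subring (finite_extension T xs)"
    using Cons.prems g_subring_simple_extension_imp_algebraic[OF sub, of x]
      g_subring_of_algebraic_extension[OF sub, of x] by simp
  then show ?case using Cons by simp
qed simp

text \<open>
  An algebraic element \<open>x\<close> is an eigenvalue of its own multiplication on \<open>F\<close>: the eigenvalue found in \<open>K\<close>
  can be compared with \<open>x\<close> because the eigenvector is invertible.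
\<close>

lemma algebraic_over_algebraically_closed:
  assumes "algebraically_closed K" "field F" "h \<in> ring_hom K F"
    and x: "x \<in> carrier F" "((ring.algebraic F) over (h ` carrier K)) x"
  shows "x \<in> h ` carrier K"
proof -
  interpret K: algebraically_closed K by fact
  interpret F: field F by fact
  interpret h: ring_hom_ring K F h
    using ring_hom_ringI2[OF K.is_ring F.is_ring assms(3)] .
  have T: "subring (h ` carrier K) F" by (rule h.img_is_subring[OF K.carrier_is_subring])
  interpret lin_action K F "\<lambda>c y. h c \<otimes>\<^bsub>F\<^esub> y"
    by (rule lin_action.intro[OF K.field_axioms F.abelian_group_axioms], rule lin_action_axioms.intro)
      (simp_all add: F.r_distr F.l_distr F.m_assoc)
  obtain p where p: "p \<in> carrier ((h ` carrier K)[X]\<^bsub>F\<^esub>)" "p \<noteq> []" "F.eval p x = \<zero>\<^bsub>F\<^esub>"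
    using F.algebraicE[OF T x] by blast
  have pT: "set p \<subseteq> h ` carrier K" "hd p \<noteq> \<zero>\<^bsub>F\<^esub>"
    using p univ_poly_carrier[of F "h ` carrier K" p] by (auto simp: polynomial_def)
  define cs where "cs = map (inv_into (carrier K) h) p"
  have "map h cs = map (\<lambda>y. y) p"
    unfolding cs_def map_map by (rule map_cong) (use pT(1) in \<open>auto simp: f_inv_into_f\<close>)
  then have cs: "p = map h cs" "set cs \<subseteq> carrier K"
    using pT(1) by (auto simp: cs_def intro: inv_into_into)
  let ?mx = "\<lambda>y. x \<otimes>\<^bsub>F\<^esub> y"
  have "poly_at ?mx \<one>\<^bsub>F\<^esub> (rev as) = F.eval (map h as) x" if "set as \<subseteq> carrier K" for as
    using that
  proof (induction as rule: rev_induct)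
    case (snoc a as)
    have "set (map h as) \<subseteq> carrier F" using snoc.prems by auto
    then show ?case
      using snoc F.eval_append_aux[of "map h as" "h a" x] x F.eval_in_carrier[of "map h as" x]
      by (simp add: F.a_comm F.m_comm)
  qed simp
  then have val: "poly_at ?mx \<one>\<^bsub>F\<^esub> (rev cs) = \<zero>\<^bsub>F\<^esub>" using cs p(3) by simp
  have "\<not> set (rev cs) \<subseteq> {\<zero>\<^bsub>K\<^esub>}"
  proof
    assume z: "set (rev cs) \<subseteq> {\<zero>\<^bsub>K\<^esub>}"
    have "cs \<noteq> []" using cs(1) p(2) by auto
    then have "hd cs \<in> set (rev cs)" by simp
    then have "hd cs = \<zero>\<^bsub>K\<^esub>" using z by blast
    then show False using pT(2) cs(1) \<open>cs \<noteq> []\<close> by (simp add: hd_map)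
  qed
  then have "\<exists>l\<in>carrier K. \<exists>w\<in>carrier F. w \<noteq> \<zero>\<^bsub>F\<^esub> \<and> x \<otimes>\<^bsub>F\<^esub> w = h l \<otimes>\<^bsub>F\<^esub> w"
    using x cs(2) val
    by (intro exists_eigenvector[OF assms(1) lin_action_axioms, where v = "\<one>\<^bsub>F\<^esub>" and cs = "rev cs"])
      (auto simp: F.r_distr F.m_lcomm)
  then obtain l w where "l \<in> carrier K" "w \<in> carrier F" "w \<noteq> \<zero>\<^bsub>F\<^esub>" "x \<otimes>\<^bsub>F\<^esub> w = h l \<otimes>\<^bsub>F\<^esub> w" by blast
  then have "x = h l" using F.m_rcancel[of w x "h l"] x by simp
  then show ?thesis using \<open>l \<in> carrier K\<close> by blast
qed

text \<open>
  A field is trivially a G-domain. This property descends along the tower that adjoins the generators one by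
  one, and forces every step of the tower to be algebraic, hence trivial.
\<close>

theorem zariski_lemma:
  assumes "algebraically_closed K" "field F" "h \<in> ring_hom K F"
    and "set xs \<subseteq> carrier F" "ring.finite_extension F (h ` carrier K) xs = carrier F"
  shows "carrier F = h ` carrier K"
proof -
  interpret K: algebraically_closed K by fact
  interpret F: field F by fact
  interpret h: ring_hom_ring K F h
    using ring_hom_ringI2[OF K.is_ring F.is_ring assms(3)] .
  let ?T = "h ` carrier K"
  have T: "subring ?T F" by (rule h.img_is_subring[OF K.carrier_is_subring])
  have G: "F.g_subring (carrier F)"
    unfolding F.g_subring_def
  proof (rule bexI[of _ "\<one>\<^bsub>F\<^esub>"], intro conjI ballI impI)
    fix s assume "s \<in> carrier F" "s \<noteq> \<zero>\<^bsub>F\<^esub>"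
    then have "s \<in> Units F" by (simp add: F.field_Units)
    then show "\<exists>t\<in>carrier F. \<exists>n::nat. s \<otimes>\<^bsub>F\<^esub> t = \<one>\<^bsub>F\<^esub> [^]\<^bsub>F\<^esub> n"
      by (intro bexI[of _ "inv\<^bsub>F\<^esub> s"] exI[of _ 0]) auto
  qed auto
  show ?thesis using assms(4,5)
  proof (induction xs rule: rev_induct)
    case Nil
    then show ?case by simp
  next
    case (snoc x xs)
    let ?Tx = "F.simple_extension ?T x"
    have x: "x \<in> carrier F" "set xs \<subseteq> carrier F" using snoc.prems by auto
    have sub: "subring ?Tx F" by (rule F.simple_extension_is_subring[OF T x(1)])
    have ext: "F.finite_extension ?Tx xs = carrier F" using snoc.prems by simp
    then have "F.g_subring ?Tx"
      using F.g_subring_of_finite_extension[OF sub x(2)] G by simp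
    then have "((ring.algebraic F) over ?T) x"
      by (rule F.g_subring_simple_extension_imp_algebraic[OF T x(1)])
    then have "x \<in> ?T" by (rule algebraic_over_algebraically_closed[OF assms(1-3) x(1)])
    then have "?Tx = ?T"
      using F.simple_extension_subring_incl[OF T order_refl]
        F.simple_extension_incl[OF subringE(1)[OF T] x(1)] by blast
    then show ?case using snoc.IH[OF x(2)] ext by simp
  qed
qed

text \<open>
  The weak Nullstellensatz: \<open>B/q\<close> is a field and a finitely generated algebra over \<open>K\<close>.
\<close>

lemma maximalideal_residue:
  fixes K :: "'k ring" and B :: "('k, 'b) module"
  assumes K: "algebraically_closed K" and B: "algebra K B" "fin_gen_over K B"
    and q: "maximalideal q B" and b: "b \<in> carrier B"
  shows "\<exists>c\<in>carrier K. b \<ominus>\<^bsub>B\<^esub> c \<odot>\<^bsub>B\<^esub> \<one>\<^bsub>B\<^esub> \<in> q"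
proof -
  interpret K: algebraically_closed K by fact
  interpret B: algebra K B by fact
  interpret q: maximalideal q B by fact
  let ?F = "B Quot q"
  interpret F: field ?F by (rule q.quotient_is_field[OF B.M_cring])
  interpret pr: ring_hom_ring B ?F "(+>\<^bsub>B\<^esub>) q" by (rule q.rcos_ring_hom_ring)
  define h where "h c = q +>\<^bsub>B\<^esub> (c \<odot>\<^bsub>B\<^esub> \<one>\<^bsub>B\<^esub>)" for c
  have one: "c \<odot>\<^bsub>B\<^esub> \<one>\<^bsub>B\<^esub> \<otimes>\<^bsub>B\<^esub> (e \<odot>\<^bsub>B\<^esub> \<one>\<^bsub>B\<^esub>) = (c \<otimes>\<^bsub>K\<^esub> e) \<odot>\<^bsub>B\<^esub> \<one>\<^bsub>B\<^esub>"
    if "c \<in> carrier K" "e \<in> carrier K" for c e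
    using that by (simp add: B.smult_assoc2 B.smult_assoc1)
  have h: "h \<in> ring_hom K ?F"
    using one by (intro ring_hom_memI) (auto simp: h_def B.smult_l_distr simp flip: pr.hom_mult pr.hom_add)
  interpret h: ring_hom_ring K ?F h using ring_hom_ringI2[OF K.is_ring F.is_ring h] .
  let ?T = "h ` carrier K"
  have T: "subring ?T ?F" by (rule h.img_is_subring[OF K.carrier_is_subring])
  obtain S where S: "finite S" "S \<subseteq> carrier B"
    and gen: "generate_ring B ((\<lambda>c. c \<odot>\<^bsub>B\<^esub> \<one>\<^bsub>B\<^esub>) ` carrier K \<union> S) = carrier B"
    using B(2) unfolding fin_gen_over_def by blast
  obtain xs where xs: "set xs = (+>\<^bsub>B\<^esub>) q ` S"
    using finite_list[of "(+>\<^bsub>B\<^esub>) q ` S"] S(1) by auto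
  have xsF: "set xs \<subseteq> carrier ?F" using xs S(2) by auto
  let ?E = "F.finite_extension ?T xs"
  have E: "subring ?E ?F" by (rule F.finite_extension_is_subring[OF T xsF])
  have TE: "?T \<subseteq> ?E" by (rule F.finite_extension_incl[OF subringE(1)[OF T] xsF])
  have xsE: "set xs \<subseteq> ?E" by (rule F.finite_extension_mem[OF T xsF])
  have "subring {b \<in> carrier B. q +>\<^bsub>B\<^esub> b \<in> ?E} B"
    using subringE[OF E] by (intro B.subringI) (auto simp del: F.finite_extension.simps)
  moreover have "(\<lambda>c. c \<odot>\<^bsub>B\<^esub> \<one>\<^bsub>B\<^esub>) ` carrier K \<union> S \<subseteq> {b \<in> carrier B. q +>\<^bsub>B\<^esub> b \<in> ?E}"
    using TE xsE S(2) xs by (auto simp: h_def simp del: F.finite_extension.simps)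
  ultimately have "carrier B \<subseteq> {b \<in> carrier B. q +>\<^bsub>B\<^esub> b \<in> ?E}"
    using B.generate_ring_min_subring1[of "(\<lambda>c. c \<odot>\<^bsub>B\<^esub> \<one>\<^bsub>B\<^esub>) ` carrier K \<union> S"] gen S(2) by blast
  then have "?E = carrier ?F"
    using subringE(1)[OF E] by (auto simp: FactRing_def A_RCOSETS_def' a_r_coset_def' simp del: F.finite_extension.simps)
  then have "carrier ?F = ?T" by (rule zariski_lemma[OF K F.field_axioms h xsF])
  moreover have "q +>\<^bsub>B\<^esub> b \<in> carrier ?F" using b by simp
  ultimately obtain c where c: "c \<in> carrier K" "q +>\<^bsub>B\<^esub> b = h c" by blast
  then have "b \<ominus>\<^bsub>B\<^esub> c \<odot>\<^bsub>B\<^esub> \<one>\<^bsub>B\<^esub> \<in> q"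
    using B.quotient_eq_iff_same_a_r_cos[OF q.is_ideal b, of "c \<odot>\<^bsub>B\<^esub> \<one>\<^bsub>B\<^esub>"] by (simp add: h_def)
  then show ?thesis using c(1) by blast
qed

lemma (in cring) exists_maximalideal:
  assumes "\<one> \<noteq> \<zero>"
  shows "\<exists>M. maximalideal M R"
proof -
  define \<A> where "\<A> = {I. ideal I R \<and> \<one> \<notin> I}"
  have "\<exists>M\<in>\<A>. \<forall>J\<in>\<A>. M \<subseteq> J \<longrightarrow> J = M"
  proof (rule subset_Zorn_nonempty)
    show "\<A> \<noteq> {}" using zeroideal assms by (auto simp: \<A>_def)
    fix C assume C: "C \<noteq> {}" "subset.chain \<A> C"
    then have "subset.chain {I. ideal I R} C" by (auto simp: subset_chain_def \<A>_def)
    then have "ideal (\<Union>C) R" using chain_Union_is_ideal[of C] C(1) by simp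
    then show "\<Union>C \<in> \<A>" using C by (auto simp: \<A>_def subset_chain_def)
  qed
  then obtain M where M: "M \<in> \<A>" "\<And>J. J \<in> \<A> \<Longrightarrow> M \<subseteq> J \<Longrightarrow> J = M" by blast
  have "maximalideal M R"
  proof (rule maximalidealI)
    fix J assume J: "ideal J R" "M \<subseteq> J" "J \<subseteq> carrier R"
    show "J = M \<or> J = carrier R"
      using M(2)[of J] J ideal.one_imp_carrier[OF J(1)] by (auto simp: \<A>_def)
  qed (use M(1) in \<open>auto simp: \<A>_def\<close>)
  then show ?thesis by blast
qed

section \<open>Simple modules\<close>

lemma (in abelian_group) diff_eq_zero_iff:
  assumes "a \<in> carrier G" "b \<in> carrier G"
  shows "a \<ominus> b = \<zero> \<longleftrightarrow> a = b"
  using assms minus_equality[of a "\<ominus> b"] by (auto simp: a_minus_def r_neg)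

context left_module
begin

lemma smult_zero_left: "x \<in> carrier M \<Longrightarrow> \<zero>\<^bsub>R\<^esub> \<odot>\<^bsub>M\<^esub> x = \<zero>\<^bsub>M\<^esub>"
  using smult_l_distr[of "\<zero>\<^bsub>R\<^esub>" "\<zero>\<^bsub>R\<^esub>" x] smult_closed[of "\<zero>\<^bsub>R\<^esub>" x]
    M.add.r_cancel_one[of "\<zero>\<^bsub>R\<^esub> \<odot>\<^bsub>M\<^esub> x" "\<zero>\<^bsub>R\<^esub> \<odot>\<^bsub>M\<^esub> x"] by auto

lemma smult_zero_right: "a \<in> carrier R \<Longrightarrow> a \<odot>\<^bsub>M\<^esub> \<zero>\<^bsub>M\<^esub> = \<zero>\<^bsub>M\<^esub>"
  using smult_r_distr[of a "\<zero>\<^bsub>M\<^esub>" "\<zero>\<^bsub>M\<^esub>"] smult_closed[of a "\<zero>\<^bsub>M\<^esub>"]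
    M.add.r_cancel_one[of "a \<odot>\<^bsub>M\<^esub> \<zero>\<^bsub>M\<^esub>" "a \<odot>\<^bsub>M\<^esub> \<zero>\<^bsub>M\<^esub>"] by auto

lemma smult_neg_left:
  assumes "a \<in> carrier R" "x \<in> carrier M"
  shows "(\<ominus>\<^bsub>R\<^esub> a) \<odot>\<^bsub>M\<^esub> x = \<ominus>\<^bsub>M\<^esub> (a \<odot>\<^bsub>M\<^esub> x)"
proof -
  have "(\<ominus>\<^bsub>R\<^esub> a) \<odot>\<^bsub>M\<^esub> x \<oplus>\<^bsub>M\<^esub> a \<odot>\<^bsub>M\<^esub> x = \<zero>\<^bsub>M\<^esub>"
    using assms smult_l_distr[of "\<ominus>\<^bsub>R\<^esub> a" a x] by (simp add: R.l_neg smult_zero_left)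
  then show ?thesis using assms M.minus_equality by (simp add: smult_closed)
qed

lemma smult_diff_left:
  assumes "a \<in> carrier R" "b \<in> carrier R" "x \<in> carrier M"
  shows "(a \<ominus>\<^bsub>R\<^esub> b) \<odot>\<^bsub>M\<^esub> x = a \<odot>\<^bsub>M\<^esub> x \<ominus>\<^bsub>M\<^esub> b \<odot>\<^bsub>M\<^esub> x"
  using assms by (simp add: a_minus_def smult_l_distr smult_neg_left)

lemma smult_finsum_right:
  assumes "a \<in> carrier R" "finite I" "\<And>i. i \<in> I \<Longrightarrow> f i \<in> carrier M"
  shows "a \<odot>\<^bsub>M\<^esub> (\<Oplus>\<^bsub>M\<^esub>i\<in>I. f i) = (\<Oplus>\<^bsub>M\<^esub>i\<in>I. a \<odot>\<^bsub>M\<^esub> f i)"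
  using assms(2,3)
proof (induction I rule: finite_induct)
  case empty
  then show ?case using assms(1) smult_zero_right by simp
next
  case (insert i I)
  then have "f \<in> I \<rightarrow> carrier M" "(\<lambda>i. a \<odot>\<^bsub>M\<^esub> f i) \<in> I \<rightarrow> carrier M" "f i \<in> carrier M"
    "a \<odot>\<^bsub>M\<^esub> f i \<in> carrier M"
    using smult_closed assms(1) by auto
  then show ?case using insert assms(1) by (simp add: smult_r_distr)
qed

lemma smult_finsum_left:
  assumes "x \<in> carrier M" "finite I" "\<And>i. i \<in> I \<Longrightarrow> f i \<in> carrier R"
  shows "(\<Oplus>\<^bsub>R\<^esub>i\<in>I. f i) \<odot>\<^bsub>M\<^esub> x = (\<Oplus>\<^bsub>M\<^esub>i\<in>I. f i \<odot>\<^bsub>M\<^esub> x)"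
  using assms(2,3)
proof (induction I rule: finite_induct)
  case empty
  then show ?case using assms(1) smult_zero_left by simp
next
  case (insert i I)
  then have "f \<in> I \<rightarrow> carrier R" "(\<lambda>i. f i \<odot>\<^bsub>M\<^esub> x) \<in> I \<rightarrow> carrier M" "f i \<in> carrier R"
    "f i \<odot>\<^bsub>M\<^esub> x \<in> carrier M"
    using smult_closed assms(1) by auto
  then show ?case using insert assms(1) by (simp add: smult_l_distr)
qed

lemma submodule_closedI:
  assumes "N \<subseteq> carrier M" "\<zero>\<^bsub>M\<^esub> \<in> N"
    and "\<And>x y. x \<in> N \<Longrightarrow> y \<in> N \<Longrightarrow> x \<oplus>\<^bsub>M\<^esub> y \<in> N"
    and "\<And>a x. a \<in> carrier R \<Longrightarrow> x \<in> N \<Longrightarrow> a \<odot>\<^bsub>M\<^esub> x \<in> N"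
  shows "Module.submodule N R M"
proof (intro Module.submodule.intro subgroup.intro Module.submodule_axioms.intro)
  show "inv\<^bsub>add_monoid M\<^esub> x \<in> N" if "x \<in> N" for x
  proof -
    have "(\<ominus>\<^bsub>R\<^esub> \<one>\<^bsub>R\<^esub>) \<odot>\<^bsub>M\<^esub> x = \<ominus>\<^bsub>M\<^esub> x"
      using that assms(1) smult_neg_left[of "\<one>\<^bsub>R\<^esub>" x] smult_one[of x] by auto
    then have "\<ominus>\<^bsub>M\<^esub> x \<in> N" using assms(4)[of "\<ominus>\<^bsub>R\<^esub> \<one>\<^bsub>R\<^esub>" x] that by simp
    then show ?thesis by (simp add: a_inv_def)
  qed
qed (use assms in auto)

definition annihilator :: "'a set" where
  "annihilator = {a \<in> carrier R. \<forall>v\<in>carrier M. a \<odot>\<^bsub>M\<^esub> v = \<zero>\<^bsub>M\<^esub>}"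

lemma ideal_annihilator: "ideal annihilator R"
proof (rule idealI)
  show "subgroup annihilator (add_monoid R)"
    by (rule R.add.subgroupI)
      (auto simp: annihilator_def smult_l_distr smult_neg_left smult_zero_left intro!: exI[of _ "\<zero>\<^bsub>R\<^esub>"]
        simp flip: a_inv_def)
qed (auto simp: annihilator_def smult_assoc smult_zero_right smult_closed R.ring_axioms)

lemma annihilatorD: "a \<in> annihilator \<Longrightarrow> v \<in> carrier M \<Longrightarrow> a \<odot>\<^bsub>M\<^esub> v = \<zero>\<^bsub>M\<^esub>"
  by (simp add: annihilator_def)

lemma annihilator_diff_iff:
  assumes "a \<in> carrier R" "b \<in> carrier R"
  shows "a \<ominus>\<^bsub>R\<^esub> b \<in> annihilator \<longleftrightarrow> (\<forall>v\<in>carrier M. a \<odot>\<^bsub>M\<^esub> v = b \<odot>\<^bsub>M\<^esub> v)"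
proof -
  have "a \<odot>\<^bsub>M\<^esub> v \<ominus>\<^bsub>M\<^esub> b \<odot>\<^bsub>M\<^esub> v = \<zero>\<^bsub>M\<^esub> \<longleftrightarrow> a \<odot>\<^bsub>M\<^esub> v = b \<odot>\<^bsub>M\<^esub> v" if "v \<in> carrier M" for v
    using M.diff_eq_zero_iff[of "a \<odot>\<^bsub>M\<^esub> v" "b \<odot>\<^bsub>M\<^esub> v"] assms that smult_closed by simp
  then show ?thesis using assms by (simp add: annihilator_def smult_diff_left)
qed

end

lemma simple_module_cyclic:
  fixes A :: "('a, 'm) ring_scheme" and M :: "('a, 'v) module"
  assumes "simple_module A M" "v \<in> carrier M" "v \<noteq> \<zero>\<^bsub>M\<^esub>" "w \<in> carrier M"
  obtains a where "a \<in> carrier A" "a \<odot>\<^bsub>M\<^esub> v = w"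
proof -
  interpret left_module A M using assms(1) by (simp add: simple_module_def)
  let ?N = "(\<lambda>a. a \<odot>\<^bsub>M\<^esub> v) ` carrier A"
  have "Module.submodule ?N A M"
  proof (rule submodule_closedI)
    show "\<zero>\<^bsub>M\<^esub> \<in> ?N" using smult_zero_left[OF assms(2)] by (metis R.zero_closed imageI)
    show "x \<oplus>\<^bsub>M\<^esub> y \<in> ?N" if "x \<in> ?N" "y \<in> ?N" for x y
      using that assms(2) by (auto simp: smult_l_distr[symmetric])
    show "a \<odot>\<^bsub>M\<^esub> x \<in> ?N" if "a \<in> carrier A" "x \<in> ?N" for a x
      using that assms(2) by (auto simp: smult_assoc[symmetric])
  qed (use assms(2) smult_closed in auto)
  then have "?N = {\<zero>\<^bsub>M\<^esub>} \<or> ?N = carrier M" using assms(1) by (simp add: simple_module_def)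
  moreover have "v \<in> ?N" using smult_one[OF assms(2)] by (metis R.one_closed imageI)
  ultimately have "w \<in> ?N" using assms by blast
  then show thesis using that by blast
qed

section \<open>Spans and linear relations\<close>

context lin_action
begin

definition lspan :: "'v set \<Rightarrow> 'v set" where
  "lspan S = {(\<Oplus>\<^bsub>V\<^esub>x\<in>S. act (c x) x) | c. c \<in> S \<rightarrow> carrier K}"

definition lindep_free :: "'v set \<Rightarrow> bool" where
  "lindep_free S \<longleftrightarrow> (\<forall>c\<in>S \<rightarrow> carrier K. (\<Oplus>\<^bsub>V\<^esub>x\<in>S. act (c x) x) = \<zero>\<^bsub>V\<^esub> \<longrightarrow> (\<forall>x\<in>S. c x = \<zero>\<^bsub>K\<^esub>))"

definition is_basis :: "'v set \<Rightarrow> bool" where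
  "is_basis S \<longleftrightarrow> finite S \<and> S \<subseteq> carrier V \<and> lindep_free S \<and> lspan S = carrier V"

lemma lspan_insert:
  assumes "finite S" "S \<subseteq> carrier V" "x \<in> carrier V" "x \<notin> S" "w \<in> lspan S" "l \<in> carrier K"
  shows "act l x \<oplus>\<^bsub>V\<^esub> w \<in> lspan (insert x S)"
proof -
  obtain c where c: "c \<in> S \<rightarrow> carrier K" "w = (\<Oplus>\<^bsub>V\<^esub>y\<in>S. act (c y) y)"
    using assms(5) by (auto simp: lspan_def)
  define c' where "c' = c(x := l)"
  have c': "c' \<in> insert x S \<rightarrow> carrier K" using c(1) assms(6) by (auto simp: c'_def)
  have "(\<Oplus>\<^bsub>V\<^esub>y\<in>insert x S. act (c' y) y) = act (c' x) x \<oplus>\<^bsub>V\<^esub> (\<Oplus>\<^bsub>V\<^esub>y\<in>S. act (c' y) y)"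
    by (rule V.finsum_insert) (use assms c' act_closed in auto)
  also have "(\<Oplus>\<^bsub>V\<^esub>y\<in>S. act (c' y) y) = (\<Oplus>\<^bsub>V\<^esub>y\<in>S. act (c y) y)"
    by (rule V.finsum_cong') (use assms c act_closed in \<open>auto simp: c'_def\<close>)
  finally have "act l x \<oplus>\<^bsub>V\<^esub> w = (\<Oplus>\<^bsub>V\<^esub>y\<in>insert x S. act (c' y) y)"
    using c(2) by (simp add: c'_def[THEN fun_cong, of x])
  then show ?thesis unfolding lspan_def using c' by (intro CollectI exI[of _ c'] conjI)
qed

definition coord :: "'v set \<Rightarrow> 'v \<Rightarrow> 'v \<Rightarrow> 'k" where
  "coord S v = (SOME c. c \<in> S \<rightarrow> carrier K \<and> v = (\<Oplus>\<^bsub>V\<^esub>x\<in>S. act (c x) x))"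

lemma coord:
  assumes "v \<in> lspan S"
  shows "coord S v \<in> S \<rightarrow> carrier K" "v = (\<Oplus>\<^bsub>V\<^esub>x\<in>S. act (coord S v x) x)"
proof -
  have "\<exists>c. c \<in> S \<rightarrow> carrier K \<and> v = (\<Oplus>\<^bsub>V\<^esub>x\<in>S. act (c x) x)"
    using assms unfolding lspan_def by blast
  note c = someI_ex[OF this, folded coord_def]
  show "coord S v \<in> S \<rightarrow> carrier K" by (rule conjunct1[OF c])
  show "v = (\<Oplus>\<^bsub>V\<^esub>x\<in>S. act (coord S v x) x)" by (rule conjunct2[OF c])
qed

lemma lspan_add:
  assumes S: "finite S" "S \<subseteq> carrier V" and v: "v \<in> lspan S" and w: "w \<in> lspan S"
  shows "v \<oplus>\<^bsub>V\<^esub> w \<in> lspan S"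
proof -
  let ?b = "coord S v" and ?c = "coord S w"
  have b: "?b x \<in> carrier K" "?c x \<in> carrier K" if "x \<in> S" for x
    using coord(1)[OF v] coord(1)[OF w] that by auto
  have xc: "x \<in> carrier V" if "x \<in> S" for x using that S(2) by blast
  have "(\<Oplus>\<^bsub>V\<^esub>x\<in>S. act (?b x \<oplus>\<^bsub>K\<^esub> ?c x) x) = (\<Oplus>\<^bsub>V\<^esub>x\<in>S. act (?b x) x \<oplus>\<^bsub>V\<^esub> act (?c x) x)"
    by (rule V.finsum_cong') (use b xc act_closed in \<open>auto simp: act_plus\<close>)
  also have "\<dots> = (\<Oplus>\<^bsub>V\<^esub>x\<in>S. act (?b x) x) \<oplus>\<^bsub>V\<^esub> (\<Oplus>\<^bsub>V\<^esub>x\<in>S. act (?c x) x)"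
    by (rule V.finsum_addf) (use b xc act_closed in auto)
  also have "\<dots> = v \<oplus>\<^bsub>V\<^esub> w" using coord(2)[OF v] coord(2)[OF w] by simp
  finally have "v \<oplus>\<^bsub>V\<^esub> w = (\<Oplus>\<^bsub>V\<^esub>x\<in>S. act (?b x \<oplus>\<^bsub>K\<^esub> ?c x) x)" by simp
  moreover have "(\<lambda>x. ?b x \<oplus>\<^bsub>K\<^esub> ?c x) \<in> S \<rightarrow> carrier K" using b by auto
  ultimately show ?thesis unfolding lspan_def
    by (intro CollectI exI[of _ "\<lambda>x. ?b x \<oplus>\<^bsub>K\<^esub> ?c x"] conjI)
qed

lemma lspan_act:
  assumes S: "finite S" "S \<subseteq> carrier V" and x: "x \<in> S" and c: "c \<in> carrier K"
  shows "act c x \<in> lspan S"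
proof -
  let ?c = "\<lambda>y. if y = x then c else \<zero>\<^bsub>K\<^esub>"
  have xc: "y \<in> carrier V" if "y \<in> S" for y using that S(2) by blast
  have "(\<Oplus>\<^bsub>V\<^esub>y\<in>S. act (?c y) y) = (\<Oplus>\<^bsub>V\<^esub>y\<in>S. if y = x then act c y else \<zero>\<^bsub>V\<^esub>)"
    by (rule V.finsum_cong') (use c xc act_closed in \<open>auto simp: act_zero\<close>)
  also have "\<dots> = act c x"
    by (rule V.finsum_delta) (use S x c xc act_closed in auto)
  finally have "act c x = (\<Oplus>\<^bsub>V\<^esub>y\<in>S. act (?c y) y)" by simp
  moreover have "?c \<in> S \<rightarrow> carrier K" using c by auto
  ultimately show ?thesis unfolding lspan_def by (intro CollectI exI[of _ ?c] conjI)
qed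

lemma lspan_family:
  assumes "finite P" "\<And>p. p \<in> P \<Longrightarrow> g p \<in> carrier V" "\<And>p. p \<in> P \<Longrightarrow> c p \<in> carrier K"
  shows "(\<Oplus>\<^bsub>V\<^esub>p\<in>P. act (c p) (g p)) \<in> lspan (g ` P)"
proof -
  have S: "finite (g ` P)" "g ` P \<subseteq> carrier V" using assms by auto
  have "(\<Oplus>\<^bsub>V\<^esub>p\<in>P'. act (c p) (g p)) \<in> lspan (g ` P)" if "finite P'" "P' \<subseteq> P" for P'
    using that
  proof (induction P' rule: finite_induct)
    case empty
    have "(\<Oplus>\<^bsub>V\<^esub>x\<in>g ` P. act \<zero>\<^bsub>K\<^esub> x) = (\<Oplus>\<^bsub>V\<^esub>x\<in>g ` P. \<zero>\<^bsub>V\<^esub>)"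
      by (rule V.finsum_cong') (use assms in \<open>auto simp: act_zero\<close>)
    then have "\<zero>\<^bsub>V\<^esub> = (\<Oplus>\<^bsub>V\<^esub>x\<in>g ` P. act \<zero>\<^bsub>K\<^esub> x)" by simp
    moreover have "(\<lambda>_. \<zero>\<^bsub>K\<^esub>) \<in> g ` P \<rightarrow> carrier K" by auto
    ultimately have "\<zero>\<^bsub>V\<^esub> \<in> lspan (g ` P)"
      unfolding lspan_def by (intro CollectI exI[of _ "\<lambda>_. \<zero>\<^bsub>K\<^esub>"] conjI)
    then show ?case by simp
  next
    case (insert p P')
    have "(\<Oplus>\<^bsub>V\<^esub>p\<in>insert p P'. act (c p) (g p)) = act (c p) (g p) \<oplus>\<^bsub>V\<^esub> (\<Oplus>\<^bsub>V\<^esub>p\<in>P'. act (c p) (g p))"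
      by (rule V.finsum_insert) (use insert assms act_closed in auto)
    moreover have "act (c p) (g p) \<in> lspan (g ` P)"
      by (rule lspan_act[OF S]) (use insert assms in auto)
    ultimately show ?case using insert lspan_add[OF S] by simp
  qed
  then show ?thesis using assms(1) by blast
qed

lemma relation_of_coords:
  assumes S: "finite S" "S \<subseteq> carrier V" and P: "finite P"
    and c: "\<And>p. p \<in> P \<Longrightarrow> c p \<in> S \<rightarrow> carrier K"
    and w: "\<And>p. p \<in> P \<Longrightarrow> w p = (\<Oplus>\<^bsub>V\<^esub>x\<in>S. act (c p x) x)"
    and \<beta>: "\<And>p. p \<in> P \<Longrightarrow> \<beta> p \<in> carrier K"
    and rel: "\<And>x. x \<in> S \<Longrightarrow> (\<Oplus>\<^bsub>K\<^esub>p\<in>P. \<beta> p \<otimes>\<^bsub>K\<^esub> c p x) = \<zero>\<^bsub>K\<^esub>"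
  shows "(\<Oplus>\<^bsub>V\<^esub>p\<in>P. act (\<beta> p) (w p)) = \<zero>\<^bsub>V\<^esub>"
proof -
  have cc: "c p x \<in> carrier K" if "p \<in> P" "x \<in> S" for p x using c[OF that(1)] that(2) by auto
  have xc: "x \<in> carrier V" if "x \<in> S" for x using that S(2) by blast
  have sum_act: "(\<Oplus>\<^bsub>V\<^esub>p\<in>P'. act (f p) x) = act (\<Oplus>\<^bsub>K\<^esub>p\<in>P'. f p) x"
    if "finite P'" "\<And>p. p \<in> P' \<Longrightarrow> f p \<in> carrier K" "x \<in> carrier V" for P' f x
    using that(1,2)
  proof (induction P' rule: finite_induct)
    case empty
    then show ?case using that(3) act_zero by simp
  next
    case (insert p P')
    have "(\<Oplus>\<^bsub>V\<^esub>p\<in>insert p P'. act (f p) x) = act (f p) x \<oplus>\<^bsub>V\<^esub> (\<Oplus>\<^bsub>V\<^esub>p\<in>P'. act (f p) x)"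
      by (rule V.finsum_insert) (use insert that(3) act_closed in auto)
    also have "\<dots> = act (f p \<oplus>\<^bsub>K\<^esub> (\<Oplus>\<^bsub>K\<^esub>p\<in>P'. f p)) x"
      using insert that(3) by (subst act_plus) (auto intro!: K.finsum_closed)
    also have "f p \<oplus>\<^bsub>K\<^esub> (\<Oplus>\<^bsub>K\<^esub>p\<in>P'. f p) = (\<Oplus>\<^bsub>K\<^esub>p\<in>insert p P'. f p)"
      by (rule K.finsum_insert[symmetric]) (use insert in auto)
    finally show ?case .
  qed
  have "(\<Oplus>\<^bsub>V\<^esub>p\<in>P. act (\<beta> p) (w p)) = (\<Oplus>\<^bsub>V\<^esub>p\<in>P. \<Oplus>\<^bsub>V\<^esub>x\<in>S. act (\<beta> p \<otimes>\<^bsub>K\<^esub> c p x) x)"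
  proof (rule V.finsum_cong')
    fix p assume p: "p \<in> P"
    have "act (\<beta> p) (w p) = (\<Oplus>\<^bsub>V\<^esub>x\<in>S. act (\<beta> p) (act (c p x) x))"
      unfolding w[OF p] by (rule act_finsum) (use S p \<beta> cc xc act_closed in auto)
    also have "\<dots> = (\<Oplus>\<^bsub>V\<^esub>x\<in>S. act (\<beta> p \<otimes>\<^bsub>K\<^esub> c p x) x)"
      by (rule V.finsum_cong') (use p \<beta> cc xc act_closed in \<open>auto simp: act_mult\<close>)
    finally show "act (\<beta> p) (w p) = (\<Oplus>\<^bsub>V\<^esub>x\<in>S. act (\<beta> p \<otimes>\<^bsub>K\<^esub> c p x) x)" .
  qed (use \<beta> cc xc act_closed in \<open>auto intro!: V.finsum_closed\<close>)
  also have "\<dots> = (\<Oplus>\<^bsub>V\<^esub>x\<in>S. \<Oplus>\<^bsub>V\<^esub>p\<in>P. act (\<beta> p \<otimes>\<^bsub>K\<^esub> c p x) x)"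
    by (rule V.finsum_swap) (use S P \<beta> cc xc act_closed in auto)
  also have "\<dots> = (\<Oplus>\<^bsub>V\<^esub>x\<in>S. \<zero>\<^bsub>V\<^esub>)"
  proof (rule V.finsum_cong')
    fix x assume x: "x \<in> S"
    have "(\<Oplus>\<^bsub>V\<^esub>p\<in>P. act (\<beta> p \<otimes>\<^bsub>K\<^esub> c p x) x) = act (\<Oplus>\<^bsub>K\<^esub>p\<in>P. \<beta> p \<otimes>\<^bsub>K\<^esub> c p x) x"
      by (rule sum_act) (use P x \<beta> cc xc in auto)
    then show "(\<Oplus>\<^bsub>V\<^esub>p\<in>P. act (\<beta> p \<otimes>\<^bsub>K\<^esub> c p x) x) = \<zero>\<^bsub>V\<^esub>" using rel[OF x] x xc act_zero by simp
  qed auto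
  finally show ?thesis by simp
qed

lemma exists_relation:
  assumes S: "finite S" "S \<subseteq> carrier V" "lspan S = carrier V"
    and P: "finite P" "card S < card P" and w: "\<And>p. p \<in> P \<Longrightarrow> w p \<in> carrier V"
  shows "\<exists>\<beta>. (\<forall>p\<in>P. \<beta> p \<in> carrier K) \<and> (\<exists>p\<in>P. \<beta> p \<noteq> \<zero>\<^bsub>K\<^esub>) \<and>
    (\<Oplus>\<^bsub>V\<^esub>p\<in>P. act (\<beta> p) (w p)) = \<zero>\<^bsub>V\<^esub>"
proof -
  have wS: "w p \<in> lspan S" if "p \<in> P" for p using w[OF that] S(3) by simp
  have cc: "coord S (w p) x \<in> carrier K" if "p \<in> P" "x \<in> S" for p x
    using coord(1)[OF wS[OF that(1)]] that(2) by auto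
  have "\<exists>\<beta>. (\<forall>p\<in>P. \<beta> p \<in> carrier K) \<and> (\<exists>p\<in>P. \<beta> p \<noteq> \<zero>\<^bsub>K\<^esub>) \<and>
      (\<forall>x\<in>S. (\<Oplus>\<^bsub>K\<^esub>p\<in>P. \<beta> p \<otimes>\<^bsub>K\<^esub> coord S (w p) x) = \<zero>\<^bsub>K\<^esub>)"
    by (rule K.exists_linear_relation[OF K.carrier_is_subring S(1) P cc])
  then obtain \<beta> where \<beta>: "\<And>p. p \<in> P \<Longrightarrow> \<beta> p \<in> carrier K" "\<exists>p\<in>P. \<beta> p \<noteq> \<zero>\<^bsub>K\<^esub>"
      "\<And>x. x \<in> S \<Longrightarrow> (\<Oplus>\<^bsub>K\<^esub>p\<in>P. \<beta> p \<otimes>\<^bsub>K\<^esub> coord S (w p) x) = \<zero>\<^bsub>K\<^esub>" by blast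
  have "(\<Oplus>\<^bsub>V\<^esub>p\<in>P. act (\<beta> p) (w p)) = \<zero>\<^bsub>V\<^esub>"
    by (rule relation_of_coords[OF S(1,2) P(1) coord(1)[OF wS] coord(2)[OF wS] \<beta>(1,3)])
  then show ?thesis using \<beta> by blast
qed

lemma poly_at_append:
  assumes \<phi>: "\<And>v. v \<in> carrier V \<Longrightarrow> \<phi> v \<in> carrier V"
      "\<And>v w. v \<in> carrier V \<Longrightarrow> w \<in> carrier V \<Longrightarrow> \<phi> (v \<oplus>\<^bsub>V\<^esub> w) = \<phi> v \<oplus>\<^bsub>V\<^esub> \<phi> w"
      "\<And>c v. c \<in> carrier K \<Longrightarrow> v \<in> carrier V \<Longrightarrow> \<phi> (act c v) = act c (\<phi> v)"
    and v: "v \<in> carrier V" and "set cs \<subseteq> carrier K" "c \<in> carrier K"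
  shows "poly_at \<phi> v (cs @ [c]) = act c ((\<phi> ^^ length cs) v) \<oplus>\<^bsub>V\<^esub> poly_at \<phi> v cs"
  using assms(5)
proof (induction cs)
  case Nil
  then show ?case using assms(6) v act_closed \<phi>_zero[OF \<phi>] by simp
next
  case (Cons b cs)
  have it: "(\<phi> ^^ n) v \<in> carrier V" for n using \<phi>(1) v by (induction n) auto
  have "poly_at \<phi> v cs \<in> carrier V" using poly_at_closed[OF \<phi> v] Cons.prems by simp
  then show ?case
    using Cons assms(6) v it[of "length cs"] act_closed \<phi> by (simp add: V.a_ac)
qed

lemma poly_at_map:
  assumes \<phi>: "\<And>v. v \<in> carrier V \<Longrightarrow> \<phi> v \<in> carrier V"
      "\<And>v w. v \<in> carrier V \<Longrightarrow> w \<in> carrier V \<Longrightarrow> \<phi> (v \<oplus>\<^bsub>V\<^esub> w) = \<phi> v \<oplus>\<^bsub>V\<^esub> \<phi> w"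
      "\<And>c v. c \<in> carrier K \<Longrightarrow> v \<in> carrier V \<Longrightarrow> \<phi> (act c v) = act c (\<phi> v)"
    and v: "v \<in> carrier V" and "\<And>i. i < n \<Longrightarrow> \<beta> i \<in> carrier K"
  shows "poly_at \<phi> v (map \<beta> [0..<n]) = (\<Oplus>\<^bsub>V\<^esub>i\<in>{..<n}. act (\<beta> i) ((\<phi> ^^ i) v))"
  using assms(5)
proof (induction n)
  case (Suc n)
  have it: "(\<phi> ^^ n) v \<in> carrier V" for n using \<phi>(1) v by (induction n) auto
  have "poly_at \<phi> v (map \<beta> [0..<Suc n]) = act (\<beta> n) ((\<phi> ^^ n) v) \<oplus>\<^bsub>V\<^esub> poly_at \<phi> v (map \<beta> [0..<n])"
    using poly_at_append[OF \<phi> v, of "map \<beta> [0..<n]" "\<beta> n"] Suc.prems by (auto simp: image_subset_iff)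
  also have "\<dots> = act (\<beta> n) ((\<phi> ^^ n) v) \<oplus>\<^bsub>V\<^esub> (\<Oplus>\<^bsub>V\<^esub>i\<in>{..<n}. act (\<beta> i) ((\<phi> ^^ i) v))"
    using Suc by simp
  also have "\<dots> = (\<Oplus>\<^bsub>V\<^esub>i\<in>{..<Suc n}. act (\<beta> i) ((\<phi> ^^ i) v))"
    unfolding lessThan_Suc by (rule V.finsum_insert[symmetric]) (use Suc.prems it act_closed in auto)
  finally show ?case .
qed simp

end

section \<open>Schur's lemma and density\<close>

locale algebra_rep = K: algebraically_closed K + A: assoc_algebra K A + V: left_module A V
  for K :: "'k ring" and A :: "('k, 'a) module" and V :: "('a, 'v) module"
begin

definition scal :: "'k \<Rightarrow> 'a" where "scal c = c \<odot>\<^bsub>A\<^esub> \<one>\<^bsub>A\<^esub>"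

lemma scal_closed [simp, intro]: "c \<in> carrier K \<Longrightarrow> scal c \<in> carrier A"
  by (simp add: scal_def)

lemma scal_mult: "c \<in> carrier K \<Longrightarrow> a \<in> carrier A \<Longrightarrow> scal c \<otimes>\<^bsub>A\<^esub> a = c \<odot>\<^bsub>A\<^esub> a"
  by (simp add: scal_def A.smult_mult_left)

lemma mult_scal: "c \<in> carrier K \<Longrightarrow> a \<in> carrier A \<Longrightarrow> a \<otimes>\<^bsub>A\<^esub> scal c = c \<odot>\<^bsub>A\<^esub> a"
  by (simp add: scal_def A.smult_mult_right)

definition act :: "'k \<Rightarrow> 'v \<Rightarrow> 'v" where "act c v = scal c \<odot>\<^bsub>V\<^esub> v"

sublocale L: lin_action K V act
proof (rule lin_action.intro[OF K.field_axioms V.M.abelian_group_axioms], rule lin_action_axioms.intro)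
  show "act (b \<otimes>\<^bsub>K\<^esub> c) v = act b (act c v)" if "b \<in> carrier K" "c \<in> carrier K" "v \<in> carrier V" for b c v
  proof -
    have "scal (b \<otimes>\<^bsub>K\<^esub> c) = scal b \<otimes>\<^bsub>A\<^esub> scal c"
      using that by (simp add: scal_mult) (simp add: scal_def A.smult_assoc1)
    then show ?thesis using that by (simp add: act_def V.smult_assoc)
  qed
  show "act (b \<oplus>\<^bsub>K\<^esub> c) v = act b v \<oplus>\<^bsub>V\<^esub> act c v" if "b \<in> carrier K" "c \<in> carrier K" "v \<in> carrier V" for b c v
  proof -
    have "scal (b \<oplus>\<^bsub>K\<^esub> c) = scal b \<oplus>\<^bsub>A\<^esub> scal c"
      using that by (simp add: scal_def A.smult_l_distr)
    then show ?thesis using that by (simp add: act_def V.smult_l_distr)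
  qed
  show "act \<one>\<^bsub>K\<^esub> v = v" if "v \<in> carrier V" for v
    using that by (simp add: act_def scal_def V.smult_one)
qed (simp_all add: act_def V.smult_closed V.smult_r_distr)

lemma smult_act:
  assumes "a \<in> carrier A" "c \<in> carrier K" "v \<in> carrier V"
  shows "a \<odot>\<^bsub>V\<^esub> act c v = act c (a \<odot>\<^bsub>V\<^esub> v)"
proof -
  have "a \<otimes>\<^bsub>A\<^esub> scal c = scal c \<otimes>\<^bsub>A\<^esub> a" using assms by (simp add: scal_mult mult_scal)
  then show ?thesis using assms V.smult_assoc[of a "scal c" v] V.smult_assoc[of "scal c" a v]
    by (simp add: act_def)
qed

lemma smult_lincomb:
  assumes "a \<in> carrier A" "finite I" "\<And>i. i \<in> I \<Longrightarrow> c i \<in> carrier K" "\<And>i. i \<in> I \<Longrightarrow> f i \<in> carrier V"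
  shows "a \<odot>\<^bsub>V\<^esub> (\<Oplus>\<^bsub>V\<^esub>i\<in>I. act (c i) (f i)) = (\<Oplus>\<^bsub>V\<^esub>i\<in>I. act (c i) (a \<odot>\<^bsub>V\<^esub> f i))"
proof -
  have "a \<odot>\<^bsub>V\<^esub> (\<Oplus>\<^bsub>V\<^esub>i\<in>I. act (c i) (f i)) = (\<Oplus>\<^bsub>V\<^esub>i\<in>I. a \<odot>\<^bsub>V\<^esub> act (c i) (f i))"
    by (rule V.smult_finsum_right) (use assms L.act_closed in auto)
  also have "\<dots> = (\<Oplus>\<^bsub>V\<^esub>i\<in>I. act (c i) (a \<odot>\<^bsub>V\<^esub> f i))"
    by (rule V.M.finsum_cong') (use assms L.act_closed V.smult_closed in \<open>auto simp: smult_act\<close>)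
  finally show ?thesis .
qed

lemma annihilates_span:
  assumes "finite S" "S \<subseteq> carrier V" "L.lspan S = carrier V" "a \<in> carrier A"
    "\<And>x. x \<in> S \<Longrightarrow> a \<odot>\<^bsub>V\<^esub> x = \<zero>\<^bsub>V\<^esub>"
  shows "a \<in> V.annihilator"
proof -
  have "a \<odot>\<^bsub>V\<^esub> v = \<zero>\<^bsub>V\<^esub>" if v: "v \<in> carrier V" for v
  proof -
    obtain c where c: "c \<in> S \<rightarrow> carrier K" "v = (\<Oplus>\<^bsub>V\<^esub>x\<in>S. act (c x) x)"
      using v assms(3) unfolding L.lspan_def by blast
    have "a \<odot>\<^bsub>V\<^esub> v = (\<Oplus>\<^bsub>V\<^esub>x\<in>S. act (c x) (a \<odot>\<^bsub>V\<^esub> x))"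
      unfolding c(2) by (rule smult_lincomb) (use assms c in auto)
    also have "\<dots> = (\<Oplus>\<^bsub>V\<^esub>x\<in>S. \<zero>\<^bsub>V\<^esub>)"
      by (rule V.M.finsum_cong') (use assms c in \<open>auto simp: L.act_zero_right Pi_iff\<close>)
    finally show ?thesis by simp
  qed
  then show ?thesis using assms(4) by (simp add: V.annihilator_def)
qed

end

locale simple_rep = algebra_rep + assumes simple: "simple_module A V"
begin

text \<open>
  The iterates \<open>\<phi>\<^sup>n v\<close> lie in a space of finite dimension, so they satisfy a relation and \<open>\<phi>\<close> has an
  eigenvector. It generates \<open>V\<close>, and \<open>\<phi>\<close> commutes with \<open>A\<close>.
\<close>

lemma schur:
  assumes S: "finite S" "S \<subseteq> carrier V" "L.lspan S = carrier V"
    and \<phi>: "\<And>v. v \<in> carrier V \<Longrightarrow> \<phi> v \<in> carrier V"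
      "\<And>v w. v \<in> carrier V \<Longrightarrow> w \<in> carrier V \<Longrightarrow> \<phi> (v \<oplus>\<^bsub>V\<^esub> w) = \<phi> v \<oplus>\<^bsub>V\<^esub> \<phi> w"
      "\<And>a v. a \<in> carrier A \<Longrightarrow> v \<in> carrier V \<Longrightarrow> \<phi> (a \<odot>\<^bsub>V\<^esub> v) = a \<odot>\<^bsub>V\<^esub> \<phi> v"
  obtains l where "l \<in> carrier K" "\<And>v. v \<in> carrier V \<Longrightarrow> \<phi> v = act l v"
proof -
  have \<phi>_act: "\<phi> (act c v) = act c (\<phi> v)" if "c \<in> carrier K" "v \<in> carrier V" for c v
    using that by (simp add: act_def \<phi>(3))
  obtain v where v: "v \<in> carrier V" "v \<noteq> \<zero>\<^bsub>V\<^esub>"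
    using simple V.M.zero_closed unfolding simple_module_def by blast
  have it: "(\<phi> ^^ n) v \<in> carrier V" for n using \<phi>(1) v by (induction n) auto
  have "\<exists>\<beta>. (\<forall>p\<in>{..<Suc (card S)}. \<beta> p \<in> carrier K) \<and> (\<exists>p\<in>{..<Suc (card S)}. \<beta> p \<noteq> \<zero>\<^bsub>K\<^esub>) \<and>
      (\<Oplus>\<^bsub>V\<^esub>p\<in>{..<Suc (card S)}. act (\<beta> p) ((\<phi> ^^ p) v)) = \<zero>\<^bsub>V\<^esub>"
    by (rule L.exists_relation[OF S]) (use it in auto)
  then obtain \<beta> where \<beta>: "\<And>p. p < Suc (card S) \<Longrightarrow> \<beta> p \<in> carrier K" "\<exists>p<Suc (card S). \<beta> p \<noteq> \<zero>\<^bsub>K\<^esub>"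
      "(\<Oplus>\<^bsub>V\<^esub>p\<in>{..<Suc (card S)}. act (\<beta> p) ((\<phi> ^^ p) v)) = \<zero>\<^bsub>V\<^esub>"
    by (auto simp del: lessThan_Suc)
  let ?cs = "map \<beta> [0..<Suc (card S)]"
  have cs1: "set ?cs \<subseteq> carrier K" using \<beta>(1) by (auto simp del: upt_Suc)
  obtain p where p: "p < Suc (card S)" "\<beta> p \<noteq> \<zero>\<^bsub>K\<^esub>" using \<beta>(2) by blast
  then have "\<beta> p \<in> set ?cs" by (simp del: upt_Suc)
  then have cs2: "\<not> set ?cs \<subseteq> {\<zero>\<^bsub>K\<^esub>}" using p(2) by blast
  note cs = cs1 cs2
  have "L.poly_at \<phi> v ?cs = \<zero>\<^bsub>V\<^esub>"
    using L.poly_at_map[OF \<phi>(1,2) \<phi>_act v(1), of "Suc (card S)" \<beta>] \<beta>(1,3)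
    by (simp del: upt_Suc)
  then have "\<exists>l\<in>carrier K. \<exists>w\<in>carrier V. w \<noteq> \<zero>\<^bsub>V\<^esub> \<and> \<phi> w = act l w"
    by (intro exists_eigenvector[OF K.algebraically_closed_axioms L.lin_action_axioms \<phi>(1,2) \<phi>_act v cs])
  then obtain l w where l: "l \<in> carrier K" "w \<in> carrier V" "w \<noteq> \<zero>\<^bsub>V\<^esub>" "\<phi> w = act l w" by blast
  have "\<phi> u = act l u" if u: "u \<in> carrier V" for u
  proof -
    obtain a where "a \<in> carrier A" "a \<odot>\<^bsub>V\<^esub> w = u" using simple_module_cyclic[OF simple l(2,3) u] .
    then show ?thesis using \<phi>(3)[of a w] l smult_act[of a l w] by simp
  qed
  then show thesis using that l(1) by blast
qed

text \<open>
  Jacobson density. Suppose that the elements \<open>t\<close> killing \<open>S\<close> do not all kill \<open>x\<close>. Then they map \<open>x\<close> onto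
  all of \<open>V\<close>, and \<open>t x \<mapsto> t w\<close> is a well-defined endomorphism. By Schur's lemma it is a scalar \<open>l\<close>, and
  \<open>w - l x\<close> is killed by everything that kills \<open>S\<close>.
\<close>

lemma density:
  assumes G: "finite G" "G \<subseteq> carrier V" "L.lspan G = carrier V"
    and S: "finite S" "S \<subseteq> carrier V"
    and w: "w \<in> carrier V"
    and kill: "\<And>t. t \<in> carrier A \<Longrightarrow> (\<forall>x\<in>S. t \<odot>\<^bsub>V\<^esub> x = \<zero>\<^bsub>V\<^esub>) \<Longrightarrow> t \<odot>\<^bsub>V\<^esub> w = \<zero>\<^bsub>V\<^esub>"
  shows "w \<in> L.lspan S"
  using S w kill
proof (induction S arbitrary: w rule: finite_induct)
  case empty
  have "w = \<zero>\<^bsub>V\<^esub>" using empty.prems(3)[of "\<one>\<^bsub>A\<^esub>"] empty.prems(2) V.smult_one by simp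
  then show ?case by (simp add: L.lspan_def)
next
  case (insert x S)
  have x: "x \<in> carrier V" and S: "S \<subseteq> carrier V" using insert.prems by auto
  define N where "N = {t \<in> carrier A. \<forall>y\<in>S. t \<odot>\<^bsub>V\<^esub> y = \<zero>\<^bsub>V\<^esub>}"
  have Nc: "t \<in> carrier A" if "t \<in> N" for t using that by (simp add: N_def)
  have N_mult: "a \<otimes>\<^bsub>A\<^esub> t \<in> N" if "a \<in> carrier A" "t \<in> N" for a t
    using that S by (auto simp: N_def V.smult_assoc V.smult_zero_right)
  have N_diff: "s \<ominus>\<^bsub>A\<^esub> t \<in> N" if "s \<in> N" "t \<in> N" for s t
    using that S by (auto simp: N_def V.smult_diff_left V.smult_closed V.M.diff_eq_zero_iff)
  have N_add: "s \<oplus>\<^bsub>A\<^esub> t \<in> N" if "s \<in> N" "t \<in> N" for s t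
    using that S by (auto simp: N_def V.smult_l_distr)
  have killN: "t \<odot>\<^bsub>V\<^esub> w = \<zero>\<^bsub>V\<^esub>" if "t \<in> N" "t \<odot>\<^bsub>V\<^esub> x = \<zero>\<^bsub>V\<^esub>" for t
    using insert.prems(3)[of t] that by (auto simp: N_def)
  show ?case
  proof (cases "\<forall>t\<in>N. t \<odot>\<^bsub>V\<^esub> x = \<zero>\<^bsub>V\<^esub>")
    case True
    have "w \<in> L.lspan S"
      by (rule insert.IH[OF S insert.prems(2)]) (use True killN in \<open>auto simp: N_def\<close>)
    then have "act \<zero>\<^bsub>K\<^esub> x \<oplus>\<^bsub>V\<^esub> w \<in> L.lspan (insert x S)"
      by (intro L.lspan_insert) (use insert x S in auto)
    then show ?thesis using x insert.prems(2) by (simp add: L.act_zero)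
  next
    case False
    then obtain t0 where t0: "t0 \<in> N" "t0 \<odot>\<^bsub>V\<^esub> x \<noteq> \<zero>\<^bsub>V\<^esub>" by blast
    have onto: "\<exists>t\<in>N. t \<odot>\<^bsub>V\<^esub> x = v" if v: "v \<in> carrier V" for v
    proof -
      obtain a where "a \<in> carrier A" "a \<odot>\<^bsub>V\<^esub> (t0 \<odot>\<^bsub>V\<^esub> x) = v"
        using simple_module_cyclic[OF simple V.smult_closed[OF Nc[OF t0(1)] x] t0(2) v] .
      then show ?thesis using N_mult[of a t0] t0(1) Nc x V.smult_assoc[of a t0 x] by auto
    qed
    define \<phi> where "\<phi> v = (SOME t. t \<in> N \<and> t \<odot>\<^bsub>V\<^esub> x = v) \<odot>\<^bsub>V\<^esub> w" for v
    have \<phi>: "\<phi> (t \<odot>\<^bsub>V\<^esub> x) = t \<odot>\<^bsub>V\<^esub> w" if t: "t \<in> N" for t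
    proof -
      define s where "s = (SOME s. s \<in> N \<and> s \<odot>\<^bsub>V\<^esub> x = t \<odot>\<^bsub>V\<^esub> x)"
      have s: "s \<in> N" "s \<odot>\<^bsub>V\<^esub> x = t \<odot>\<^bsub>V\<^esub> x"
        unfolding s_def using someI[of "\<lambda>s. s \<in> N \<and> s \<odot>\<^bsub>V\<^esub> x = t \<odot>\<^bsub>V\<^esub> x" t] t by auto
      have "(s \<ominus>\<^bsub>A\<^esub> t) \<odot>\<^bsub>V\<^esub> w = \<zero>\<^bsub>V\<^esub>"
        using killN[OF N_diff[OF s(1) t]] s Nc t x V.smult_closed
        by (simp add: V.smult_diff_left V.smult_closed V.M.diff_eq_zero_iff)
      then have "s \<odot>\<^bsub>V\<^esub> w = t \<odot>\<^bsub>V\<^esub> w"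
        using s t Nc insert.prems(2) V.smult_closed V.M.diff_eq_zero_iff
        by (simp add: V.smult_diff_left)
      then show ?thesis by (simp add: \<phi>_def s_def)
    qed
    have "\<And>v. v \<in> carrier V \<Longrightarrow> \<phi> v \<in> carrier V"
      "\<And>v u. v \<in> carrier V \<Longrightarrow> u \<in> carrier V \<Longrightarrow> \<phi> (v \<oplus>\<^bsub>V\<^esub> u) = \<phi> v \<oplus>\<^bsub>V\<^esub> \<phi> u"
      "\<And>a v. a \<in> carrier A \<Longrightarrow> v \<in> carrier V \<Longrightarrow> \<phi> (a \<odot>\<^bsub>V\<^esub> v) = a \<odot>\<^bsub>V\<^esub> \<phi> v"
    proof -
      fix v assume "v \<in> carrier V"
      then obtain t where t: "t \<in> N" "t \<odot>\<^bsub>V\<^esub> x = v" using onto by blast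
      show "\<phi> v \<in> carrier V" using \<phi>[OF t(1)] t Nc insert.prems(2) V.smult_closed by auto
      show "\<phi> (a \<odot>\<^bsub>V\<^esub> v) = a \<odot>\<^bsub>V\<^esub> \<phi> v" if a: "a \<in> carrier A" for a
        using \<phi>[OF t(1)] \<phi>[OF N_mult[OF a t(1)]] t a Nc x insert.prems(2) V.smult_assoc by simp
      fix u assume "u \<in> carrier V"
      then obtain s where s: "s \<in> N" "s \<odot>\<^bsub>V\<^esub> x = u" using onto by blast
      show "\<phi> (v \<oplus>\<^bsub>V\<^esub> u) = \<phi> v \<oplus>\<^bsub>V\<^esub> \<phi> u"
        using \<phi>[OF t(1)] \<phi>[OF s(1)] \<phi>[OF N_add[OF t(1) s(1)]] t s Nc x insert.prems(2)
        by (simp add: V.smult_l_distr)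
    qed
    then obtain l where l: "l \<in> carrier K" "\<And>v. v \<in> carrier V \<Longrightarrow> \<phi> v = act l v"
      using schur[OF G, of \<phi>] by blast
    define w' where "w' = w \<ominus>\<^bsub>V\<^esub> act l x"
    have w': "w' \<in> carrier V" using insert.prems(2) x l L.act_closed by (simp add: w'_def)
    have "w' \<in> L.lspan S"
    proof (rule insert.IH[OF S w'])
      fix t assume "t \<in> carrier A" "\<forall>y\<in>S. t \<odot>\<^bsub>V\<^esub> y = \<zero>\<^bsub>V\<^esub>"
      then have t: "t \<in> N" "t \<in> carrier A" by (auto simp: N_def)
      have "t \<odot>\<^bsub>V\<^esub> w = act l (t \<odot>\<^bsub>V\<^esub> x)" using \<phi>[OF t(1)] l t x V.smult_closed by simp
      also have "\<dots> = t \<odot>\<^bsub>V\<^esub> act l x" using smult_act t x l by simp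
      finally have eq: "t \<odot>\<^bsub>V\<^esub> w = t \<odot>\<^bsub>V\<^esub> act l x" .
      have "t \<odot>\<^bsub>V\<^esub> w' \<oplus>\<^bsub>V\<^esub> t \<odot>\<^bsub>V\<^esub> act l x = t \<odot>\<^bsub>V\<^esub> (w' \<oplus>\<^bsub>V\<^esub> act l x)"
        using t w' x l L.act_closed by (simp add: V.smult_r_distr)
      also have "w' \<oplus>\<^bsub>V\<^esub> act l x = w"
        using insert.prems(2) x l L.act_closed by (simp add: w'_def a_minus_def V.M.a_assoc V.M.l_neg)
      finally show "t \<odot>\<^bsub>V\<^esub> w' = \<zero>\<^bsub>V\<^esub>"
        using eq t w' x l L.act_closed V.smult_closed
          V.M.add.r_cancel_one'[of "t \<odot>\<^bsub>V\<^esub> act l x" "t \<odot>\<^bsub>V\<^esub> w'"] V.M.add.l_cancel_one[of "t \<odot>\<^bsub>V\<^esub> act l x" "t \<odot>\<^bsub>V\<^esub> w'"]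
          V.M.a_comm[of "t \<odot>\<^bsub>V\<^esub> w'" "t \<odot>\<^bsub>V\<^esub> act l x"] by simp
    qed
    then have "act l x \<oplus>\<^bsub>V\<^esub> w' \<in> L.lspan (insert x S)"
      by (intro L.lspan_insert) (use insert x S l in auto)
    moreover have "act l x \<oplus>\<^bsub>V\<^esub> w' = w"
      using insert.prems(2) x l L.act_closed
      by (simp add: w'_def a_minus_def V.M.a_lcomm V.M.r_neg)
    ultimately show ?thesis by simp
  qed
qed

context
  fixes S assumes S: "L.is_basis S"
begin

lemma basis_facts: "finite S" "S \<subseteq> carrier V" "L.lindep_free S" "L.lspan S = carrier V"
  using S by (auto simp: L.is_basis_def)

text \<open>
  A basis vector is not in the span of the others, so by density some element moves it and kills the others.
  By simplicity its image can be moved to any \<open>v\<close>.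
\<close>

lemma exists_elementary_operator:
  assumes b: "b \<in> S" and v: "v \<in> carrier V"
  obtains t where "t \<in> carrier A" "t \<odot>\<^bsub>V\<^esub> b = v" "\<And>y. y \<in> S \<Longrightarrow> y \<noteq> b \<Longrightarrow> t \<odot>\<^bsub>V\<^esub> y = \<zero>\<^bsub>V\<^esub>"
proof -
  note G = basis_facts(1,2,4)
  have bc: "b \<in> carrier V" using b G by blast
  have fin: "finite (S - {b})" "S - {b} \<subseteq> carrier V" using G by auto
  have "\<exists>t\<in>carrier A. (\<forall>y\<in>S - {b}. t \<odot>\<^bsub>V\<^esub> y = \<zero>\<^bsub>V\<^esub>) \<and> t \<odot>\<^bsub>V\<^esub> b \<noteq> \<zero>\<^bsub>V\<^esub>"
  proof (rule ccontr)
    assume "\<not> ?thesis"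
    then have "b \<in> L.lspan (S - {b})" by (intro density[OF G fin bc]) blast
    then obtain c where c: "c \<in> S - {b} \<rightarrow> carrier K" "b = (\<Oplus>\<^bsub>V\<^esub>y\<in>S - {b}. act (c y) y)"
      by (auto simp: L.lspan_def)
    define c' where "c' = c(b := \<ominus>\<^bsub>K\<^esub> \<one>\<^bsub>K\<^esub>)"
    have c': "c' \<in> S \<rightarrow> carrier K" using c(1) by (auto simp: c'_def)
    have Gc: "y \<in> carrier V" if "y \<in> S" for y using that G(2) by blast
    have ac: "act (c' y) y \<in> carrier V" if "y \<in> S" for y
      using that c' Gc L.act_closed by (simp add: Pi_iff)
    have ac': "act (c y) y \<in> carrier V" if "y \<in> S - {b}" for y
      using that c(1) Gc L.act_closed by (simp add: Pi_iff)
    have "(\<Oplus>\<^bsub>V\<^esub>y\<in>S. act (c' y) y) = (\<Oplus>\<^bsub>V\<^esub>y\<in>insert b (S - {b}). act (c' y) y)"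
      using b by (simp add: insert_absorb)
    also have "\<dots> = act (c' b) b \<oplus>\<^bsub>V\<^esub> (\<Oplus>\<^bsub>V\<^esub>y\<in>S - {b}. act (c' y) y)"
      by (rule V.M.finsum_insert) (use fin b ac in auto)
    also have "(\<Oplus>\<^bsub>V\<^esub>y\<in>S - {b}. act (c' y) y) = (\<Oplus>\<^bsub>V\<^esub>y\<in>S - {b}. act (c y) y)"
      by (rule V.M.finsum_cong') (use ac' in \<open>auto simp: c'_def\<close>)
    also have "act (c' b) b \<oplus>\<^bsub>V\<^esub> \<dots> = \<zero>\<^bsub>V\<^esub>"
      using bc c(2)[symmetric] by (simp add: c'_def L.act_minus L.act_one V.M.l_neg)
    finally have "c' b = \<zero>\<^bsub>K\<^esub>"
      using basis_facts(3) c' b unfolding L.lindep_free_def by blast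
    then show False
      by (simp add: c'_def)
  qed
  then obtain t where t: "t \<in> carrier A" "\<forall>y\<in>S - {b}. t \<odot>\<^bsub>V\<^esub> y = \<zero>\<^bsub>V\<^esub>" "t \<odot>\<^bsub>V\<^esub> b \<noteq> \<zero>\<^bsub>V\<^esub>" by blast
  obtain a where a: "a \<in> carrier A" "a \<odot>\<^bsub>V\<^esub> (t \<odot>\<^bsub>V\<^esub> b) = v"
    using simple_module_cyclic[OF simple V.smult_closed[OF t(1) bc] t(3) v] .
  show thesis
  proof (rule that[of "a \<otimes>\<^bsub>A\<^esub> t"])
    show "a \<otimes>\<^bsub>A\<^esub> t \<in> carrier A" "(a \<otimes>\<^bsub>A\<^esub> t) \<odot>\<^bsub>V\<^esub> b = v"
      using a t bc V.smult_assoc by auto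
    show "(a \<otimes>\<^bsub>A\<^esub> t) \<odot>\<^bsub>V\<^esub> y = \<zero>\<^bsub>V\<^esub>" if "y \<in> S" "y \<noteq> b" for y
    proof -
      have "y \<in> carrier V" using that G by blast
      then show ?thesis using a t that V.smult_assoc V.smult_zero_right by auto
    qed
  qed
qed

lemma exists_matrix_units:
  assumes f: "inj_on f {..<d}" "f ` {..<d} \<subseteq> S" and d: "0 < d"
  obtains e where "matrix_units A V.annihilator d e" "e 0 0 \<notin> V.annihilator"
    "\<And>i j y. i < d \<Longrightarrow> j < d \<Longrightarrow> y \<in> S \<Longrightarrow> e i j \<odot>\<^bsub>V\<^esub> y = (if y = f j then f i else \<zero>\<^bsub>V\<^esub>)"
proof -
  note G = basis_facts(1,2,4)
  have fX: "f i \<in> S" "f i \<in> carrier V" if "i < d" for i using f that G by auto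
  define e where "e i j = (SOME t. t \<in> carrier A \<and>
    (\<forall>y\<in>S. t \<odot>\<^bsub>V\<^esub> y = (if y = f j then f i else \<zero>\<^bsub>V\<^esub>)))" for i j
  have eP: "e i j \<in> carrier A \<and> (\<forall>y\<in>S. e i j \<odot>\<^bsub>V\<^esub> y = (if y = f j then f i else \<zero>\<^bsub>V\<^esub>))"
    if ij: "i < d" "j < d" for i j
  proof -
    obtain t where t: "t \<in> carrier A" "t \<odot>\<^bsub>V\<^esub> f j = f i" "\<And>y. y \<in> S \<Longrightarrow> y \<noteq> f j \<Longrightarrow> t \<odot>\<^bsub>V\<^esub> y = \<zero>\<^bsub>V\<^esub>"
      using exists_elementary_operator[OF fX(1)[OF ij(2)] fX(2)[OF ij(1)]] by blast
    show ?thesis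
      unfolding e_def by (rule someI[of _ t]) (use t in simp)
  qed
  have e: "\<And>i j. i < d \<Longrightarrow> j < d \<Longrightarrow> e i j \<in> carrier A"
    "\<And>i j y. i < d \<Longrightarrow> j < d \<Longrightarrow> y \<in> S \<Longrightarrow> e i j \<odot>\<^bsub>V\<^esub> y = (if y = f j then f i else \<zero>\<^bsub>V\<^esub>)"
    by (rule conjunct1[OF eP]; assumption) (rule bspec[OF conjunct2[OF eP]]; assumption)
  have fnz: "f i \<noteq> \<zero>\<^bsub>V\<^esub>" if "i < d" for i
  proof
    assume z: "f i = \<zero>\<^bsub>V\<^esub>"
    define c where "c y = (if y = f i then \<one>\<^bsub>K\<^esub> else \<zero>\<^bsub>K\<^esub>)" for y
    have "(\<Oplus>\<^bsub>V\<^esub>y\<in>S. act (c y) y) = (\<Oplus>\<^bsub>V\<^esub>y\<in>S. \<zero>\<^bsub>V\<^esub>)"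
      by (rule V.M.finsum_cong') (use G z in \<open>auto simp: c_def L.act_zero L.act_zero_right subset_iff\<close>)
    then have c0: "(\<Oplus>\<^bsub>V\<^esub>y\<in>S. act (c y) y) = \<zero>\<^bsub>V\<^esub>" by simp
    have cK: "c \<in> S \<rightarrow> carrier K" by (simp add: c_def)
    have "\<forall>x\<in>S. c x = \<zero>\<^bsub>K\<^esub>"
      by (rule mp[OF bspec[OF basis_facts(3)[unfolded L.lindep_free_def] cK] c0])
    then have "c (f i) = \<zero>\<^bsub>K\<^esub>" using fX(1)[OF that] by (rule bspec)
    then show False by (simp add: c_def)
  qed
  have "e 0 0 \<odot>\<^bsub>V\<^esub> f 0 \<noteq> \<zero>\<^bsub>V\<^esub>"
    using e(2)[of 0 0 "f 0"] fnz[of 0] fX[of 0] d by simp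
  then have "e 0 0 \<notin> V.annihilator"
    using V.annihilatorD[of "e 0 0" "f 0"] fX(2)[OF d] by blast
  moreover have "matrix_units A V.annihilator d e"
  proof (rule matrix_units.intro)
    fix i j k l assume ijkl: "i < d" "j < d" "k < d" "l < d"
    let ?a = "e i j \<otimes>\<^bsub>A\<^esub> e k l \<ominus>\<^bsub>A\<^esub> (if j = k then e i l else \<zero>\<^bsub>A\<^esub>)"
    have jk: "f k = f j \<longleftrightarrow> j = k" using f(1) ijkl by (auto simp: inj_on_def)
    show "?a \<in> V.annihilator"
    proof (rule annihilates_span[OF G])
      show "?a \<in> carrier A" using e(1) ijkl by auto
      fix y assume y: "y \<in> S"
      have yc: "y \<in> carrier V" using y G by blast
      have "?a \<odot>\<^bsub>V\<^esub> y = e i j \<odot>\<^bsub>V\<^esub> (e k l \<odot>\<^bsub>V\<^esub> y) \<ominus>\<^bsub>V\<^esub> (if j = k then e i l else \<zero>\<^bsub>A\<^esub>) \<odot>\<^bsub>V\<^esub> y"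
        using e(1) ijkl yc by (subst V.smult_diff_left) (auto simp: V.smult_assoc)
      also have "\<dots> = \<zero>\<^bsub>V\<^esub>"
        using e ijkl y yc jk fX by (auto simp: V.smult_zero_left V.smult_zero_right V.M.diff_eq_zero_iff)
      finally show "?a \<odot>\<^bsub>V\<^esub> y = \<zero>\<^bsub>V\<^esub>" .
    qed
  qed (use V.ideal_annihilator e d in auto)
  ultimately show thesis using that e(2) by blast
qed

text \<open>
  The image of \<open>N\<close> in the endomorphism ring of \<open>V\<close> is a nonzero ideal of a full matrix ring, hence contains
  the identity.
\<close>

lemma comaximal_with_annihilator:
  assumes N: "ideal N A" "\<not> N \<subseteq> V.annihilator"
  obtains t where "t \<in> N" "t \<in> carrier A" "t \<ominus>\<^bsub>A\<^esub> \<one>\<^bsub>A\<^esub> \<in> V.annihilator"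
proof -
  note G = basis_facts(1,2,4)
  interpret N: ideal N A by fact
  obtain s where s: "s \<in> N" "s \<notin> V.annihilator" using N(2) by blast
  have sc: "s \<in> carrier A" using s N.Icarr by simp
  then obtain b where b: "b \<in> S" "s \<odot>\<^bsub>V\<^esub> b \<noteq> \<zero>\<^bsub>V\<^esub>" using annihilates_span[OF G sc] s by blast
  have bc: "b \<in> carrier V" using b G by blast
  \<comment> \<open>the projections onto the basis lines lie in the image of \<open>N\<close>\<close>
  have "\<exists>t. t \<in> N \<and> (\<forall>y\<in>S. t \<odot>\<^bsub>V\<^esub> y = (if y = x then x else \<zero>\<^bsub>V\<^esub>))" if x: "x \<in> S" for x
  proof -
    have xc: "x \<in> carrier V" using x G by blast
    obtain p where p: "p \<in> carrier A" "p \<odot>\<^bsub>V\<^esub> x = b" "\<And>y. y \<in> S \<Longrightarrow> y \<noteq> x \<Longrightarrow> p \<odot>\<^bsub>V\<^esub> y = \<zero>\<^bsub>V\<^esub>"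
      using exists_elementary_operator[OF x bc] by blast
    obtain r where r: "r \<in> carrier A" "r \<odot>\<^bsub>V\<^esub> (s \<odot>\<^bsub>V\<^esub> b) = x"
      using simple_module_cyclic[OF simple V.smult_closed[OF sc bc] b(2) xc] .
    have "r \<otimes>\<^bsub>A\<^esub> s \<otimes>\<^bsub>A\<^esub> p \<in> N" using s r p N.I_l_closed N.I_r_closed by simp
    moreover have "(r \<otimes>\<^bsub>A\<^esub> s \<otimes>\<^bsub>A\<^esub> p) \<odot>\<^bsub>V\<^esub> y = (if y = x then x else \<zero>\<^bsub>V\<^esub>)" if y: "y \<in> S" for y
    proof -
      have yc: "y \<in> carrier V" using y G by blast
      have "(r \<otimes>\<^bsub>A\<^esub> s \<otimes>\<^bsub>A\<^esub> p) \<odot>\<^bsub>V\<^esub> y = r \<odot>\<^bsub>V\<^esub> (s \<odot>\<^bsub>V\<^esub> (p \<odot>\<^bsub>V\<^esub> y))"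
        using r sc p yc V.smult_closed by (simp add: V.smult_assoc)
      then show ?thesis using p r sc y by (auto simp: V.smult_zero_right)
    qed
    ultimately show ?thesis by blast
  qed
  then obtain t where t: "\<And>x. x \<in> S \<Longrightarrow> t x \<in> N"
    "\<And>x y. x \<in> S \<Longrightarrow> y \<in> S \<Longrightarrow> t x \<odot>\<^bsub>V\<^esub> y = (if y = x then x else \<zero>\<^bsub>V\<^esub>)" by metis
  define a where "a = (\<Oplus>\<^bsub>A\<^esub>x\<in>S. t x)"
  have tc: "t x \<in> carrier A" if "x \<in> S" for x using t(1)[OF that] N.Icarr by simp
  have aN: "a \<in> N"
  proof -
    have "(\<Oplus>\<^bsub>A\<^esub>x\<in>S'. t x) \<in> N" if "finite S'" "S' \<subseteq> S" for S'
      using that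
    proof (induction S' rule: finite_induct)
      case (insert x S')
      then have "(\<Oplus>\<^bsub>A\<^esub>x\<in>insert x S'. t x) = t x \<oplus>\<^bsub>A\<^esub> (\<Oplus>\<^bsub>A\<^esub>x\<in>S'. t x)"
        by (intro A.finsum_insert) (use tc in auto)
      then show ?case using insert t(1) N.a_closed by auto
    qed (simp add: N.zero_closed)
    then show ?thesis using G by (simp add: a_def)
  qed
  have ac: "a \<in> carrier A" using aN N.Icarr by simp
  have "a \<ominus>\<^bsub>A\<^esub> \<one>\<^bsub>A\<^esub> \<in> V.annihilator"
  proof (rule annihilates_span[OF G])
    fix y assume y: "y \<in> S"
    have yc: "y \<in> carrier V" using y G by blast
    have "a \<odot>\<^bsub>V\<^esub> y = (\<Oplus>\<^bsub>V\<^esub>x\<in>S. t x \<odot>\<^bsub>V\<^esub> y)"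
      unfolding a_def by (rule V.smult_finsum_left) (use G yc tc in auto)
    also have "\<dots> = (\<Oplus>\<^bsub>V\<^esub>x\<in>S. if y = x then x else \<zero>\<^bsub>V\<^esub>)"
      by (rule V.M.finsum_cong') (use G y t in auto)
    also have "\<dots> = y" by (rule V.M.finsum_delta) (use G y yc in auto)
    finally show "(a \<ominus>\<^bsub>A\<^esub> \<one>\<^bsub>A\<^esub>) \<odot>\<^bsub>V\<^esub> y = \<zero>\<^bsub>V\<^esub>"
      using ac yc by (simp add: V.smult_diff_left V.smult_one V.M.diff_eq_zero_iff)
  qed (use ac in auto)
  then show thesis using that aN ac by blast
qed

end

end

section \<open>Dimensions\<close>

lemma restrict_scalars_simps:
  "carrier (restrict_scalars A V) = carrier V" "\<zero>\<^bsub>restrict_scalars A V\<^esub> = \<zero>\<^bsub>V\<^esub>"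
  "x \<oplus>\<^bsub>restrict_scalars A V\<^esub> y = x \<oplus>\<^bsub>V\<^esub> y"
  "c \<odot>\<^bsub>restrict_scalars A V\<^esub> x = (c \<odot>\<^bsub>A\<^esub> \<one>\<^bsub>A\<^esub>) \<odot>\<^bsub>V\<^esub> x"
  "finsum (restrict_scalars A V) f I = finsum V f I"
  by (simp_all add: restrict_scalars_def finsum_def finprod_def)

context algebra_rep
begin

lemma vectorspace_restrict_scalars: "vectorspace K (restrict_scalars A V)"
proof -
  have "abelian_group (restrict_scalars A V)"
  proof (rule abelian_groupI)
    fix x assume "x \<in> carrier (restrict_scalars A V)"
    then show "\<exists>y\<in>carrier (restrict_scalars A V). y \<oplus>\<^bsub>restrict_scalars A V\<^esub> x = \<zero>\<^bsub>restrict_scalars A V\<^esub>"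
      by (intro bexI[of _ "\<ominus>\<^bsub>V\<^esub> x"]) (auto simp: restrict_scalars_simps V.M.l_neg)
  next
    fix x y assume "x \<in> carrier (restrict_scalars A V)" "y \<in> carrier (restrict_scalars A V)"
    then show "x \<oplus>\<^bsub>restrict_scalars A V\<^esub> y = y \<oplus>\<^bsub>restrict_scalars A V\<^esub> x"
      by (simp add: restrict_scalars_simps V.M.a_comm)
  qed (auto simp: restrict_scalars_simps V.M.a_assoc)
  moreover have "c \<odot>\<^bsub>restrict_scalars A V\<^esub> x = act c x" for c x
    by (simp add: restrict_scalars_simps act_def scal_def)
  ultimately have "module K (restrict_scalars A V)"
    by (intro moduleI K.is_cring)
      (simp_all add: restrict_scalars_simps(1-3,5) L.act_closed L.act_plus L.act_add L.act_mult L.act_one)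
  then show ?thesis by (simp add: vectorspace_def K.field_axioms)
qed

lemma lincomb_restrict_scalars:
  "module.lincomb (restrict_scalars A V) c S = (\<Oplus>\<^bsub>V\<^esub>x\<in>S. act (c x) x)"
proof -
  interpret W: vectorspace K "restrict_scalars A V" by (rule vectorspace_restrict_scalars)
  show ?thesis by (simp add: W.lincomb_def restrict_scalars_simps act_def scal_def)
qed

lemma kdim_of_basis:
  assumes G: "finite G" "G \<subseteq> carrier V" "L.lspan G = carrier V"
  obtains S where "L.is_basis S" "kdim K A V = enat (card S)"
proof -
  interpret W: vectorspace K "restrict_scalars A V" by (rule vectorspace_restrict_scalars)
  have span: "W.span S = L.lspan S" if "finite S" "S \<subseteq> carrier V" for S
    using W.finite_span[of S] that
    by (auto simp: restrict_scalars_simps(1) lincomb_restrict_scalars L.lspan_def)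
  have fd: "W.fin_dim"
    unfolding W.fin_dim_def using G span[OF G(1,2)] by (auto simp: restrict_scalars_simps(1))
  obtain S where S: "finite S" "W.basis S" using W.finite_basis_exists[OF fd] by blast
  have Sc: "S \<subseteq> carrier V" using S(2) by (simp add: W.basis_def restrict_scalars_simps(1))
  have "L.lindep_free S"
    unfolding L.lindep_free_def
  proof (intro ballI impI)
    fix c x assume c: "c \<in> S \<rightarrow> carrier K" "(\<Oplus>\<^bsub>V\<^esub>x\<in>S. act (c x) x) = \<zero>\<^bsub>V\<^esub>" and x: "x \<in> S"
    show "c x = \<zero>\<^bsub>K\<^esub>"
    proof (rule ccontr)
      assume "c x \<noteq> \<zero>\<^bsub>K\<^esub>"
      then have "W.lin_dep S"
        using W.lin_dep_crit[OF S(1) order_refl c(1) x] c(2)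
        by (simp add: lincomb_restrict_scalars restrict_scalars_simps(2))
      then show False using S(2) by (simp add: W.basis_def)
    qed
  qed
  moreover have "L.lspan S = carrier V"
    using S(2) span[OF S(1) Sc] by (simp add: W.basis_def restrict_scalars_simps(1))
  ultimately have "L.is_basis S" using S(1) Sc by (simp add: L.is_basis_def)
  moreover have "kdim K A V = enat (card S)"
    using fd W.dim_basis[OF S] by (simp add: kdim_def)
  ultimately show thesis using that by blast
qed

lemma kdim_ge_card_independent:
  assumes "finite S" "S \<subseteq> carrier V" "L.lindep_free S"
  shows "enat (card S) \<le> kdim K A V"
proof -
  interpret W: vectorspace K "restrict_scalars A V" by (rule vectorspace_restrict_scalars)
  have "W.lin_indpt S"
    by (rule W.finite_lin_indpt2)
      (use assms in \<open>auto simp: restrict_scalars_simps(1,2) lincomb_restrict_scalars L.lindep_free_def\<close>)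
  then show ?thesis
    using W.li_le_dim(2)[of S] assms by (auto simp: kdim_def restrict_scalars_simps(1))
qed

end

lemma module_hom_finsum:
  assumes V: "left_module A V" and W: "left_module A W" and h: "h \<in> module_hom A V W"
    and "finite I" "\<And>i. i \<in> I \<Longrightarrow> f i \<in> carrier V"
  shows "h (\<Oplus>\<^bsub>V\<^esub>i\<in>I. f i) = (\<Oplus>\<^bsub>W\<^esub>i\<in>I. h (f i))"
proof -
  interpret V: left_module A V by fact
  interpret W: left_module A W by fact
  have hc: "h v \<in> carrier W" if "v \<in> carrier V" for v using h that by (auto simp: module_hom_def)
  have hadd: "h (v \<oplus>\<^bsub>V\<^esub> w) = h v \<oplus>\<^bsub>W\<^esub> h w" if "v \<in> carrier V" "w \<in> carrier V" for v w
    using h that by (auto simp: module_hom_def)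
  have h0: "h \<zero>\<^bsub>V\<^esub> = \<zero>\<^bsub>W\<^esub>"
    using hadd[of "\<zero>\<^bsub>V\<^esub>" "\<zero>\<^bsub>V\<^esub>"] hc[of "\<zero>\<^bsub>V\<^esub>"] W.M.add.r_cancel_one[of "h \<zero>\<^bsub>V\<^esub>" "h \<zero>\<^bsub>V\<^esub>"] by auto
  show ?thesis using assms(4,5)
  proof (induction I rule: finite_induct)
    case (insert i I)
    have "(\<Oplus>\<^bsub>V\<^esub>i\<in>insert i I. f i) = f i \<oplus>\<^bsub>V\<^esub> (\<Oplus>\<^bsub>V\<^esub>i\<in>I. f i)"
      by (rule V.M.finsum_insert) (use insert in auto)
    moreover have "(\<Oplus>\<^bsub>W\<^esub>i\<in>insert i I. h (f i)) = h (f i) \<oplus>\<^bsub>W\<^esub> (\<Oplus>\<^bsub>W\<^esub>i\<in>I. h (f i))"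
      by (rule W.M.finsum_insert) (use insert hc in auto)
    ultimately show ?case using insert by (simp add: hadd V.M.finsum_closed Pi_iff)
  qed (simp add: h0)
qed

text \<open>
  The competitors of a large module live on subsets of \<open>A\<close>, so \<open>W\<close> is first replaced by an isomorphic module
  of that kind.
\<close>

lemma large_module_kdim_ge:
  fixes A :: "('k, 'a) module" and V :: "('a, 'v) module" and W :: "('a, 'w) module"
  assumes V: "large_module K A V" and W: "algebra_rep K A W" "simple_module A W"
    and S: "finite S" "S \<subseteq> carrier W" "lin_action.lindep_free K W (algebra_rep.act A W) S"
  shows "enat (card S) \<le> kdim K A V"
proof -
  interpret W: algebra_rep K A W by fact
  obtain W' :: "('a, 'a set) module" where W': "simple_module A W'" "module_isomorphic A W W'"
    using simple_module_representative[OF W(2)] by blast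
  interpret W': algebra_rep K A W'
    using W'(1) W.K.algebraically_closed_axioms W.A.assoc_algebra_axioms
    by (simp add: algebra_rep_def simple_module_def)
  obtain h where h: "h \<in> module_hom A W W'" "bij_betw h (carrier W) (carrier W')"
    using W'(2) unfolding module_isomorphic_def by blast
  have hc: "h v \<in> carrier W'" if "v \<in> carrier W" for v using h that by (auto simp: module_hom_def)
  have inj: "inj_on h (carrier W)" using h(2) by (simp add: bij_betw_def)
  have injS: "inj_on h S" using inj S(2) inj_on_subset by blast
  have hact: "h (W.act c v) = W'.act c (h v)" if "c \<in> carrier K" "v \<in> carrier W" for c v
    using h(1) that W.scal_closed[OF that(1)]
    by (auto simp: W.act_def W'.act_def W.scal_def W'.scal_def module_hom_def)
  have hsum: "h (\<Oplus>\<^bsub>W\<^esub>i\<in>I. f i) = (\<Oplus>\<^bsub>W'\<^esub>i\<in>I. h (f i))"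
    if "finite I" "\<And>i. i \<in> I \<Longrightarrow> f i \<in> carrier W" for I :: "'w set" and f
    by (rule module_hom_finsum[OF W.V.left_module_axioms W'.V.left_module_axioms h(1) that])
  have "W'.L.lindep_free (h ` S)"
    unfolding W'.L.lindep_free_def
  proof (intro ballI impI)
    fix c y assume c: "c \<in> h ` S \<rightarrow> carrier K" "(\<Oplus>\<^bsub>W'\<^esub>y\<in>h ` S. W'.act (c y) y) = \<zero>\<^bsub>W'\<^esub>"
      and y: "y \<in> h ` S"
    have xs: "x \<in> carrier W" "c (h x) \<in> carrier K" if "x \<in> S" for x using that S(2) c(1) by auto
    have "h (\<Oplus>\<^bsub>W\<^esub>x\<in>S. W.act (c (h x)) x) = (\<Oplus>\<^bsub>W'\<^esub>x\<in>S. h (W.act (c (h x)) x))"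
      by (rule hsum) (use S xs W.L.act_closed in auto)
    also have "\<dots> = (\<Oplus>\<^bsub>W'\<^esub>x\<in>S. W'.act (c (h x)) (h x))"
      by (rule W'.V.M.finsum_cong') (use xs hact hc W'.L.act_closed in auto)
    also have "\<dots> = (\<Oplus>\<^bsub>W'\<^esub>y\<in>h ` S. W'.act (c y) y)"
      by (rule W'.V.M.finsum_reindex[symmetric]) (use injS xs hc W'.L.act_closed in auto)
    also have "\<dots> = h \<zero>\<^bsub>W\<^esub>" using c(2) hsum[of "{}"] by simp
    finally have "(\<Oplus>\<^bsub>W\<^esub>x\<in>S. W.act (c (h x)) x) = \<zero>\<^bsub>W\<^esub>"
      by (rule inj_onD[OF inj]) (use xs W.L.act_closed in \<open>auto intro!: W.V.M.finsum_closed\<close>)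
    moreover have "(\<lambda>x. c (h x)) \<in> S \<rightarrow> carrier K" using xs by auto
    ultimately have "\<forall>x\<in>S. c (h x) = \<zero>\<^bsub>K\<^esub>"
      by (intro mp[OF bspec[OF S(3)[unfolded W.L.lindep_free_def]]])
    then show "c y = \<zero>\<^bsub>K\<^esub>" using y by blast
  qed
  then have "enat (card (h ` S)) \<le> kdim K A W'"
    by (intro W'.kdim_ge_card_independent) (use S hc in auto)
  also have "kdim K A W' \<le> kdim K A V" using V W'(1) by (simp add: large_module_def)
  finally show ?thesis using card_image[OF injS] by simp
qed

section \<open>Evaluation modules\<close>

locale matrix_rep = K: algebraically_closed K + A: assoc_algebra K A + B: algebra K B
  for K :: "'k ring" and A :: "('k, 'a) module" and B :: "('k, 'b) module" +
  fixes d :: nat and \<tau> :: "'a \<Rightarrow> nat \<times> nat \<Rightarrow> 'b"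
  assumes \<tau>: "\<tau> \<in> alg_hom K A (mat_algebra B d)"
begin

lemma \<tau>_carrier: "a \<in> carrier A \<Longrightarrow> \<tau> a \<in> {..<d} \<times> {..<d} \<rightarrow>\<^sub>E carrier B"
  using \<tau> by (auto simp: alg_hom_def ring_hom_def mat_algebra_def Pi_iff)

lemma \<tau>_closed: "a \<in> carrier A \<Longrightarrow> i < d \<Longrightarrow> j < d \<Longrightarrow> \<tau> a (i, j) \<in> carrier B"
  using \<tau>_carrier[of a] by auto

lemma \<tau>_add: "a \<in> carrier A \<Longrightarrow> b \<in> carrier A \<Longrightarrow> i < d \<Longrightarrow> j < d \<Longrightarrow>
    \<tau> (a \<oplus>\<^bsub>A\<^esub> b) (i, j) = \<tau> a (i, j) \<oplus>\<^bsub>B\<^esub> \<tau> b (i, j)"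
  using \<tau> by (simp add: alg_hom_def ring_hom_def mat_algebra_def)

lemma \<tau>_mult: "a \<in> carrier A \<Longrightarrow> b \<in> carrier A \<Longrightarrow> i < d \<Longrightarrow> j < d \<Longrightarrow>
    \<tau> (a \<otimes>\<^bsub>A\<^esub> b) (i, j) = (\<Oplus>\<^bsub>B\<^esub>l\<in>{..<d}. \<tau> a (i, l) \<otimes>\<^bsub>B\<^esub> \<tau> b (l, j))"
  using \<tau> by (simp add: alg_hom_def ring_hom_def mat_algebra_def)

lemma \<tau>_one: "i < d \<Longrightarrow> j < d \<Longrightarrow> \<tau> \<one>\<^bsub>A\<^esub> (i, j) = (if i = j then \<one>\<^bsub>B\<^esub> else \<zero>\<^bsub>B\<^esub>)"
  using \<tau> by (simp add: alg_hom_def ring_hom_def mat_algebra_def scalar_mat_def)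

lemma \<tau>_smult: "c \<in> carrier K \<Longrightarrow> a \<in> carrier A \<Longrightarrow> i < d \<Longrightarrow> j < d \<Longrightarrow>
    \<tau> (c \<odot>\<^bsub>A\<^esub> a) (i, j) = c \<odot>\<^bsub>B\<^esub> \<tau> a (i, j)"
  using \<tau> by (simp add: alg_hom_def mat_algebra_def)

lemma \<tau>_zero: "i < d \<Longrightarrow> j < d \<Longrightarrow> \<tau> \<zero>\<^bsub>A\<^esub> (i, j) = \<zero>\<^bsub>B\<^esub>"
  using \<tau>_add[of "\<zero>\<^bsub>A\<^esub>" "\<zero>\<^bsub>A\<^esub>" i j] \<tau>_closed[of "\<zero>\<^bsub>A\<^esub>" i j]
    B.M.add.r_cancel_one[of "\<tau> \<zero>\<^bsub>A\<^esub> (i, j)" "\<tau> \<zero>\<^bsub>A\<^esub> (i, j)"] by auto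

lemma \<tau>_diff:
  assumes "a \<in> carrier A" "b \<in> carrier A" "i < d" "j < d"
  shows "\<tau> (a \<ominus>\<^bsub>A\<^esub> b) (i, j) = \<tau> a (i, j) \<ominus>\<^bsub>B\<^esub> \<tau> b (i, j)"
proof -
  have "\<tau> (\<ominus>\<^bsub>A\<^esub> b) (i, j) \<oplus>\<^bsub>B\<^esub> \<tau> b (i, j) = \<zero>\<^bsub>B\<^esub>"
    using \<tau>_add[of "\<ominus>\<^bsub>A\<^esub> b" b i j] assms \<tau>_zero by (simp add: A.l_neg)
  then have "\<tau> (\<ominus>\<^bsub>A\<^esub> b) (i, j) = \<ominus>\<^bsub>B\<^esub> \<tau> b (i, j)"
    using assms \<tau>_closed B.minus_equality by simp
  then show ?thesis using assms \<tau>_add by (simp add: a_minus_def)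
qed

lemma \<tau>_finsum:
  assumes "finite I" "\<And>k. k \<in> I \<Longrightarrow> f k \<in> carrier A" "i < d" "j < d"
  shows "\<tau> (\<Oplus>\<^bsub>A\<^esub>k\<in>I. f k) (i, j) = (\<Oplus>\<^bsub>B\<^esub>k\<in>I. \<tau> (f k) (i, j))"
  using assms(1,2)
proof (induction I rule: finite_induct)
  case empty
  then show ?case using \<tau>_zero assms by simp
next
  case (insert k I)
  have "(\<Oplus>\<^bsub>A\<^esub>k\<in>insert k I. f k) = f k \<oplus>\<^bsub>A\<^esub> (\<Oplus>\<^bsub>A\<^esub>k\<in>I. f k)"
    by (rule A.finsum_insert) (use insert in auto)
  moreover have "(\<Oplus>\<^bsub>B\<^esub>k\<in>insert k I. \<tau> (f k) (i, j)) = \<tau> (f k) (i, j) \<oplus>\<^bsub>B\<^esub> (\<Oplus>\<^bsub>B\<^esub>k\<in>I. \<tau> (f k) (i, j))"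
    by (rule B.finsum_insert) (use insert assms \<tau>_closed in auto)
  ultimately show ?case using insert assms by (simp add: \<tau>_add A.finsum_closed Pi_iff)
qed

definition trace :: "'a \<Rightarrow> 'b" where "trace a = (\<Oplus>\<^bsub>B\<^esub>i\<in>{..<d}. \<tau> a (i, i))"

lemma trace_closed: "a \<in> carrier A \<Longrightarrow> trace a \<in> carrier B"
  unfolding trace_def by (auto intro!: B.finsum_closed \<tau>_closed)

lemma trace_add:
  assumes "a \<in> carrier A" "b \<in> carrier A"
  shows "trace (a \<oplus>\<^bsub>A\<^esub> b) = trace a \<oplus>\<^bsub>B\<^esub> trace b"
proof -
  have "trace (a \<oplus>\<^bsub>A\<^esub> b) = (\<Oplus>\<^bsub>B\<^esub>i\<in>{..<d}. \<tau> a (i, i) \<oplus>\<^bsub>B\<^esub> \<tau> b (i, i))"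
    unfolding trace_def by (rule B.finsum_cong') (use assms \<tau>_closed in \<open>auto simp: \<tau>_add\<close>)
  also have "\<dots> = trace a \<oplus>\<^bsub>B\<^esub> trace b"
    unfolding trace_def by (rule B.finsum_addf) (use assms \<tau>_closed in auto)
  finally show ?thesis .
qed

lemma trace_mult:
  assumes "a \<in> carrier A" "b \<in> carrier A"
  shows "trace (a \<otimes>\<^bsub>A\<^esub> b) = (\<Oplus>\<^bsub>B\<^esub>i\<in>{..<d}. \<Oplus>\<^bsub>B\<^esub>l\<in>{..<d}. \<tau> a (i, l) \<otimes>\<^bsub>B\<^esub> \<tau> b (l, i))"
  unfolding trace_def
  by (rule B.finsum_cong') (use assms \<tau>_closed in \<open>auto simp: \<tau>_mult intro!: B.finsum_closed\<close>)

lemma trace_comm: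
  assumes "a \<in> carrier A" "b \<in> carrier A"
  shows "trace (a \<otimes>\<^bsub>A\<^esub> b) = trace (b \<otimes>\<^bsub>A\<^esub> a)"
proof -
  have "trace (a \<otimes>\<^bsub>A\<^esub> b) = (\<Oplus>\<^bsub>B\<^esub>l\<in>{..<d}. \<Oplus>\<^bsub>B\<^esub>i\<in>{..<d}. \<tau> a (i, l) \<otimes>\<^bsub>B\<^esub> \<tau> b (l, i))"
    unfolding trace_mult[OF assms] by (rule B.finsum_swap) (use assms \<tau>_closed in auto)
  also have "\<dots> = trace (b \<otimes>\<^bsub>A\<^esub> a)"
    unfolding trace_mult[OF assms(2,1)]
  proof (rule B.finsum_cong')
    fix l assume l: "l \<in> {..<d}"
    show "(\<Oplus>\<^bsub>B\<^esub>i\<in>{..<d}. \<tau> a (i, l) \<otimes>\<^bsub>B\<^esub> \<tau> b (l, i)) = (\<Oplus>\<^bsub>B\<^esub>i\<in>{..<d}. \<tau> b (l, i) \<otimes>\<^bsub>B\<^esub> \<tau> a (i, l))"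
      by (rule B.finsum_cong') (use assms l \<tau>_closed in \<open>auto simp: B.m_comm\<close>)
  qed (use assms \<tau>_closed in \<open>auto intro!: B.finsum_closed\<close>)
  finally show ?thesis .
qed

end

lemma foldSetD_cong:
  "(S, y) \<in> foldSetD D f e \<Longrightarrow> (\<And>x. x \<in> S \<Longrightarrow> f x = g x) \<Longrightarrow> (S, y) \<in> foldSetD D g e"
proof (induction S y rule: foldSetD.induct)
  case (insertI x A y)
  then have "(A, y) \<in> foldSetD D g e" "f x = g x" by auto
  then show ?case
    using insertI.hyps by (metis foldSetD.insertI)
qed (auto intro: foldSetD.emptyI)

text \<open>
  Congruence without membership conditions; it makes the coordinates of a product in an
  evaluation module available before the factors are known to lie in the carriers.
\<close>

lemma finsum_cong_pointwise:
  assumes "\<And>x. x \<in> S \<Longrightarrow> f x = g x"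
  shows "finsum G f S = finsum G g S"
proof -
  have "(S, y) \<in> foldSetD (carrier G) ((\<oplus>\<^bsub>G\<^esub>) \<circ> f) \<zero>\<^bsub>G\<^esub> \<longleftrightarrow>
      (S, y) \<in> foldSetD (carrier G) ((\<oplus>\<^bsub>G\<^esub>) \<circ> g) \<zero>\<^bsub>G\<^esub>" for y
    by (rule iffI; erule foldSetD_cong) (simp_all add: assms)
  then show ?thesis by (simp add: finsum_def finprod_def foldD_def)
qed

locale eval_rep = matrix_rep + q: maximalideal q B for q +
  assumes fg: "fin_gen_over K B"
begin

abbreviation F where "F \<equiv> B Quot q"

abbreviation W where "W \<equiv> eval_module B d \<tau> q"

abbreviation res where "res b \<equiv> q +>\<^bsub>B\<^esub> b"

sublocale F: field F by (rule q.quotient_is_field[OF B.M_cring])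

sublocale pr: ring_hom_ring B F "\<lambda>b. res b" by (rule q.rcos_ring_hom_ring)

lemma res_eq_iff: "a \<in> carrier B \<Longrightarrow> b \<in> carrier B \<Longrightarrow> res a = res b \<longleftrightarrow> a \<ominus>\<^bsub>B\<^esub> b \<in> q"
  using B.quotient_eq_iff_same_a_r_cos[OF q.is_ideal] by blast

lemma res_zero_iff: "b \<in> carrier B \<Longrightarrow> res b = \<zero>\<^bsub>F\<^esub> \<longleftrightarrow> b \<in> q"
  using res_eq_iff[of b "\<zero>\<^bsub>B\<^esub>"] by (simp add: a_minus_def)

lemma F_scalar:
  assumes "y \<in> carrier F"
  obtains c where "c \<in> carrier K" "y = res (c \<odot>\<^bsub>B\<^esub> \<one>\<^bsub>B\<^esub>)"
proof -
  obtain b where b: "b \<in> carrier B" "y = res b"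
    using assms by (auto simp: FactRing_def A_RCOSETS_def' a_r_coset_def')
  obtain c where c: "c \<in> carrier K" "b \<ominus>\<^bsub>B\<^esub> c \<odot>\<^bsub>B\<^esub> \<one>\<^bsub>B\<^esub> \<in> q"
    using maximalideal_residue[OF K.algebraically_closed_axioms B.algebra_axioms fg q.maximalideal_axioms b(1)] by blast
  then show thesis using that b res_eq_iff[of b "c \<odot>\<^bsub>B\<^esub> \<one>\<^bsub>B\<^esub>"] by simp
qed

lemma W_simps:
  "carrier W = {..<d} \<rightarrow>\<^sub>E carrier F"
  "i < d \<Longrightarrow> \<zero>\<^bsub>W\<^esub> i = \<zero>\<^bsub>F\<^esub>"
  "i < d \<Longrightarrow> (v \<oplus>\<^bsub>W\<^esub> w) i = v i \<oplus>\<^bsub>F\<^esub> w i"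
  "i < d \<Longrightarrow> (a \<odot>\<^bsub>W\<^esub> v) i = (\<Oplus>\<^bsub>F\<^esub>j\<in>{..<d}. res (\<tau> a (i, j)) \<otimes>\<^bsub>F\<^esub> v j)"
proof -
  show "carrier W = {..<d} \<rightarrow>\<^sub>E carrier F"
    "i < d \<Longrightarrow> \<zero>\<^bsub>W\<^esub> i = \<zero>\<^bsub>F\<^esub>" "i < d \<Longrightarrow> (v \<oplus>\<^bsub>W\<^esub> w) i = v i \<oplus>\<^bsub>F\<^esub> w i"
    by (simp_all add: eval_module_def)
  assume i: "i < d"
  have "(a \<odot>\<^bsub>W\<^esub> v) i = (\<Oplus>\<^bsub>F\<^esub>j\<in>{..<d}. eval_mat B d q (\<tau> a) (i, j) \<otimes>\<^bsub>F\<^esub> v j)"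
    using i by (simp add: eval_module_def)
  also have "\<dots> = (\<Oplus>\<^bsub>F\<^esub>j\<in>{..<d}. res (\<tau> a (i, j)) \<otimes>\<^bsub>F\<^esub> v j)"
    by (rule finsum_cong_pointwise) (use i in \<open>auto simp: eval_mat_def\<close>)
  finally show "(a \<odot>\<^bsub>W\<^esub> v) i = (\<Oplus>\<^bsub>F\<^esub>j\<in>{..<d}. res (\<tau> a (i, j)) \<otimes>\<^bsub>F\<^esub> v j)" .
qed

end

section \<open>Modules over a matrix algebra\<close>

context algebra_rep
begin

lemma lincomb_smult:
  assumes "finite P" "\<And>p. p \<in> P \<Longrightarrow> \<beta> p \<in> carrier K" "\<And>p. p \<in> P \<Longrightarrow> a p \<in> carrier A" "v \<in> carrier V"
  shows "(\<Oplus>\<^bsub>A\<^esub>p\<in>P. scal (\<beta> p) \<otimes>\<^bsub>A\<^esub> a p) \<odot>\<^bsub>V\<^esub> v = (\<Oplus>\<^bsub>V\<^esub>p\<in>P. act (\<beta> p) (a p \<odot>\<^bsub>V\<^esub> v))"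
proof -
  have "(\<Oplus>\<^bsub>A\<^esub>p\<in>P. scal (\<beta> p) \<otimes>\<^bsub>A\<^esub> a p) \<odot>\<^bsub>V\<^esub> v = (\<Oplus>\<^bsub>V\<^esub>p\<in>P. (scal (\<beta> p) \<otimes>\<^bsub>A\<^esub> a p) \<odot>\<^bsub>V\<^esub> v)"
    by (rule V.smult_finsum_left) (use assms in auto)
  also have "\<dots> = (\<Oplus>\<^bsub>V\<^esub>p\<in>P. act (\<beta> p) (a p \<odot>\<^bsub>V\<^esub> v))"
    by (rule V.M.finsum_cong') (use assms V.smult_closed in \<open>auto simp: act_def V.smult_assoc\<close>)
  finally show ?thesis .
qed

text \<open>
  Through coordinates with respect to \<open>G\<close>, the algebra acts by matrices with \<open>card G * card G\<close> entries.
\<close>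

lemma exists_relation_mod_annihilator:
  assumes G: "finite G" "G \<subseteq> carrier V" "L.lspan G = carrier V"
    and P: "finite P" "card G * card G < card P" and a: "\<And>p. p \<in> P \<Longrightarrow> a p \<in> carrier A"
  shows "\<exists>\<beta>. (\<forall>p\<in>P. \<beta> p \<in> carrier K) \<and> (\<exists>p\<in>P. \<beta> p \<noteq> \<zero>\<^bsub>K\<^esub>) \<and>
    (\<Oplus>\<^bsub>A\<^esub>p\<in>P. scal (\<beta> p) \<otimes>\<^bsub>A\<^esub> a p) \<in> V.annihilator"
proof -
  have Gc: "x \<in> carrier V" if "x \<in> G" for x using that G by blast
  define m where "m p x = L.coord G (a p \<odot>\<^bsub>V\<^esub> x)" for p x
  have aG: "a p \<odot>\<^bsub>V\<^esub> x \<in> L.lspan G" if "p \<in> P" "x \<in> G" for p x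
    using V.smult_closed[OF a[OF that(1)] Gc[OF that(2)]] G(3) by simp
  note m = L.coord[OF aG, folded m_def]
  have mc: "m p x y \<in> carrier K" if "p \<in> P" "x \<in> G" "y \<in> G" for p x y
    using m(1)[OF that(1,2)] that(3) by auto
  have "\<exists>\<beta>. (\<forall>p\<in>P. \<beta> p \<in> carrier K) \<and> (\<exists>p\<in>P. \<beta> p \<noteq> \<zero>\<^bsub>K\<^esub>) \<and>
      (\<forall>z\<in>G \<times> G. (\<Oplus>\<^bsub>K\<^esub>p\<in>P. \<beta> p \<otimes>\<^bsub>K\<^esub> m p (fst z) (snd z)) = \<zero>\<^bsub>K\<^esub>)"
  proof (rule K.exists_linear_relation[OF K.carrier_is_subring _ P(1)])
    show "m p (fst z) (snd z) \<in> carrier K" if "p \<in> P" "z \<in> G \<times> G" for p z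
      using mc that by auto
  qed (use G(1) P(2) in \<open>simp_all add: card_cartesian_product\<close>)
  then obtain \<beta> where \<beta>: "\<And>p. p \<in> P \<Longrightarrow> \<beta> p \<in> carrier K" "\<exists>p\<in>P. \<beta> p \<noteq> \<zero>\<^bsub>K\<^esub>"
      "\<And>x y. x \<in> G \<Longrightarrow> y \<in> G \<Longrightarrow> (\<Oplus>\<^bsub>K\<^esub>p\<in>P. \<beta> p \<otimes>\<^bsub>K\<^esub> m p x y) = \<zero>\<^bsub>K\<^esub>"
  proof (elim exE conjE)
    fix \<beta>
    assume "\<forall>p\<in>P. \<beta> p \<in> carrier K" "\<exists>p\<in>P. \<beta> p \<noteq> \<zero>\<^bsub>K\<^esub>"
      and "\<forall>z\<in>G \<times> G. (\<Oplus>\<^bsub>K\<^esub>p\<in>P. \<beta> p \<otimes>\<^bsub>K\<^esub> m p (fst z) (snd z)) = \<zero>\<^bsub>K\<^esub>"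
    then show thesis using that[of \<beta>] by simp
  qed
  have "(\<Oplus>\<^bsub>A\<^esub>p\<in>P. scal (\<beta> p) \<otimes>\<^bsub>A\<^esub> a p) \<in> V.annihilator"
  proof (rule annihilates_span[OF G])
    show "(\<Oplus>\<^bsub>A\<^esub>p\<in>P. scal (\<beta> p) \<otimes>\<^bsub>A\<^esub> a p) \<in> carrier A"
      using \<beta> a by (auto intro!: A.finsum_closed)
    fix x assume x: "x \<in> G"
    have "(\<Oplus>\<^bsub>A\<^esub>p\<in>P. scal (\<beta> p) \<otimes>\<^bsub>A\<^esub> a p) \<odot>\<^bsub>V\<^esub> x = (\<Oplus>\<^bsub>V\<^esub>p\<in>P. act (\<beta> p) (a p \<odot>\<^bsub>V\<^esub> x))"
      by (rule lincomb_smult) (use P \<beta> a Gc x in auto)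
    also have "\<dots> = \<zero>\<^bsub>V\<^esub>"
      by (rule L.relation_of_coords[OF G(1,2) P(1), of "\<lambda>p. m p x"]) (use m x \<beta> in auto)
    finally show "(\<Oplus>\<^bsub>A\<^esub>p\<in>P. scal (\<beta> p) \<otimes>\<^bsub>A\<^esub> a p) \<odot>\<^bsub>V\<^esub> x = \<zero>\<^bsub>V\<^esub>" .
  qed
  then show ?thesis using \<beta> by blast
qed

end

locale rep_with_units = algebra_rep + fixes d e
  assumes units: "matrix_units A V.annihilator d e"
begin

sublocale mu: matrix_units A V.annihilator d e by (rule units)

lemma unit_closed: "i < d \<Longrightarrow> j < d \<Longrightarrow> v \<in> carrier V \<Longrightarrow> e i j \<odot>\<^bsub>V\<^esub> v \<in> carrier V"
  by (simp add: V.smult_closed mu.e_closed)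

lemma unit_smult:
  assumes "i < d" "j < d" "k < d" "l < d" "v \<in> carrier V"
  shows "e i j \<odot>\<^bsub>V\<^esub> (e k l \<odot>\<^bsub>V\<^esub> v) = (if j = k then e i l \<odot>\<^bsub>V\<^esub> v else \<zero>\<^bsub>V\<^esub>)"
proof -
  have "(e i j \<otimes>\<^bsub>A\<^esub> e k l) \<odot>\<^bsub>V\<^esub> v = (if j = k then e i l else \<zero>\<^bsub>A\<^esub>) \<odot>\<^bsub>V\<^esub> v"
    using mu.e_mult[OF assms(1-4)] assms mu.e_closed
    by (subst (asm) V.annihilator_diff_iff) auto
  then show ?thesis using assms mu.e_closed by (auto simp: V.smult_assoc V.smult_zero_left)
qed

definition comb where
  "comb \<kappa> = (\<Oplus>\<^bsub>A\<^esub>p\<in>{..<d} \<times> {..<d}. scal (\<kappa> p) \<otimes>\<^bsub>A\<^esub> e (fst p) (snd p))"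

lemma comb_closed:
  assumes "\<forall>p\<in>{..<d} \<times> {..<d}. \<kappa> p \<in> carrier K"
  shows "comb \<kappa> \<in> carrier A"
  unfolding comb_def using assms mu.e_closed by (intro A.finsum_closed) auto

lemma comb_smult:
  assumes "\<forall>p\<in>{..<d} \<times> {..<d}. \<kappa> p \<in> carrier K" "v \<in> carrier V"
  shows "comb \<kappa> \<odot>\<^bsub>V\<^esub> v = (\<Oplus>\<^bsub>V\<^esub>p\<in>{..<d} \<times> {..<d}. act (\<kappa> p) (e (fst p) (snd p) \<odot>\<^bsub>V\<^esub> v))"
  unfolding comb_def by (rule lincomb_smult) (use assms mu.e_closed in auto)

lemma sandwich_comb:
  assumes \<kappa>': "\<forall>p\<in>{..<d} \<times> {..<d}. \<kappa> p \<in> carrier K" and v: "v \<in> carrier V"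
    and ab: "i < d" "j < d"
  shows "e 0 i \<odot>\<^bsub>V\<^esub> (comb \<kappa> \<odot>\<^bsub>V\<^esub> (e j 0 \<odot>\<^bsub>V\<^esub> v)) = act (\<kappa> (i, j)) (e 0 0 \<odot>\<^bsub>V\<^esub> v)"
proof -
  note \<kappa> = bspec[OF \<kappa>']
  let ?I = "{..<d} \<times> {..<d}"
  have v': "e j 0 \<odot>\<^bsub>V\<^esub> v \<in> carrier V" using unit_closed ab v mu.d_pos by simp
  have "e 0 i \<odot>\<^bsub>V\<^esub> (comb \<kappa> \<odot>\<^bsub>V\<^esub> (e j 0 \<odot>\<^bsub>V\<^esub> v))
      = (\<Oplus>\<^bsub>V\<^esub>p\<in>?I. act (\<kappa> p) (e 0 i \<odot>\<^bsub>V\<^esub> (e (fst p) (snd p) \<odot>\<^bsub>V\<^esub> (e j 0 \<odot>\<^bsub>V\<^esub> v))))"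
    unfolding comb_smult[OF \<kappa>' v']
    by (rule smult_lincomb) (use \<kappa> v' unit_closed mu.e_closed ab mu.d_pos in auto)
  also have "\<dots> = (\<Oplus>\<^bsub>V\<^esub>p\<in>?I. if p = (i, j) then act (\<kappa> p) (e 0 0 \<odot>\<^bsub>V\<^esub> v) else \<zero>\<^bsub>V\<^esub>)"
  proof (rule V.M.finsum_cong')
    fix p assume p: "p \<in> ?I"
    then obtain k l where kl: "p = (k, l)" "k < d" "l < d" by auto
    have \<kappa>p: "\<kappa> p \<in> carrier K" by (rule \<kappa>[OF p])
    have 1: "e k l \<odot>\<^bsub>V\<^esub> (e j 0 \<odot>\<^bsub>V\<^esub> v) = (if l = j then e k 0 \<odot>\<^bsub>V\<^esub> v else \<zero>\<^bsub>V\<^esub>)"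
      using unit_smult kl ab v mu.d_pos by simp
    have 2: "e 0 i \<odot>\<^bsub>V\<^esub> (e k 0 \<odot>\<^bsub>V\<^esub> v) = (if i = k then e 0 0 \<odot>\<^bsub>V\<^esub> v else \<zero>\<^bsub>V\<^esub>)"
      using unit_smult kl ab v mu.d_pos by simp
    have 3: "e 0 i \<odot>\<^bsub>V\<^esub> \<zero>\<^bsub>V\<^esub> = \<zero>\<^bsub>V\<^esub>" using V.smult_zero_right mu.e_closed mu.d_pos ab by simp
    show "act (\<kappa> p) (e 0 i \<odot>\<^bsub>V\<^esub> (e (fst p) (snd p) \<odot>\<^bsub>V\<^esub> (e j 0 \<odot>\<^bsub>V\<^esub> v)))
        = (if p = (i, j) then act (\<kappa> p) (e 0 0 \<odot>\<^bsub>V\<^esub> v) else \<zero>\<^bsub>V\<^esub>)"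
      using kl \<kappa>p 1 2 3 L.act_zero_right by auto
  qed (use \<kappa> v unit_closed mu.d_pos L.act_closed in auto)
  also have "\<dots> = act (\<kappa> (i, j)) (e 0 0 \<odot>\<^bsub>V\<^esub> v)"
    by (rule V.M.finsum_delta) (use \<kappa> v unit_closed mu.d_pos L.act_closed ab in auto)
  finally show ?thesis .
qed

lemma comb_annihilator_imp_zero:
  assumes \<kappa>': "\<forall>p\<in>{..<d} \<times> {..<d}. \<kappa> p \<in> carrier K" and s: "comb \<kappa> \<in> V.annihilator"
    and e00: "e 0 0 \<notin> V.annihilator" and ij: "i < d" "j < d"
  shows "\<kappa> (i, j) = \<zero>\<^bsub>K\<^esub>"
proof -
  note \<kappa> = bspec[OF \<kappa>']
  obtain v where v: "v \<in> carrier V" "e 0 0 \<odot>\<^bsub>V\<^esub> v \<noteq> \<zero>\<^bsub>V\<^esub>"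
    using e00 mu.e_closed[OF mu.d_pos mu.d_pos] unfolding V.annihilator_def by blast
  have "comb \<kappa> \<odot>\<^bsub>V\<^esub> (e j 0 \<odot>\<^bsub>V\<^esub> v) = \<zero>\<^bsub>V\<^esub>"
    using V.annihilatorD[OF s] unit_closed ij v mu.d_pos by simp
  then have "act (\<kappa> (i, j)) (e 0 0 \<odot>\<^bsub>V\<^esub> v) = \<zero>\<^bsub>V\<^esub>"
    using sandwich_comb[OF \<kappa>' v(1) ij] V.smult_zero_right mu.e_closed mu.d_pos ij by simp
  then show ?thesis
    using L.act_eq_zero[OF \<kappa>[of "(i, j)"] unit_closed[of 0 0 v] _ v(2)] ij mu.d_pos v(1) by simp
qed

text \<open>
  Whether \<open>t\<close> kills the vector \<open>e\<^sub>0\<^sub>0 v\<close> is decided by the first column of coefficients of \<open>t\<close>, thus by an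
  element of \<open>A\<close> that does not depend on \<open>v\<close>. This allows vectors of different modules to be compared.
\<close>

lemma kills_iff:
  assumes \<kappa>': "\<forall>p\<in>{..<d} \<times> {..<d}. \<kappa> p \<in> carrier K" and s: "t \<ominus>\<^bsub>A\<^esub> comb \<kappa> \<in> V.annihilator"
    and t: "t \<in> carrier A" and v: "v \<in> carrier V" "e 0 0 \<odot>\<^bsub>V\<^esub> v \<noteq> \<zero>\<^bsub>V\<^esub>"
  shows "t \<odot>\<^bsub>V\<^esub> (e 0 0 \<odot>\<^bsub>V\<^esub> v) = \<zero>\<^bsub>V\<^esub> \<longleftrightarrow> t \<otimes>\<^bsub>A\<^esub> e 0 0 \<in> V.annihilator"
proof
  have e00: "e 0 0 \<in> carrier A" using mu.e_closed mu.d_pos by simp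
  assume "t \<otimes>\<^bsub>A\<^esub> e 0 0 \<in> V.annihilator"
  from V.annihilatorD[OF this v(1)] show "t \<odot>\<^bsub>V\<^esub> (e 0 0 \<odot>\<^bsub>V\<^esub> v) = \<zero>\<^bsub>V\<^esub>"
    using t e00 v by (simp add: V.smult_assoc)
next
  note \<kappa> = bspec[OF \<kappa>']
  have e00: "e 0 0 \<in> carrier A" using mu.e_closed mu.d_pos by simp
  assume kill: "t \<odot>\<^bsub>V\<^esub> (e 0 0 \<odot>\<^bsub>V\<^esub> v) = \<zero>\<^bsub>V\<^esub>"
  have t_eq: "t \<odot>\<^bsub>V\<^esub> u = comb \<kappa> \<odot>\<^bsub>V\<^esub> u" if "u \<in> carrier V" for u
    using s that t comb_closed[OF \<kappa>'] by (simp add: V.annihilator_diff_iff)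
  have zero: "\<kappa> (i, 0) = \<zero>\<^bsub>K\<^esub>" if i: "i < d" for i
  proof -
    have "act (\<kappa> (i, 0)) (e 0 0 \<odot>\<^bsub>V\<^esub> v) = e 0 i \<odot>\<^bsub>V\<^esub> (t \<odot>\<^bsub>V\<^esub> (e 0 0 \<odot>\<^bsub>V\<^esub> v))"
      using sandwich_comb[OF \<kappa>' v(1) i mu.d_pos] t_eq unit_closed v(1) mu.d_pos by simp
    also have "\<dots> = \<zero>\<^bsub>V\<^esub>" using kill V.smult_zero_right mu.e_closed mu.d_pos i by simp
    finally show ?thesis
      using L.act_eq_zero[OF \<kappa>[of "(i, 0)"] unit_closed[of 0 0 v] _ v(2)] i mu.d_pos v(1) by simp
  qed
  have z: "(t \<otimes>\<^bsub>A\<^esub> e 0 0) \<odot>\<^bsub>V\<^esub> u = \<zero>\<^bsub>V\<^esub>" if u: "u \<in> carrier V" for u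
  proof -
    have u': "e 0 0 \<odot>\<^bsub>V\<^esub> u \<in> carrier V" using unit_closed u mu.d_pos by simp
    have "(t \<otimes>\<^bsub>A\<^esub> e 0 0) \<odot>\<^bsub>V\<^esub> u = comb \<kappa> \<odot>\<^bsub>V\<^esub> (e 0 0 \<odot>\<^bsub>V\<^esub> u)"
      using t e00 u u' t_eq by (simp add: V.smult_assoc)
    also have "\<dots> = (\<Oplus>\<^bsub>V\<^esub>p\<in>{..<d} \<times> {..<d}. act (\<kappa> p) (e (fst p) (snd p) \<odot>\<^bsub>V\<^esub> (e 0 0 \<odot>\<^bsub>V\<^esub> u)))"
      by (rule comb_smult[OF \<kappa>' u'])
    also have "\<dots> = (\<Oplus>\<^bsub>V\<^esub>p\<in>{..<d} \<times> {..<d}. \<zero>\<^bsub>V\<^esub>)"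
    proof (rule V.M.finsum_cong')
      fix p assume p: "p \<in> {..<d} \<times> {..<d}"
      then obtain k l where kl: "p = (k, l)" "k < d" "l < d" by auto
      show "act (\<kappa> p) (e (fst p) (snd p) \<odot>\<^bsub>V\<^esub> (e 0 0 \<odot>\<^bsub>V\<^esub> u)) = \<zero>\<^bsub>V\<^esub>"
        using kl zero \<kappa>[OF p] unit_smult[of k l 0 0 u] unit_closed u mu.d_pos
        by (cases "l = 0") (auto simp: L.act_zero L.act_zero_right)
    qed auto
    finally show ?thesis by simp
  qed
  show "t \<otimes>\<^bsub>A\<^esub> e 0 0 \<in> V.annihilator"
    unfolding V.annihilator_def by (intro CollectI conjI ballI z A.m_closed t e00)
qed

end

text \<open>
  The algebra \<open>A\<close> acts on \<open>W\<close> through a quotient of dimension at most \<open>d\<^sup>2\<close>, which maps onto the algebra acting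
  on \<open>V\<close>. The latter contains \<open>d\<^sup>2\<close> independent matrix units, so the two algebras agree and the units span
  them. Hence \<open>e\<^sub>0\<^sub>0 v\<close> and \<open>e\<^sub>0\<^sub>0 w\<close> have the same annihilator, and \<open>t e\<^sub>0\<^sub>0 v \<mapsto> t e\<^sub>0\<^sub>0 w\<close> is an injective
  homomorphism. It is onto because \<open>W\<close> has dimension at most \<open>d\<close> and the vectors \<open>e\<^sub>i\<^sub>0 w\<close> are independent.
\<close>

lemma isomorphic_of_annihilator_subset:
  fixes K :: "'k ring" and A :: "('k, 'a) module" and V :: "('a, 'v) module" and W :: "('a, 'w) module"
  assumes V: "simple_rep K A V" and W: "algebra_rep K A W"
    and G: "finite G" "G \<subseteq> carrier W" "lin_action.lspan K W (algebra_rep.act A W) G = carrier W"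
      "card G \<le> d"
    and e: "matrix_units A (left_module.annihilator A V) d e" "e 0 0 \<notin> left_module.annihilator A V"
    and sub: "left_module.annihilator A W \<subseteq> left_module.annihilator A V"
  shows "module_isomorphic A V W"
proof -
  interpret V: simple_rep K A V by fact
  interpret W: algebra_rep K A W by fact
  interpret VU: rep_with_units K A V d e
    by (intro rep_with_units.intro rep_with_units_axioms.intro V.algebra_rep_axioms e(1))
  let ?I = "{..<d} \<times> {..<d}"
  let ?J = "V.V.annihilator" and ?N = "W.V.annihilator"
  have d: "0 < d" by (rule VU.mu.d_pos)
  note ec = VU.mu.e_closed
  interpret N: ideal ?N A by (rule W.V.ideal_annihilator)
  have expand: "\<exists>\<kappa>. (\<forall>p\<in>?I. \<kappa> p \<in> carrier K) \<and> t \<ominus>\<^bsub>A\<^esub> VU.comb \<kappa> \<in> ?N" if t: "t \<in> carrier A" for t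
  proof -
    \<comment> \<open>\<open>None\<close> stands for \<open>t\<close>: it is related to the units modulo the annihilator of \<open>W\<close>\<close>
    define P where "P = insert None (Some ` ?I)"
    define a where "a p = (case p of None \<Rightarrow> t | Some p \<Rightarrow> e (fst p) (snd p))" for p
    have P: "finite P" "card P = Suc (d * d)"
      by (simp_all add: P_def card_image card_cartesian_product)
    have ac: "a p \<in> carrier A" if "p \<in> P" for p using that t ec by (auto simp: P_def a_def)
    have "card G * card G < card P" using mult_le_mono[OF G(4) G(4)] P(2) by simp
    then have "\<exists>\<beta>. (\<forall>p\<in>P. \<beta> p \<in> carrier K) \<and> (\<exists>p\<in>P. \<beta> p \<noteq> \<zero>\<^bsub>K\<^esub>) \<and>
        (\<Oplus>\<^bsub>A\<^esub>p\<in>P. V.scal (\<beta> p) \<otimes>\<^bsub>A\<^esub> a p) \<in> ?N"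
      by (rule W.exists_relation_mod_annihilator[OF G(1-3) P(1)]) (rule ac)
    then obtain \<beta> where \<beta>K: "\<forall>p\<in>P. \<beta> p \<in> carrier K" and \<beta>2: "\<exists>p\<in>P. \<beta> p \<noteq> \<zero>\<^bsub>K\<^esub>"
      and \<beta>3: "(\<Oplus>\<^bsub>A\<^esub>p\<in>P. V.scal (\<beta> p) \<otimes>\<^bsub>A\<^esub> a p) \<in> ?N" by (elim exE conjE) (rule that)
    note \<beta> = bspec[OF \<beta>K] \<beta>2 \<beta>3
    define \<gamma> where "\<gamma> = \<beta> None"
    define s where "s = VU.comb (\<lambda>p. \<beta> (Some p))"
    have \<gamma>: "\<gamma> \<in> carrier K" and \<beta>S': "\<forall>p\<in>?I. \<beta> (Some p) \<in> carrier K"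
      using \<beta>(1) by (auto simp: \<gamma>_def P_def)
    note \<beta>S = bspec[OF \<beta>S']
    have sc: "s \<in> carrier A" unfolding s_def by (rule VU.comb_closed[OF \<beta>S'])
    have "(\<Oplus>\<^bsub>A\<^esub>p\<in>P. V.scal (\<beta> p) \<otimes>\<^bsub>A\<^esub> a p)
        = V.scal (\<beta> None) \<otimes>\<^bsub>A\<^esub> a None \<oplus>\<^bsub>A\<^esub> (\<Oplus>\<^bsub>A\<^esub>p\<in>Some ` ?I. V.scal (\<beta> p) \<otimes>\<^bsub>A\<^esub> a p)"
      unfolding P_def by (rule V.A.finsum_insert) (use \<beta>(1) ac in \<open>auto simp: P_def\<close>)
    also have "(\<Oplus>\<^bsub>A\<^esub>p\<in>Some ` ?I. V.scal (\<beta> p) \<otimes>\<^bsub>A\<^esub> a p) = s"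
      unfolding s_def VU.comb_def
      by (subst V.A.finsum_reindex) (use \<beta>(1) ac in \<open>auto simp: P_def a_def\<close>)
    finally have rel: "V.scal \<gamma> \<otimes>\<^bsub>A\<^esub> t \<oplus>\<^bsub>A\<^esub> s \<in> ?N" using \<beta>(3) by (simp add: a_def \<gamma>_def)
    have \<gamma>0: "\<gamma> \<noteq> \<zero>\<^bsub>K\<^esub>"
    proof
      assume z: "\<gamma> = \<zero>\<^bsub>K\<^esub>"
      then have "V.scal \<gamma> \<otimes>\<^bsub>A\<^esub> t \<oplus>\<^bsub>A\<^esub> s = s" using t sc by (simp add: V.scal_mult)
      then have "s \<in> ?J" using rel sub by auto
      then have "\<beta> (Some p) = \<zero>\<^bsub>K\<^esub>" if "p \<in> ?I" for p
        using VU.comb_annihilator_imp_zero[OF \<beta>S' _ e(2), of "fst p" "snd p"] that unfolding s_def by auto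
      then show False using \<beta>(2) z by (auto simp: P_def \<gamma>_def)
    qed
    then have u: "\<gamma> \<in> Units K" using \<gamma> V.K.field_Units by simp
    define g where "g = inv\<^bsub>K\<^esub> \<gamma>"
    have g: "g \<in> carrier K" "g \<otimes>\<^bsub>K\<^esub> \<gamma> = \<one>\<^bsub>K\<^esub>" using u by (auto simp: g_def)
    define \<kappa> where "\<kappa> p = \<ominus>\<^bsub>K\<^esub> (g \<otimes>\<^bsub>K\<^esub> \<beta> (Some p))" for p
    have \<kappa>: "\<kappa> p \<in> carrier K" if "p \<in> ?I" for p using g \<beta>S[OF that] by (simp add: \<kappa>_def)
    then have \<kappa>': "\<forall>p\<in>?I. \<kappa> p \<in> carrier K" by blast
    have "g \<odot>\<^bsub>A\<^esub> s = (\<Oplus>\<^bsub>A\<^esub>p\<in>?I. \<ominus>\<^bsub>A\<^esub> (V.scal (\<kappa> p) \<otimes>\<^bsub>A\<^esub> e (fst p) (snd p)))"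
    proof -
      have "V.scal g \<otimes>\<^bsub>A\<^esub> s = (\<Oplus>\<^bsub>A\<^esub>p\<in>?I. V.scal g \<otimes>\<^bsub>A\<^esub> (V.scal (\<beta> (Some p)) \<otimes>\<^bsub>A\<^esub> e (fst p) (snd p)))"
        unfolding s_def VU.comb_def by (rule V.A.finsum_rdistr) (use g \<beta>S ec in auto)
      also have "\<dots> = (\<Oplus>\<^bsub>A\<^esub>p\<in>?I. \<ominus>\<^bsub>A\<^esub> (V.scal (\<kappa> p) \<otimes>\<^bsub>A\<^esub> e (fst p) (snd p)))"
      proof (rule V.A.finsum_cong')
        fix p assume p: "p \<in> ?I"
        have c: "\<beta> (Some p) \<in> carrier K" "e (fst p) (snd p) \<in> carrier A" using \<beta>S[OF p] p ec by auto
        then show "V.scal g \<otimes>\<^bsub>A\<^esub> (V.scal (\<beta> (Some p)) \<otimes>\<^bsub>A\<^esub> e (fst p) (snd p))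
            = \<ominus>\<^bsub>A\<^esub> (V.scal (\<kappa> p) \<otimes>\<^bsub>A\<^esub> e (fst p) (snd p))"
          using g \<kappa>[OF p] by (simp add: V.scal_mult \<kappa>_def V.A.smult_assoc1 V.A.smult_l_minus)
      qed (use \<kappa> ec in auto)
      finally show ?thesis using g sc by (simp add: V.scal_mult)
    qed
    also have "\<dots> = \<ominus>\<^bsub>A\<^esub> VU.comb \<kappa>"
    proof -
      have "(\<Oplus>\<^bsub>A\<^esub>p\<in>?I. \<ominus>\<^bsub>A\<^esub> (V.scal (\<kappa> p) \<otimes>\<^bsub>A\<^esub> e (fst p) (snd p))) \<oplus>\<^bsub>A\<^esub> VU.comb \<kappa>
          = (\<Oplus>\<^bsub>A\<^esub>p\<in>?I. \<ominus>\<^bsub>A\<^esub> (V.scal (\<kappa> p) \<otimes>\<^bsub>A\<^esub> e (fst p) (snd p)) \<oplus>\<^bsub>A\<^esub> V.scal (\<kappa> p) \<otimes>\<^bsub>A\<^esub> e (fst p) (snd p))"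
        unfolding VU.comb_def by (rule V.A.finsum_addf[symmetric]) (use \<kappa> ec in auto)
      also have "\<dots> = (\<Oplus>\<^bsub>A\<^esub>p\<in>?I. \<zero>\<^bsub>A\<^esub>)"
        by (rule V.A.finsum_cong') (use \<kappa> ec in \<open>auto simp: V.A.l_neg\<close>)
      finally have sum0: "(\<Oplus>\<^bsub>A\<^esub>p\<in>?I. \<ominus>\<^bsub>A\<^esub> (V.scal (\<kappa> p) \<otimes>\<^bsub>A\<^esub> e (fst p) (snd p))) \<oplus>\<^bsub>A\<^esub> VU.comb \<kappa> = \<zero>\<^bsub>A\<^esub>"
        by simp
      show ?thesis
        by (rule V.A.minus_equality[symmetric, OF sum0 VU.comb_closed[OF \<kappa>']])
          (use \<kappa> ec in \<open>auto intro!: V.A.finsum_closed\<close>)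
    qed
    finally have gs: "g \<odot>\<^bsub>A\<^esub> s = \<ominus>\<^bsub>A\<^esub> VU.comb \<kappa>" .
    have "V.scal g \<otimes>\<^bsub>A\<^esub> (V.scal \<gamma> \<otimes>\<^bsub>A\<^esub> t \<oplus>\<^bsub>A\<^esub> s) \<in> ?N"
      using N.I_l_closed[OF rel] g by simp
    also have "V.scal g \<otimes>\<^bsub>A\<^esub> (V.scal \<gamma> \<otimes>\<^bsub>A\<^esub> t \<oplus>\<^bsub>A\<^esub> s) = t \<ominus>\<^bsub>A\<^esub> VU.comb \<kappa>"
      using g \<gamma> t sc gs
      by (simp add: V.scal_mult V.A.smult_r_distr V.A.smult_assoc1[symmetric] a_minus_def)
    finally show ?thesis using \<kappa>' by blast
  qed
  have JN: "?J = ?N"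
  proof
    show "?J \<subseteq> ?N"
    proof
      fix t assume t: "t \<in> ?J"
      then have tc: "t \<in> carrier A" by (rule ideal.Icarr[OF V.V.ideal_annihilator])
      obtain \<kappa> where \<kappa>: "\<forall>p\<in>?I. \<kappa> p \<in> carrier K" "t \<ominus>\<^bsub>A\<^esub> VU.comb \<kappa> \<in> ?N"
        using expand[OF tc] by (elim exE conjE) (rule that)
      have cc: "VU.comb \<kappa> \<in> carrier A" by (rule VU.comb_closed[OF \<kappa>(1)])
      have "t \<ominus>\<^bsub>A\<^esub> VU.comb \<kappa> \<in> ?J" using \<kappa>(2) sub by (rule rev_subsetD)
      then have eq: "\<forall>v\<in>carrier V. t \<odot>\<^bsub>V\<^esub> v = VU.comb \<kappa> \<odot>\<^bsub>V\<^esub> v"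
        by (simp only: V.V.annihilator_diff_iff[OF tc cc])
      have "VU.comb \<kappa> \<odot>\<^bsub>V\<^esub> v = \<zero>\<^bsub>V\<^esub>" if "v \<in> carrier V" for v
        using bspec[OF eq that] V.V.annihilatorD[OF t that] by simp
      then have "VU.comb \<kappa> \<in> ?J" unfolding V.V.annihilator_def by (intro CollectI conjI ballI cc)
      then have "\<kappa> p = \<zero>\<^bsub>K\<^esub>" if "p \<in> ?I" for p
        using VU.comb_annihilator_imp_zero[OF \<kappa>(1) _ e(2), of "fst p" "snd p"] that by auto
      then have "VU.comb \<kappa> = (\<Oplus>\<^bsub>A\<^esub>p\<in>?I. \<zero>\<^bsub>A\<^esub>)"
        unfolding VU.comb_def by (intro V.A.finsum_cong') (use ec in \<open>auto simp: V.scal_mult\<close>)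
      then show "t \<in> ?N" using \<kappa>(2) tc by (simp add: a_minus_def)
    qed
  qed (rule sub)
  interpret WU: rep_with_units K A W d e
    by (intro rep_with_units.intro rep_with_units_axioms.intro W.algebra_rep_axioms e(1)[unfolded JN])
  have e00: "e 0 0 \<in> carrier A" using ec d by simp
  obtain v where v: "v \<in> carrier V" "e 0 0 \<odot>\<^bsub>V\<^esub> v \<noteq> \<zero>\<^bsub>V\<^esub>"
    using e(2) e00 unfolding V.V.annihilator_def by blast
  obtain w where w: "w \<in> carrier W" "e 0 0 \<odot>\<^bsub>W\<^esub> w \<noteq> \<zero>\<^bsub>W\<^esub>"
    using e(2) e00 unfolding JN W.V.annihilator_def by blast
  define v1 where "v1 = e 0 0 \<odot>\<^bsub>V\<^esub> v"
  define w1 where "w1 = e 0 0 \<odot>\<^bsub>W\<^esub> w"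
  have v1: "v1 \<in> carrier V" "v1 \<noteq> \<zero>\<^bsub>V\<^esub>"
    unfolding v1_def by (rule VU.unit_closed[OF d d v(1)], rule v(2))
  have w1: "w1 \<in> carrier W" "w1 \<noteq> \<zero>\<^bsub>W\<^esub>"
    unfolding w1_def by (rule WU.unit_closed[OF d d w(1)], rule w(2))
  have kill: "t \<odot>\<^bsub>V\<^esub> v1 = \<zero>\<^bsub>V\<^esub> \<longleftrightarrow> t \<odot>\<^bsub>W\<^esub> w1 = \<zero>\<^bsub>W\<^esub>" if t: "t \<in> carrier A" for t
  proof -
    obtain \<kappa> where \<kappa>: "\<forall>p\<in>?I. \<kappa> p \<in> carrier K" "t \<ominus>\<^bsub>A\<^esub> VU.comb \<kappa> \<in> ?N"
      using expand[OF t] by (elim exE conjE) (rule that)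
    show ?thesis
      using VU.kills_iff[OF \<kappa>(1) _ t v] WU.kills_iff[OF \<kappa>(1) _ t w] \<kappa>(2) JN
      by (simp add: v1_def w1_def)
  qed
  have kill2: "t \<odot>\<^bsub>V\<^esub> v1 = s \<odot>\<^bsub>V\<^esub> v1 \<longleftrightarrow> t \<odot>\<^bsub>W\<^esub> w1 = s \<odot>\<^bsub>W\<^esub> w1"
    if "t \<in> carrier A" "s \<in> carrier A" for s t
    using kill[of "t \<ominus>\<^bsub>A\<^esub> s"] that v1 w1 V.V.smult_closed W.V.smult_closed
    by (simp add: V.V.smult_diff_left W.V.smult_diff_left V.V.M.diff_eq_zero_iff W.V.M.diff_eq_zero_iff)
  have onto: "\<exists>t\<in>carrier A. t \<odot>\<^bsub>V\<^esub> v1 = u" if "u \<in> carrier V" for u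
    using simple_module_cyclic[OF V.simple v1 that] by blast
  define h where "h u = (SOME t. t \<in> carrier A \<and> t \<odot>\<^bsub>V\<^esub> v1 = u) \<odot>\<^bsub>W\<^esub> w1" for u
  have h: "h (t \<odot>\<^bsub>V\<^esub> v1) = t \<odot>\<^bsub>W\<^esub> w1" if t: "t \<in> carrier A" for t
  proof -
    define s where "s = (SOME s. s \<in> carrier A \<and> s \<odot>\<^bsub>V\<^esub> v1 = t \<odot>\<^bsub>V\<^esub> v1)"
    have "s \<in> carrier A \<and> s \<odot>\<^bsub>V\<^esub> v1 = t \<odot>\<^bsub>V\<^esub> v1"
      unfolding s_def by (rule someI[of _ t]) (use t in simp)
    then show ?thesis using kill2[of s t] t by (simp add: h_def s_def)
  qed
  have hom: "h u \<in> carrier W"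
    "\<And>u'. u' \<in> carrier V \<Longrightarrow> h (u \<oplus>\<^bsub>V\<^esub> u') = h u \<oplus>\<^bsub>W\<^esub> h u'"
    "\<And>a. a \<in> carrier A \<Longrightarrow> h (a \<odot>\<^bsub>V\<^esub> u) = a \<odot>\<^bsub>W\<^esub> h u" if u: "u \<in> carrier V" for u
  proof -
    obtain t where t: "t \<in> carrier A" "t \<odot>\<^bsub>V\<^esub> v1 = u" using onto[OF u] by blast
    show "h u \<in> carrier W" using h[OF t(1)] t w1 W.V.smult_closed by auto
    show "h (u \<oplus>\<^bsub>V\<^esub> u') = h u \<oplus>\<^bsub>W\<^esub> h u'" if u': "u' \<in> carrier V" for u'
    proof -
      obtain s where s: "s \<in> carrier A" "s \<odot>\<^bsub>V\<^esub> v1 = u'" using onto[OF u'] by blast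
      show ?thesis
        using h[OF t(1)] h[OF s(1)] h[of "t \<oplus>\<^bsub>A\<^esub> s"] s t v1 w1
        by (simp add: V.V.smult_l_distr W.V.smult_l_distr)
    qed
    show "h (a \<odot>\<^bsub>V\<^esub> u) = a \<odot>\<^bsub>W\<^esub> h u" if a: "a \<in> carrier A" for a
      using h[OF t(1)] h[of "a \<otimes>\<^bsub>A\<^esub> t"] a t v1 w1 by (simp add: V.V.smult_assoc W.V.smult_assoc)
  qed
  have "h \<in> module_hom A V W"
    unfolding module_hom_def using hom by (intro CollectI conjI allI impI funcsetI) simp_all
  moreover have "bij_betw h (carrier V) (carrier W)"
  proof (rule bij_betw_imageI)
    show "inj_on h (carrier V)"
    proof (rule inj_onI)
      fix u u' assume u: "u \<in> carrier V" "u' \<in> carrier V" "h u = h u'"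
      obtain t where t: "t \<in> carrier A" "t \<odot>\<^bsub>V\<^esub> v1 = u" using onto[OF u(1)] by blast
      obtain s where s: "s \<in> carrier A" "s \<odot>\<^bsub>V\<^esub> v1 = u'" using onto[OF u(2)] by blast
      show "u = u'" using kill2[OF t(1) s(1)] h[OF t(1)] h[OF s(1)] t s u(3) by simp
    qed
    have "y \<in> h ` carrier V" if y: "y \<in> carrier W" for y
    proof -
      \<comment> \<open>\<open>None\<close> stands for \<open>y\<close>: it is related to the vectors \<open>e i 0 w1\<close>\<close>
      define P where "P = insert None (Some ` {..<d})"
      define f where "f p = (case p of None \<Rightarrow> y | Some i \<Rightarrow> e i 0 \<odot>\<^bsub>W\<^esub> w1)" for p
      have P: "finite P" "card G < card P" using G(4) by (simp_all add: P_def card_image)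
      have fc: "f p \<in> carrier W" if "p \<in> P" for p
        using that y WU.unit_closed w1 d by (auto simp: P_def f_def)
      have "\<exists>\<beta>. (\<forall>p\<in>P. \<beta> p \<in> carrier K) \<and> (\<exists>p\<in>P. \<beta> p \<noteq> \<zero>\<^bsub>K\<^esub>) \<and>
          (\<Oplus>\<^bsub>W\<^esub>p\<in>P. W.act (\<beta> p) (f p)) = \<zero>\<^bsub>W\<^esub>"
        by (rule W.L.exists_relation[OF G(1-3) P]) (rule fc)
      then obtain \<beta> where \<beta>K: "\<forall>p\<in>P. \<beta> p \<in> carrier K" and \<beta>2: "\<exists>p\<in>P. \<beta> p \<noteq> \<zero>\<^bsub>K\<^esub>"
        and \<beta>3: "(\<Oplus>\<^bsub>W\<^esub>p\<in>P. W.act (\<beta> p) (f p)) = \<zero>\<^bsub>W\<^esub>" by (elim exE conjE) (rule that)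
      note \<beta> = bspec[OF \<beta>K] \<beta>2 \<beta>3
      define \<gamma> where "\<gamma> = \<beta> None"
      have \<gamma>: "\<gamma> \<in> carrier K" and \<beta>S: "\<And>i. i < d \<Longrightarrow> \<beta> (Some i) \<in> carrier K"
        using \<beta>(1) by (auto simp: \<gamma>_def P_def)
      define s where "s = (\<Oplus>\<^bsub>A\<^esub>i\<in>{..<d}. W.scal (\<beta> (Some i)) \<otimes>\<^bsub>A\<^esub> e i 0)"
      have sc: "s \<in> carrier A" unfolding s_def using \<beta>S ec d by (auto intro!: V.A.finsum_closed)
      have sw: "s \<odot>\<^bsub>W\<^esub> w1 = (\<Oplus>\<^bsub>W\<^esub>i\<in>{..<d}. W.act (\<beta> (Some i)) (e i 0 \<odot>\<^bsub>W\<^esub> w1))"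
        unfolding s_def by (rule W.lincomb_smult) (use \<beta>S ec d w1 in auto)
      have "(\<Oplus>\<^bsub>W\<^esub>p\<in>P. W.act (\<beta> p) (f p))
          = W.act (\<beta> None) (f None) \<oplus>\<^bsub>W\<^esub> (\<Oplus>\<^bsub>W\<^esub>p\<in>Some ` {..<d}. W.act (\<beta> p) (f p))"
        unfolding P_def
        by (rule W.V.M.finsum_insert) (use \<beta>(1) fc W.L.act_closed in \<open>auto simp: P_def\<close>)
      also have "(\<Oplus>\<^bsub>W\<^esub>p\<in>Some ` {..<d}. W.act (\<beta> p) (f p)) = s \<odot>\<^bsub>W\<^esub> w1"
        unfolding sw by (subst W.V.M.finsum_reindex)
          (use \<beta>(1) fc W.L.act_closed in \<open>auto simp: P_def f_def\<close>)
      finally have rel: "W.act \<gamma> y \<oplus>\<^bsub>W\<^esub> s \<odot>\<^bsub>W\<^esub> w1 = \<zero>\<^bsub>W\<^esub>" using \<beta>(3) by (simp add: f_def \<gamma>_def)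
      have sand: "e 0 i \<odot>\<^bsub>W\<^esub> (s \<odot>\<^bsub>W\<^esub> w1) = W.act (\<beta> (Some i)) w1" if i: "i < d" for i
      proof -
        have "e 0 i \<odot>\<^bsub>W\<^esub> (s \<odot>\<^bsub>W\<^esub> w1)
            = (\<Oplus>\<^bsub>W\<^esub>j\<in>{..<d}. W.act (\<beta> (Some j)) (e 0 i \<odot>\<^bsub>W\<^esub> (e j 0 \<odot>\<^bsub>W\<^esub> w1)))"
          unfolding sw by (rule W.smult_lincomb) (use i \<beta>S ec d w1 WU.unit_closed in auto)
        also have "\<dots> = (\<Oplus>\<^bsub>W\<^esub>j\<in>{..<d}. if i = j then W.act (\<beta> (Some j)) w1 else \<zero>\<^bsub>W\<^esub>)"
        proof (rule W.V.M.finsum_cong')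
          fix j assume "j \<in> {..<d}"
          then have j: "j < d" by simp
          have "e 0 0 \<odot>\<^bsub>W\<^esub> w1 = w1" using WU.unit_smult[of 0 0 0 0 w] d w by (simp add: w1_def)
          then show "W.act (\<beta> (Some j)) (e 0 i \<odot>\<^bsub>W\<^esub> (e j 0 \<odot>\<^bsub>W\<^esub> w1))
              = (if i = j then W.act (\<beta> (Some j)) w1 else \<zero>\<^bsub>W\<^esub>)"
            using WU.unit_smult[of 0 i j 0 w1] i j d w1 \<beta>S[OF j] by (auto simp: W.L.act_zero_right)
        qed (use \<beta>S w1 W.L.act_closed in auto)
        also have "\<dots> = W.act (\<beta> (Some i)) w1"
          by (rule W.V.M.finsum_delta) (use i \<beta>S w1 W.L.act_closed in auto)
        finally show ?thesis .
      qed
      have \<gamma>0: "\<gamma> \<noteq> \<zero>\<^bsub>K\<^esub>"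
      proof
        assume z: "\<gamma> = \<zero>\<^bsub>K\<^esub>"
        then have "s \<odot>\<^bsub>W\<^esub> w1 = \<zero>\<^bsub>W\<^esub>" using rel y sc w1 W.V.smult_closed by (simp add: W.L.act_zero)
        then have "\<beta> (Some i) = \<zero>\<^bsub>K\<^esub>" if "i < d" for i
          using sand[OF that] W.V.smult_zero_right ec d that W.L.act_eq_zero[OF \<beta>S[OF that] w1(1) _ w1(2)]
          by simp
        then show False using \<beta>(2) z by (auto simp: P_def \<gamma>_def)
      qed
      then have u: "\<gamma> \<in> Units K" using \<gamma> V.K.field_Units by simp
      define g where "g = \<ominus>\<^bsub>K\<^esub> (inv\<^bsub>K\<^esub> \<gamma>)"
      have g: "g \<in> carrier K" "g \<otimes>\<^bsub>K\<^esub> \<gamma> = \<ominus>\<^bsub>K\<^esub> \<one>\<^bsub>K\<^esub>" using u \<gamma> by (auto simp: g_def V.K.l_minus)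
      have sw1: "s \<odot>\<^bsub>W\<^esub> w1 \<in> carrier W" using sc w1 W.V.smult_closed by simp
      have "\<zero>\<^bsub>W\<^esub> = W.act g (W.act \<gamma> y \<oplus>\<^bsub>W\<^esub> s \<odot>\<^bsub>W\<^esub> w1)" using rel g W.L.act_zero_right by simp
      also have "\<dots> = \<ominus>\<^bsub>W\<^esub> y \<oplus>\<^bsub>W\<^esub> W.act g (s \<odot>\<^bsub>W\<^esub> w1)"
        using g \<gamma> y sw1 W.L.act_closed
        by (simp add: W.L.act_add W.L.act_mult[symmetric] W.L.act_minus W.L.act_one)
      finally have "y = W.act g (s \<odot>\<^bsub>W\<^esub> w1)"
        using y g sw1 W.L.act_closed W.V.M.diff_eq_zero_iff[of "W.act g (s \<odot>\<^bsub>W\<^esub> w1)" y]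
        by (simp add: a_minus_def W.V.M.a_comm)
      also have "\<dots> = (W.scal g \<otimes>\<^bsub>A\<^esub> s) \<odot>\<^bsub>W\<^esub> w1"
        using g sc w1 by (simp add: W.act_def W.V.smult_assoc)
      also have "\<dots> = h ((W.scal g \<otimes>\<^bsub>A\<^esub> s) \<odot>\<^bsub>V\<^esub> v1)"
        by (rule h[symmetric]) (use g sc in auto)
      finally show ?thesis using g sc v1 V.V.smult_closed by auto
    qed
    moreover have "h u \<in> carrier W" if "u \<in> carrier V" for u
    proof -
      obtain t where "t \<in> carrier A" "t \<odot>\<^bsub>V\<^esub> v1 = u" using onto[OF \<open>u \<in> carrier V\<close>] by blast
      then show ?thesis using h[of t] w1 W.V.smult_closed by auto
    qed
    ultimately show "h ` carrier V = carrier W" by blast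
  qed
  ultimately show ?thesis unfolding module_isomorphic_def by blast
qed

section \<open>The standard basis of an evaluation module\<close>

context eval_rep
begin

lemma W_eqI:
  "v \<in> carrier W \<Longrightarrow> w \<in> carrier W \<Longrightarrow> (\<And>i. i < d \<Longrightarrow> v i = w i) \<Longrightarrow> v = w"
  unfolding W_simps(1) by (rule PiE_ext) auto

lemma W_comp: "v \<in> carrier W \<Longrightarrow> i < d \<Longrightarrow> v i \<in> carrier F"
  unfolding W_simps(1) by auto

lemma W_zero_closed: "\<zero>\<^bsub>W\<^esub> \<in> carrier W"
  unfolding W_simps(1) by (auto simp: eval_module_def)

lemma W_add_closed: "v \<in> carrier W \<Longrightarrow> w \<in> carrier W \<Longrightarrow> v \<oplus>\<^bsub>W\<^esub> w \<in> carrier W"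
  using W_comp[of v] W_comp[of w] unfolding W_simps(1) by (simp add: eval_module_def)

lemma W_smult_closed:
  assumes "a \<in> carrier A" "v \<in> carrier W"
  shows "a \<odot>\<^bsub>W\<^esub> v \<in> carrier W"
proof -
  have "(a \<odot>\<^bsub>W\<^esub> v) i \<in> carrier F" if "i < d" for i
    using assms that W_comp \<tau>_closed by (auto simp: W_simps(4) intro!: F.finsum_closed)
  moreover have "(a \<odot>\<^bsub>W\<^esub> v) i = undefined" if "i \<notin> {..<d}" for i
    using that by (simp add: eval_module_def)
  ultimately show ?thesis unfolding W_simps(1) by (auto intro!: PiE_I)
qed

lemma res_closed: "a \<in> carrier A \<Longrightarrow> i < d \<Longrightarrow> j < d \<Longrightarrow> res (\<tau> a (i, j)) \<in> carrier F"
  using \<tau>_closed by simp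

lemma W_abelian_group: "abelian_group W"
proof (rule abelian_groupI)
  show "\<zero>\<^bsub>W\<^esub> \<in> carrier W" by (rule W_zero_closed)
  fix x assume x: "x \<in> carrier W"
  show "\<zero>\<^bsub>W\<^esub> \<oplus>\<^bsub>W\<^esub> x = x"
    by (rule W_eqI) (use x W_zero_closed W_add_closed W_comp in \<open>auto simp: W_simps(2,3)\<close>)
  define y where "y = (\<lambda>i\<in>{..<d}. \<ominus>\<^bsub>F\<^esub> x i)"
  have y: "y \<in> carrier W" using W_comp[OF x] by (simp add: W_simps(1) y_def)
  have "y \<oplus>\<^bsub>W\<^esub> x = \<zero>\<^bsub>W\<^esub>"
    by (rule W_eqI)
      (use x y W_zero_closed W_add_closed W_comp in \<open>auto simp: W_simps(2,3) y_def F.l_neg\<close>)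
  then show "\<exists>y\<in>carrier W. y \<oplus>\<^bsub>W\<^esub> x = \<zero>\<^bsub>W\<^esub>" using y by blast
  fix y assume y: "y \<in> carrier W"
  show "x \<oplus>\<^bsub>W\<^esub> y \<in> carrier W" by (rule W_add_closed[OF x y])
  show "x \<oplus>\<^bsub>W\<^esub> y = y \<oplus>\<^bsub>W\<^esub> x"
    by (rule W_eqI) (use x y W_add_closed W_comp in \<open>auto simp: W_simps(3) F.a_comm\<close>)
  fix z assume z: "z \<in> carrier W"
  show "x \<oplus>\<^bsub>W\<^esub> y \<oplus>\<^bsub>W\<^esub> z = x \<oplus>\<^bsub>W\<^esub> (y \<oplus>\<^bsub>W\<^esub> z)"
    by (rule W_eqI) (use x y z W_add_closed W_comp in \<open>auto simp: W_simps(3) F.a_assoc\<close>)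
qed

lemma W_left_module: "left_module A W"
proof (rule left_module.intro[OF A.ring_axioms W_abelian_group], rule left_module_axioms.intro)
  fix a x assume a: "a \<in> carrier A" and x: "x \<in> carrier W"
  note xc = W_comp[OF x]
  note ac = res_closed[OF a]
  show "a \<odot>\<^bsub>W\<^esub> x \<in> carrier W" by (rule W_smult_closed[OF a x])
  { fix b assume b: "b \<in> carrier A"
    note bc = res_closed[OF b]
    show "(a \<oplus>\<^bsub>A\<^esub> b) \<odot>\<^bsub>W\<^esub> x = a \<odot>\<^bsub>W\<^esub> x \<oplus>\<^bsub>W\<^esub> b \<odot>\<^bsub>W\<^esub> x"
    proof (rule W_eqI)
      fix i assume i: "i < d"
      have "((a \<oplus>\<^bsub>A\<^esub> b) \<odot>\<^bsub>W\<^esub> x) i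
          = (\<Oplus>\<^bsub>F\<^esub>j\<in>{..<d}. res (\<tau> a (i, j)) \<otimes>\<^bsub>F\<^esub> x j \<oplus>\<^bsub>F\<^esub> res (\<tau> b (i, j)) \<otimes>\<^bsub>F\<^esub> x j)"
        unfolding W_simps(4)[OF i]
        by (rule F.finsum_cong') (use a b i xc \<tau>_closed in \<open>auto simp: \<tau>_add F.l_distr\<close>)
      also have "\<dots> = (\<Oplus>\<^bsub>F\<^esub>j\<in>{..<d}. res (\<tau> a (i, j)) \<otimes>\<^bsub>F\<^esub> x j) \<oplus>\<^bsub>F\<^esub>
          (\<Oplus>\<^bsub>F\<^esub>j\<in>{..<d}. res (\<tau> b (i, j)) \<otimes>\<^bsub>F\<^esub> x j)"
        by (rule F.finsum_addf) (use i xc ac bc in auto)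
      finally show "((a \<oplus>\<^bsub>A\<^esub> b) \<odot>\<^bsub>W\<^esub> x) i = (a \<odot>\<^bsub>W\<^esub> x \<oplus>\<^bsub>W\<^esub> b \<odot>\<^bsub>W\<^esub> x) i"
        using i by (simp add: W_simps(3,4))
    qed (use a b x W_smult_closed W_add_closed in auto)
    show "(a \<otimes>\<^bsub>A\<^esub> b) \<odot>\<^bsub>W\<^esub> x = a \<odot>\<^bsub>W\<^esub> (b \<odot>\<^bsub>W\<^esub> x)"
    proof (rule W_eqI)
      fix i assume i: "i < d"
      have "((a \<otimes>\<^bsub>A\<^esub> b) \<odot>\<^bsub>W\<^esub> x) i
          = (\<Oplus>\<^bsub>F\<^esub>j\<in>{..<d}. \<Oplus>\<^bsub>F\<^esub>l\<in>{..<d}. res (\<tau> a (i, l)) \<otimes>\<^bsub>F\<^esub> res (\<tau> b (l, j)) \<otimes>\<^bsub>F\<^esub> x j)"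
        unfolding W_simps(4)[OF i]
      proof (rule F.finsum_cong')
        fix j assume j: "j \<in> {..<d}"
        have "res (\<tau> (a \<otimes>\<^bsub>A\<^esub> b) (i, j)) = (\<Oplus>\<^bsub>F\<^esub>l\<in>{..<d}. res (\<tau> a (i, l) \<otimes>\<^bsub>B\<^esub> \<tau> b (l, j)))"
          using a b i j by (simp add: \<tau>_mult, subst pr.hom_finsum) (auto simp: \<tau>_closed comp_def)
        also have "\<dots> = (\<Oplus>\<^bsub>F\<^esub>l\<in>{..<d}. res (\<tau> a (i, l)) \<otimes>\<^bsub>F\<^esub> res (\<tau> b (l, j)))"
          by (rule F.finsum_cong') (use a b i j \<tau>_closed in auto)
        finally have "res (\<tau> (a \<otimes>\<^bsub>A\<^esub> b) (i, j)) \<otimes>\<^bsub>F\<^esub> x j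
            = (\<Oplus>\<^bsub>F\<^esub>l\<in>{..<d}. res (\<tau> a (i, l)) \<otimes>\<^bsub>F\<^esub> res (\<tau> b (l, j))) \<otimes>\<^bsub>F\<^esub> x j" by simp
        also have "\<dots> = (\<Oplus>\<^bsub>F\<^esub>l\<in>{..<d}. res (\<tau> a (i, l)) \<otimes>\<^bsub>F\<^esub> res (\<tau> b (l, j)) \<otimes>\<^bsub>F\<^esub> x j)"
          by (rule F.finsum_ldistr) (use i j ac bc xc in auto)
        finally show "res (\<tau> (a \<otimes>\<^bsub>A\<^esub> b) (i, j)) \<otimes>\<^bsub>F\<^esub> x j
            = (\<Oplus>\<^bsub>F\<^esub>l\<in>{..<d}. res (\<tau> a (i, l)) \<otimes>\<^bsub>F\<^esub> res (\<tau> b (l, j)) \<otimes>\<^bsub>F\<^esub> x j)" .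
      qed (use i ac bc xc in \<open>auto intro!: F.finsum_closed\<close>)
      also have "\<dots> = (\<Oplus>\<^bsub>F\<^esub>l\<in>{..<d}. \<Oplus>\<^bsub>F\<^esub>j\<in>{..<d}. res (\<tau> a (i, l)) \<otimes>\<^bsub>F\<^esub> res (\<tau> b (l, j)) \<otimes>\<^bsub>F\<^esub> x j)"
        by (rule F.finsum_swap) (use i ac bc xc in auto)
      also have "\<dots> = (\<Oplus>\<^bsub>F\<^esub>l\<in>{..<d}. res (\<tau> a (i, l)) \<otimes>\<^bsub>F\<^esub> (b \<odot>\<^bsub>W\<^esub> x) l)"
      proof (rule F.finsum_cong')
        fix l assume l: "l \<in> {..<d}"
        have "(\<Oplus>\<^bsub>F\<^esub>j\<in>{..<d}. res (\<tau> a (i, l)) \<otimes>\<^bsub>F\<^esub> res (\<tau> b (l, j)) \<otimes>\<^bsub>F\<^esub> x j)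
            = (\<Oplus>\<^bsub>F\<^esub>j\<in>{..<d}. res (\<tau> a (i, l)) \<otimes>\<^bsub>F\<^esub> (res (\<tau> b (l, j)) \<otimes>\<^bsub>F\<^esub> x j))"
          by (rule F.finsum_cong') (use i l ac bc xc in \<open>auto simp: F.m_assoc\<close>)
        also have "\<dots> = res (\<tau> a (i, l)) \<otimes>\<^bsub>F\<^esub> (\<Oplus>\<^bsub>F\<^esub>j\<in>{..<d}. res (\<tau> b (l, j)) \<otimes>\<^bsub>F\<^esub> x j)"
          by (rule F.finsum_rdistr[symmetric]) (use i l ac bc xc in auto)
        finally show "(\<Oplus>\<^bsub>F\<^esub>j\<in>{..<d}. res (\<tau> a (i, l)) \<otimes>\<^bsub>F\<^esub> res (\<tau> b (l, j)) \<otimes>\<^bsub>F\<^esub> x j)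
            = res (\<tau> a (i, l)) \<otimes>\<^bsub>F\<^esub> (b \<odot>\<^bsub>W\<^esub> x) l" using l by (simp add: W_simps(4))
      qed (use i ac b x W_comp W_smult_closed in auto)
      finally show "((a \<otimes>\<^bsub>A\<^esub> b) \<odot>\<^bsub>W\<^esub> x) i = (a \<odot>\<^bsub>W\<^esub> (b \<odot>\<^bsub>W\<^esub> x)) i"
        using i by (simp add: W_simps(4))
    qed (use a b x W_smult_closed in auto)
  }
  fix y assume y: "y \<in> carrier W"
  show "a \<odot>\<^bsub>W\<^esub> (x \<oplus>\<^bsub>W\<^esub> y) = a \<odot>\<^bsub>W\<^esub> x \<oplus>\<^bsub>W\<^esub> a \<odot>\<^bsub>W\<^esub> y"
  proof (rule W_eqI)
    fix i assume i: "i < d"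
    have "(a \<odot>\<^bsub>W\<^esub> (x \<oplus>\<^bsub>W\<^esub> y)) i
        = (\<Oplus>\<^bsub>F\<^esub>j\<in>{..<d}. res (\<tau> a (i, j)) \<otimes>\<^bsub>F\<^esub> x j \<oplus>\<^bsub>F\<^esub> res (\<tau> a (i, j)) \<otimes>\<^bsub>F\<^esub> y j)"
      unfolding W_simps(4)[OF i]
      by (rule F.finsum_cong') (use i xc ac W_comp[OF y] in \<open>auto simp: W_simps(3) F.r_distr\<close>)
    also have "\<dots> = (\<Oplus>\<^bsub>F\<^esub>j\<in>{..<d}. res (\<tau> a (i, j)) \<otimes>\<^bsub>F\<^esub> x j) \<oplus>\<^bsub>F\<^esub>
        (\<Oplus>\<^bsub>F\<^esub>j\<in>{..<d}. res (\<tau> a (i, j)) \<otimes>\<^bsub>F\<^esub> y j)"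
      by (rule F.finsum_addf) (use i xc ac W_comp[OF y] in auto)
    finally show "(a \<odot>\<^bsub>W\<^esub> (x \<oplus>\<^bsub>W\<^esub> y)) i = (a \<odot>\<^bsub>W\<^esub> x \<oplus>\<^bsub>W\<^esub> a \<odot>\<^bsub>W\<^esub> y) i"
      using i by (simp add: W_simps(3,4))
  qed (use a x y W_smult_closed W_add_closed in auto)
next
  fix x assume x: "x \<in> carrier W"
  show "\<one>\<^bsub>A\<^esub> \<odot>\<^bsub>W\<^esub> x = x"
  proof (rule W_eqI)
    fix i assume i: "i < d"
    have "(\<one>\<^bsub>A\<^esub> \<odot>\<^bsub>W\<^esub> x) i = (\<Oplus>\<^bsub>F\<^esub>j\<in>{..<d}. if i = j then x j else \<zero>\<^bsub>F\<^esub>)"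
      unfolding W_simps(4)[OF i] by (rule F.finsum_cong') (use i W_comp[OF x] in \<open>auto simp: \<tau>_one\<close>)
    also have "\<dots> = x i" by (rule F.finsum_delta) (use i W_comp[OF x] in auto)
    finally show "(\<one>\<^bsub>A\<^esub> \<odot>\<^bsub>W\<^esub> x) i = x i" .
  qed (use x W_smult_closed in auto)
qed

sublocale R: algebra_rep K A W
  by (rule algebra_rep.intro[OF K.algebraically_closed_axioms A.assoc_algebra_axioms W_left_module])

lemma W_finsum:
  assumes "finite I" "\<And>k. k \<in> I \<Longrightarrow> f k \<in> carrier W" "i < d"
  shows "(\<Oplus>\<^bsub>W\<^esub>k\<in>I. f k) i = (\<Oplus>\<^bsub>F\<^esub>k\<in>I. f k i)"
  using assms(1,2)
proof (induction I rule: finite_induct)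
  case empty
  then show ?case using assms(3) by (simp add: W_simps(2))
next
  case (insert k I)
  have "(\<Oplus>\<^bsub>W\<^esub>k\<in>insert k I. f k) = f k \<oplus>\<^bsub>W\<^esub> (\<Oplus>\<^bsub>W\<^esub>k\<in>I. f k)"
    by (rule R.V.M.finsum_insert) (use insert in auto)
  moreover have "(\<Oplus>\<^bsub>F\<^esub>k\<in>insert k I. f k i) = f k i \<oplus>\<^bsub>F\<^esub> (\<Oplus>\<^bsub>F\<^esub>k\<in>I. f k i)"
    by (rule F.finsum_insert) (use insert assms(3) W_comp in auto)
  ultimately show ?case using insert assms(3) by (simp add: W_simps(3))
qed

lemma \<tau>_scal: "c \<in> carrier K \<Longrightarrow> i < d \<Longrightarrow> j < d \<Longrightarrow>
    \<tau> (R.scal c) (i, j) = (if i = j then c \<odot>\<^bsub>B\<^esub> \<one>\<^bsub>B\<^esub> else \<zero>\<^bsub>B\<^esub>)"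
  by (simp add: R.scal_def \<tau>_smult \<tau>_one)

lemma W_act:
  assumes "c \<in> carrier K" "v \<in> carrier W" "i < d"
  shows "R.act c v i = res (c \<odot>\<^bsub>B\<^esub> \<one>\<^bsub>B\<^esub>) \<otimes>\<^bsub>F\<^esub> v i"
proof -
  have "R.act c v i = (\<Oplus>\<^bsub>F\<^esub>j\<in>{..<d}. if i = j then res (c \<odot>\<^bsub>B\<^esub> \<one>\<^bsub>B\<^esub>) \<otimes>\<^bsub>F\<^esub> v j else \<zero>\<^bsub>F\<^esub>)"
    unfolding R.act_def W_simps(4)[OF assms(3)]
    by (rule F.finsum_cong') (use assms W_comp in \<open>auto simp: \<tau>_scal\<close>)
  also have "\<dots> = res (c \<odot>\<^bsub>B\<^esub> \<one>\<^bsub>B\<^esub>) \<otimes>\<^bsub>F\<^esub> v i"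
    by (rule F.finsum_delta) (use assms W_comp in auto)
  finally show ?thesis .
qed

lemma res_scalar_zero:
  assumes c: "c \<in> carrier K" and z: "res (c \<odot>\<^bsub>B\<^esub> \<one>\<^bsub>B\<^esub>) = \<zero>\<^bsub>F\<^esub>"
  shows "c = \<zero>\<^bsub>K\<^esub>"
proof (rule ccontr)
  assume "c \<noteq> \<zero>\<^bsub>K\<^esub>"
  then have u: "c \<in> Units K" using c K.field_Units by simp
  have "\<one>\<^bsub>B\<^esub> = (inv\<^bsub>K\<^esub> c \<odot>\<^bsub>B\<^esub> \<one>\<^bsub>B\<^esub>) \<otimes>\<^bsub>B\<^esub> (c \<odot>\<^bsub>B\<^esub> \<one>\<^bsub>B\<^esub>)"
    using u c by (simp add: B.smult_assoc2 B.smult_assoc1[symmetric])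
  then have "\<one>\<^bsub>F\<^esub> = res (inv\<^bsub>K\<^esub> c \<odot>\<^bsub>B\<^esub> \<one>\<^bsub>B\<^esub>) \<otimes>\<^bsub>F\<^esub> res (c \<odot>\<^bsub>B\<^esub> \<one>\<^bsub>B\<^esub>)"
    using u c pr.hom_mult pr.hom_one
    by (metis B.one_closed B.smult_closed K.Units_inv_closed)
  then have "\<one>\<^bsub>F\<^esub> = \<zero>\<^bsub>F\<^esub>" using z u c by simp
  then show False by simp
qed

definition std where
  "std (j :: nat) = (\<lambda>i\<in>{..<d}. if i = j then \<one>\<^bsub>F\<^esub> else \<zero>\<^bsub>F\<^esub>)"

lemma std_closed: "std j \<in> carrier W"
  unfolding W_simps(1) by (simp add: std_def)

lemma std_comp: "i < d \<Longrightarrow> std j i = (if i = j then \<one>\<^bsub>F\<^esub> else \<zero>\<^bsub>F\<^esub>)"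
  by (simp add: std_def)

lemma inj_std: "inj_on std {..<d}"
proof (rule inj_onI)
  fix i j assume "i \<in> {..<d}" "j \<in> {..<d}" "std i = std j"
  then have "std i i = std j i" "i < d" by auto
  then show "i = j" by (auto simp: std_comp split: if_splits)
qed

lemma smult_std:
  assumes "a \<in> carrier A" "i < d" "j < d"
  shows "(a \<odot>\<^bsub>W\<^esub> std j) i = res (\<tau> a (i, j))"
proof -
  have "(a \<odot>\<^bsub>W\<^esub> std j) i = (\<Oplus>\<^bsub>F\<^esub>l\<in>{..<d}. if l = j then res (\<tau> a (i, l)) else \<zero>\<^bsub>F\<^esub>)"
    unfolding W_simps(4)[OF assms(2)]
    by (rule F.finsum_cong') (use assms \<tau>_closed in \<open>auto simp: std_comp\<close>)
  also have "\<dots> = res (\<tau> a (i, j))"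
    by (rule F.finsum_delta) (use assms \<tau>_closed in auto)
  finally show ?thesis .
qed

lemma std_comb:
  assumes c: "\<And>j. j < d \<Longrightarrow> c (std j) \<in> carrier K" and i: "i < d"
  shows "(\<Oplus>\<^bsub>W\<^esub>x\<in>std ` {..<d}. R.act (c x) x) i = res (c (std i) \<odot>\<^bsub>B\<^esub> \<one>\<^bsub>B\<^esub>)"
proof -
  have "(\<Oplus>\<^bsub>W\<^esub>x\<in>std ` {..<d}. R.act (c x) x) = (\<Oplus>\<^bsub>W\<^esub>j\<in>{..<d}. R.act (c (std j)) (std j))"
    by (rule R.V.M.finsum_reindex) (use c std_closed R.L.act_closed inj_std in auto)
  then have "(\<Oplus>\<^bsub>W\<^esub>x\<in>std ` {..<d}. R.act (c x) x) i = (\<Oplus>\<^bsub>F\<^esub>j\<in>{..<d}. R.act (c (std j)) (std j) i)"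
    using W_finsum[of "{..<d}" "\<lambda>j. R.act (c (std j)) (std j)" i] c std_closed R.L.act_closed i by simp
  also have "\<dots> = (\<Oplus>\<^bsub>F\<^esub>j\<in>{..<d}. if i = j then res (c (std j) \<odot>\<^bsub>B\<^esub> \<one>\<^bsub>B\<^esub>) else \<zero>\<^bsub>F\<^esub>)"
    by (rule F.finsum_cong') (use c i std_closed in \<open>auto simp: W_act std_comp\<close>)
  also have "\<dots> = res (c (std i) \<odot>\<^bsub>B\<^esub> \<one>\<^bsub>B\<^esub>)"
    by (rule F.finsum_delta) (use c i in auto)
  finally show ?thesis .
qed

lemma std_basis: "R.L.is_basis (std ` {..<d})"
  unfolding R.L.is_basis_def
proof (intro conjI)
  show "R.L.lindep_free (std ` {..<d})"
    unfolding R.L.lindep_free_def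
  proof (intro ballI impI)
    fix c x assume c: "c \<in> std ` {..<d} \<rightarrow> carrier K"
      "(\<Oplus>\<^bsub>W\<^esub>x\<in>std ` {..<d}. R.act (c x) x) = \<zero>\<^bsub>W\<^esub>" and x: "x \<in> std ` {..<d}"
    then obtain i where i: "i < d" "x = std i" by auto
    have "res (c (std i) \<odot>\<^bsub>B\<^esub> \<one>\<^bsub>B\<^esub>) = \<zero>\<^bsub>F\<^esub>"
      using std_comb[of c i] c i by (auto simp: W_simps(2))
    then show "c x = \<zero>\<^bsub>K\<^esub>" using res_scalar_zero[of "c (std i)"] c(1) i by auto
  qed
  show "R.L.lspan (std ` {..<d}) = carrier W"
  proof
    show "R.L.lspan (std ` {..<d}) \<subseteq> carrier W"
      using std_closed by (auto simp: R.L.lspan_def Pi_iff intro!: R.V.M.finsum_closed R.L.act_closed)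
    show "carrier W \<subseteq> R.L.lspan (std ` {..<d})"
    proof
      fix w assume w: "w \<in> carrier W"
      define k where "k i = (SOME c. c \<in> carrier K \<and> w i = res (c \<odot>\<^bsub>B\<^esub> \<one>\<^bsub>B\<^esub>))" for i
      have k: "k i \<in> carrier K" "w i = res (k i \<odot>\<^bsub>B\<^esub> \<one>\<^bsub>B\<^esub>)" if "i < d" for i
      proof -
        have "\<exists>c. c \<in> carrier K \<and> w i = res (c \<odot>\<^bsub>B\<^esub> \<one>\<^bsub>B\<^esub>)"
          by (rule F_scalar[OF W_comp[OF w that]]) (intro exI conjI)
        from someI_ex[OF this] show "k i \<in> carrier K" "w i = res (k i \<odot>\<^bsub>B\<^esub> \<one>\<^bsub>B\<^esub>)"
          by (simp_all add: k_def)
      qed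
      define c where "c x = k (the_inv_into {..<d} std x)" for x
      have c: "c (std j) = k j" if "j < d" for j
        using that inj_std by (simp add: c_def the_inv_into_f_f)
      have cK: "c \<in> std ` {..<d} \<rightarrow> carrier K" using c k(1) by auto
      have "w = (\<Oplus>\<^bsub>W\<^esub>x\<in>std ` {..<d}. R.act (c x) x)"
      proof (rule W_eqI[OF w])
        show "(\<Oplus>\<^bsub>W\<^esub>x\<in>std ` {..<d}. R.act (c x) x) \<in> carrier W"
          using cK std_closed R.L.act_closed by (auto intro!: R.V.M.finsum_closed)
        fix i assume i: "i < d"
        show "w i = (\<Oplus>\<^bsub>W\<^esub>x\<in>std ` {..<d}. R.act (c x) x) i"
          using std_comb[of c i] c k i by simp
      qed
      then show "w \<in> R.L.lspan (std ` {..<d})"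
        unfolding R.L.lspan_def using cK by (intro CollectI exI[of _ c] conjI)
    qed
  qed
qed (use std_closed in auto)

lemma card_std: "card (std ` {..<d}) = d"
  by (simp add: card_image inj_std)

lemma annihilator_eq: "R.V.annihilator = {a \<in> carrier A. \<forall>i<d. \<forall>j<d. \<tau> a (i, j) \<in> q}"
proof (intro equalityI subsetI)
  fix a assume a: "a \<in> R.V.annihilator"
  then have ac: "a \<in> carrier A" by (simp add: R.V.annihilator_def)
  have "\<tau> a (i, j) \<in> q" if ij: "i < d" "j < d" for i j
  proof -
    have "res (\<tau> a (i, j)) = \<zero>\<^bsub>F\<^esub>"
      using smult_std[OF ac ij] R.V.annihilatorD[OF a std_closed] ij by (simp add: W_simps(2))
    then show ?thesis using res_zero_iff \<tau>_closed[OF ac ij] by simp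
  qed
  then show "a \<in> {a \<in> carrier A. \<forall>i<d. \<forall>j<d. \<tau> a (i, j) \<in> q}" using ac by simp
next
  fix a assume a: "a \<in> {a \<in> carrier A. \<forall>i<d. \<forall>j<d. \<tau> a (i, j) \<in> q}"
  have "a \<odot>\<^bsub>W\<^esub> v = \<zero>\<^bsub>W\<^esub>" if v: "v \<in> carrier W" for v
  proof (rule W_eqI)
    fix i assume i: "i < d"
    have "(a \<odot>\<^bsub>W\<^esub> v) i = (\<Oplus>\<^bsub>F\<^esub>j\<in>{..<d}. \<zero>\<^bsub>F\<^esub>)"
      unfolding W_simps(4)[OF i]
    proof (rule F.finsum_cong')
      fix j assume j: "j \<in> {..<d}"
      have "res (\<tau> a (i, j)) = \<zero>\<^bsub>F\<^esub>" using a i j res_zero_iff \<tau>_closed by simp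
      then show "res (\<tau> a (i, j)) \<otimes>\<^bsub>F\<^esub> v j = \<zero>\<^bsub>F\<^esub>" using W_comp[OF v] j by simp
    qed auto
    then show "(a \<odot>\<^bsub>W\<^esub> v) i = \<zero>\<^bsub>W\<^esub> i" using i by (simp add: W_simps(2))
  qed (use a v W_smult_closed W_zero_closed in auto)
  then show "a \<in> R.V.annihilator" using a by (simp add: R.V.annihilator_def)
qed

text \<open>
  By density the matrix units of the simple evaluation lift to \<open>A\<close>, and the lifts of the first one have trace
  one modulo \<open>q\<close>. This keeps their traces nonzero in \<open>B\<close>.
\<close>

lemma exists_matrix_units_of_trace_one:
  assumes "simple_module A W" "0 < d"
  obtains e where "matrix_units A R.V.annihilator d e"
    "\<And>u. u \<in> carrier A \<Longrightarrow> u \<ominus>\<^bsub>A\<^esub> e 0 0 \<in> R.V.annihilator \<Longrightarrow> trace u \<notin> q"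
proof -
  interpret S: simple_rep K A W
    by (rule simple_rep.intro[OF R.algebra_rep_axioms]) (simp add: simple_rep_axioms_def assms(1))
  obtain e where e: "matrix_units A R.V.annihilator d e" "e 0 0 \<notin> R.V.annihilator"
    "\<And>i j y. i < d \<Longrightarrow> j < d \<Longrightarrow> y \<in> std ` {..<d} \<Longrightarrow> e i j \<odot>\<^bsub>W\<^esub> y = (if y = std j then std i else \<zero>\<^bsub>W\<^esub>)"
    by (rule S.exists_matrix_units[OF std_basis inj_std order_refl assms(2)]) blast
  interpret mu: matrix_units A R.V.annihilator d e by (rule e(1))
  have e00: "e 0 0 \<in> carrier A" using mu.e_closed assms(2) by simp
  have ent: "res (\<tau> (e 0 0) (i, i)) = (if i = 0 then \<one>\<^bsub>F\<^esub> else \<zero>\<^bsub>F\<^esub>)" if i: "i < d" for i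
  proof -
    have "std i = std 0 \<longleftrightarrow> i = 0" using inj_std i assms(2) by (auto simp: inj_on_def)
    moreover have "e 0 0 \<odot>\<^bsub>W\<^esub> std i = (if std i = std 0 then std 0 else \<zero>\<^bsub>W\<^esub>)"
      by (rule e(3)) (use i assms(2) in simp_all)
    ultimately have "(e 0 0 \<odot>\<^bsub>W\<^esub> std i) i = (if i = 0 then \<one>\<^bsub>F\<^esub> else \<zero>\<^bsub>F\<^esub>)"
      using i by (cases "i = 0") (simp_all add: std_comp W_simps(2))
    then show ?thesis using smult_std[OF e00 i i] by simp
  qed
  have "trace u \<notin> q" if u: "u \<in> carrier A" "u \<ominus>\<^bsub>A\<^esub> e 0 0 \<in> R.V.annihilator" for u
  proof
    assume t: "trace u \<in> q"
    have "res (\<tau> u (i, i)) = res (\<tau> (e 0 0) (i, i))" if i: "i < d" for i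
    proof -
      have "\<tau> (u \<ominus>\<^bsub>A\<^esub> e 0 0) (i, i) \<in> q" using u(2) i unfolding annihilator_eq by blast
      then have "\<tau> u (i, i) \<ominus>\<^bsub>B\<^esub> \<tau> (e 0 0) (i, i) \<in> q" using \<tau>_diff[OF u(1) e00 i i] by simp
      then show ?thesis using res_eq_iff[OF \<tau>_closed[OF u(1) i i] \<tau>_closed[OF e00 i i]] by simp
    qed
    then have ent': "res (\<tau> u (i, i)) = (if i = 0 then \<one>\<^bsub>F\<^esub> else \<zero>\<^bsub>F\<^esub>)" if "i < d" for i
      using ent that by simp
    have "res (trace u) = (\<Oplus>\<^bsub>F\<^esub>i\<in>{..<d}. res (\<tau> u (i, i)))"
      unfolding trace_def using u \<tau>_closed by (subst pr.hom_finsum) (auto simp: comp_def)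
    also have "\<dots> = (\<Oplus>\<^bsub>F\<^esub>i\<in>{..<d}. if i = 0 then \<one>\<^bsub>F\<^esub> else \<zero>\<^bsub>F\<^esub>)"
      by (rule F.finsum_cong') (use ent' in auto)
    also have "\<dots> = \<one>\<^bsub>F\<^esub>" by (rule F.finsum_delta) (use assms(2) in auto)
    finally show False using t res_zero_iff[of "trace u"] trace_closed u by simp
  qed
  then show thesis using that e(1) by blast
qed

end

section \<open>The center acts through a field\<close>

lemma (in ring) subring_center: "subring (center R) R"
proof (rule subringI)
  show "center R \<subseteq> carrier R" "\<one> \<in> center R" by (auto simp: center_def)
  show "\<ominus> x \<in> center R" if "x \<in> center R" for x
    using that by (auto simp: center_def l_minus r_minus)
  show "x \<otimes> y \<in> center R" if x: "x \<in> center R" and y: "y \<in> center R" for x y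
  proof -
    have xy: "x \<in> carrier R" "y \<in> carrier R" using x y by (simp_all add: center_def)
    have comm: "x \<otimes> y \<otimes> a = a \<otimes> (x \<otimes> y)" if a: "a \<in> carrier R" for a
    proof -
      have c: "x \<in> carrier R" "y \<in> carrier R" and xa: "x \<otimes> a = a \<otimes> x" and ya: "y \<otimes> a = a \<otimes> y"
        using x y a by (auto simp: center_def)
      have "x \<otimes> y \<otimes> a = x \<otimes> (a \<otimes> y)" using c a ya by (simp add: m_assoc)
      also have "\<dots> = (a \<otimes> x) \<otimes> y" using c a xa by (simp add: m_assoc[symmetric])
      finally show ?thesis using c a by (simp add: m_assoc)
    qed
    show ?thesis unfolding center_def by (intro CollectI conjI ballI comm m_closed xy)
  qed
  show "x \<oplus> y \<in> center R" if "x \<in> center R" "y \<in> center R" for x y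
    using that by (auto simp: center_def l_distr r_distr)
qed

text \<open>
  Nonzero images of central elements act surjectively on \<open>V\<close>, and \<open>V\<close> is finitely generated over the center. In
  a minimal generating family \<open>g\<close>, a relation with a nonzero coefficient at \<open>p0\<close> would make \<open>g p0\<close>
  superfluous: every vector is divisible by this coefficient, and a multiple of the relation removes \<open>g p0\<close> from
  the product. So coefficients are unique, and writing \<open>g p1\<close> as \<open>z u\<close> with \<open>u\<close> expanded over \<open>g\<close> gives the
  inverse of \<open>z\<close> as a coefficient of \<open>u\<close>.
\<close>

lemma central_inverse_mod_annihilator:
  fixes A :: "('a, 'm) ring_scheme" and V :: "('a, 'v) module"
  assumes simple: "simple_module A V" and fin: "module_finite_over_center A"
    and z: "z \<in> center A" "z \<notin> left_module.annihilator A V"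
  obtains z' where "z' \<in> center A" "\<And>v. v \<in> carrier V \<Longrightarrow> z \<odot>\<^bsub>V\<^esub> (z' \<odot>\<^bsub>V\<^esub> v) = v"
proof -
  interpret V: left_module A V using simple by (simp add: simple_module_def)
  note Z = subringE[OF V.R.subring_center]
  have Zc: "x \<in> carrier A" if "x \<in> center A" for x using Z(1) that by blast
  have Zcomm: "x \<odot>\<^bsub>V\<^esub> (a \<odot>\<^bsub>V\<^esub> v) = a \<odot>\<^bsub>V\<^esub> (x \<odot>\<^bsub>V\<^esub> v)"
    if "x \<in> center A" "a \<in> carrier A" "v \<in> carrier V" for x a v
    using that V.smult_assoc[of x a v] V.smult_assoc[of a x v] by (simp add: center_def)
  have surj: "\<exists>v'\<in>carrier V. x \<odot>\<^bsub>V\<^esub> v' = v"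
    if x: "x \<in> center A" "x \<notin> V.annihilator" and v: "v \<in> carrier V" for x v
  proof -
    obtain u where u: "u \<in> carrier V" "x \<odot>\<^bsub>V\<^esub> u \<noteq> \<zero>\<^bsub>V\<^esub>" using x Zc by (auto simp: V.annihilator_def)
    obtain a where a: "a \<in> carrier A" "a \<odot>\<^bsub>V\<^esub> (x \<odot>\<^bsub>V\<^esub> u) = v"
      using simple_module_cyclic[OF simple V.smult_closed[OF Zc[OF x(1)] u(1)] u(2) v] .
    then show ?thesis
      using Zcomm[OF x(1) a(1) u(1)] V.smult_closed[OF a(1) u(1)] by auto
  qed
  obtain v0 where v0: "v0 \<in> carrier V" "v0 \<noteq> \<zero>\<^bsub>V\<^esub>"
    using simple V.M.zero_closed unfolding simple_module_def by blast
  obtain S where S: "finite S" "S \<subseteq> carrier A"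
    "\<And>a. a \<in> carrier A \<Longrightarrow> \<exists>c\<in>S \<rightarrow> center A. a = (\<Oplus>\<^bsub>A\<^esub>s\<in>S. c s \<otimes>\<^bsub>A\<^esub> s)"
    using fin unfolding module_finite_over_center_def by blast
  define g where "g s = s \<odot>\<^bsub>V\<^esub> v0" for s
  have g: "g s \<in> carrier V" if "s \<in> S" for s
    using that S(2) v0 V.smult_closed by (auto simp: g_def)
  define gen where "gen P \<longleftrightarrow> (\<forall>v\<in>carrier V. \<exists>c\<in>P \<rightarrow> center A. v = (\<Oplus>\<^bsub>V\<^esub>p\<in>P. c p \<odot>\<^bsub>V\<^esub> g p))" for P
  have "gen S"
    unfolding gen_def
  proof
    fix v assume v: "v \<in> carrier V"
    obtain a where a: "a \<in> carrier A" "a \<odot>\<^bsub>V\<^esub> v0 = v" using simple_module_cyclic[OF simple v0 v] .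
    obtain c where c: "c \<in> S \<rightarrow> center A" "a = (\<Oplus>\<^bsub>A\<^esub>s\<in>S. c s \<otimes>\<^bsub>A\<^esub> s)" using S(3)[OF a(1)] by blast
    have cc: "c s \<in> carrier A" "s \<in> carrier A" if "s \<in> S" for s using c(1) that Zc S(2) by auto
    have "v = (\<Oplus>\<^bsub>V\<^esub>s\<in>S. (c s \<otimes>\<^bsub>A\<^esub> s) \<odot>\<^bsub>V\<^esub> v0)"
      unfolding a(2)[symmetric] c(2) by (rule V.smult_finsum_left) (use S cc v0 in auto)
    also have "\<dots> = (\<Oplus>\<^bsub>V\<^esub>s\<in>S. c s \<odot>\<^bsub>V\<^esub> g s)"
      by (rule V.M.finsum_cong') (use cc v0 V.smult_closed in \<open>auto simp: g_def V.smult_assoc\<close>)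
    finally show "\<exists>c\<in>S \<rightarrow> center A. v = (\<Oplus>\<^bsub>V\<^esub>p\<in>S. c p \<odot>\<^bsub>V\<^esub> g p)" using c(1) by (intro bexI[of _ c])
  qed
  then obtain P where P: "P \<subseteq> S" "gen P" "\<And>P'. P' \<subseteq> S \<Longrightarrow> gen P' \<Longrightarrow> card P \<le> card P'"
    using ex_has_least_nat[of "\<lambda>P. P \<subseteq> S \<and> gen P" S card] by auto
  have finP: "finite P" using P(1) S(1) finite_subset by blast
  have gP: "g p \<in> carrier V" if "p \<in> P" for p using g that P(1) by blast
  have genP: "\<exists>c. c \<in> P \<rightarrow> center A \<and> v = (\<Oplus>\<^bsub>V\<^esub>p\<in>P. c p \<odot>\<^bsub>V\<^esub> g p)" if "v \<in> carrier V" for v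
    using P(2) that unfolding gen_def by blast
  have comb: "x \<odot>\<^bsub>V\<^esub> (\<Oplus>\<^bsub>V\<^esub>p\<in>P. c p \<odot>\<^bsub>V\<^esub> g p) = (\<Oplus>\<^bsub>V\<^esub>p\<in>P. (x \<otimes>\<^bsub>A\<^esub> c p) \<odot>\<^bsub>V\<^esub> g p)"
    if x: "x \<in> center A" and c: "c \<in> P \<rightarrow> center A" for x c
  proof -
    have cc: "c p \<in> carrier A" if "p \<in> P" for p using c that Zc by auto
    have "x \<odot>\<^bsub>V\<^esub> (\<Oplus>\<^bsub>V\<^esub>p\<in>P. c p \<odot>\<^bsub>V\<^esub> g p) = (\<Oplus>\<^bsub>V\<^esub>p\<in>P. x \<odot>\<^bsub>V\<^esub> (c p \<odot>\<^bsub>V\<^esub> g p))"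
      by (rule V.smult_finsum_right) (use finP cc gP Zc[OF x] V.smult_closed in auto)
    also have "\<dots> = (\<Oplus>\<^bsub>V\<^esub>p\<in>P. (x \<otimes>\<^bsub>A\<^esub> c p) \<odot>\<^bsub>V\<^esub> g p)"
      by (rule V.M.finsum_cong') (use cc gP Zc[OF x] V.smult_closed in \<open>auto simp: V.smult_assoc\<close>)
    finally show ?thesis .
  qed
  have diff: "(\<Oplus>\<^bsub>V\<^esub>p\<in>P. b p \<odot>\<^bsub>V\<^esub> g p) \<ominus>\<^bsub>V\<^esub> (\<Oplus>\<^bsub>V\<^esub>p\<in>P. c p \<odot>\<^bsub>V\<^esub> g p)
      = (\<Oplus>\<^bsub>V\<^esub>p\<in>P. (b p \<ominus>\<^bsub>A\<^esub> c p) \<odot>\<^bsub>V\<^esub> g p)"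
    if b: "b \<in> P \<rightarrow> center A" and c: "c \<in> P \<rightarrow> center A" for b c
  proof -
    have cc: "c p \<in> carrier A" "b p \<in> carrier A" if "p \<in> P" for p using b c that Zc by auto
    have s: "(\<Oplus>\<^bsub>V\<^esub>p\<in>P. c p \<odot>\<^bsub>V\<^esub> g p) \<in> carrier V" "(\<Oplus>\<^bsub>V\<^esub>p\<in>P. (b p \<ominus>\<^bsub>A\<^esub> c p) \<odot>\<^bsub>V\<^esub> g p) \<in> carrier V"
      using cc gP V.smult_closed by (auto intro!: V.M.finsum_closed)
    have "(\<Oplus>\<^bsub>V\<^esub>p\<in>P. (b p \<ominus>\<^bsub>A\<^esub> c p) \<odot>\<^bsub>V\<^esub> g p) \<oplus>\<^bsub>V\<^esub> (\<Oplus>\<^bsub>V\<^esub>p\<in>P. c p \<odot>\<^bsub>V\<^esub> g p)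
        = (\<Oplus>\<^bsub>V\<^esub>p\<in>P. (b p \<ominus>\<^bsub>A\<^esub> c p) \<odot>\<^bsub>V\<^esub> g p \<oplus>\<^bsub>V\<^esub> c p \<odot>\<^bsub>V\<^esub> g p)"
      by (rule V.M.finsum_addf[symmetric]) (use cc gP V.smult_closed in auto)
    also have "\<dots> = (\<Oplus>\<^bsub>V\<^esub>p\<in>P. b p \<odot>\<^bsub>V\<^esub> g p)"
    proof (rule V.M.finsum_cong')
      fix p assume p: "p \<in> P"
      have "(b p \<ominus>\<^bsub>A\<^esub> c p) \<oplus>\<^bsub>A\<^esub> c p = b p"
        using cc[OF p] by (simp add: a_minus_def V.R.a_assoc V.R.l_neg)
      then show "(b p \<ominus>\<^bsub>A\<^esub> c p) \<odot>\<^bsub>V\<^esub> g p \<oplus>\<^bsub>V\<^esub> c p \<odot>\<^bsub>V\<^esub> g p = b p \<odot>\<^bsub>V\<^esub> g p"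
        using cc[OF p] gP[OF p] by (simp add: V.smult_l_distr[symmetric])
    qed (use cc gP V.smult_closed in auto)
    finally have "(\<Oplus>\<^bsub>V\<^esub>p\<in>P. b p \<odot>\<^bsub>V\<^esub> g p)
        = (\<Oplus>\<^bsub>V\<^esub>p\<in>P. (b p \<ominus>\<^bsub>A\<^esub> c p) \<odot>\<^bsub>V\<^esub> g p) \<oplus>\<^bsub>V\<^esub> (\<Oplus>\<^bsub>V\<^esub>p\<in>P. c p \<odot>\<^bsub>V\<^esub> g p)" by simp
    then show ?thesis using s by (simp add: a_minus_def V.M.a_assoc V.M.r_neg)
  qed
  have Zdiff: "x \<ominus>\<^bsub>A\<^esub> y \<in> center A" if "x \<in> center A" "y \<in> center A" for x y
    using that Z(5,7) by (simp add: a_minus_def)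
  have indep: "\<zeta> p0 \<in> V.annihilator"
    if \<zeta>: "\<zeta> \<in> P \<rightarrow> center A" "(\<Oplus>\<^bsub>V\<^esub>p\<in>P. \<zeta> p \<odot>\<^bsub>V\<^esub> g p) = \<zero>\<^bsub>V\<^esub>" and p0: "p0 \<in> P" for \<zeta> p0
  proof (rule ccontr)
    assume na: "\<zeta> p0 \<notin> V.annihilator"
    have \<zeta>0: "\<zeta> p0 \<in> center A" using \<zeta>(1) p0 by auto
    have "gen (P - {p0})"
      unfolding gen_def
    proof
      fix v assume v: "v \<in> carrier V"
      obtain v' where v': "v' \<in> carrier V" "\<zeta> p0 \<odot>\<^bsub>V\<^esub> v' = v" using surj[OF \<zeta>0 na v] by blast
      obtain \<eta> where \<eta>: "\<eta> \<in> P \<rightarrow> center A" "v' = (\<Oplus>\<^bsub>V\<^esub>p\<in>P. \<eta> p \<odot>\<^bsub>V\<^esub> g p)" using genP[OF v'(1)] by blast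
      have \<eta>0: "\<eta> p0 \<in> center A" using \<eta>(1) p0 by auto
      \<comment> \<open>\<open>\<zeta> p0\<close> times the expansion of \<open>v'\<close>, minus \<open>\<eta> p0\<close> times the relation\<close>
      define c where "c p = \<zeta> p0 \<otimes>\<^bsub>A\<^esub> \<eta> p \<ominus>\<^bsub>A\<^esub> \<eta> p0 \<otimes>\<^bsub>A\<^esub> \<zeta> p" for p
      have cP: "c \<in> P \<rightarrow> center A" using Zdiff Z(6) \<eta>(1) \<zeta>(1) \<zeta>0 \<eta>0 by (auto simp: c_def Pi_iff)
      have cg: "c p \<odot>\<^bsub>V\<^esub> g p \<in> carrier V" if "p \<in> P" for p
        using cP that by (intro V.smult_closed Zc gP) auto
      have "v = \<zeta> p0 \<odot>\<^bsub>V\<^esub> v' \<ominus>\<^bsub>V\<^esub> \<eta> p0 \<odot>\<^bsub>V\<^esub> \<zero>\<^bsub>V\<^esub>"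
        using v'(2) v V.smult_zero_right[OF Zc[OF \<eta>0]] by (simp add: a_minus_def)
      also have "\<dots> = (\<Oplus>\<^bsub>V\<^esub>p\<in>P. c p \<odot>\<^bsub>V\<^esub> g p)"
        unfolding \<eta>(2) \<zeta>(2)[symmetric] comb[OF \<zeta>0 \<eta>(1)] comb[OF \<eta>0 \<zeta>(1)] c_def
        by (rule diff) (use Z(6) \<eta>(1) \<zeta>(1) \<zeta>0 \<eta>0 in \<open>auto simp: Pi_iff\<close>)
      also have "\<dots> = (\<Oplus>\<^bsub>V\<^esub>p\<in>insert p0 (P - {p0}). c p \<odot>\<^bsub>V\<^esub> g p)"
        using p0 by (simp add: insert_absorb)
      also have "\<dots> = c p0 \<odot>\<^bsub>V\<^esub> g p0 \<oplus>\<^bsub>V\<^esub> (\<Oplus>\<^bsub>V\<^esub>p\<in>P - {p0}. c p \<odot>\<^bsub>V\<^esub> g p)"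
        by (rule V.M.finsum_insert) (use finP p0 cg in auto)
      also have "c p0 = \<zero>\<^bsub>A\<^esub>"
      proof -
        have "\<zeta> p0 \<otimes>\<^bsub>A\<^esub> \<eta> p0 = \<eta> p0 \<otimes>\<^bsub>A\<^esub> \<zeta> p0"
          using \<zeta>0 Zc[OF \<eta>0] unfolding center_def by blast
        then show ?thesis using Zc[OF \<zeta>0] Zc[OF \<eta>0] by (simp add: c_def a_minus_def V.R.r_neg)
      qed
      finally have "v = (\<Oplus>\<^bsub>V\<^esub>p\<in>P - {p0}. c p \<odot>\<^bsub>V\<^esub> g p)"
        using gP[OF p0] cg by (simp add: V.smult_zero_left V.M.finsum_closed Pi_iff)
      moreover have "c \<in> P - {p0} \<rightarrow> center A" using cP by auto
      ultimately show "\<exists>c\<in>P - {p0} \<rightarrow> center A. v = (\<Oplus>\<^bsub>V\<^esub>p\<in>P - {p0}. c p \<odot>\<^bsub>V\<^esub> g p)" by (rule bexI)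
    qed
    then have "card P \<le> card (P - {p0})" using P(1,3) by blast
    then show False using p0 finP card_Diff1_less by fastforce
  qed
  have "P \<noteq> {}"
  proof
    assume "P = {}"
    then show False using genP[OF v0(1)] v0(2) by simp
  qed
  then obtain p1 where p1: "p1 \<in> P" by blast
  obtain u where u: "u \<in> carrier V" "z \<odot>\<^bsub>V\<^esub> u = g p1" using surj[OF z gP[OF p1]] by blast
  obtain \<eta> where \<eta>: "\<eta> \<in> P \<rightarrow> center A" "u = (\<Oplus>\<^bsub>V\<^esub>p\<in>P. \<eta> p \<odot>\<^bsub>V\<^esub> g p)" using genP[OF u(1)] by blast
  define b where "b p = (if p = p1 then \<one>\<^bsub>A\<^esub> else \<zero>\<^bsub>A\<^esub>)" for p
  have b: "b \<in> P \<rightarrow> center A" using Z(2,3) by (auto simp: b_def)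
  have z\<eta>: "(\<lambda>p. z \<otimes>\<^bsub>A\<^esub> \<eta> p) \<in> P \<rightarrow> center A" using Z(6) z(1) \<eta>(1) by auto
  have "(\<Oplus>\<^bsub>V\<^esub>p\<in>P. b p \<odot>\<^bsub>V\<^esub> g p) = (\<Oplus>\<^bsub>V\<^esub>p\<in>P. if p = p1 then g p else \<zero>\<^bsub>V\<^esub>)"
    by (rule V.M.finsum_cong') (use gP in \<open>auto simp: b_def V.smult_one V.smult_zero_left\<close>)
  also have "\<dots> = g p1" by (rule V.M.finsum_delta) (use finP p1 gP in auto)
  finally have bsum: "(\<Oplus>\<^bsub>V\<^esub>p\<in>P. b p \<odot>\<^bsub>V\<^esub> g p) = g p1" .
  have "(\<Oplus>\<^bsub>V\<^esub>p\<in>P. (z \<otimes>\<^bsub>A\<^esub> \<eta> p \<ominus>\<^bsub>A\<^esub> b p) \<odot>\<^bsub>V\<^esub> g p) = z \<odot>\<^bsub>V\<^esub> u \<ominus>\<^bsub>V\<^esub> g p1"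
    unfolding diff[OF z\<eta> b, symmetric] bsum \<eta>(2) comb[OF z(1) \<eta>(1)] ..
  also have "\<dots> = \<zero>\<^bsub>V\<^esub>" using u gP[OF p1] by (simp add: V.M.diff_eq_zero_iff)
  finally have "z \<otimes>\<^bsub>A\<^esub> \<eta> p1 \<ominus>\<^bsub>A\<^esub> b p1 \<in> V.annihilator"
    by (intro indep[of "\<lambda>p. z \<otimes>\<^bsub>A\<^esub> \<eta> p \<ominus>\<^bsub>A\<^esub> b p"]) (use p1 Zdiff z\<eta> b in auto)
  moreover have \<eta>1: "\<eta> p1 \<in> center A" using \<eta>(1) p1 by auto
  ultimately have "(z \<otimes>\<^bsub>A\<^esub> \<eta> p1) \<odot>\<^bsub>V\<^esub> v = v" if "v \<in> carrier V" for v
    using that Zc[OF z(1)] Zc[OF \<eta>1] by (simp add: V.annihilator_diff_iff b_def V.smult_one)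
  then show thesis
    using that[OF \<eta>1] Zc[OF z(1)] Zc[OF \<eta>1] by (simp add: V.smult_assoc)
qed

section \<open>Central elements from dual bases\<close>

lemma (in abelian_monoid) finsum_cartesian:
  assumes "finite I" "finite J" "\<And>i j. i \<in> I \<Longrightarrow> j \<in> J \<Longrightarrow> f i j \<in> carrier G"
  shows "(\<Oplus>p\<in>I \<times> J. f (fst p) (snd p)) = (\<Oplus>i\<in>I. \<Oplus>j\<in>J. f i j)"
  using assms(1,3)
proof (induction I rule: finite_induct)
  case (insert i I)
  have "(\<Oplus>p\<in>insert i I \<times> J. f (fst p) (snd p)) = (\<Oplus>p\<in>(Pair i ` J) \<union> I \<times> J. f (fst p) (snd p))"
    by (rule arg_cong[where f = "finsum G _"]) auto
  also have "\<dots> = (\<Oplus>p\<in>Pair i ` J. f (fst p) (snd p)) \<oplus> (\<Oplus>p\<in>I \<times> J. f (fst p) (snd p))"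
    by (rule finsum_Un_disjoint) (use insert assms(2) in auto)
  also have "(\<Oplus>p\<in>Pair i ` J. f (fst p) (snd p)) = (\<Oplus>j\<in>J. f i j)"
    by (subst finsum_reindex) (use insert in \<open>auto simp: inj_on_def\<close>)
  also have "(\<Oplus>j\<in>J. f i j) \<oplus> (\<Oplus>p\<in>I \<times> J. f (fst p) (snd p)) = (\<Oplus>i\<in>insert i I. \<Oplus>j\<in>J. f i j)"
    using insert by (subst finsum_insert) (auto intro!: finsum_closed)
  finally show ?case .
qed simp

locale domain_matrix_rep = matrix_rep + BD: domain B
begin

abbreviation Sq where "Sq \<equiv> {..<d} \<times> {..<d}"

text \<open>
  Orthogonality of \<open>d\<^sup>2\<close> matrices to \<open>d\<^sup>2\<close> matrices is turned into the completeness relation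
  \<open>\<Sum>\<^sub>p c\<^sub>p \<otimes> e\<^sub>p = \<delta> \<cdot> flip\<close>, stated in entries. The factor \<open>\<delta>\<close> is the trace of a lift of \<open>e\<^sub>0\<^sub>0\<close>.
\<close>

lemma \<tau>_dual_basis:
  assumes mu: "matrix_units A I d e"
    and nz: "\<And>u. u \<in> carrier A \<Longrightarrow> u \<ominus>\<^bsub>A\<^esub> e 0 0 \<in> I \<Longrightarrow> trace u \<noteq> \<zero>\<^bsub>B\<^esub>"
  obtains c \<delta> where "\<delta> \<in> carrier B" "\<delta> \<noteq> \<zero>\<^bsub>B\<^esub>" "\<And>p. p \<in> Sq \<Longrightarrow> c p \<in> carrier A"
    "\<And>p. p \<in> Sq \<Longrightarrow> c p \<ominus>\<^bsub>A\<^esub> e (snd p) (fst p) \<in> I"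
    "\<And>t s m r. t < d \<Longrightarrow> s < d \<Longrightarrow> m < d \<Longrightarrow> r < d \<Longrightarrow>
      (\<Oplus>\<^bsub>B\<^esub>p\<in>Sq. \<tau> (c p) (t, s) \<otimes>\<^bsub>B\<^esub> \<tau> (e (fst p) (snd p)) (m, r)) = (if m = s \<and> r = t then \<delta> else \<zero>\<^bsub>B\<^esub>)"
proof -
  interpret mu: matrix_units A I d e by (rule mu)
  show thesis
  proof (rule mu.dual_basis[OF B.M.abelian_group_axioms trace_closed trace_add trace_comm])
    fix u c assume u: "u \<in> carrier A" "u \<ominus>\<^bsub>A\<^esub> e 0 0 \<in> I"
      and c: "\<And>p. p \<in> Sq \<Longrightarrow> c p \<in> carrier A" "\<And>p. p \<in> Sq \<Longrightarrow> c p \<ominus>\<^bsub>A\<^esub> e (snd p) (fst p) \<in> I"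
      and dual: "\<And>p r. p \<in> Sq \<Longrightarrow> r \<in> Sq \<Longrightarrow>
        trace (c p \<otimes>\<^bsub>A\<^esub> e (fst r) (snd r)) = (if p = r then trace u else \<zero>\<^bsub>B\<^esub>)"
    have ec: "e (fst p) (snd p) \<in> carrier A" if "p \<in> Sq" for p using that mu.e_closed by auto
    define x where "x r k = \<tau> (e (fst r) (snd r)) k" for r k
    define y where "y p k = \<tau> (c p) (snd k, fst k)" for p k
    have xc: "x r k \<in> carrier B" if "r \<in> Sq" "k \<in> Sq" for r k
      using that \<tau>_closed[OF ec[OF that(1)], of "fst k" "snd k"] by (auto simp: x_def)
    have yc: "y r k \<in> carrier B" if "r \<in> Sq" "k \<in> Sq" for r k
      using that \<tau>_closed[OF c(1)[OF that(1)], of "snd k" "fst k"] by (auto simp: y_def)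
    have pairing: "(\<Oplus>\<^bsub>B\<^esub>k\<in>Sq. y p k \<otimes>\<^bsub>B\<^esub> x r k) = (if p = r then trace u else \<zero>\<^bsub>B\<^esub>)"
      if p: "p \<in> Sq" and r: "r \<in> Sq" for p r
    proof -
      have "(\<Oplus>\<^bsub>B\<^esub>k\<in>Sq. y p k \<otimes>\<^bsub>B\<^esub> x r k)
          = (\<Oplus>\<^bsub>B\<^esub>k\<in>Sq. (\<lambda>l i. \<tau> (c p) (i, l) \<otimes>\<^bsub>B\<^esub> \<tau> (e (fst r) (snd r)) (l, i)) (fst k) (snd k))"
        by (simp add: x_def y_def)
      also have "\<dots> = (\<Oplus>\<^bsub>B\<^esub>l\<in>{..<d}. \<Oplus>\<^bsub>B\<^esub>i\<in>{..<d}. \<tau> (c p) (i, l) \<otimes>\<^bsub>B\<^esub> \<tau> (e (fst r) (snd r)) (l, i))"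
        by (rule B.finsum_cartesian) (use c(1)[OF p] ec[OF r] \<tau>_closed in auto)
      also have "\<dots> = (\<Oplus>\<^bsub>B\<^esub>i\<in>{..<d}. \<Oplus>\<^bsub>B\<^esub>l\<in>{..<d}. \<tau> (c p) (i, l) \<otimes>\<^bsub>B\<^esub> \<tau> (e (fst r) (snd r)) (l, i))"
        by (rule B.finsum_swap) (use c(1)[OF p] ec[OF r] \<tau>_closed in auto)
      also have "\<dots> = trace (c p \<otimes>\<^bsub>A\<^esub> e (fst r) (snd r))"
        by (rule trace_mult[symmetric]) (use c(1)[OF p] ec[OF r] in auto)
      finally show ?thesis using dual[OF p r] by simp
    qed
    have flip: "(\<Oplus>\<^bsub>B\<^esub>p\<in>Sq. y p k \<otimes>\<^bsub>B\<^esub> x p l) = (if k = l then trace u else \<zero>\<^bsub>B\<^esub>)"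
      if "k \<in> Sq" "l \<in> Sq" for k l
      by (rule BD.biorthogonal_flip[OF _ trace_closed[OF u(1)] nz[OF u] xc yc pairing that]) simp_all
    show thesis
    proof (rule that[OF trace_closed[OF u(1)] nz[OF u] c])
      show "(\<Oplus>\<^bsub>B\<^esub>p\<in>Sq. \<tau> (c p) (t, s) \<otimes>\<^bsub>B\<^esub> \<tau> (e (fst p) (snd p)) (m, r))
          = (if m = s \<and> r = t then trace u else \<zero>\<^bsub>B\<^esub>)" if "t < d" "s < d" "m < d" "r < d" for t s m r
        using flip[of "(s, t)" "(m, r)"] that by (auto simp: x_def y_def)
    qed
  qed
qed

text \<open>
  Moving \<open>z\<close> through the units in \<open>\<Sum>\<^sub>p c\<^sub>p \<otimes> z e\<^sub>p = \<Sum>\<^sub>p c\<^sub>p \<otimes> e\<^sub>p z\<close> and using completeness on both sides shows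
  that, up to \<open>\<delta>\<close>, off-diagonal entries of \<open>\<tau> z\<close> vanish and diagonal entries agree.
\<close>

lemma center_scalar:
  assumes mu: "matrix_units A I d e"
    and nz: "\<And>u. u \<in> carrier A \<Longrightarrow> u \<ominus>\<^bsub>A\<^esub> e 0 0 \<in> I \<Longrightarrow> trace u \<noteq> \<zero>\<^bsub>B\<^esub>"
    and z: "z \<in> center A"
  shows "\<exists>f\<in>carrier B. \<tau> z = scalar_mat B d f"
proof -
  interpret mu: matrix_units A I d e by (rule mu)
  obtain c \<delta> where \<delta>: "\<delta> \<in> carrier B" "\<delta> \<noteq> \<zero>\<^bsub>B\<^esub>" and c: "\<And>p. p \<in> Sq \<Longrightarrow> c p \<in> carrier A"
    and dual: "\<And>t s m r. t < d \<Longrightarrow> s < d \<Longrightarrow> m < d \<Longrightarrow> r < d \<Longrightarrow>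
      (\<Oplus>\<^bsub>B\<^esub>p\<in>Sq. \<tau> (c p) (t, s) \<otimes>\<^bsub>B\<^esub> \<tau> (e (fst p) (snd p)) (m, r)) = (if m = s \<and> r = t then \<delta> else \<zero>\<^bsub>B\<^esub>)"
    by (rule \<tau>_dual_basis[OF mu nz]) auto
  have zc: "z \<in> carrier A" using z by (simp add: center_def)
  have ec: "e (fst p) (snd p) \<in> carrier A" if "p \<in> Sq" for p using that mu.e_closed by auto
  have tz: "\<tau> z (i, j) \<in> carrier B" if "i < d" "j < d" for i j using \<tau>_closed[OF zc that] .
  have te: "\<tau> (e (fst p) (snd p)) (i, j) \<in> carrier B" if "p \<in> Sq" "i < d" "j < d" for p i j
    using \<tau>_closed[OF ec[OF that(1)] that(2,3)] .
  have tc: "\<tau> (c p) (i, j) \<in> carrier B" if "p \<in> Sq" "i < d" "j < d" for p i j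
    using \<tau>_closed[OF c[OF that(1)] that(2,3)] .
  have key: "(if r = t then \<tau> z (m, s) \<otimes>\<^bsub>B\<^esub> \<delta> else \<zero>\<^bsub>B\<^esub>) = (if m = s then \<tau> z (t, r) \<otimes>\<^bsub>B\<^esub> \<delta> else \<zero>\<^bsub>B\<^esub>)"
    if b: "t < d" "s < d" "m < d" "r < d" for t s m r
  proof -
    have L: "(\<Oplus>\<^bsub>B\<^esub>p\<in>Sq. \<tau> (c p) (t, s) \<otimes>\<^bsub>B\<^esub> \<tau> (z \<otimes>\<^bsub>A\<^esub> e (fst p) (snd p)) (m, r))
        = (if r = t then \<tau> z (m, s) \<otimes>\<^bsub>B\<^esub> \<delta> else \<zero>\<^bsub>B\<^esub>)"
    proof -
      have "(\<Oplus>\<^bsub>B\<^esub>p\<in>Sq. \<tau> (c p) (t, s) \<otimes>\<^bsub>B\<^esub> \<tau> (z \<otimes>\<^bsub>A\<^esub> e (fst p) (snd p)) (m, r))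
          = (\<Oplus>\<^bsub>B\<^esub>p\<in>Sq. \<Oplus>\<^bsub>B\<^esub>l\<in>{..<d}. \<tau> z (m, l) \<otimes>\<^bsub>B\<^esub> (\<tau> (c p) (t, s) \<otimes>\<^bsub>B\<^esub> \<tau> (e (fst p) (snd p)) (l, r)))"
      proof (rule B.finsum_cong')
        fix p assume p: "p \<in> Sq"
        have "\<tau> (c p) (t, s) \<otimes>\<^bsub>B\<^esub> \<tau> (z \<otimes>\<^bsub>A\<^esub> e (fst p) (snd p)) (m, r)
            = (\<Oplus>\<^bsub>B\<^esub>l\<in>{..<d}. \<tau> (c p) (t, s) \<otimes>\<^bsub>B\<^esub> (\<tau> z (m, l) \<otimes>\<^bsub>B\<^esub> \<tau> (e (fst p) (snd p)) (l, r)))"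
          unfolding \<tau>_mult[OF zc ec[OF p] b(3,4)]
          by (rule B.finsum_rdistr) (use tc[OF p] tz te[OF p] b in auto)
        also have "\<dots> = (\<Oplus>\<^bsub>B\<^esub>l\<in>{..<d}. \<tau> z (m, l) \<otimes>\<^bsub>B\<^esub> (\<tau> (c p) (t, s) \<otimes>\<^bsub>B\<^esub> \<tau> (e (fst p) (snd p)) (l, r)))"
          by (rule B.finsum_cong') (use tc[OF p] tz te[OF p] b in \<open>auto simp: B.m_lcomm\<close>)
        finally show "\<tau> (c p) (t, s) \<otimes>\<^bsub>B\<^esub> \<tau> (z \<otimes>\<^bsub>A\<^esub> e (fst p) (snd p)) (m, r)
            = (\<Oplus>\<^bsub>B\<^esub>l\<in>{..<d}. \<tau> z (m, l) \<otimes>\<^bsub>B\<^esub> (\<tau> (c p) (t, s) \<otimes>\<^bsub>B\<^esub> \<tau> (e (fst p) (snd p)) (l, r)))" .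
      qed (use tc tz te b in \<open>auto intro!: B.finsum_closed simp del: mem_Sigma_iff\<close>)
      also have "\<dots> = (\<Oplus>\<^bsub>B\<^esub>l\<in>{..<d}. \<Oplus>\<^bsub>B\<^esub>p\<in>Sq. \<tau> z (m, l) \<otimes>\<^bsub>B\<^esub> (\<tau> (c p) (t, s) \<otimes>\<^bsub>B\<^esub> \<tau> (e (fst p) (snd p)) (l, r)))"
        by (rule B.finsum_swap) (use tc tz te b in \<open>auto simp del: mem_Sigma_iff\<close>)
      also have "\<dots> = (\<Oplus>\<^bsub>B\<^esub>l\<in>{..<d}. if l = s then (if r = t then \<tau> z (m, l) \<otimes>\<^bsub>B\<^esub> \<delta> else \<zero>\<^bsub>B\<^esub>) else \<zero>\<^bsub>B\<^esub>)"
      proof (rule B.finsum_cong')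
        fix l assume l: "l \<in> {..<d}"
        have "(\<Oplus>\<^bsub>B\<^esub>p\<in>Sq. \<tau> z (m, l) \<otimes>\<^bsub>B\<^esub> (\<tau> (c p) (t, s) \<otimes>\<^bsub>B\<^esub> \<tau> (e (fst p) (snd p)) (l, r)))
            = \<tau> z (m, l) \<otimes>\<^bsub>B\<^esub> (\<Oplus>\<^bsub>B\<^esub>p\<in>Sq. \<tau> (c p) (t, s) \<otimes>\<^bsub>B\<^esub> \<tau> (e (fst p) (snd p)) (l, r))"
          by (rule B.finsum_rdistr[symmetric]) (use tc tz te b l in \<open>auto simp del: mem_Sigma_iff\<close>)
        then show "(\<Oplus>\<^bsub>B\<^esub>p\<in>Sq. \<tau> z (m, l) \<otimes>\<^bsub>B\<^esub> (\<tau> (c p) (t, s) \<otimes>\<^bsub>B\<^esub> \<tau> (e (fst p) (snd p)) (l, r)))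
            = (if l = s then (if r = t then \<tau> z (m, l) \<otimes>\<^bsub>B\<^esub> \<delta> else \<zero>\<^bsub>B\<^esub>) else \<zero>\<^bsub>B\<^esub>)"
          using dual[OF b(1,2), of l r] b l tz by auto
      qed (use tz \<delta> b in auto)
      also have "\<dots> = (if r = t then \<tau> z (m, s) \<otimes>\<^bsub>B\<^esub> \<delta> else \<zero>\<^bsub>B\<^esub>)"
        by (rule B.finsum_delta) (use b tz \<delta> in auto)
      finally show ?thesis .
    qed
    have R: "(\<Oplus>\<^bsub>B\<^esub>p\<in>Sq. \<tau> (c p) (t, s) \<otimes>\<^bsub>B\<^esub> \<tau> (e (fst p) (snd p) \<otimes>\<^bsub>A\<^esub> z) (m, r))
        = (if m = s then \<tau> z (t, r) \<otimes>\<^bsub>B\<^esub> \<delta> else \<zero>\<^bsub>B\<^esub>)"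
    proof -
      have "(\<Oplus>\<^bsub>B\<^esub>p\<in>Sq. \<tau> (c p) (t, s) \<otimes>\<^bsub>B\<^esub> \<tau> (e (fst p) (snd p) \<otimes>\<^bsub>A\<^esub> z) (m, r))
          = (\<Oplus>\<^bsub>B\<^esub>p\<in>Sq. \<Oplus>\<^bsub>B\<^esub>l\<in>{..<d}. \<tau> z (l, r) \<otimes>\<^bsub>B\<^esub> (\<tau> (c p) (t, s) \<otimes>\<^bsub>B\<^esub> \<tau> (e (fst p) (snd p)) (m, l)))"
      proof (rule B.finsum_cong')
        fix p assume p: "p \<in> Sq"
        have "\<tau> (c p) (t, s) \<otimes>\<^bsub>B\<^esub> \<tau> (e (fst p) (snd p) \<otimes>\<^bsub>A\<^esub> z) (m, r)
            = (\<Oplus>\<^bsub>B\<^esub>l\<in>{..<d}. \<tau> (c p) (t, s) \<otimes>\<^bsub>B\<^esub> (\<tau> (e (fst p) (snd p)) (m, l) \<otimes>\<^bsub>B\<^esub> \<tau> z (l, r)))"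
          unfolding \<tau>_mult[OF ec[OF p] zc b(3,4)]
          by (rule B.finsum_rdistr) (use tc[OF p] tz te[OF p] b in auto)
        also have "\<dots> = (\<Oplus>\<^bsub>B\<^esub>l\<in>{..<d}. \<tau> z (l, r) \<otimes>\<^bsub>B\<^esub> (\<tau> (c p) (t, s) \<otimes>\<^bsub>B\<^esub> \<tau> (e (fst p) (snd p)) (m, l)))"
          by (rule B.finsum_cong') (use tc[OF p] tz te[OF p] b in \<open>auto simp: B.m_ac\<close>)
        finally show "\<tau> (c p) (t, s) \<otimes>\<^bsub>B\<^esub> \<tau> (e (fst p) (snd p) \<otimes>\<^bsub>A\<^esub> z) (m, r)
            = (\<Oplus>\<^bsub>B\<^esub>l\<in>{..<d}. \<tau> z (l, r) \<otimes>\<^bsub>B\<^esub> (\<tau> (c p) (t, s) \<otimes>\<^bsub>B\<^esub> \<tau> (e (fst p) (snd p)) (m, l)))" .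
      qed (use tc tz te b in \<open>auto intro!: B.finsum_closed simp del: mem_Sigma_iff\<close>)
      also have "\<dots> = (\<Oplus>\<^bsub>B\<^esub>l\<in>{..<d}. \<Oplus>\<^bsub>B\<^esub>p\<in>Sq. \<tau> z (l, r) \<otimes>\<^bsub>B\<^esub> (\<tau> (c p) (t, s) \<otimes>\<^bsub>B\<^esub> \<tau> (e (fst p) (snd p)) (m, l)))"
        by (rule B.finsum_swap) (use tc tz te b in \<open>auto simp del: mem_Sigma_iff\<close>)
      also have "\<dots> = (\<Oplus>\<^bsub>B\<^esub>l\<in>{..<d}. if l = t then (if m = s then \<tau> z (l, r) \<otimes>\<^bsub>B\<^esub> \<delta> else \<zero>\<^bsub>B\<^esub>) else \<zero>\<^bsub>B\<^esub>)"
      proof (rule B.finsum_cong')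
        fix l assume l: "l \<in> {..<d}"
        have "(\<Oplus>\<^bsub>B\<^esub>p\<in>Sq. \<tau> z (l, r) \<otimes>\<^bsub>B\<^esub> (\<tau> (c p) (t, s) \<otimes>\<^bsub>B\<^esub> \<tau> (e (fst p) (snd p)) (m, l)))
            = \<tau> z (l, r) \<otimes>\<^bsub>B\<^esub> (\<Oplus>\<^bsub>B\<^esub>p\<in>Sq. \<tau> (c p) (t, s) \<otimes>\<^bsub>B\<^esub> \<tau> (e (fst p) (snd p)) (m, l))"
          by (rule B.finsum_rdistr[symmetric]) (use tc tz te b l in \<open>auto simp del: mem_Sigma_iff\<close>)
        then show "(\<Oplus>\<^bsub>B\<^esub>p\<in>Sq. \<tau> z (l, r) \<otimes>\<^bsub>B\<^esub> (\<tau> (c p) (t, s) \<otimes>\<^bsub>B\<^esub> \<tau> (e (fst p) (snd p)) (m, l)))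
            = (if l = t then (if m = s then \<tau> z (l, r) \<otimes>\<^bsub>B\<^esub> \<delta> else \<zero>\<^bsub>B\<^esub>) else \<zero>\<^bsub>B\<^esub>)"
          using dual[OF b(1,2), of m l] b l tz by auto
      qed (use tz \<delta> b in auto)
      also have "\<dots> = (if m = s then \<tau> z (t, r) \<otimes>\<^bsub>B\<^esub> \<delta> else \<zero>\<^bsub>B\<^esub>)"
        by (rule B.finsum_delta) (use b tz \<delta> in auto)
      finally show ?thesis .
    qed
    have "(\<Oplus>\<^bsub>B\<^esub>p\<in>Sq. \<tau> (c p) (t, s) \<otimes>\<^bsub>B\<^esub> \<tau> (z \<otimes>\<^bsub>A\<^esub> e (fst p) (snd p)) (m, r))
        = (\<Oplus>\<^bsub>B\<^esub>p\<in>Sq. \<tau> (c p) (t, s) \<otimes>\<^bsub>B\<^esub> \<tau> (e (fst p) (snd p) \<otimes>\<^bsub>A\<^esub> z) (m, r))"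
    proof (rule B.finsum_cong')
      fix p assume p: "p \<in> Sq"
      have "z \<otimes>\<^bsub>A\<^esub> e (fst p) (snd p) = e (fst p) (snd p) \<otimes>\<^bsub>A\<^esub> z"
        using z ec[OF p] by (simp add: center_def)
      then show "\<tau> (c p) (t, s) \<otimes>\<^bsub>B\<^esub> \<tau> (z \<otimes>\<^bsub>A\<^esub> e (fst p) (snd p)) (m, r)
          = \<tau> (c p) (t, s) \<otimes>\<^bsub>B\<^esub> \<tau> (e (fst p) (snd p) \<otimes>\<^bsub>A\<^esub> z) (m, r)" by simp
    next
      show "(\<lambda>p. \<tau> (c p) (t, s) \<otimes>\<^bsub>B\<^esub> \<tau> (e (fst p) (snd p) \<otimes>\<^bsub>A\<^esub> z) (m, r)) \<in> Sq \<rightarrow> carrier B"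
      proof
        fix p assume p: "p \<in> Sq"
        show "\<tau> (c p) (t, s) \<otimes>\<^bsub>B\<^esub> \<tau> (e (fst p) (snd p) \<otimes>\<^bsub>A\<^esub> z) (m, r) \<in> carrier B"
          using tc[OF p] b \<tau>_closed[of "e (fst p) (snd p) \<otimes>\<^bsub>A\<^esub> z" m r] ec[OF p] zc by simp
      qed
    qed simp
    then show ?thesis using L R by simp
  qed
  have d: "0 < d" by (rule mu.d_pos)
  have offdiag: "\<tau> z (m, s) = \<zero>\<^bsub>B\<^esub>" if "m < d" "s < d" "m \<noteq> s" for m s
    using key[of 0 s m 0] that d \<delta> tz[of m s] BD.integral[of "\<tau> z (m, s)" \<delta>] by auto
  have diag: "\<tau> z (m, m) = \<tau> z (0, 0)" if "m < d" for m
    using key[of 0 m m 0] that d \<delta> tz[of m m] tz[of 0 0] BD.m_rcancel[of \<delta> "\<tau> z (m, m)" "\<tau> z (0, 0)"]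
    by auto
  have "\<tau> z = scalar_mat B d (\<tau> z (0, 0))"
  proof (rule PiE_ext)
    show "\<tau> z \<in> {..<d} \<times> {..<d} \<rightarrow>\<^sub>E carrier B" by (rule \<tau>_carrier[OF zc])
    show "scalar_mat B d (\<tau> z (0, 0)) \<in> {..<d} \<times> {..<d} \<rightarrow>\<^sub>E carrier B"
      using tz[OF d d] by (auto simp: scalar_mat_def)
    fix p assume "p \<in> {..<d} \<times> {..<d}"
    then obtain i j where "p = (i, j)" "i < d" "j < d" by auto
    then show "\<tau> z p = scalar_mat B d (\<tau> z (0, 0)) p"
      using offdiag diag[of j] by (auto simp: scalar_mat_def)
  qed
  then show ?thesis using tz[OF d d] by blast
qed

text \<open>
  The Casimir construction: completeness contracts \<open>\<Sum>\<^sub>p x\<^sub>p a c\<^sub>p\<close> to the trace of \<open>a\<close>.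
\<close>

lemma \<tau>_casimir:
  assumes ec: "\<And>p. p \<in> Sq \<Longrightarrow> x p \<in> carrier A" and c: "\<And>p. p \<in> Sq \<Longrightarrow> c p \<in> carrier A"
    and \<delta>: "\<delta> \<in> carrier B"
    and dual: "\<And>t s m r. t < d \<Longrightarrow> s < d \<Longrightarrow> m < d \<Longrightarrow> r < d \<Longrightarrow>
      (\<Oplus>\<^bsub>B\<^esub>p\<in>Sq. \<tau> (c p) (t, s) \<otimes>\<^bsub>B\<^esub> \<tau> (x p) (m, r)) = (if m = s \<and> r = t then \<delta> else \<zero>\<^bsub>B\<^esub>)"
    and a: "a \<in> carrier A"
  shows "\<tau> (\<Oplus>\<^bsub>A\<^esub>p\<in>Sq. x p \<otimes>\<^bsub>A\<^esub> a \<otimes>\<^bsub>A\<^esub> c p) = scalar_mat B d (trace a \<otimes>\<^bsub>B\<^esub> \<delta>)"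
proof -
  let ?z = "\<Oplus>\<^bsub>A\<^esub>p\<in>Sq. x p \<otimes>\<^bsub>A\<^esub> a \<otimes>\<^bsub>A\<^esub> c p"
  have zc: "?z \<in> carrier A" using ec c a by (intro A.finsum_closed) (auto simp del: mem_Sigma_iff)
  have ta: "\<tau> a (i, j) \<in> carrier B" if "i < d" "j < d" for i j using \<tau>_closed[OF a that] .
  have te: "\<tau> (x p) (i, j) \<in> carrier B" if "p \<in> Sq" "i < d" "j < d" for p i j
    using \<tau>_closed[OF ec[OF that(1)] that(2,3)] .
  have tc: "\<tau> (c p) (i, j) \<in> carrier B" if "p \<in> Sq" "i < d" "j < d" for p i j
    using \<tau>_closed[OF c[OF that(1)] that(2,3)] .
  have entry: "\<tau> ?z (m, r) = (if m = r then trace a \<otimes>\<^bsub>B\<^esub> \<delta> else \<zero>\<^bsub>B\<^esub>)" if mr: "m < d" "r < d" for m r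
  proof -
    let ?g = "\<lambda>p t s. \<tau> a (s, t) \<otimes>\<^bsub>B\<^esub> (\<tau> (c p) (t, r) \<otimes>\<^bsub>B\<^esub> \<tau> (x p) (m, s))"
    have gc: "?g p t s \<in> carrier B" if "p \<in> Sq" "t < d" "s < d" for p t s
      using that ta te tc mr by (simp del: mem_Sigma_iff)
    have "\<tau> ?z (m, r) = (\<Oplus>\<^bsub>B\<^esub>p\<in>Sq. \<tau> (x p \<otimes>\<^bsub>A\<^esub> a \<otimes>\<^bsub>A\<^esub> c p) (m, r))"
      by (rule \<tau>_finsum) (use ec c a mr in \<open>auto simp del: mem_Sigma_iff\<close>)
    also have "\<dots> = (\<Oplus>\<^bsub>B\<^esub>p\<in>Sq. \<Oplus>\<^bsub>B\<^esub>t\<in>{..<d}. \<Oplus>\<^bsub>B\<^esub>s\<in>{..<d}. ?g p t s)"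
    proof (rule B.finsum_cong')
      fix p assume p: "p \<in> Sq"
      have "\<tau> (x p \<otimes>\<^bsub>A\<^esub> a \<otimes>\<^bsub>A\<^esub> c p) (m, r) = (\<Oplus>\<^bsub>B\<^esub>t\<in>{..<d}. \<tau> (x p \<otimes>\<^bsub>A\<^esub> a) (m, t) \<otimes>\<^bsub>B\<^esub> \<tau> (c p) (t, r))"
        by (rule \<tau>_mult) (use ec[OF p] c[OF p] a mr in auto)
      also have "\<dots> = (\<Oplus>\<^bsub>B\<^esub>t\<in>{..<d}. \<Oplus>\<^bsub>B\<^esub>s\<in>{..<d}. ?g p t s)"
      proof (rule B.finsum_cong')
        fix t assume t: "t \<in> {..<d}"
        have "\<tau> (x p \<otimes>\<^bsub>A\<^esub> a) (m, t) \<otimes>\<^bsub>B\<^esub> \<tau> (c p) (t, r)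
            = (\<Oplus>\<^bsub>B\<^esub>s\<in>{..<d}. \<tau> (x p) (m, s) \<otimes>\<^bsub>B\<^esub> \<tau> a (s, t)) \<otimes>\<^bsub>B\<^esub> \<tau> (c p) (t, r)"
          using \<tau>_mult[OF ec[OF p] a mr(1), of t] t by simp
        also have "\<dots> = (\<Oplus>\<^bsub>B\<^esub>s\<in>{..<d}. \<tau> (x p) (m, s) \<otimes>\<^bsub>B\<^esub> \<tau> a (s, t) \<otimes>\<^bsub>B\<^esub> \<tau> (c p) (t, r))"
          by (rule B.finsum_ldistr) (use te[OF p] tc[OF p] ta mr t in auto)
        also have "\<dots> = (\<Oplus>\<^bsub>B\<^esub>s\<in>{..<d}. ?g p t s)"
          by (rule B.finsum_cong') (use te[OF p] tc[OF p] ta mr t in \<open>auto simp: B.m_ac\<close>)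
        finally show "\<tau> (x p \<otimes>\<^bsub>A\<^esub> a) (m, t) \<otimes>\<^bsub>B\<^esub> \<tau> (c p) (t, r) = (\<Oplus>\<^bsub>B\<^esub>s\<in>{..<d}. ?g p t s)" .
      qed (use gc[OF p] in \<open>auto intro!: B.finsum_closed\<close>)
      finally show "\<tau> (x p \<otimes>\<^bsub>A\<^esub> a \<otimes>\<^bsub>A\<^esub> c p) (m, r) = (\<Oplus>\<^bsub>B\<^esub>t\<in>{..<d}. \<Oplus>\<^bsub>B\<^esub>s\<in>{..<d}. ?g p t s)" .
    next
      show "(\<lambda>p. \<Oplus>\<^bsub>B\<^esub>t\<in>{..<d}. \<Oplus>\<^bsub>B\<^esub>s\<in>{..<d}. ?g p t s) \<in> Sq \<rightarrow> carrier B"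
      proof
        fix p assume p: "p \<in> Sq"
        show "(\<Oplus>\<^bsub>B\<^esub>t\<in>{..<d}. \<Oplus>\<^bsub>B\<^esub>s\<in>{..<d}. ?g p t s) \<in> carrier B"
          using gc[OF p] by (auto intro!: B.finsum_closed)
      qed
    qed simp
    also have "\<dots> = (\<Oplus>\<^bsub>B\<^esub>t\<in>{..<d}. \<Oplus>\<^bsub>B\<^esub>p\<in>Sq. \<Oplus>\<^bsub>B\<^esub>s\<in>{..<d}. ?g p t s)"
    proof (rule B.finsum_swap)
      fix p t assume "p \<in> Sq" "t \<in> {..<d}"
      then show "(\<Oplus>\<^bsub>B\<^esub>s\<in>{..<d}. ?g p t s) \<in> carrier B"
        using gc[OF \<open>p \<in> Sq\<close>] by (auto intro!: B.finsum_closed)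
    qed simp_all
    also have "\<dots> = (\<Oplus>\<^bsub>B\<^esub>t\<in>{..<d}. if m = r then \<tau> a (t, t) \<otimes>\<^bsub>B\<^esub> \<delta> else \<zero>\<^bsub>B\<^esub>)"
    proof (rule B.finsum_cong')
      fix t assume t: "t \<in> {..<d}"
      have "(\<Oplus>\<^bsub>B\<^esub>p\<in>Sq. \<Oplus>\<^bsub>B\<^esub>s\<in>{..<d}. ?g p t s) = (\<Oplus>\<^bsub>B\<^esub>s\<in>{..<d}. \<Oplus>\<^bsub>B\<^esub>p\<in>Sq. ?g p t s)"
        by (rule B.finsum_swap) (use gc t in \<open>auto simp del: mem_Sigma_iff\<close>)
      also have "\<dots> = (\<Oplus>\<^bsub>B\<^esub>s\<in>{..<d}. if s = t then (if m = r then \<tau> a (s, t) \<otimes>\<^bsub>B\<^esub> \<delta> else \<zero>\<^bsub>B\<^esub>) else \<zero>\<^bsub>B\<^esub>)"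
      proof (rule B.finsum_cong')
        fix s assume s: "s \<in> {..<d}"
        have "(\<Oplus>\<^bsub>B\<^esub>p\<in>Sq. ?g p t s) = \<tau> a (s, t) \<otimes>\<^bsub>B\<^esub> (\<Oplus>\<^bsub>B\<^esub>p\<in>Sq. \<tau> (c p) (t, r) \<otimes>\<^bsub>B\<^esub> \<tau> (x p) (m, s))"
          by (rule B.finsum_rdistr[symmetric]) (use ta te tc mr t s in \<open>auto simp del: mem_Sigma_iff\<close>)
        then show "(\<Oplus>\<^bsub>B\<^esub>p\<in>Sq. ?g p t s)
            = (if s = t then (if m = r then \<tau> a (s, t) \<otimes>\<^bsub>B\<^esub> \<delta> else \<zero>\<^bsub>B\<^esub>) else \<zero>\<^bsub>B\<^esub>)"
          using dual[of t r m s] mr t s ta by auto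
      qed (use ta \<delta> t in auto)
      also have "\<dots> = (if m = r then \<tau> a (t, t) \<otimes>\<^bsub>B\<^esub> \<delta> else \<zero>\<^bsub>B\<^esub>)"
        by (rule B.finsum_delta) (use ta \<delta> t in auto)
      finally show "(\<Oplus>\<^bsub>B\<^esub>p\<in>Sq. \<Oplus>\<^bsub>B\<^esub>s\<in>{..<d}. ?g p t s) = (if m = r then \<tau> a (t, t) \<otimes>\<^bsub>B\<^esub> \<delta> else \<zero>\<^bsub>B\<^esub>)" .
    qed (use ta \<delta> in auto)
    also have "\<dots> = (if m = r then trace a \<otimes>\<^bsub>B\<^esub> \<delta> else \<zero>\<^bsub>B\<^esub>)"
    proof (cases "m = r")
      case True
      have "trace a \<otimes>\<^bsub>B\<^esub> \<delta> = (\<Oplus>\<^bsub>B\<^esub>t\<in>{..<d}. \<tau> a (t, t) \<otimes>\<^bsub>B\<^esub> \<delta>)"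
        unfolding trace_def by (rule B.finsum_ldistr) (use ta \<delta> in auto)
      then show ?thesis using True by simp
    qed simp
    finally show ?thesis .
  qed
  show ?thesis
  proof (rule PiE_ext)
    show "\<tau> ?z \<in> {..<d} \<times> {..<d} \<rightarrow>\<^sub>E carrier B" by (rule \<tau>_carrier[OF zc])
    show "scalar_mat B d (trace a \<otimes>\<^bsub>B\<^esub> \<delta>) \<in> {..<d} \<times> {..<d} \<rightarrow>\<^sub>E carrier B"
      using trace_closed[OF a] \<delta> by (auto simp: scalar_mat_def)
    fix p assume "p \<in> {..<d} \<times> {..<d}"
    then obtain i j where "p = (i, j)" "i < d" "j < d" by auto
    then show "\<tau> ?z p = scalar_mat B d (trace a \<otimes>\<^bsub>B\<^esub> \<delta>) p"
      using entry[of i j] by (auto simp: scalar_mat_def)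
  qed
qed

end

section \<open>The maximal ideal of the center cut out by a simple module\<close>

context matrix_rep
begin

definition scalar_of :: "'a \<Rightarrow> 'b \<Rightarrow> bool" where
  "scalar_of z f \<longleftrightarrow> z \<in> carrier A \<and> f \<in> carrier B \<and> \<tau> z = scalar_mat B d f"

lemma scalar_ofI:
  assumes "z \<in> carrier A" "f \<in> carrier B"
    "\<And>i j. i < d \<Longrightarrow> j < d \<Longrightarrow> \<tau> z (i, j) = (if i = j then f else \<zero>\<^bsub>B\<^esub>)"
  shows "scalar_of z f"
proof -
  have "\<tau> z = scalar_mat B d f"
  proof (rule PiE_ext)
    show "\<tau> z \<in> {..<d} \<times> {..<d} \<rightarrow>\<^sub>E carrier B" by (rule \<tau>_carrier[OF assms(1)])
    show "scalar_mat B d f \<in> {..<d} \<times> {..<d} \<rightarrow>\<^sub>E carrier B"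
      using assms(2) by (auto simp: scalar_mat_def)
    fix p assume "p \<in> {..<d} \<times> {..<d}"
    then obtain i j where "p = (i, j)" "i < d" "j < d" by auto
    then show "\<tau> z p = scalar_mat B d f p" using assms(3)[of i j] by (simp add: scalar_mat_def)
  qed
  then show ?thesis using assms by (simp add: scalar_of_def)
qed

lemma scalar_ofD:
  assumes "scalar_of z f"
  shows "z \<in> carrier A" "f \<in> carrier B" "\<tau> z = scalar_mat B d f"
    "i < d \<Longrightarrow> j < d \<Longrightarrow> \<tau> z (i, j) = (if i = j then f else \<zero>\<^bsub>B\<^esub>)"
  using assms by (auto simp: scalar_of_def scalar_mat_def)

lemma scalar_of_zero: "scalar_of \<zero>\<^bsub>A\<^esub> \<zero>\<^bsub>B\<^esub>"
  by (rule scalar_ofI) (auto simp: \<tau>_zero)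

lemma scalar_of_one: "scalar_of \<one>\<^bsub>A\<^esub> \<one>\<^bsub>B\<^esub>"
  by (rule scalar_ofI) (auto simp: \<tau>_one)

lemma scalar_of_add:
  assumes "scalar_of z f" "scalar_of w g"
  shows "scalar_of (z \<oplus>\<^bsub>A\<^esub> w) (f \<oplus>\<^bsub>B\<^esub> g)"
  using scalar_ofD[OF assms(1)] scalar_ofD[OF assms(2)]
  by (intro scalar_ofI) (auto simp: \<tau>_add)

lemma scalar_of_diff:
  assumes "scalar_of z f" "scalar_of w g"
  shows "scalar_of (z \<ominus>\<^bsub>A\<^esub> w) (f \<ominus>\<^bsub>B\<^esub> g)"
  using scalar_ofD[OF assms(1)] scalar_ofD[OF assms(2)]
  by (intro scalar_ofI) (auto simp: \<tau>_diff)

lemma scalar_of_uminus: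
  assumes "scalar_of z f"
  shows "scalar_of (\<ominus>\<^bsub>A\<^esub> z) (\<ominus>\<^bsub>B\<^esub> f)"
  using scalar_of_diff[OF scalar_of_zero assms] scalar_ofD(1,2)[OF assms] by (simp add: a_minus_def)

lemma \<tau>_scalar_left:
  assumes "scalar_of z f" "b \<in> carrier A" "i < d" "j < d"
  shows "\<tau> (z \<otimes>\<^bsub>A\<^esub> b) (i, j) = f \<otimes>\<^bsub>B\<^esub> \<tau> b (i, j)"
proof -
  note z = scalar_ofD[OF assms(1)]
  have "\<tau> (z \<otimes>\<^bsub>A\<^esub> b) (i, j) = (\<Oplus>\<^bsub>B\<^esub>l\<in>{..<d}. if i = l then f \<otimes>\<^bsub>B\<^esub> \<tau> b (l, j) else \<zero>\<^bsub>B\<^esub>)"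
    unfolding \<tau>_mult[OF z(1) assms(2-4)]
    by (rule B.finsum_cong') (use z assms \<tau>_closed in auto)
  also have "\<dots> = f \<otimes>\<^bsub>B\<^esub> \<tau> b (i, j)"
    by (rule B.finsum_delta) (use z assms \<tau>_closed in auto)
  finally show ?thesis .
qed

lemma \<tau>_scalar_right:
  assumes "scalar_of z f" "b \<in> carrier A" "i < d" "j < d"
  shows "\<tau> (b \<otimes>\<^bsub>A\<^esub> z) (i, j) = f \<otimes>\<^bsub>B\<^esub> \<tau> b (i, j)"
proof -
  note z = scalar_ofD[OF assms(1)]
  have "\<tau> (b \<otimes>\<^bsub>A\<^esub> z) (i, j) = (\<Oplus>\<^bsub>B\<^esub>l\<in>{..<d}. if l = j then f \<otimes>\<^bsub>B\<^esub> \<tau> b (i, l) else \<zero>\<^bsub>B\<^esub>)"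
    unfolding \<tau>_mult[OF assms(2) z(1) assms(3,4)]
    by (rule B.finsum_cong') (use z assms \<tau>_closed in \<open>auto simp: B.m_comm\<close>)
  also have "\<dots> = f \<otimes>\<^bsub>B\<^esub> \<tau> b (i, j)"
    by (rule B.finsum_delta) (use z assms \<tau>_closed in auto)
  finally show ?thesis .
qed

lemma scalar_of_mult:
  assumes "scalar_of z f" "scalar_of w g"
  shows "scalar_of (z \<otimes>\<^bsub>A\<^esub> w) (f \<otimes>\<^bsub>B\<^esub> g)"
  using scalar_ofD[OF assms(1)] scalar_ofD[OF assms(2)] \<tau>_scalar_left[OF assms(1)]
  by (intro scalar_ofI) auto

lemma scalar_of_scalar:
  assumes "c \<in> carrier K"
  shows "scalar_of (c \<odot>\<^bsub>A\<^esub> \<one>\<^bsub>A\<^esub>) (c \<odot>\<^bsub>B\<^esub> \<one>\<^bsub>B\<^esub>)"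
  by (rule scalar_ofI) (use assms in \<open>auto simp: \<tau>_smult \<tau>_one\<close>)

lemma impression_scalars_eq: "impression_scalars A B d \<tau> = {f. \<exists>z. scalar_of z f}"
proof (intro equalityI subsetI)
  fix f assume "f \<in> impression_scalars A B d \<tau>"
  then have f: "f \<in> carrier B" "scalar_mat B d f \<in> \<tau> ` carrier A"
    by (simp_all add: impression_scalars_def)
  from f(2) obtain z where "scalar_mat B d f = \<tau> z" "z \<in> carrier A" by (rule imageE)
  then have "scalar_of z f" using f(1) by (simp add: scalar_of_def)
  then show "f \<in> {f. \<exists>z. scalar_of z f}" by (intro CollectI exI)
next
  fix f assume "f \<in> {f. \<exists>z. scalar_of z f}"
  then obtain z where z: "scalar_of z f" by (elim CollectE exE)
  have "scalar_mat B d f \<in> \<tau> ` carrier A"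
    unfolding scalar_ofD(3)[OF z, symmetric] using scalar_ofD(1)[OF z] by (rule imageI)
  then show "f \<in> impression_scalars A B d \<tau>"
    using scalar_ofD(2)[OF z] by (simp add: impression_scalars_def)
qed

end

locale matrix_mono = matrix_rep +
  assumes inj: "inj_on \<tau> (carrier A)"
begin

lemma \<tau>_eqI:
  assumes "a \<in> carrier A" "b \<in> carrier A" "\<And>i j. i < d \<Longrightarrow> j < d \<Longrightarrow> \<tau> a (i, j) = \<tau> b (i, j)"
  shows "a = b"
proof (rule inj_onD[OF inj _ assms(1,2)])
  show "\<tau> a = \<tau> b"
    by (rule PiE_ext[OF \<tau>_carrier[OF assms(1)] \<tau>_carrier[OF assms(2)]]) (use assms(3) in auto)
qed

lemma scalar_of_unique: "scalar_of z f \<Longrightarrow> scalar_of w f \<Longrightarrow> z = w"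
  by (rule inj_onD[OF inj]) (simp_all add: scalar_of_def)

lemma scalar_of_imp_center:
  assumes "scalar_of z f"
  shows "z \<in> center A"
proof -
  have "z \<otimes>\<^bsub>A\<^esub> b = b \<otimes>\<^bsub>A\<^esub> z" if b: "b \<in> carrier A" for b
    by (rule \<tau>_eqI) (use \<tau>_scalar_left[OF assms b] \<tau>_scalar_right[OF assms b] scalar_ofD(1)[OF assms] b in auto)
  then show ?thesis using scalar_ofD(1)[OF assms] by (simp add: center_def)
qed

text \<open>
  The ring of scalars is a copy of the center, and this ideal is its intersection with the annihilator of \<open>V\<close>.
  A central element outside the annihilator is inverted, modulo the annihilator, by another central
  element.
\<close>

lemma maximalideal_annihilating_scalars:
  assumes simple: "simple_module A V" and fin: "module_finite_over_center A"
    and center: "\<And>z. z \<in> center A \<Longrightarrow> \<exists>f. scalar_of z f"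
  shows "maximalideal {f. \<exists>z \<in> left_module.annihilator A V. scalar_of z f}
    (B\<lparr>carrier := impression_scalars A B d \<tau>\<rparr>)"
proof -
  interpret V: left_module A V using simple by (simp add: simple_module_def)
  interpret J: ideal V.annihilator A by (rule V.ideal_annihilator)
  define R where "R = impression_scalars A B d \<tau>"
  define m where "m = {f. \<exists>z \<in> V.annihilator. scalar_of z f}"
  have R: "f \<in> R \<longleftrightarrow> (\<exists>z. scalar_of z f)" for f by (simp add: R_def impression_scalars_eq)
  have RI: "f \<in> R" if "scalar_of z f" for z f using that unfolding R by (rule exI)
  have m: "f \<in> m \<longleftrightarrow> (\<exists>z. z \<in> V.annihilator \<and> scalar_of z f)" for f by (auto simp: m_def)
  have mI: "f \<in> m" if "z \<in> V.annihilator" "scalar_of z f" for z f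
    unfolding m by (rule exI[of _ z]) (intro conjI that)
  have mE: thesis if "f \<in> m" "\<And>z. z \<in> V.annihilator \<Longrightarrow> scalar_of z f \<Longrightarrow> thesis" for f thesis
    using that(1) unfolding m by (elim exE conjE) (rule that(2))
  have mR: "f \<in> R" if "f \<in> m" for f using that by (rule mE) (rule RI)
  have "subring R B"
  proof (rule B.subringI)
    show "R \<subseteq> carrier B"
    proof
      fix f assume "f \<in> R"
      then obtain z where "scalar_of z f" unfolding R by (elim exE)
      then show "f \<in> carrier B" by (rule scalar_ofD(2))
    qed
    show "\<one>\<^bsub>B\<^esub> \<in> R" by (rule RI[OF scalar_of_one])
    show "\<ominus>\<^bsub>B\<^esub> f \<in> R" if f: "f \<in> R" for f
    proof -
      obtain z where z: "scalar_of z f" using f unfolding R by (elim exE)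
      show ?thesis by (rule RI[OF scalar_of_uminus[OF z]])
    qed
    show "f \<otimes>\<^bsub>B\<^esub> g \<in> R" if fg: "f \<in> R" "g \<in> R" for f g
    proof -
      obtain z where z: "scalar_of z f" using fg(1) unfolding R by (elim exE)
      obtain w where w: "scalar_of w g" using fg(2) unfolding R by (elim exE)
      show ?thesis by (rule RI[OF scalar_of_mult[OF z w]])
    qed
    show "f \<oplus>\<^bsub>B\<^esub> g \<in> R" if fg: "f \<in> R" "g \<in> R" for f g
    proof -
      obtain z where z: "scalar_of z f" using fg(1) unfolding R by (elim exE)
      obtain w where w: "scalar_of w g" using fg(2) unfolding R by (elim exE)
      show ?thesis by (rule RI[OF scalar_of_add[OF z w]])
    qed
  qed
  then interpret R: ring "B\<lparr>carrier := R\<rparr>" by (rule B.subring_is_ring)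
  have "maximalideal m (B\<lparr>carrier := R\<rparr>)"
  proof (rule maximalidealI)
    show "ideal m (B\<lparr>carrier := R\<rparr>)"
    proof (rule idealI[OF R.ring_axioms])
      show "subgroup m (add_monoid (B\<lparr>carrier := R\<rparr>))"
      proof (rule R.add.subgroupI)
        show "m \<subseteq> carrier (B\<lparr>carrier := R\<rparr>)" using mR by auto
        show "m \<noteq> {}" using mI[OF J.zero_closed scalar_of_zero] by blast
        show "f \<oplus>\<^bsub>B\<lparr>carrier := R\<rparr>\<^esub> g \<in> m" if fg: "f \<in> m" "g \<in> m" for f g
        proof -
          obtain z where z: "z \<in> V.annihilator" "scalar_of z f" using fg(1) by (rule mE)
          obtain w where w: "w \<in> V.annihilator" "scalar_of w g" using fg(2) by (rule mE)
          show ?thesis using mI[OF J.a_closed[OF z(1) w(1)] scalar_of_add[OF z(2) w(2)]] by simp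
        qed
        fix f assume f: "f \<in> m"
        then obtain z where z: "z \<in> V.annihilator" "scalar_of z f" by (rule mE)
        have "\<ominus>\<^bsub>A\<^esub> z \<in> V.annihilator" using J.a_inv_closed z(1) by simp
        then have n: "\<ominus>\<^bsub>B\<^esub> f \<in> m" using scalar_of_uminus[OF z(2)] by (rule mI)
        have "\<ominus>\<^bsub>B\<^esub> f \<oplus>\<^bsub>B\<^esub> f = \<zero>\<^bsub>B\<^esub>" using scalar_ofD(2)[OF z(2)] by (simp add: B.l_neg)
        then have "\<ominus>\<^bsub>B\<lparr>carrier := R\<rparr>\<^esub> f = \<ominus>\<^bsub>B\<^esub> f"
          using R.minus_equality[of "\<ominus>\<^bsub>B\<^esub> f" f] mR[OF n] mR[OF f] by simp
        then show "\<ominus>\<^bsub>B\<lparr>carrier := R\<rparr>\<^esub> f \<in> m" using n by simp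
      qed
      fix f x assume f: "f \<in> m" and "x \<in> carrier (B\<lparr>carrier := R\<rparr>)"
      then have x: "x \<in> R" by simp
      obtain z where z: "z \<in> V.annihilator" "scalar_of z f" using f by (rule mE)
      obtain w where w: "scalar_of w x" using x unfolding R by (elim exE)
      have "w \<otimes>\<^bsub>A\<^esub> z \<in> V.annihilator" using J.I_l_closed[OF z(1) scalar_ofD(1)[OF w]] .
      then show "x \<otimes>\<^bsub>B\<lparr>carrier := R\<rparr>\<^esub> f \<in> m" using mI[OF _ scalar_of_mult[OF w z(2)]] by simp
      have "z \<otimes>\<^bsub>A\<^esub> w \<in> V.annihilator" using J.I_r_closed[OF z(1) scalar_ofD(1)[OF w]] .
      then show "f \<otimes>\<^bsub>B\<lparr>carrier := R\<rparr>\<^esub> x \<in> m" using mI[OF _ scalar_of_mult[OF z(2) w]] by simp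
    qed
    show "carrier (B\<lparr>carrier := R\<rparr>) \<noteq> m"
    proof
      assume "carrier (B\<lparr>carrier := R\<rparr>) = m"
      then have "\<one>\<^bsub>B\<^esub> \<in> m" using RI[OF scalar_of_one] by simp
      then obtain z where "z \<in> V.annihilator" "scalar_of z \<one>\<^bsub>B\<^esub>" by (rule mE)
      then have "\<one>\<^bsub>A\<^esub> \<in> V.annihilator" using scalar_of_unique[OF scalar_of_one] by simp
      then have "v = \<zero>\<^bsub>V\<^esub>" if "v \<in> carrier V" for v
        using V.annihilatorD[of "\<one>\<^bsub>A\<^esub>" v] V.smult_one[OF that] that by simp
      then show False using simple V.M.zero_closed unfolding simple_module_def by blast
    qed
    fix I assume I: "ideal I (B\<lparr>carrier := R\<rparr>)" "m \<subseteq> I" "I \<subseteq> carrier (B\<lparr>carrier := R\<rparr>)"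
    show "I = m \<or> I = carrier (B\<lparr>carrier := R\<rparr>)"
    proof (cases "I \<subseteq> m")
      case False
      interpret I: ideal I "B\<lparr>carrier := R\<rparr>" by (rule I(1))
      obtain f where f: "f \<in> I" "f \<notin> m" using False by blast
      have "f \<in> R" using f(1) I(3) by auto
      then obtain z where z: "scalar_of z f" unfolding R by (elim exE)
      have zJ: "z \<notin> V.annihilator" using f(2) mI[OF _ z] by (rule contrapos_nn)
      obtain y where y: "y \<in> center A" "\<And>v. v \<in> carrier V \<Longrightarrow> z \<odot>\<^bsub>V\<^esub> (y \<odot>\<^bsub>V\<^esub> v) = v"
        using central_inverse_mod_annihilator[OF simple fin scalar_of_imp_center[OF z] zJ] by blast
      obtain g where g: "scalar_of y g" using center[OF y(1)] by blast
      note zc = scalar_ofD(1)[OF z] and yc = scalar_ofD(1)[OF g]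
      have "\<one>\<^bsub>A\<^esub> \<ominus>\<^bsub>A\<^esub> z \<otimes>\<^bsub>A\<^esub> y \<in> V.annihilator"
        using y(2) zc yc by (subst V.annihilator_diff_iff) (simp_all add: V.smult_one V.smult_assoc)
      then have "\<one>\<^bsub>B\<^esub> \<ominus>\<^bsub>B\<^esub> f \<otimes>\<^bsub>B\<^esub> g \<in> m"
        using scalar_of_diff[OF scalar_of_one scalar_of_mult[OF z g]] by (rule mI)
      then have "\<one>\<^bsub>B\<^esub> \<ominus>\<^bsub>B\<^esub> f \<otimes>\<^bsub>B\<^esub> g \<in> I" using I(2) by (rule rev_subsetD)
      moreover have "f \<otimes>\<^bsub>B\<^esub> g \<in> I"
        using I.I_r_closed[OF f(1), of g] RI[OF g] by simp
      ultimately have "(\<one>\<^bsub>B\<^esub> \<ominus>\<^bsub>B\<^esub> f \<otimes>\<^bsub>B\<^esub> g) \<oplus>\<^bsub>B\<^esub> f \<otimes>\<^bsub>B\<^esub> g \<in> I" using I.a_closed by force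
      moreover have "(\<one>\<^bsub>B\<^esub> \<ominus>\<^bsub>B\<^esub> f \<otimes>\<^bsub>B\<^esub> g) \<oplus>\<^bsub>B\<^esub> f \<otimes>\<^bsub>B\<^esub> g = \<one>\<^bsub>B\<^esub>"
        using scalar_ofD(2)[OF z] scalar_ofD(2)[OF g] by (simp add: a_minus_def B.a_assoc B.l_neg)
      ultimately show ?thesis using I.one_imp_carrier by simp
    qed (use I(2) in blast)
  qed
  then show ?thesis by (simp add: m_def R_def)
qed

end

section \<open>Lifting matrix units to an intersection of two ideals\<close>

lemma matrix_units_cong:
  fixes A :: "('a, 'm) ring_scheme" (structure)
  assumes e: "matrix_units A I d e" and e': "\<And>i j. i < d \<Longrightarrow> j < d \<Longrightarrow> e' i j \<in> carrier A"
    "\<And>i j. i < d \<Longrightarrow> j < d \<Longrightarrow> e' i j \<ominus> e i j \<in> I"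
  shows "matrix_units A I d e'"
proof -
  interpret e: matrix_units A I d e by (rule e)
  have eq: "e.proj (e' i j) = e.proj (e i j)" if "i < d" "j < d" for i j
    using e.proj_eq_iff e'[OF that] e.e_closed[OF that] by simp
  show ?thesis
  proof (rule matrix_units.intro[OF e.ideal_I e'(1) _ e.d_pos])
    fix i j k l assume b: "i < d" "j < d" "k < d" "l < d"
    have "e.proj (e' i j \<otimes> e' k l) = e.proj (if j = k then e' i l else \<zero>)"
      using e.proj_mult[OF b] eq b e'(1) by (simp add: e.pr.hom_mult e.pr.hom_zero)
    then show "e' i j \<otimes> e' k l \<ominus> (if j = k then e' i l else \<zero>) \<in> I"
      using b e'(1) by (subst (asm) e.proj_eq_iff) auto
  qed
qed

lemma matrix_units_inter:
  fixes A :: "('a, 'm) ring_scheme" (structure)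
  assumes "matrix_units A I d e" "matrix_units A J d e"
  shows "matrix_units A (I \<inter> J) d e"
proof -
  interpret I: matrix_units A I d e by fact
  show ?thesis
  proof (rule matrix_units.intro)
    show "ideal (I \<inter> J) A" by (rule I.i_intersect[OF I.ideal_I matrix_units.ideal_I[OF assms(2)]])
    show "e i j \<otimes> e k l \<ominus> (if j = k then e i l else \<zero>) \<in> I \<inter> J"
      if b: "i < d" "j < d" "k < d" "l < d" for i j k l
      using I.e_mult[OF b] matrix_units.e_mult[OF assms(2) b] by (rule IntI)
  qed (use I.e_closed I.d_pos in auto)
qed

text \<open>
  The element \<open>t\<close> is \<open>0\<close> modulo \<open>J\<close> and \<open>1\<close> modulo \<open>I\<close>, so it interpolates between the two families.
\<close>

lemma exists_common_matrix_units:
  fixes A :: "('a, 'm) ring_scheme" (structure)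
  assumes e: "matrix_units A I d e" and e': "matrix_units A J d e'"
    and t: "t \<in> J" "t \<ominus> \<one> \<in> I"
  obtains f where "matrix_units A I d f" "matrix_units A J d f"
    "\<And>i j. i < d \<Longrightarrow> j < d \<Longrightarrow> f i j \<ominus> e i j \<in> I"
    "\<And>i j. i < d \<Longrightarrow> j < d \<Longrightarrow> f i j \<ominus> e' i j \<in> J"
proof -
  interpret I: matrix_units A I d e by (rule e)
  interpret J: matrix_units A J d e' by (rule e')
  have tc: "t \<in> carrier A" using t(1) by (rule ideal.Icarr[OF J.ideal_I])
  define f where "f i j = e' i j \<oplus> t \<otimes> (e i j \<ominus> e' i j)" for i j
  have fc: "f i j \<in> carrier A" if "i < d" "j < d" for i j
    using I.e_closed[OF that] J.e_closed[OF that] tc by (simp add: f_def)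
  have fI: "f i j \<ominus> e i j \<in> I" if b: "i < d" "j < d" for i j
  proof -
    note c = I.e_closed[OF b] J.e_closed[OF b]
    have "(t \<ominus> \<one>) \<otimes> (e i j \<ominus> e' i j) \<in> I"
      by (rule ideal.I_r_closed[OF I.ideal_I t(2)]) (use c in simp)
    also have "(t \<ominus> \<one>) \<otimes> (e i j \<ominus> e' i j) = f i j \<ominus> e i j"
      using c tc by (simp add: f_def a_minus_def I.l_distr I.l_minus I.minus_add I.a_ac)
    finally show ?thesis .
  qed
  have fJ: "f i j \<ominus> e' i j \<in> J" if b: "i < d" "j < d" for i j
  proof -
    note c = I.e_closed[OF b] J.e_closed[OF b]
    define x where "x = t \<otimes> (e i j \<ominus> e' i j)"
    have xc: "x \<in> carrier A" using c tc by (simp add: x_def)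
    have "f i j = x \<oplus> e' i j" using c xc by (simp add: f_def I.a_comm flip: x_def)
    then have "f i j \<ominus> e' i j = x" using c xc by (simp add: a_minus_def I.a_assoc I.r_neg)
    moreover have "x \<in> J"
      unfolding x_def by (rule ideal.I_r_closed[OF J.ideal_I t(1)]) (use c in simp)
    ultimately show ?thesis by simp
  qed
  show thesis
    by (rule that[OF matrix_units_cong[OF e fc fI] matrix_units_cong[OF e' fc fJ] fI fJ])
qed

section \<open>A central element separating a point from a simple module\<close>

context domain_matrix_rep
begin

text \<open>
  Let \<open>f\<close> be matrix units modulo \<open>J \<inter> J0\<close>, with dual family \<open>c\<close>. The element \<open>z = \<Sum>\<^sub>p f\<^sub>p (a f\<^sub>0\<^sub>0) c\<^sub>p\<close> lies in \<open>N\<close>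
  together with \<open>a\<close>, and it is a scalar by the Casimir construction. Modulo \<open>J\<close>, where \<open>a\<close> is \<open>1\<close> and \<open>c\<^sub>p\<close> is
  the transposed unit, \<open>z\<close> is \<open>\<Sum>\<^sub>i f\<^sub>i\<^sub>i\<close>, which is not \<open>0\<close>. Working modulo
  \<open>J \<inter> J0\<close> secures the trace condition, which may fail for lifts modulo \<open>J\<close> alone.
\<close>

lemma exists_separating_scalar:
  assumes e: "matrix_units A J d e" "e 0 0 \<notin> J"
    and e0: "matrix_units A J0 d e0"
    and nz: "\<And>u. u \<in> carrier A \<Longrightarrow> u \<ominus>\<^bsub>A\<^esub> e0 0 0 \<in> J0 \<Longrightarrow> trace u \<noteq> \<zero>\<^bsub>B\<^esub>"
    and t: "t \<in> J0" "t \<ominus>\<^bsub>A\<^esub> \<one>\<^bsub>A\<^esub> \<in> J"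
    and N: "ideal N A" and a: "a \<in> N" "a \<ominus>\<^bsub>A\<^esub> \<one>\<^bsub>A\<^esub> \<in> J"
  obtains z f where "z \<in> N" "z \<notin> J" "scalar_of z f"
proof -
  interpret N: ideal N A by (rule N)
  have ac: "a \<in> carrier A" using a(1) by (rule N.Icarr)
  obtain f where f: "matrix_units A J d f" "matrix_units A J0 d f"
    and fJ: "\<And>i j. i < d \<Longrightarrow> j < d \<Longrightarrow> f i j \<ominus>\<^bsub>A\<^esub> e i j \<in> J"
    and fJ0: "\<And>i j. i < d \<Longrightarrow> j < d \<Longrightarrow> f i j \<ominus>\<^bsub>A\<^esub> e0 i j \<in> J0"
    by (rule exists_common_matrix_units[OF e(1) e0 t]) auto
  interpret f: matrix_units A J d f by (rule f(1))
  have d: "0 < d" by (rule f.d_pos)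
  note mu = matrix_units_inter[OF f]
  have ec: "e 0 0 \<in> carrier A" "e0 0 0 \<in> carrier A"
    using matrix_units.e_closed[OF e(1) d d] matrix_units.e_closed[OF e0 d d] .
  have nz': "trace u \<noteq> \<zero>\<^bsub>B\<^esub>" if u: "u \<in> carrier A" "u \<ominus>\<^bsub>A\<^esub> f 0 0 \<in> J \<inter> J0" for u
  proof (rule nz[OF u(1)])
    have "(u \<ominus>\<^bsub>A\<^esub> f 0 0) \<oplus>\<^bsub>A\<^esub> (f 0 0 \<ominus>\<^bsub>A\<^esub> e0 0 0) \<in> J0"
      using u(2) fJ0[OF d d] additive_subgroup.a_closed[OF ideal.axioms(1)[OF matrix_units.ideal_I[OF e0]]]
      by blast
    also have "(u \<ominus>\<^bsub>A\<^esub> f 0 0) \<oplus>\<^bsub>A\<^esub> (f 0 0 \<ominus>\<^bsub>A\<^esub> e0 0 0) = u \<ominus>\<^bsub>A\<^esub> e0 0 0"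
      using u(1) f.e_closed[OF d d] ec(2)
      by (simp add: a_minus_def A.a_assoc) (simp add: A.a_assoc[symmetric] A.l_neg)
    finally show "u \<ominus>\<^bsub>A\<^esub> e0 0 0 \<in> J0" .
  qed
  obtain c \<delta> where \<delta>: "\<delta> \<in> carrier B" and c: "\<And>p. p \<in> Sq \<Longrightarrow> c p \<in> carrier A"
    "\<And>p. p \<in> Sq \<Longrightarrow> c p \<ominus>\<^bsub>A\<^esub> f (snd p) (fst p) \<in> J \<inter> J0"
    and dual: "\<And>t s m r. t < d \<Longrightarrow> s < d \<Longrightarrow> m < d \<Longrightarrow> r < d \<Longrightarrow>
      (\<Oplus>\<^bsub>B\<^esub>p\<in>Sq. \<tau> (c p) (t, s) \<otimes>\<^bsub>B\<^esub> \<tau> (f (fst p) (snd p)) (m, r)) = (if m = s \<and> r = t then \<delta> else \<zero>\<^bsub>B\<^esub>)"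
    by (rule \<tau>_dual_basis[OF mu nz']) auto
  have fc: "f (fst p) (snd p) \<in> carrier A" "f (snd p) (fst p) \<in> carrier A" if "p \<in> Sq" for p
    using that f.e_closed by auto
  have f00: "f 0 0 \<in> carrier A" using f.e_closed d by simp
  define g where "g p = f (fst p) (snd p) \<otimes>\<^bsub>A\<^esub> (a \<otimes>\<^bsub>A\<^esub> f 0 0) \<otimes>\<^bsub>A\<^esub> c p" for p
  define z where "z = (\<Oplus>\<^bsub>A\<^esub>p\<in>Sq. g p)"
  have gc: "g p \<in> carrier A" if "p \<in> Sq" for p
    using fc[OF that] c(1)[OF that] ac f00 by (simp add: g_def)
  have zc: "z \<in> carrier A" unfolding z_def using gc by (intro A.finsum_closed) blast
  have "\<tau> z = scalar_mat B d (trace (a \<otimes>\<^bsub>A\<^esub> f 0 0) \<otimes>\<^bsub>B\<^esub> \<delta>)"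
    unfolding z_def g_def by (rule \<tau>_casimir[OF fc(1) c(1) \<delta> dual]) (use ac f00 in auto)
  then have zs: "scalar_of z (trace (a \<otimes>\<^bsub>A\<^esub> f 0 0) \<otimes>\<^bsub>B\<^esub> \<delta>)"
    using zc \<delta> ac f00 trace_closed by (simp add: scalar_of_def)
  have gN: "g p \<in> N" if "p \<in> Sq" for p
    unfolding g_def using fc[OF that] c(1)[OF that] a(1) f00 N.I_l_closed N.I_r_closed by simp
  have "(\<Oplus>\<^bsub>A\<^esub>p\<in>P. g p) \<in> N" if "finite P" "P \<subseteq> Sq" for P
    using that
  proof (induction P rule: finite_induct)
    case (insert p P)
    then have p: "p \<in> Sq" "P \<subseteq> Sq" by blast+
    have "(\<Oplus>\<^bsub>A\<^esub>p\<in>insert p P. g p) = g p \<oplus>\<^bsub>A\<^esub> (\<Oplus>\<^bsub>A\<^esub>p\<in>P. g p)"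
      by (rule A.finsum_insert) (use insert(1,2) p gc in blast)+
    then show ?case using insert.IH[OF p(2)] gN[OF p(1)] N.a_closed by simp
  qed (simp add: N.zero_closed)
  then have zN: "z \<in> N" by (simp add: z_def)
  \<comment> \<open>\<open>z\<close> fixes \<open>f 0 0\<close> modulo \<open>J\<close>; multiplication by \<open>f 0 0\<close> leaves one summand\<close>
  have zJ: "z \<notin> J"
  proof
    assume "z \<in> J"
    then have "z \<otimes>\<^bsub>A\<^esub> f 0 0 \<in> J" using f00 by (rule f.I_r_closed)
    then have z0: "f.proj (z \<otimes>\<^bsub>A\<^esub> f 0 0) = \<zero>\<^bsub>f.Quo\<^esub>"
      by (intro iffD2[OF f.proj_zero_iff] A.m_closed zc f00)
    have pa: "f.proj a = \<one>\<^bsub>f.Quo\<^esub>"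
      using a(2) ac f.proj_eq_iff[of a "\<one>\<^bsub>A\<^esub>"] f.pr.hom_one by simp
    have pc: "f.proj (c p) = f.proj (f (snd p) (fst p))" if "p \<in> Sq" for p
      using c(1)[OF that] c(2)[OF that] fc(2)[OF that] f.proj_eq_iff by blast
    have "f.proj (z \<otimes>\<^bsub>A\<^esub> f 0 0) = f.proj (\<Oplus>\<^bsub>A\<^esub>p\<in>Sq. g p \<otimes>\<^bsub>A\<^esub> f 0 0)"
      unfolding z_def by (subst A.finsum_ldistr) (use gc f00 in blast)+
    also have "\<dots> = (\<Oplus>\<^bsub>f.Quo\<^esub>p\<in>Sq. f.proj (g p \<otimes>\<^bsub>A\<^esub> f 0 0))"
      by (subst f.pr.hom_finsum) (use gc f00 in \<open>auto simp: comp_def simp del: mem_Sigma_iff\<close>)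
    also have "\<dots> = (\<Oplus>\<^bsub>f.Quo\<^esub>p\<in>Sq. if p = (0, 0) then f.proj (f 0 0) else \<zero>\<^bsub>f.Quo\<^esub>)"
    proof (rule f.pr.S.finsum_cong')
      fix p assume p: "p \<in> Sq"
      then obtain i j where ij: "p = (i, j)" "i < d" "j < d" by auto
      have P: "f.proj (f k l) \<in> carrier f.Quo" if "k < d" "l < d" for k l
        using f.e_closed[OF that] f.pr.hom_closed by simp
      have "f.proj (g p \<otimes>\<^bsub>A\<^esub> f 0 0)
          = f.proj (f i j) \<otimes>\<^bsub>f.Quo\<^esub> f.proj (f 0 0) \<otimes>\<^bsub>f.Quo\<^esub> f.proj (f j i) \<otimes>\<^bsub>f.Quo\<^esub> f.proj (f 0 0)"
        using pc[OF p] pa fc[OF p] c(1)[OF p] ac f00 P[OF d d] ij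
        by (simp add: g_def f.pr.hom_mult)
      also have "\<dots> = (if p = (0, 0) then f.proj (f 0 0) else \<zero>\<^bsub>f.Quo\<^esub>)"
        using f.proj_mult d ij P by (auto simp: f.pr.S.m_assoc)
      finally show "f.proj (g p \<otimes>\<^bsub>A\<^esub> f 0 0) = (if p = (0, 0) then f.proj (f 0 0) else \<zero>\<^bsub>f.Quo\<^esub>)" .
    qed (use f00 f.pr.hom_closed in auto)
    also have "\<dots> = f.proj (f 0 0)"
      by (rule f.pr.S.finsum_delta) (use d f00 f.pr.hom_closed in auto)
    finally have "f.proj (z \<otimes>\<^bsub>A\<^esub> f 0 0) = f.proj (f 0 0)" .
    from trans[OF this[symmetric] z0] have "f 0 0 \<in> J" by (rule iffD1[OF f.proj_zero_iff[OF f00]])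
    then have "f 0 0 \<ominus>\<^bsub>A\<^esub> (f 0 0 \<ominus>\<^bsub>A\<^esub> e 0 0) \<in> J"
      using fJ[OF d d] f.a_closed f.a_inv_closed by (simp add: a_minus_def)
    moreover have "f 0 0 \<ominus>\<^bsub>A\<^esub> (f 0 0 \<ominus>\<^bsub>A\<^esub> e 0 0) = e 0 0"
      using f00 ec(1) by (simp add: a_minus_def A.minus_add A.a_assoc[symmetric] A.r_neg)
    ultimately show False using e(2) by simp
  qed
  show thesis by (rule that[OF zN zJ zs])
qed

end

section \<open>Large modules are evaluation modules\<close>

text \<open>
  Since the center acts through \<open>K\<close>, a finite generating family over the center is one over \<open>K\<close>.
\<close>

lemma exists_finite_span:
  fixes A :: "('k, 'a) module" and V :: "('a, 'v) module"
  assumes V: "simple_rep K A V" and fin: "module_finite_over_center A"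
    and center: "\<And>z. z \<in> center A \<Longrightarrow> \<exists>c\<in>carrier K. \<forall>v\<in>carrier V. z \<odot>\<^bsub>V\<^esub> v = algebra_rep.act A V c v"
  obtains G where "finite G" "G \<subseteq> carrier V" "lin_action.lspan K V (algebra_rep.act A V) G = carrier V"
proof -
  interpret V: simple_rep K A V by (rule V)
  obtain v0 where v0: "v0 \<in> carrier V" "v0 \<noteq> \<zero>\<^bsub>V\<^esub>"
    using V.simple V.V.M.zero_closed unfolding simple_module_def by blast
  obtain S where S: "finite S" "S \<subseteq> carrier A"
    "\<And>a. a \<in> carrier A \<Longrightarrow> \<exists>c\<in>S \<rightarrow> center A. a = (\<Oplus>\<^bsub>A\<^esub>s\<in>S. c s \<otimes>\<^bsub>A\<^esub> s)"
    using fin unfolding module_finite_over_center_def by blast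
  define G where "G = (\<lambda>s. s \<odot>\<^bsub>V\<^esub> v0) ` S"
  have Sc: "s \<in> carrier A" "s \<odot>\<^bsub>V\<^esub> v0 \<in> carrier V" if "s \<in> S" for s
    using that S(2) v0(1) V.V.smult_closed by auto
  have "v \<in> V.L.lspan G" if v: "v \<in> carrier V" for v
  proof -
    obtain a where a: "a \<in> carrier A" "a \<odot>\<^bsub>V\<^esub> v0 = v"
      using simple_module_cyclic[OF V.simple v0 v] .
    obtain c where c: "c \<in> S \<rightarrow> center A" "a = (\<Oplus>\<^bsub>A\<^esub>s\<in>S. c s \<otimes>\<^bsub>A\<^esub> s)" using S(3)[OF a(1)] by blast
    have cz: "c s \<in> center A" if "s \<in> S" for s using c(1) that by auto
    have cc: "c s \<in> carrier A" if "s \<in> S" for s using cz[OF that] by (simp add: center_def)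
    define k where "k s = (SOME k. k \<in> carrier K \<and> (\<forall>v\<in>carrier V. c s \<odot>\<^bsub>V\<^esub> v = V.act k v))" for s
    have k: "k s \<in> carrier K \<and> (\<forall>v\<in>carrier V. c s \<odot>\<^bsub>V\<^esub> v = V.act (k s) v)" if "s \<in> S" for s
      unfolding k_def by (rule someI_ex) (use center[OF cz[OF that]] in blast)
    have "v = (\<Oplus>\<^bsub>V\<^esub>s\<in>S. (c s \<otimes>\<^bsub>A\<^esub> s) \<odot>\<^bsub>V\<^esub> v0)"
      unfolding a(2)[symmetric] c(2) by (rule V.V.smult_finsum_left) (use S(1) cc Sc v0 in auto)
    also have "\<dots> = (\<Oplus>\<^bsub>V\<^esub>s\<in>S. V.act (k s) (s \<odot>\<^bsub>V\<^esub> v0))"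
      by (rule V.V.M.finsum_cong') (use cc Sc v0 k V.L.act_closed in \<open>auto simp: V.V.smult_assoc\<close>)
    also have "\<dots> \<in> V.L.lspan G"
      unfolding G_def by (rule V.L.lspan_family) (use S(1) Sc k in auto)
    finally show ?thesis .
  qed
  moreover have "V.L.lspan G \<subseteq> carrier V"
    using Sc V.L.act_closed unfolding V.L.lspan_def
    by (auto intro!: V.V.M.finsum_closed simp: G_def Pi_iff)
  ultimately have "V.L.lspan G = carrier V" by blast
  then show thesis using that[of G] S(1) Sc by (auto simp: G_def)
qed

context eval_rep
begin

lemma kdim_large_ge:
  assumes "simple_module A W" "large_module K A V"
  shows "enat d \<le> kdim K A V"
  using large_module_kdim_ge[OF assms(2) R.algebra_rep_axioms assms(1), of "std ` {..<d}"] std_basis card_std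
  by (simp add: R.L.is_basis_def)

lemma isomorphic_of_eval_kernel:
  assumes "simple_rep K A V" "matrix_units A (left_module.annihilator A V) d e"
    "e 0 0 \<notin> left_module.annihilator A V" "R.V.annihilator \<subseteq> left_module.annihilator A V"
  shows "module_isomorphic A V W"
proof (rule isomorphic_of_annihilator_subset[OF assms(1) R.algebra_rep_axioms _ _ _ _ assms(2-4)])
  show "finite (std ` {..<d})" "std ` {..<d} \<subseteq> carrier W" "R.L.lspan (std ` {..<d}) = carrier W"
    using std_basis by (simp_all add: R.L.is_basis_def)
  show "card (std ` {..<d}) \<le> d" by (simp add: card_std)
qed

end

theorem propositionA:
  fixes K :: "'k ring"
    and A :: "('k, 'a) module"
    and B :: "('k, 'b) module"
    and d :: nat
    and \<tau> :: "'a \<Rightarrow> nat \<times> nat \<Rightarrow> 'b"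
    and V :: "('a, 'v) module"
  assumes "algebraically_closed K" and "char_zero K"
    and "assoc_algebra K A" and "fin_gen_over K A"
    and "module_finite_over_center A"
    and "impression K A B d \<tau>"
    and "primeideal {\<zero>\<^bsub>B\<^esub>} B"
    and "large_module K A V"
  shows "\<exists>q \<in> Max_spec B. module_isomorphic A V (eval_module B d \<tau> q)"
proof -
  define R where "R = impression_scalars A B d \<tau>"
  have pre: "pre_impression K A B d \<tau>"
    and contract: "(\<lambda>q. q \<inter> R) ` Max_spec B = Max_spec (B\<lparr>carrier := R\<rparr>)"
    using assms(6) by (simp_all add: impression_def Let_def R_def)
  obtain U where B: "algebra K B" "fin_gen_over K B"
    and \<tau>: "\<tau> \<in> alg_hom K A (mat_algebra B d)" "inj_on \<tau> (carrier A)"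
    and U: "openin (zariski B) U" "(zariski B) closure_of U = Max_spec B"
    and Us: "\<And>q. q \<in> U \<Longrightarrow> simple_module A (eval_module B d \<tau> q)"
    using pre unfolding pre_impression_def by blast
  have cB: "cring B" using B(1) by (simp add: algebra_def)
  have dB: "domain B" by (rule cring.zeroprimeideal_domainI[OF cB assms(7)])
  have rep: "matrix_rep K A B d \<tau>"
    by (intro matrix_rep.intro matrix_rep_axioms.intro assms(1,3) B(1) \<tau>(1))
  interpret M: matrix_mono K A B d \<tau>
    by (intro matrix_mono.intro matrix_mono_axioms.intro rep \<tau>(2))
  interpret D: domain_matrix_rep K A B d \<tau> by (intro domain_matrix_rep.intro rep dB)
  have simple: "simple_module A V" using assms(8) by (simp add: large_module_def)
  have rV: "simple_rep K A V"
    using simple assms(1,3)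
    by (simp add: simple_rep_def simple_rep_axioms_def algebra_rep_def simple_module_def)
  interpret V: simple_rep K A V by (rule rV)
  let ?J = "V.V.annihilator"
  have "Max_spec B \<noteq> {}"
    using cring.exists_maximalideal[OF cB] domain.one_not_zero[OF dB] by (auto simp: Max_spec_def)
  then have "U \<noteq> {}" using U(2) by auto
  then obtain q0 where q0: "q0 \<in> U" by blast
  then have q0M: "q0 \<in> Max_spec B"
    using openin_subset[OF U(1)] topspace_zariski[OF cB] by blast
  have ev: "eval_rep K A B d \<tau> q" if "q \<in> Max_spec B" for q
    using that B(2) rep by (simp add: eval_rep_def eval_rep_axioms_def Max_spec_def)
  note ev0 = ev[OF q0M]
  have d: "0 < d"
  proof (rule ccontr)
    assume "\<not> 0 < d"
    then have "carrier (eval_module B d \<tau> q0) = {\<zero>\<^bsub>eval_module B d \<tau> q0\<^esub>}"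
      by (simp add: eval_module_def restrict_def)
    then show False using Us[OF q0] by (simp add: simple_module_def)
  qed
  let ?Jq = "left_module.annihilator A (eval_module B d \<tau> q0)"
  obtain e0 where e0: "matrix_units A ?Jq d e0"
    and e0q: "\<And>u. u \<in> carrier A \<Longrightarrow> u \<ominus>\<^bsub>A\<^esub> e0 0 0 \<in> ?Jq \<Longrightarrow> M.trace u \<notin> q0"
    by (rule eval_rep.exists_matrix_units_of_trace_one[OF ev0 Us[OF q0] d]) blast
  have q0_ideal: "ideal q0 B" using q0M by (simp add: Max_spec_def maximalideal_def)
  have nz: "M.trace u \<noteq> \<zero>\<^bsub>B\<^esub>" if "u \<in> carrier A" "u \<ominus>\<^bsub>A\<^esub> e0 0 0 \<in> ?Jq" for u
    using e0q[OF that] additive_subgroup.zero_closed[OF ideal.axioms(1)[OF q0_ideal]] by metis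
  have center: "\<exists>f. M.scalar_of z f" if "z \<in> center A" for z
    using D.center_scalar[OF e0 nz that] that by (auto simp: M.scalar_of_def center_def)
  define m where "m = {f. \<exists>z \<in> ?J. M.scalar_of z f}"
  \<comment> \<open>the point \<open>q\<close> comes from the surjectivity of the contraction map\<close>
  have "m \<in> Max_spec (B\<lparr>carrier := R\<rparr>)"
    using M.maximalideal_annihilating_scalars[OF simple assms(5) center]
    by (simp add: Max_spec_def m_def R_def)
  then have "m \<in> (\<lambda>q. q \<inter> R) ` Max_spec B" unfolding contract .
  then obtain q where qm: "m = q \<inter> R" and qM: "q \<in> Max_spec B" by (rule imageE)
  note q = qM qm[symmetric]
  have in_J: "z \<in> ?J" if "M.scalar_of z f" "f \<in> q" for z f
  proof -
    have "f \<in> R"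
      unfolding R_def M.impression_scalars_eq using that(1) by (intro CollectI exI)
    then have "f \<in> m" unfolding q(2)[symmetric] using that(2) by (intro IntI)
    then obtain y where "y \<in> ?J" "M.scalar_of y f" unfolding m_def by (elim CollectE bexE)
    then show ?thesis using M.scalar_of_unique[OF that(1)] by simp
  qed
  have q_max: "maximalideal q B" using q(1) by (simp add: Max_spec_def)
  \<comment> \<open>residues in \<open>K\<close> at \<open>q\<close> are the central characters of \<open>V\<close>\<close>
  have central_act: "\<exists>c\<in>carrier K. \<forall>v\<in>carrier V. z \<odot>\<^bsub>V\<^esub> v = V.act c v" if z: "z \<in> center A" for z
  proof -
    obtain f where f: "M.scalar_of z f" using center[OF z] by (elim exE)
    obtain c where c: "c \<in> carrier K" "f \<ominus>\<^bsub>B\<^esub> c \<odot>\<^bsub>B\<^esub> \<one>\<^bsub>B\<^esub> \<in> q"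
      using maximalideal_residue[OF assms(1) B q_max M.scalar_ofD(2)[OF f]] by (elim bexE)
    have "z \<ominus>\<^bsub>A\<^esub> V.scal c \<in> ?J"
      unfolding V.scal_def
      by (rule in_J[OF M.scalar_of_diff[OF f M.scalar_of_scalar[OF c(1)]] c(2)])
    then have "\<forall>v\<in>carrier V. z \<odot>\<^bsub>V\<^esub> v = V.act c v"
      unfolding V.act_def
      by (rule iffD1[OF V.V.annihilator_diff_iff[OF M.scalar_ofD(1)[OF f] V.scal_closed[OF c(1)]]])
    then show ?thesis using c(1) by (intro bexI[of _ c])
  qed
  obtain G where G: "finite G" "G \<subseteq> carrier V" "V.L.lspan G = carrier V"
    by (rule exists_finite_span[OF rV assms(5) central_act])
  obtain S where S: "V.L.is_basis S" "kdim K A V = enat (card S)"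
    by (rule V.kdim_of_basis[OF G])
  \<comment> \<open>here largeness of \<open>V\<close> enters, against the simple module at \<open>q0\<close>\<close>
  have "d \<le> card S" using eval_rep.kdim_large_ge[OF ev0 Us[OF q0] assms(8)] S(2) by simp
  moreover have "finite S" using S(1) by (simp add: V.L.is_basis_def)
  ultimately obtain b where b: "b ` {..<d} \<subseteq> S" "inj_on b {..<d}"
    using card_le_inj[of "{..<d}" S] by auto
  obtain e where e: "matrix_units A ?J d e" "e 0 0 \<notin> ?J"
    by (rule V.exists_matrix_units[OF S(1) b(2,1) d]) blast
  show ?thesis
  proof (cases "?Jq \<subseteq> ?J")
    case True
    then show ?thesis using eval_rep.isomorphic_of_eval_kernel[OF ev0 rV e] q0M by blast
  next
    case J0: False
    let ?N = "left_module.annihilator A (eval_module B d \<tau> q)"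
    have ideal_ann: "ideal (left_module.annihilator A (eval_module B d \<tau> p)) A" if "p \<in> Max_spec B" for p
      by (rule left_module.ideal_annihilator[OF eval_rep.W_left_module[OF ev[OF that]]])
    obtain t where t: "t \<in> ?Jq" "t \<ominus>\<^bsub>A\<^esub> \<one>\<^bsub>A\<^esub> \<in> ?J"
      by (rule V.comaximal_with_annihilator[OF S(1) ideal_ann[OF q0M] J0])
    have "?N \<subseteq> ?J"
    proof (rule ccontr)
      assume N: "\<not> ?N \<subseteq> ?J"
      obtain a where a: "a \<in> ?N" "a \<ominus>\<^bsub>A\<^esub> \<one>\<^bsub>A\<^esub> \<in> ?J"
        by (rule V.comaximal_with_annihilator[OF S(1) ideal_ann[OF q(1)] N])
      obtain z f where z: "z \<in> ?N" "z \<notin> ?J" "M.scalar_of z f"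
        by (rule D.exists_separating_scalar[OF e e0 nz t ideal_ann[OF q(1)] a])
      have "\<tau> z (0, 0) \<in> q"
        using z(1) d unfolding eval_rep.annihilator_eq[OF ev[OF q(1)]] by blast
      then have "f \<in> q" using M.scalar_ofD(4)[OF z(3) d d] by simp
      with z(2) show False using in_J[OF z(3)] by simp
    qed
    then show ?thesis using eval_rep.isomorphic_of_eval_kernel[OF ev[OF q(1)] rV e] q(1) by blast
  qed
qed

end
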